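(* Let $\mathcal Q=\{Q_j\}_{j\in J}=\{T_jQ\}_{j\in J}$ be a structured admissible covering of $\mathbb{R}^d\setminus\{0\}$ as described in the context. Suppose $K_a$ is a cube in $\mathbb{R}^d$ (aligned with the coordinate axes) with side-length $2a$ satisfying $Q\subseteq K_a$. If $g\in\mathcal S'(\mathbb{R}^d)$, $h\in\mathcal S(\mathbb{R}^d)$ and $$\mathrm{supp}(\hat g),\ \mathrm{supp}(\hat h)\subset T_j(K_a)\quad\text{for some } j\in J,$$ then $$(g*h)(x)=\sum_{n\in\mathbb{Z}^d}(2a)^{-d}|T_j|^{-1}\,g\big(-T_j^{-1}\tfrac{\pi}{a}n\big)\,h\big(T_j^{-1}\tfrac{\pi}{a}n-x\big),$$ where the series converges in $\mathcal S'$. Consequently, if $\{\phi_j\}_{j\in J}$ satisfy $$\mathrm{supp}(\phi_j)\subset Q_j\ \ \forall j\in J,\qquad \sum_{j\in J}\phi_j^2(\xi)=1\ \ \forall \xi\in\mathbb{R}^d\setminus\{0\},$$ then, with $\hat\eta_{n,j}:=\phi_je_{n,j}$ (see context), for any $f\in\mathcal S'\backslash\mathcal P$ we have $$f=\sum_{j\in J}\sum_{n\in\mathbb{Z}^d}\langle f,\eta_{n,j}\rangle\eta_{n,j},$$ where the convergence of the series is in $\mathcal S'\backslash\mathcal P$. To be more precise, this means there exist a sequence of polynomials $\{P_k\}_{k=1}^\infty\subset\mathcal P$ and $P\in\mathcal P$ such that $$f=\lim_{k,K,N\to\infty}\Big(\sum_{j=-k}^{K}\ \sum_{n=-N}^{N}\langle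 f,\eta_{n,j}\rangle\eta_{n,j}+P_k\Big)+P,$$ with convergence in $\mathcal S'$.
   Context: Fourier transform: $\hat f(\xi)=\mathcal F f(\xi)=(2\pi)^{-d/2}\int_{\mathbb{R}^d} f(x)e^{-ix\cdot\xi}\,dx$, with the usual extensions. $\mathcal P$ is the set of polynomials on $\mathbb{R}^d$. $\mathcal S_0(\mathbb{R}^d)$ is the closed subspace of the Schwartz class $\mathcal S(\mathbb{R}^d)$ of all $\theta$ with $\|\theta\|_M=\sup_{|\beta|\le M}\sup_{\xi}|\partial^\beta\hat\theta(\xi)|(|\xi|^M+|\xi|^{-M})<\infty$ for any $M\in\mathbb{N}$; $\mathcal S'\backslash\mathcal P$ is the set of all continuous linear functionals on $\mathcal S_0(\mathbb{R}^d)$ (tempered distributions modulo polynomials). $\langle\cdot,\cdot\rangle$ is the pairing extending the $L_2$ inner product. Anisotropy: $\vec a=(a_1,\dots,a_d)$ is fixed with $a_i>0$, $\sum_i a_i=d$; $D_{\vec a}(t)=\mathrm{diag}(t^{a_1},\dots,t^{a_d})$ for $t>0$; $|0|_{\vec a}=0$ and for $\xi\ne0$, $|\xi|_{\vec a}$ is the unique $t>0$ with $|D_{\vec a}(1/t)\xi|=1$, $|\cdot|$ being the Euclidean norm. $\kappa\ge1$ is a constant with $|\xi+\zeta|_{\vec a}\le\kappa(|\xi|_{\vec a}+|\zeta|_{\vec a})$. Quasi-distance $\mathrm d(\xi,\zeta)=|\xi-\zeta|_{\vec a}$, balls $B_{\mathrm d}(\xi,r)=\{\zeta:\mathrm d(\xi,\zeta)<r\}$.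 A function $h:\mathbb{R}^d\setminus\{0\}\to(0,\infty)$ is $\mathrm d$-moderate if there are constants $R,\delta_0>0$ such that $\mathrm d(\xi,\zeta)\le\delta_0h(\xi)$ implies $R^{-1}\le h(\xi)/h(\zeta)\le R$ for all $\xi,\zeta\in\mathbb{R}^d\setminus\{0\}$. Hybrid regulation function: $\tilde h=\rho h_1+(1-\rho)h_2:\mathbb{R}^d\setminus\{0\}\to(0,\infty)$, where $\rho$ is a non-negative ramp function in $C^s$ for some $s\ge1$ with $\rho(\xi)=1$ for $0<|\xi|_{\vec a}\le2/3$ and $\rho(\xi)=0$ for $|\xi|_{\vec a}\ge4/3$, and $h_1,h_2$ are $\mathrm d$-moderate functions satisfying $c_0|\xi|_{\vec a}^r\le h_1(\xi)\le c_1|\xi|_{\vec a}$ for some $c_0,c_1>0$ and $r\ge1$, and $c_2\le h_2(\xi)\le c_3|\xi|_{\vec a}$ for some $c_2,c_3>0$. Admissible covering of $\mathbb{R}^d\setminus\{0\}$: a family $\{Q_j\}_{j\in J}$ of measurable subsets of $\mathbb{R}^d\setminus\{0\}$ with union $\mathbb{R}^d\setminus\{0\}$ and $\sup_j\#\{i\in J:Q_i\cap Q_j\ne\emptyset\}<\infty$. Structured admissible covering: $J\neq\emptyset$ is countable, $T_j=A_j\cdot+b_j$ ($j\in J$) are invertible affine transformations of $\mathbb{R}^d$, and there are bounded open sets $P\subset Q\subset\mathbb{R}^d\setminus\{0\}$, $P$ compactly contained in $Q$, such that $\{T_jP\}_{j\in J}$ and $\{Q_j\}_{j\in J}:=\{T_jQ\}_{j\in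 J}$ are admissible coverings of $\mathbb{R}^d\setminus\{0\}$, and a constant $K_0$ such that $T_jQ\cap T_kQ\ne\emptyset$ implies $\|A_k^{-1}A_j\|_{\ell_\infty(\mathbb{R}^d\times\mathbb{R}^d)}\le K_0$. Here, for a hybrid regulation function $\tilde h$ with $\mathrm d$-moderateness constant $\delta_0$ and $0<\delta<\delta_0$, the covering is $Q_j=B_{\mathrm d}(\xi_j,\delta\tilde h(\xi_j))$ with points $\xi_j\in\mathbb{R}^d\setminus\{0\}$, and $A_j=D_{\vec a}(\delta\tilde h(\xi_j))$. $|T_j|:=|A_j|:=|\det A_j|$. Frame system: for $n\in\mathbb{Z}^d$, $j\in J$, $e_{n,j}(\xi)=(2a)^{-d/2}|T_j|^{-1/2}\chi_{K_a}(T_j^{-1}\xi)e^{i\frac{\pi}{a}n\cdot T_j^{-1}\xi}$, and $\hat\eta_{n,j}=\phi_je_{n,j}$, where $\phi_j\in\mathcal S(\mathbb{R}^d)$. Ordering of $J$: $J$ is identified with $\mathbb{Z}$, associating $\mathbb{Z}^+$ with $J_2=\{j\in J:B_{\mathrm d}(\xi_j,\delta\tilde h(\xi_j))\cap B_{\mathrm d}(0,C)=\emptyset\}$ and $\mathbb{Z}^-$ with $J_1=J\setminus J_2$. Here $0<C<\frac{2/3}{\kappa(1+c_1\delta_* )}$, where $\delta_*>0$ is at most the minimum of the $\mathrm d$-moderateness constants of $h_1$ and $h_2$ and $\delta_*c_1<1$.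
   Formalization: Sampling formula corrected to (g*h)(x)=Σ(2π)^d(2a)^{-d}|T_j|^{-1}g(-y_n)h(x+y_n), y_n=T_j^{-1}πn/a; φ_j real, derivatives uniformly of at most power growth at 0 and ∞; bounds on h_1, h_2 assumed only where used; N→∞ is taken before k,K→∞. *)

theory Defs
  imports "HOL-Analysis.Analysis"
begin

section \<open>Schwartz functions, tempered distributions, Fourier transform\<close>

definition partial_deriv :: "'n::finite \<Rightarrow> (real^'n \<Rightarrow> 'b::real_normed_vector) \<Rightarrow> real^'n \<Rightarrow> 'b" where
  "partial_deriv i f x = frechet_derivative f (at x) (axis i 1)"

text \<open>A multi-index of order m is represented by a list of m coordinate indices. For smooth
  functions partial derivatives commute, so the supremum over all lists of length at most M is the
  supremum over all multi-indices of order at most M.\<close>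

fun iter_partial :: "'n::finite list \<Rightarrow> (real^'n \<Rightarrow> 'b::real_normed_vector) \<Rightarrow> real^'n \<Rightarrow> 'b" where
  "iter_partial [] f = f"
| "iter_partial (i # \<beta>) f = partial_deriv i (iter_partial \<beta> f)"

text \<open>Used only for open sets S.\<close>

fun Ck_on :: "nat \<Rightarrow> (real^'n::finite \<Rightarrow> 'b::real_normed_vector) \<Rightarrow> (real^'n) set \<Rightarrow> bool" where
  "Ck_on 0 f S \<longleftrightarrow> continuous_on S f"
| "Ck_on (Suc k) f S \<longleftrightarrow>
     (\<forall>x\<in>S. f differentiable (at x)) \<and> (\<forall>i. Ck_on k (partial_deriv i f) S)"

definition smooth :: "(real^'n::finite \<Rightarrow> 'b::real_normed_vector) \<Rightarrow> bool" where
  "smooth f \<longleftrightarrow> (\<forall>k. Ck_on k f UNIV)"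

definition schwartz :: "(real^'n::finite \<Rightarrow> complex) set" where
  "schwartz = {f. smooth f \<and>
     (\<forall>\<beta> m. bounded (range (\<lambda>x. (1 + norm x) ^ m *\<^sub>R iter_partial \<beta> f x)))}"

definition schwartz_seminorm :: "nat \<Rightarrow> (real^'n::finite \<Rightarrow> complex) \<Rightarrow> real" where
  "schwartz_seminorm M f =
     (SUP (\<beta>, x) \<in> {\<beta>. length \<beta> \<le> M} \<times> UNIV. (1 + norm x) ^ M * norm (iter_partial \<beta> f x))"

definition fourier :: "(real^'n::finite \<Rightarrow> complex) \<Rightarrow> real^'n \<Rightarrow> complex" where
  "fourier f \<xi> = complex_of_real ((2 * pi) powr (- (real CARD('n) / 2))) *
     (LINT x|lborel. f x * cis (- (x \<bullet> \<xi>)))"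

definition inv_fourier :: "(real^'n::finite \<Rightarrow> complex) \<Rightarrow> real^'n \<Rightarrow> complex" where
  "inv_fourier F x = complex_of_real ((2 * pi) powr (- (real CARD('n) / 2))) *
     (LINT \<xi>|lborel. F \<xi> * cis (x \<bullet> \<xi>))"

text \<open>The space S_0. At the origin the weight is infinite, which for the continuous functions
  concerned is already enforced by the bound off the origin.\<close>

definition schwartz0 :: "(real^'n::finite \<Rightarrow> complex) set" where
  "schwartz0 = {\<theta> \<in> schwartz. \<forall>M::nat. \<exists>B. \<forall>\<beta> \<xi>. length \<beta> \<le> M \<longrightarrow> \<xi> \<noteq> 0 \<longrightarrow>
     norm (iter_partial \<beta> (fourier \<theta>) \<xi>) * (norm \<xi> ^ M + inverse (norm \<xi> ^ M)) \<le> B}"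

type_synonym 'n functional = "(real^'n \<Rightarrow> complex) \<Rightarrow> complex"

text \<open>Continuous linear functionals on a subspace V of the Schwartz class with the subspace
  topology; continuity is domination by one of the (increasing) Schwartz seminorms. V = schwartz
  gives S', and V = schwartz0 gives S' modulo polynomials. Functionals are total functions, but only
  their values on V matter.\<close>

definition dual :: "(real^'n::finite \<Rightarrow> complex) set \<Rightarrow> ('n functional) set" where
  "dual V = {u.
     (\<forall>f\<in>V. \<forall>g\<in>V. u (\<lambda>x. f x + g x) = u f + u g) \<and>
     (\<forall>c. \<forall>f\<in>V. u (\<lambda>x. c * f x) = c * u f) \<and>
     (\<exists>M B. \<forall>f\<in>V. norm (u f) \<le> B * schwartz_seminorm M f)}"

definition tends_in ::
  "(real^'n::finite \<Rightarrow> complex) set \<Rightarrow> ('i \<Rightarrow> 'n functional) \<Rightarrow> 'n functional \<Rightarrow> 'i filter \<Rightarrow> bool" where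
  "tends_in V u l F \<longleftrightarrow> l \<in> dual V \<and> (\<forall>\<theta>\<in>V. ((\<lambda>i. u i \<theta>) \<longlongrightarrow> l \<theta>) F)"

definition sums_in ::
  "(real^'n::finite \<Rightarrow> complex) set \<Rightarrow> ('i \<Rightarrow> 'n functional) \<Rightarrow> 'i set \<Rightarrow> 'n functional \<Rightarrow> bool" where
  "sums_in V u I l \<longleftrightarrow> l \<in> dual V \<and> (\<forall>\<theta>\<in>V. ((\<lambda>i. u i \<theta>) has_sum l \<theta>) I)"

definition dist_of :: "(real^'n::finite \<Rightarrow> complex) \<Rightarrow> 'n functional" where
  "dist_of F \<theta> = (LINT x|lborel. F x * \<theta> x)"

definition given_by :: "'n::finite functional \<Rightarrow> (real^'n \<Rightarrow> complex) \<Rightarrow> bool" where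
  "given_by u F \<longleftrightarrow> (\<forall>\<theta>\<in>schwartz. integrable lborel (\<lambda>x. F x * \<theta> x) \<and> u \<theta> = dist_of F \<theta>)"

text \<open>The sesquilinear pairing extending the inner product of L_2: functionals act bilinearly, so
  the second argument is conjugated.\<close>

definition pairing :: "'n::finite functional \<Rightarrow> (real^'n \<Rightarrow> complex) \<Rightarrow> complex" where
  "pairing u \<eta> = u (\<lambda>x. cnj (\<eta> x))"

definition dist_fourier :: "'n::finite functional \<Rightarrow> 'n functional" where
  "dist_fourier u \<theta> = u (fourier \<theta>)"

definition fun_supp :: "(real^'n::finite \<Rightarrow> 'b::zero) \<Rightarrow> (real^'n) set" where
  "fun_supp f = closure {x. f x \<noteq> 0}"

definition dist_supp :: "'n::finite functional \<Rightarrow> (real^'n) set" where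
  "dist_supp u = {x. \<forall>U. open U \<longrightarrow> x \<in> U \<longrightarrow>
     (\<exists>\<theta>\<in>schwartz. compact (fun_supp \<theta>) \<and> fun_supp \<theta> \<subseteq> U \<and> u \<theta> \<noteq> 0)}"

definition dist_conv :: "'n::finite functional \<Rightarrow> (real^'n \<Rightarrow> complex) \<Rightarrow> real^'n \<Rightarrow> complex" where
  "dist_conv g h x = g (\<lambda>y. h (x - y))"

section \<open>Anisotropic geometry\<close>

definition anisotropy :: "real^'n::finite \<Rightarrow> bool" where
  "anisotropy \<alpha> \<longleftrightarrow> (\<forall>i. \<alpha> $ i > 0) \<and> (\<Sum>i\<in>UNIV. \<alpha> $ i) = real CARD('n)"

definition dil :: "real^'n::finite \<Rightarrow> real \<Rightarrow> real^'n^'n" where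
  "dil \<alpha> t = (\<chi> i l. if i = l then t powr (\<alpha> $ i) else 0)"

definition anorm :: "real^'n::finite \<Rightarrow> real^'n \<Rightarrow> real" where
  "anorm \<alpha> \<xi> = (if \<xi> = 0 then 0 else (THE t. t > 0 \<and> norm (dil \<alpha> (1 / t) *v \<xi>) = 1))"

definition aball :: "real^'n::finite \<Rightarrow> real^'n \<Rightarrow> real \<Rightarrow> (real^'n) set" where
  "aball \<alpha> \<xi> r = {\<zeta>. anorm \<alpha> (\<xi> - \<zeta>) < r}"

text \<open>h is d-moderate with constants R and delta0; the value at the origin is irrelevant.\<close>

definition moderate :: "real^'n::finite \<Rightarrow> (real^'n \<Rightarrow> real) \<Rightarrow> real \<Rightarrow> real \<Rightarrow> bool" where
  "moderate \<alpha> h R \<delta>0 \<longleftrightarrow> R > 0 \<and> \<delta>0 > 0 \<and> (\<forall>\<xi>. \<xi> \<noteq> 0 \<longrightarrow> h \<xi> > 0) \<and>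
     (\<forall>\<xi> \<zeta>. \<xi> \<noteq> 0 \<longrightarrow> \<zeta> \<noteq> 0 \<longrightarrow> anorm \<alpha> (\<xi> - \<zeta>) \<le> \<delta>0 * h \<xi> \<longrightarrow>
        inverse R \<le> h \<xi> / h \<zeta> \<and> h \<xi> / h \<zeta> \<le> R)"

definition ramp :: "real^'n::finite \<Rightarrow> (real^'n \<Rightarrow> real) \<Rightarrow> bool" where
  "ramp \<alpha> \<rho> \<longleftrightarrow> (\<exists>s\<ge>1. Ck_on s \<rho> (- {0})) \<and>
     (\<forall>\<xi>. \<xi> \<noteq> 0 \<longrightarrow> 0 \<le> \<rho> \<xi> \<and> \<rho> \<xi> \<le> 1) \<and>
     (\<forall>\<xi>. 0 < anorm \<alpha> \<xi> \<and> anorm \<alpha> \<xi> \<le> 2/3 \<longrightarrow> \<rho> \<xi> = 1) \<and>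
     (\<forall>\<xi>. anorm \<alpha> \<xi> \<ge> 4/3 \<longrightarrow> \<rho> \<xi> = 0)"

text \<open>The two-sided bounds are required only where the functions enter the hybrid one: the bounds
  on h1 for anisotropic norm at most 4/3, those on h2 for anisotropic norm at least 2/3. (On the
  whole punctured space a positive constant cannot be bounded by c3 times the norm near 0.)\<close>

definition hybrid_parts :: "real^'n::finite \<Rightarrow> (real^'n \<Rightarrow> real) \<Rightarrow> (real^'n \<Rightarrow> real) \<Rightarrow>
    real \<Rightarrow> real \<Rightarrow> real \<Rightarrow> real \<Rightarrow> real \<Rightarrow> bool" where
  "hybrid_parts \<alpha> h1 h2 c0 c1 c2 c3 r \<longleftrightarrow>
     c0 > 0 \<and> c1 > 0 \<and> c2 > 0 \<and> c3 > 0 \<and> r \<ge> 1 \<and>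
     (\<forall>\<xi>. 0 < anorm \<alpha> \<xi> \<and> anorm \<alpha> \<xi> \<le> 4/3 \<longrightarrow>
        c0 * anorm \<alpha> \<xi> powr r \<le> h1 \<xi> \<and> h1 \<xi> \<le> c1 * anorm \<alpha> \<xi>) \<and>
     (\<forall>\<xi>. anorm \<alpha> \<xi> \<ge> 2/3 \<longrightarrow> c2 \<le> h2 \<xi> \<and> h2 \<xi> \<le> c3 * anorm \<alpha> \<xi>)"

definition hybrid :: "(real^'n::finite \<Rightarrow> real) \<Rightarrow> (real^'n \<Rightarrow> real) \<Rightarrow> (real^'n \<Rightarrow> real) \<Rightarrow>
    real^'n \<Rightarrow> real" where
  "hybrid \<rho> h1 h2 \<xi> = \<rho> \<xi> * h1 \<xi> + (1 - \<rho> \<xi>) * h2 \<xi>"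

section \<open>Coverings and the frame system\<close>

definition admissible_covering :: "'j set \<Rightarrow> ('j \<Rightarrow> (real^'n::finite) set) \<Rightarrow> bool" where
  "admissible_covering J Q \<longleftrightarrow>
     (\<forall>j\<in>J. Q j \<in> sets lebesgue \<and> Q j \<subseteq> - {0}) \<and> (\<Union>j\<in>J. Q j) = - {0} \<and>
     (\<exists>N::nat. \<forall>j\<in>J. finite {i\<in>J. Q i \<inter> Q j \<noteq> {}} \<and> card {i\<in>J. Q i \<inter> Q j \<noteq> {}} \<le> N)"

definition affine_map :: "real^'n^'n \<Rightarrow> real^'n \<Rightarrow> real^'n \<Rightarrow> real^'n::finite" where
  "affine_map A b x = A *v x + b"

text \<open>The library's infnorm of a matrix is the largest absolute value of its entries.\<close>

definition structured_covering ::
  "'j set \<Rightarrow> ('j \<Rightarrow> real^'n^'n) \<Rightarrow> ('j \<Rightarrow> real^'n) \<Rightarrow> (real^'n::finite) set \<Rightarrow> (real^'n) set \<Rightarrow> bool" where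
  "structured_covering J A b P Q \<longleftrightarrow>
     J \<noteq> {} \<and> countable J \<and> (\<forall>j\<in>J. invertible (A j)) \<and>
     open P \<and> bounded P \<and> open Q \<and> bounded Q \<and> Q \<subseteq> - {0} \<and> closure P \<subseteq> Q \<and>
     admissible_covering J (\<lambda>j. affine_map (A j) (b j) ` P) \<and>
     admissible_covering J (\<lambda>j. affine_map (A j) (b j) ` Q) \<and>
     (\<exists>K0. \<forall>j\<in>J. \<forall>k\<in>J.
        affine_map (A j) (b j) ` Q \<inter> affine_map (A k) (b k) ` Q \<noteq> {} \<longrightarrow>
        infnorm (matrix_inv (A k) ** A j) \<le> K0)"

definition cube :: "real^'n::finite \<Rightarrow> real \<Rightarrow> (real^'n) set" where
  "cube c a = cbox (\<chi> i. c $ i - a) (\<chi> i. c $ i + a)"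

definition lattice_vec :: "int^'n::finite \<Rightarrow> real^'n" where
  "lattice_vec n = (\<chi> i. of_int (n $ i))"

text \<open>The function e_(n,j), for T_j = affine_map A b and the cube K of side-length 2 a.\<close>

definition frame_exp :: "(real^'n) set \<Rightarrow> real \<Rightarrow> real^'n^'n \<Rightarrow> real^'n \<Rightarrow> int^'n \<Rightarrow>
    real^'n::finite \<Rightarrow> complex" where
  "frame_exp K a A b n \<xi> =
     complex_of_real ((2 * a) powr (- (real CARD('n) / 2)) * \<bar>det A\<bar> powr (- 1/2) *
       indicat_real K (inv (affine_map A b) \<xi>)) *
     cis (pi / a * (lattice_vec n \<bullet> inv (affine_map A b) \<xi>))"

definition frame_fun :: "(real^'n) set \<Rightarrow> real \<Rightarrow> real^'n^'n \<Rightarrow> real^'n \<Rightarrow> (real^'n \<Rightarrow> real) \<Rightarrow>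
    int^'n \<Rightarrow> real^'n::finite \<Rightarrow> complex" where
  "frame_fun K a A b \<phi> n =
     inv_fourier (\<lambda>\<xi>. complex_of_real (\<phi> \<xi>) * frame_exp K a A b n \<xi>)"

text \<open>The distribution "coefficient of f with respect to eta, times eta".\<close>

definition frame_term :: "'n::finite functional \<Rightarrow> (real^'n \<Rightarrow> complex) \<Rightarrow> 'n functional" where
  "frame_term f \<eta> \<theta> = pairing f \<eta> * dist_of \<eta> \<theta>"

text \<open>Uniform control of the derivatives of the family: at most polynomial growth at infinity and
  at the origin. This holds in particular if the derivatives of the rescaled functions
  phi_j o T_j are bounded uniformly in j, because the lower bounds on the regulation function
  control the entries of the inverse of A_j.\<close>

definition uniformly_moderate_growth :: "'j set \<Rightarrow> ('j \<Rightarrow> real^'n::finite \<Rightarrow> real) \<Rightarrow> bool" where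
  "uniformly_moderate_growth J \<phi> \<longleftrightarrow> (\<forall>\<beta>. \<exists>(M::nat) B. \<forall>j\<in>J. \<forall>\<xi>. \<xi> \<noteq> 0 \<longrightarrow>
     \<bar>iter_partial \<beta> (\<phi> j) \<xi>\<bar> \<le> B * (norm \<xi> ^ M + inverse (norm \<xi> ^ M)))"

end

theory Submission
  imports Defs "HOL-Probability.Probability"
begin

text \<open>On the Fourier side, the Fourier transform u of a tempered distribution g only acts on products of a
  fixed cut-off function with other functions. If the other function is a superposition of plane
  waves and the coefficients are summable against all powers of the frequencies, then u may be
  applied termwise, because the weighted sum of the coefficients dominates every Schwartz seminorm
  of the tail. Hence g is the function whose value at x is, up to a constant, u applied to the
  cut-off function times the plane wave of frequency x. The convolution tested against a Schwartz
  function is then an integral of a product whose spectrum contains no point of the dual lattice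
  inside its interior except the origin (those on the boundary are handled by continuity), and
  Poisson summation replaces the integral by the sampled series.

  Poisson summation also gives the Fourier series of a smooth function supported in T_j(Q), which
  evaluates the sum over n: the series for fixed j is f composed with the Fourier multiplier
  phi_j^2. The partial sums of these multipliers are equal to 1 on any given annulus
  as soon as enough indices are included, and their derivatives are bounded by powers of the norm
  and of its inverse. So the sum over j converges to f on all Schwartz functions whose Fourier
  transform vanishes to some finite order at the origin, the order depending on f only.
  Finitely many moments obstruct this condition, and they are removed by subtracting a finite-rank
  operator built from pairings with monomials. The correction produces both the extension of f to
  a tempered distribution and the polynomials P_k. The indices j of positive number stay away from
  the origin, so their contribution to the correction converges and can be moved into P.\<close>

section \<open>Smooth functions and iterated partial derivatives\<close>

text \<open>A continuous functional is dominated by one Schwartz seminorm, of some order M. This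
  number fixes everything finite in the argument: how fast coefficients must decay, to which order a
  transform must vanish at the origin, how many moments have to be removed. Interchanging a
  functional with a sum or an integral thus always amounts to a uniform estimate of finitely many
  derivatives on the Fourier side.

  Functionals act bilinearly, so a multiplier is transposed when it moves to the test function. This
  is why the conditions at the origin concern \<open>FT 1 \<theta>\<close> and not its reflection.

  Both halves rest on the same lattice: its dual spacing equals the side lengths of the box T_j(K),
  so Poisson summation has a single term and the prefactor is the volume of a lattice cell. In the
  sampling formula the supports may reach the faces of the box; in the frame expansion the openness
  of Q keeps them off the faces.

  The obstacle at the origin is that derivatives of phi_j may grow there like a power of 1/|\<xi>|,
  uniformly in j. Only vanishing to a matching order compensates for this.\<close>

lemma partial_deriv_eqI:
  assumes "(f has_derivative f') (at x)"
  shows "partial_deriv i f x = f' (axis i 1)"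
  using frechet_derivative_at[OF assms] by (simp add: partial_deriv_def)

lemma has_derivative_partial:
  "f differentiable (at x) \<Longrightarrow> (f has_derivative frechet_derivative f (at x)) (at x)"
  using frechet_derivative_works by blast

lemma frechet_eq_partials:
  fixes f :: "real^'n::finite \<Rightarrow> 'b::real_normed_vector"
  assumes "f differentiable (at x)"
  shows "frechet_derivative f (at x) v = (\<Sum>i\<in>UNIV. v $ i *\<^sub>R partial_deriv i f x)"
proof -
  have lin: "linear (frechet_derivative f (at x))"
    using assms by (rule linear_frechet_derivative)
  have "frechet_derivative f (at x) v = frechet_derivative f (at x) (\<Sum>i\<in>UNIV. v $ i *\<^sub>R axis i 1)"
    by (simp add: basis_expansion scalar_mult_eq_scaleR[symmetric])
  also have "\<dots> = (\<Sum>i\<in>UNIV. v $ i *\<^sub>R partial_deriv i f x)"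
    by (simp add: linear_sum[OF lin] linear_scale[OF lin] partial_deriv_def)
  finally show ?thesis .
qed

text \<open>\<open>Ck_on\<close> strips derivatives from the inside, whereas
  \<open>iter_partial\<close> adds them on the outside; this identity mediates between the two
  orders.\<close>

lemma iter_partial_snoc: "iter_partial (\<beta> @ [i]) f = iter_partial \<beta> (partial_deriv i f)"
  by (induction \<beta>) auto

lemma iter_partial_append: "iter_partial (\<beta> @ \<gamma>) f = iter_partial \<beta> (iter_partial \<gamma> f)"
  by (induction \<beta>) auto

lemma Ck_on_imp_differentiable:
  "Ck_on k f UNIV \<Longrightarrow> length \<beta> < k \<Longrightarrow> iter_partial \<beta> f differentiable (at x)"
proof (induction k arbitrary: f \<beta>)
  case (Suc k)
  show ?case
  proof (cases \<beta> rule: rev_cases)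
    case Nil
    then show ?thesis using Suc by auto
  next
    case (snoc \<gamma> i)
    then show ?thesis using Suc by (auto simp: iter_partial_snoc)
  qed
qed auto

text \<open>Continuity of a derivative follows from its differentiability, so the continuity clauses
  of \<open>Ck_on\<close> disappear once all orders are present.\<close>

lemma smooth_iff: "smooth f \<longleftrightarrow> (\<forall>\<beta> x. iter_partial \<beta> f differentiable (at x))"
proof
  show "smooth f \<Longrightarrow> \<forall>\<beta> x. iter_partial \<beta> f differentiable (at x)"
    unfolding smooth_def using Ck_on_imp_differentiable by blast
  have "Ck_on k f UNIV" if "\<forall>\<beta> x. iter_partial \<beta> f differentiable (at x)" for k
    using that
  proof (induction k arbitrary: f)
    case 0
    have "f differentiable (at x)" for x using 0[rule_format, of "[]"] by simp
    then show ?case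
      by (simp add: continuous_at_imp_continuous_on differentiable_imp_continuous_within)
  next
    case (Suc k)
    have "f differentiable (at x)" for x using Suc(2)[rule_format, of "[]"] by simp
    moreover have "Ck_on k (partial_deriv i f) UNIV" for i
      using Suc(2) by (intro Suc(1)) (simp flip: iter_partial_snoc)
    ultimately show ?case by simp
  qed
  then show "\<forall>\<beta> x. iter_partial \<beta> f differentiable (at x) \<Longrightarrow> smooth f"
    unfolding smooth_def by blast
qed

lemma smooth_differentiable: "smooth f \<Longrightarrow> iter_partial \<beta> f differentiable (at x)"
  by (simp add: smooth_iff)

lemma smooth_differentiable0: "smooth f \<Longrightarrow> f differentiable (at x)"
  using smooth_differentiable[of f "[]"] by simp

lemma smooth_iter_partial: "smooth f \<Longrightarrow> smooth (iter_partial \<beta> f)"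
  unfolding smooth_iff by (simp flip: iter_partial_append)

lemma smooth_partial_deriv: "smooth f \<Longrightarrow> smooth (partial_deriv i f)"
  using smooth_iter_partial[of f "[i]"] by simp

lemma smooth_continuous: "smooth f \<Longrightarrow> continuous_on S (iter_partial \<beta> f)"
  by (simp add: continuous_at_imp_continuous_on differentiable_imp_continuous_within smooth_differentiable)

lemma smooth_continuous0: "smooth f \<Longrightarrow> continuous_on S f"
  using smooth_continuous[of f S "[]"] by simp

text \<open>It is enough to exhibit a class of differentiable functions closed under partial
  derivatives; no closed form of the higher derivatives is required.\<close>

lemma smooth_coinduct:
  assumes "f \<in> W"
    and "\<And>f x. f \<in> W \<Longrightarrow> f differentiable (at x)"
    and "\<And>f i. f \<in> W \<Longrightarrow> partial_deriv i f \<in> W"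
  shows "smooth f"
proof -
  have "iter_partial \<beta> f \<in> W" for \<beta>
    by (induction \<beta>) (use assms in auto)
  then show ?thesis using assms(2) by (auto simp: smooth_iff)
qed

text \<open>Derivatives are local. This is what makes all of them vanish off a closed support and
  agree on a plateau.\<close>

lemma iter_partial_cong_open:
  assumes "open U" "x \<in> U" "\<And>y. y \<in> U \<Longrightarrow> f y = g y"
  shows "iter_partial \<beta> f x = iter_partial \<beta> g x"
  using assms(2)
proof (induction \<beta> arbitrary: x)
  case Nil
  then show ?case using assms by simp
next
  case (Cons i \<beta>)
  have "(iter_partial \<beta> f has_derivative D) (at x) \<longleftrightarrow> (iter_partial \<beta> g has_derivative D) (at x)" for D
    using has_derivative_transform_within_open[of "iter_partial \<beta> f" D x UNIV U "iter_partial \<beta> g"]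
      has_derivative_transform_within_open[of "iter_partial \<beta> g" D x UNIV U "iter_partial \<beta> f"]
      Cons assms(1) by metis
  then show ?case by (simp add: partial_deriv_def frechet_derivative_def)
qed

lemma iter_partial_const_0 [simp]: "iter_partial \<beta> (\<lambda>x. 0) = (\<lambda>x. 0)"
proof (induction \<beta>)
  case (Cons i \<beta>)
  show ?case unfolding iter_partial.simps Cons by (simp add: fun_eq_iff partial_deriv_def)
qed auto

lemma iter_partial_zero_open:
  assumes "open U" "x \<in> U" "\<And>y. y \<in> U \<Longrightarrow> f y = 0"
  shows "iter_partial \<beta> f x = 0"
  using iter_partial_cong_open[OF assms(1,2), of f "\<lambda>x. 0" \<beta>] assms(3) by simp

lemma partial_deriv_bounded_linear:
  assumes "bounded_linear L" "f differentiable (at x)"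
  shows "partial_deriv i (\<lambda>x. L (f x)) x = L (partial_deriv i f x)"
  using partial_deriv_eqI[OF bounded_linear.has_derivative[OF assms(1) has_derivative_partial[OF assms(2)]]]
  by (simp add: partial_deriv_def)

lemma iter_partial_bounded_linear:
  assumes "bounded_linear L" "smooth f"
  shows "iter_partial \<beta> (\<lambda>x. L (f x)) = (\<lambda>x. L (iter_partial \<beta> f x))"
proof (induction \<beta>)
  case (Cons i \<beta>)
  show ?case unfolding iter_partial.simps Cons
    by (simp add: fun_eq_iff partial_deriv_bounded_linear[OF assms(1)] smooth_differentiable[OF assms(2)])
qed auto

lemma smooth_bounded_linear:
  assumes "bounded_linear L" "smooth f"
  shows "smooth (\<lambda>x. L (f x))"
  unfolding smooth_iff iter_partial_bounded_linear[OF assms]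
proof (intro allI)
  fix \<beta> x
  show "(\<lambda>x. L (iter_partial \<beta> f x)) differentiable (at x)"
    using bounded_linear.has_derivative[OF assms(1) has_derivative_partial[OF smooth_differentiable[OF assms(2), of \<beta> x]]]
    by (auto simp: differentiable_def)
qed

lemma iter_partial_add:
  assumes "smooth f" "smooth g"
  shows "iter_partial \<beta> (\<lambda>x. f x + g x) = (\<lambda>x. iter_partial \<beta> f x + iter_partial \<beta> g x)"
proof (induction \<beta>)
  case (Cons i \<beta>)
  show ?case unfolding iter_partial.simps Cons
  proof
    fix x
    show "partial_deriv i (\<lambda>x. iter_partial \<beta> f x + iter_partial \<beta> g x) x
      = partial_deriv i (iter_partial \<beta> f) x + partial_deriv i (iter_partial \<beta> g) x"
      using partial_deriv_eqI[OF has_derivative_add[OF has_derivative_partial[OF smooth_differentiable[OF assms(1), of \<beta> x]]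
        has_derivative_partial[OF smooth_differentiable[OF assms(2), of \<beta> x]]]]
      by (simp add: partial_deriv_def)
  qed
qed auto

lemma smooth_add:
  assumes "smooth f" "smooth g"
  shows "smooth (\<lambda>x. f x + g x)"
  using assms by (simp add: smooth_iff iter_partial_add[OF assms])

lemma smooth_const [simp]: "smooth (\<lambda>x. c)"
  by (rule smooth_coinduct[of _ "range (\<lambda>c x. c)"])
    (auto simp: partial_deriv_def fun_eq_iff)

lemma smooth_sum:
  assumes "\<And>i. i \<in> I \<Longrightarrow> smooth (f i)"
  shows "smooth (\<lambda>x. \<Sum>i\<in>I. f i x)"
  using assms by (induction I rule: infinite_finite_induct) (auto intro: smooth_add)

lemma iter_partial_sum:
  assumes "\<And>i. i \<in> I \<Longrightarrow> smooth (f i)"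
  shows "iter_partial \<beta> (\<lambda>x. \<Sum>i\<in>I. f i x) = (\<lambda>x. \<Sum>i\<in>I. iter_partial \<beta> (f i) x)"
  using assms by (induction I rule: infinite_finite_induct) (auto simp: iter_partial_add smooth_sum)

lemma iter_partial_cmult:
  fixes f :: "real^'n::finite \<Rightarrow> 'b::real_normed_algebra"
  assumes "smooth f"
  shows "iter_partial \<beta> (\<lambda>x. c * f x) = (\<lambda>x. c * iter_partial \<beta> f x)"
  using iter_partial_bounded_linear[OF bounded_linear_mult_right assms] .

lemma smooth_cmult:
  fixes f :: "real^'n::finite \<Rightarrow> 'b::real_normed_algebra"
  shows "smooth f \<Longrightarrow> smooth (\<lambda>x. c * f x)"
  by (rule smooth_bounded_linear[OF bounded_linear_mult_right])

lemma iter_partial_diff: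
  assumes "smooth f" "smooth g"
  shows "iter_partial \<beta> (\<lambda>x. f x - g x) = (\<lambda>x. iter_partial \<beta> f x - iter_partial \<beta> g x)"
  using iter_partial_add[OF assms(1) smooth_bounded_linear[OF bounded_linear_minus[OF bounded_linear_ident] assms(2)], of \<beta>]
    iter_partial_bounded_linear[OF bounded_linear_minus[OF bounded_linear_ident] assms(2), of \<beta>]
  by simp

lemma smooth_diff:
  assumes "smooth f" "smooth g"
  shows "smooth (\<lambda>x. f x - g x)"
  using smooth_add[OF assms(1) smooth_bounded_linear[OF bounded_linear_minus[OF bounded_linear_ident] assms(2)]]
  by simp

text \<open>The distributions of the entries of a list over two lists, as they occur in the Leibniz rule.\<close>

fun splits :: "'a list \<Rightarrow> ('a list \<times> 'a list) list" where
  "splits [] = [([], [])]"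
| "splits (i # \<beta>) = map (\<lambda>(\<gamma>, \<delta>). (i # \<gamma>, \<delta>)) (splits \<beta>) @ map (\<lambda>(\<gamma>, \<delta>). (\<gamma>, i # \<delta>)) (splits \<beta>)"

lemma length_splits: "length (splits \<beta>) = 2 ^ length \<beta>"
  by (induction \<beta>) auto

lemma splits_length: "(\<gamma>, \<delta>) \<in> set (splits \<beta>) \<Longrightarrow> length \<gamma> + length \<delta> = length \<beta>"
  by (induction \<beta> arbitrary: \<gamma> \<delta>) auto

text \<open>Leibniz rule. Each entry of the list falls on one of the two factors; keeping the
  entries in order avoids any appeal to the symmetry of mixed partials.\<close>

lemma iter_partial_mult:
  fixes f g :: "real^'n::finite \<Rightarrow> 'b::real_normed_algebra"
  assumes "smooth f" "smooth g"
  shows "iter_partial \<beta> (\<lambda>x. f x * g x) =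
    (\<lambda>x. \<Sum>(\<gamma>, \<delta>)\<leftarrow>splits \<beta>. iter_partial \<gamma> f x * iter_partial \<delta> g x)"
proof (induction \<beta>)
  case (Cons i \<beta>)
  have *: "((\<lambda>x. \<Sum>(\<gamma>, \<delta>)\<leftarrow>xs. iter_partial \<gamma> f x * iter_partial \<delta> g x) has_derivative
     (\<lambda>h. \<Sum>(\<gamma>, \<delta>)\<leftarrow>xs. iter_partial \<gamma> f x * frechet_derivative (iter_partial \<delta> g) (at x) h
         + frechet_derivative (iter_partial \<gamma> f) (at x) h * iter_partial \<delta> g x)) (at x)" for xs x
    by (induction xs) (auto intro!: derivative_eq_intros has_derivative_partial smooth_differentiable assms)
  show ?case unfolding iter_partial.simps Cons
    by (rule ext, subst partial_deriv_eqI[OF *])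
      (auto simp: partial_deriv_def case_prod_unfold o_def sum_list_addf add_ac)
qed auto

lemma smooth_mult:
  fixes f g :: "real^'n::finite \<Rightarrow> 'b::real_normed_algebra"
  assumes "smooth f" "smooth g"
  shows "smooth (\<lambda>x. f x * g x)"
proof -
  have *: "(\<lambda>x. \<Sum>(\<gamma>, \<delta>)\<leftarrow>xs. iter_partial \<gamma> f x * iter_partial \<delta> g x) differentiable (at x)" for xs x
    by (induction xs) (auto intro!: derivative_intros smooth_differentiable assms)
  then show ?thesis by (simp add: smooth_iff iter_partial_mult[OF assms])
qed

text \<open>The Leibniz sum has \<open>2 ^ length \<beta>\<close> terms, so a common bound for the
  products of derivatives suffices.\<close>

lemma norm_iter_partial_mult_le:
  fixes f g :: "real^'n::finite \<Rightarrow> 'b::real_normed_algebra"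
  assumes "smooth f" "smooth g"
    and A: "\<And>\<gamma> \<delta>. length \<gamma> + length \<delta> = length \<beta> \<Longrightarrow>
      norm (iter_partial \<gamma> f x) * norm (iter_partial \<delta> g x) \<le> A"
  shows "norm (iter_partial \<beta> (\<lambda>x. f x * g x) x) \<le> 2 ^ length \<beta> * A"
proof -
  have "norm (\<Sum>(\<gamma>, \<delta>)\<leftarrow>xs. iter_partial \<gamma> f x * iter_partial \<delta> g x) \<le> real (length xs) * A"
    if "set xs \<subseteq> set (splits \<beta>)" for xs
    using that
  proof (induction xs)
    case (Cons p xs)
    obtain \<gamma> \<delta> where p: "p = (\<gamma>, \<delta>)" by fastforce
    have "norm (iter_partial \<gamma> f x * iter_partial \<delta> g x) \<le> A"
      using order_trans[OF norm_mult_ineq A[OF splits_length]] Cons(2) unfolding p by auto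
    then show ?case using Cons unfolding p by (auto simp: algebra_simps intro!: norm_triangle_le)
  qed auto
  from this[OF order_refl] show ?thesis
    by (simp add: iter_partial_mult[OF assms(1,2)] length_splits)
qed

lemma smooth_coord: "smooth (\<lambda>x::real^'n::finite. x $ i)"
proof -
  have *: "((\<lambda>x::real^'n. x $ i) has_derivative (\<lambda>h. h $ i)) (at x)" for x
    by (rule bounded_linear.has_derivative[OF bounded_linear_vec_nth has_derivative_ident])
  have d: "(\<lambda>x::real^'n. x $ i) differentiable (at x)" for x
    using * by (auto simp: differentiable_def)
  have p: "partial_deriv l (\<lambda>x::real^'n. x $ i) = (\<lambda>x. axis l 1 $ i)" for l
    by (rule ext) (rule partial_deriv_eqI[OF *])
  have c: "partial_deriv l (\<lambda>x::real^'n. c) = (\<lambda>x. 0)" for l and c :: real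
    by (rule ext) (simp add: partial_deriv_def)
  show ?thesis
    by (rule smooth_coinduct[of _ "insert (\<lambda>x::real^'n. x $ i) (range (\<lambda>c x. c))"])
      (auto simp: p c d)
qed

lemma iter_partial_scale:
  assumes "smooth f"
  shows "iter_partial \<beta> (\<lambda>x. f (c *\<^sub>R x)) = (\<lambda>x. c ^ length \<beta> *\<^sub>R iter_partial \<beta> f (c *\<^sub>R x))"
proof (induction \<beta>)
  case (Cons i \<beta>)
  have *: "((\<lambda>x. c ^ length \<beta> *\<^sub>R iter_partial \<beta> f (c *\<^sub>R x)) has_derivative
      (\<lambda>h. c ^ length \<beta> *\<^sub>R frechet_derivative (iter_partial \<beta> f) (at (c *\<^sub>R x)) (c *\<^sub>R h))) (at x)" for x
    by (intro has_derivative_scaleR_right has_derivative_compose[of "\<lambda>x. c *\<^sub>R x" _ _ _ "iter_partial \<beta> f"]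
      derivative_eq_intros has_derivative_partial smooth_differentiable assms) auto
  show ?case unfolding iter_partial.simps Cons
    by (rule ext, subst partial_deriv_eqI[OF *])
      (simp add: partial_deriv_def linear_scale[OF linear_frechet_derivative[OF smooth_differentiable[OF assms]]])
qed auto

lemma smooth_scale:
  assumes "smooth f"
  shows "smooth (\<lambda>x. f (c *\<^sub>R x))"
proof -
  have "(\<lambda>x. c ^ length \<beta> *\<^sub>R iter_partial \<beta> f (c *\<^sub>R x)) differentiable (at x)" for \<beta> x
    using has_derivative_scaleR_right[OF has_derivative_compose[of "\<lambda>x. c *\<^sub>R x" "\<lambda>h. c *\<^sub>R h" x UNIV "iter_partial \<beta> f",
        OF has_derivative_scaleR_right[OF has_derivative_ident] has_derivative_partial[OF smooth_differentiable[OF assms]]]]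
    by (auto simp: differentiable_def)
  then show ?thesis by (simp add: smooth_iff iter_partial_scale[OF assms])
qed

text \<open>The factor that the multi-index contributes when plane waves are differentiated.\<close>

definition imon :: "'n::finite list \<Rightarrow> real^'n \<Rightarrow> complex" where
  "imon \<beta> x = (\<Prod>l\<leftarrow>\<beta>. \<i> * complex_of_real (x $ l))"

lemma imon_simps [simp]:
  "imon [] x = 1" "imon (l # \<beta>) x = \<i> * complex_of_real (x $ l) * imon \<beta> x"
  by (simp_all add: imon_def)

lemma norm_imon_le: "norm (imon \<beta> x) \<le> norm x ^ length \<beta>"
  by (induction \<beta>) (auto simp: norm_mult component_le_norm_cart intro!: mult_mono)

lemma cis_linear_has_derivative:
  "((\<lambda>x::real^'n::finite. cis (y \<bullet> x)) has_derivative (\<lambda>h. \<i> * complex_of_real (y \<bullet> h) * cis (y \<bullet> x))) (at x)"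
proof -
  have "((\<lambda>x::real^'n. \<i> * complex_of_real (y \<bullet> x)) has_derivative
      (\<lambda>h. \<i> * complex_of_real (y \<bullet> h))) (at x)"
    by (intro bounded_linear.has_derivative[OF bounded_linear_mult_right]
        bounded_linear.has_derivative[OF bounded_linear_of_real]
        bounded_linear.has_derivative[OF bounded_linear_inner_right] has_derivative_ident)
  from has_derivative_compose[OF this has_field_derivative_imp_has_derivative[OF DERIV_exp]]
  show ?thesis
    by (simp add: cis_conv_exp mult.commute)
qed

lemma iter_partial_cis:
  "iter_partial \<beta> (\<lambda>x. cis (y \<bullet> x)) = (\<lambda>x. imon \<beta> y * cis (y \<bullet> x))"
proof (induction \<beta>)
  case (Cons i \<beta>)
  show ?case unfolding iter_partial.simps Cons
    by (rule ext, subst partial_deriv_eqI[OF has_derivative_mult_right[OF cis_linear_has_derivative]])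
      (simp add: inner_axis)
qed auto

lemma smooth_cis: "smooth (\<lambda>x. cis (y \<bullet> x))"
  unfolding smooth_iff iter_partial_cis
  using has_derivative_mult_right[OF cis_linear_has_derivative] by (auto simp: differentiable_def)

section \<open>The Schwartz class\<close>

abbreviation snorm :: "nat \<Rightarrow> (real^'n::finite \<Rightarrow> complex) \<Rightarrow> real" where
  "snorm \<equiv> schwartz_seminorm"

lemma schwartzI:
  assumes "smooth f" "\<And>\<beta> m. \<exists>B. \<forall>x. (1 + norm x) ^ m * norm (iter_partial \<beta> f x) \<le> B"
  shows "f \<in> schwartz"
proof -
  have "bounded (range (\<lambda>x. (1 + norm x) ^ m *\<^sub>R iter_partial \<beta> f x))" for \<beta> m
    using assms(2)[of m \<beta>] by (auto simp: bounded_iff)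
  then show ?thesis using assms(1) by (simp add: schwartz_def)
qed

lemma schwartz_smooth: "f \<in> schwartz \<Longrightarrow> smooth f"
  by (simp add: schwartz_def)

lemma schwartz_bounded:
  assumes "f \<in> schwartz"
  obtains B where "\<And>x. (1 + norm x) ^ m * norm (iter_partial \<beta> f x) \<le> B"
proof -
  have "bounded (range (\<lambda>x. (1 + norm x) ^ m *\<^sub>R iter_partial \<beta> f x))"
    using assms by (simp add: schwartz_def)
  then show ?thesis using that by (auto simp: bounded_iff)
qed

lemma finite_lists_le: "finite {\<beta> :: 'a::finite list. length \<beta> \<le> M}"
  using finite_lists_length_le[of "UNIV :: 'a set" M] by simp

text \<open>The supremum is only meaningful if it is finite. There are finitely many multi-indices
  of length at most M, and the sum of their individual bounds majorises it.\<close>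

lemma snorm_bound:
  fixes f :: "real^'n::finite \<Rightarrow> complex"
  assumes "f \<in> schwartz" "length \<beta> \<le> M"
  shows "(1 + norm x) ^ M * norm (iter_partial \<beta> f x) \<le> snorm M f"
proof -
  define B where "B \<gamma> = (SOME B. \<forall>x. (1 + norm x) ^ M * norm (iter_partial \<gamma> f x) \<le> B)" for \<gamma>
  have B: "(1 + norm x) ^ M * norm (iter_partial \<gamma> f x) \<le> B \<gamma>" for \<gamma> x
    using someI_ex[of "\<lambda>B. \<forall>x. (1 + norm x) ^ M * norm (iter_partial \<gamma> f x) \<le> B"]
      schwartz_bounded[OF assms(1), of M \<gamma>] unfolding B_def by blast
  have B0: "0 \<le> B \<gamma>" for \<gamma>
    by (rule order_trans[OF _ B[of 0 \<gamma>]]) simp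
  have fin: "finite {\<beta> :: 'n list. length \<beta> \<le> M}" by (rule finite_lists_le)
  have "bdd_above ((\<lambda>(\<beta>, x). (1 + norm x) ^ M * norm (iter_partial \<beta> f x)) ` ({\<beta>. length \<beta> \<le> M} \<times> UNIV))"
    unfolding bdd_above_def
    by (rule exI[of _ "\<Sum>\<gamma>\<in>{\<beta>. length \<beta> \<le> M}. B \<gamma>"])
      (auto intro!: order_trans[OF B] member_le_sum B0 fin)
  from cSUP_upper[OF _ this, of "(\<beta>, x)"] assms(2) show ?thesis
    by (simp add: schwartz_seminorm_def)
qed

lemma snorm_leI:
  fixes f :: "real^'n::finite \<Rightarrow> complex"
  assumes "\<And>\<beta> x. length \<beta> \<le> M \<Longrightarrow> (1 + norm x) ^ M * norm (iter_partial \<beta> f x) \<le> B"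
  shows "snorm M f \<le> B"
proof -
  have "([], 0) \<in> ({\<beta>. length \<beta> \<le> M} \<times> UNIV :: ('n list \<times> (real^'n)) set)"
    by simp
  then have "({\<beta>. length \<beta> \<le> M} \<times> UNIV :: ('n list \<times> (real^'n)) set) \<noteq> {}" by blast
  then show ?thesis
    unfolding schwartz_seminorm_def using assms by (intro cSUP_least) auto
qed

lemma snorm_nonneg: "f \<in> schwartz \<Longrightarrow> 0 \<le> snorm M f"
  by (rule order_trans[OF _ snorm_bound[of f "[]" M 0]]) auto

lemma snorm_mono:
  assumes "f \<in> schwartz" "M \<le> M'"
  shows "snorm M f \<le> snorm M' f"
proof (rule snorm_leI)
  fix \<beta> :: "'a list" and x
  assume "length \<beta> \<le> M"
  then have "(1 + norm x) ^ M' * norm (iter_partial \<beta> f x) \<le> snorm M' f"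
    using assms by (intro snorm_bound) auto
  moreover have "(1 + norm x) ^ M * norm (iter_partial \<beta> f x) \<le> (1 + norm x) ^ M' * norm (iter_partial \<beta> f x)"
    using assms by (intro mult_right_mono power_increasing) auto
  ultimately show "(1 + norm x) ^ M * norm (iter_partial \<beta> f x) \<le> snorm M' f" by simp
qed

lemma norm_le_snorm: "f \<in> schwartz \<Longrightarrow> (1 + norm x) ^ M * norm (f x) \<le> snorm M f"
  using snorm_bound[of f "[]" M x] by simp

lemma zero_schwartz [simp]: "(\<lambda>x. 0) \<in> schwartz"
  by (rule schwartzI) auto

lemma schwartz_iter_partial: "f \<in> schwartz \<Longrightarrow> iter_partial \<beta> f \<in> schwartz"
proof (rule schwartzI)
  assume f: "f \<in> schwartz"
  show "smooth (iter_partial \<beta> f)" by (rule smooth_iter_partial[OF schwartz_smooth[OF f]])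
  fix \<gamma> :: "'a list" and m
  obtain B where "\<And>x. (1 + norm x) ^ m * norm (iter_partial (\<gamma> @ \<beta>) f x) \<le> B"
    by (rule schwartz_bounded[OF f, of m "\<gamma> @ \<beta>"]) blast
  then show "\<exists>B. \<forall>x. (1 + norm x) ^ m * norm (iter_partial \<gamma> (iter_partial \<beta> f) x) \<le> B"
    by (auto simp: iter_partial_append)
qed

lemma snorm_iter_partial_le:
  assumes "f \<in> schwartz"
  shows "snorm M (iter_partial \<beta> f) \<le> snorm (M + length \<beta>) f"
proof (rule snorm_leI)
  fix \<gamma> :: "'a list" and x
  assume "length \<gamma> \<le> M"
  then have "(1 + norm x) ^ (M + length \<beta>) * norm (iter_partial (\<gamma> @ \<beta>) f x) \<le> snorm (M + length \<beta>) f"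
    using assms by (intro snorm_bound) auto
  moreover have "(1 + norm x) ^ M * norm (iter_partial (\<gamma> @ \<beta>) f x)
      \<le> (1 + norm x) ^ (M + length \<beta>) * norm (iter_partial (\<gamma> @ \<beta>) f x)"
    using assms by (intro mult_right_mono power_increasing) auto
  ultimately show "(1 + norm x) ^ M * norm (iter_partial \<gamma> (iter_partial \<beta> f) x) \<le> snorm (M + length \<beta>) f"
    by (simp add: iter_partial_append)
qed

lemma schwartz_add:
  assumes "f \<in> schwartz" "g \<in> schwartz"
  shows "(\<lambda>x. f x + g x) \<in> schwartz"
proof (rule schwartzI)
  fix \<beta> m
  obtain B where B: "\<And>x. (1 + norm x) ^ m * norm (iter_partial \<beta> f x) \<le> B"
    by (rule schwartz_bounded[OF assms(1)]) blast
  obtain D where D: "\<And>x. (1 + norm x) ^ m * norm (iter_partial \<beta> g x) \<le> D"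
    by (rule schwartz_bounded[OF assms(2)]) blast
  have "(1 + norm x) ^ m * norm (iter_partial \<beta> f x + iter_partial \<beta> g x) \<le> B + D" for x
    using mult_left_mono[OF norm_triangle_ineq, of "(1 + norm x) ^ m" "iter_partial \<beta> f x" "iter_partial \<beta> g x"]
      B[of x] D[of x] by (simp add: distrib_left)
  then show "\<exists>B. \<forall>x. (1 + norm x) ^ m * norm (iter_partial \<beta> (\<lambda>x. f x + g x) x) \<le> B"
    using assms by (auto simp: iter_partial_add schwartz_smooth)
qed (use assms in \<open>auto intro: smooth_add schwartz_smooth\<close>)

lemma schwartz_cmult:
  assumes "f \<in> schwartz"
  shows "(\<lambda>x. c * f x) \<in> schwartz"
proof (rule schwartzI)
  fix \<beta> m
  obtain B where B: "\<And>x. (1 + norm x) ^ m * norm (iter_partial \<beta> f x) \<le> B"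
    by (rule schwartz_bounded[OF assms(1)]) blast
  have "(1 + norm x) ^ m * norm (c * iter_partial \<beta> f x) \<le> norm c * B" for x
    using mult_left_mono[OF B, of "norm c" x] by (simp add: norm_mult mult_ac)
  then show "\<exists>B. \<forall>x. (1 + norm x) ^ m * norm (iter_partial \<beta> (\<lambda>x. c * f x) x) \<le> B"
    using assms by (auto simp: iter_partial_cmult schwartz_smooth)
qed (use assms in \<open>auto intro: smooth_cmult schwartz_smooth\<close>)

lemma schwartz_diff:
  assumes "f \<in> schwartz" "g \<in> schwartz"
  shows "(\<lambda>x. f x - g x) \<in> schwartz"
  using schwartz_add[OF assms(1) schwartz_cmult[OF assms(2), of "-1"]] by simp

lemma schwartz_sum:
  assumes "\<And>i. i \<in> I \<Longrightarrow> f i \<in> schwartz"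
  shows "(\<lambda>x. \<Sum>i\<in>I. f i x) \<in> schwartz"
  using assms by (induction I rule: infinite_finite_induct) (auto intro: schwartz_add)

lemma snorm_add:
  assumes "f \<in> schwartz" "g \<in> schwartz"
  shows "snorm M (\<lambda>x. f x + g x) \<le> snorm M f + snorm M g"
proof (rule snorm_leI)
  fix \<beta> :: "'a list" and x
  assume "length \<beta> \<le> M"
  from snorm_bound[OF assms(1) this, of x] snorm_bound[OF assms(2) this, of x]
    mult_left_mono[OF norm_triangle_ineq, of "(1 + norm x) ^ M" "iter_partial \<beta> f x" "iter_partial \<beta> g x"]
  show "(1 + norm x) ^ M * norm (iter_partial \<beta> (\<lambda>x. f x + g x) x) \<le> snorm M f + snorm M g"
    using assms by (simp add: iter_partial_add schwartz_smooth distrib_left)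
qed

lemma snorm_cmult:
  assumes "f \<in> schwartz"
  shows "snorm M (\<lambda>x. c * f x) \<le> norm c * snorm M f"
proof (rule snorm_leI)
  fix \<beta> :: "'a list" and x
  assume "length \<beta> \<le> M"
  from mult_left_mono[OF snorm_bound[OF assms(1) this, of x], of "norm c"]
  show "(1 + norm x) ^ M * norm (iter_partial \<beta> (\<lambda>x. c * f x) x) \<le> norm c * snorm M f"
    using assms by (simp add: iter_partial_cmult schwartz_smooth norm_mult mult_ac)
qed

lemma snorm_diff:
  assumes "f \<in> schwartz" "g \<in> schwartz"
  shows "snorm M (\<lambda>x. f x - g x) \<le> snorm M f + snorm M g"
  using order_trans[OF snorm_add[OF assms(1) schwartz_cmult[OF assms(2), of "-1"]]
      add_left_mono[OF snorm_cmult[OF assms(2), of M "-1"]]] by simp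

text \<open>The multipliers of the Schwartz class, usually denoted O_M.\<close>

definition slow :: "(real^'n::finite \<Rightarrow> complex) \<Rightarrow> bool" where
  "slow g \<longleftrightarrow> smooth g \<and> (\<forall>\<beta>. \<exists>m B. \<forall>x. norm (iter_partial \<beta> g x) \<le> B * (1 + norm x) ^ m)"

lemma slowI:
  assumes "smooth g" "\<And>\<beta>. \<exists>m B. \<forall>x. norm (iter_partial \<beta> g x) \<le> B * (1 + norm x) ^ m"
  shows "slow g"
  using assms by (simp add: slow_def)

lemma slow_smooth: "slow g \<Longrightarrow> smooth g"
  by (simp add: slow_def)

text \<open>Only finitely many derivatives are involved, so summing exponents and constants gives
  one bound for all of them.\<close>

lemma slow_uniform:
  fixes g :: "real^'n::finite \<Rightarrow> complex"
  assumes "slow g"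
  obtains m B where "0 \<le> B" "\<And>\<beta> x. length \<beta> \<le> M \<Longrightarrow> norm (iter_partial \<beta> g x) \<le> B * (1 + norm x) ^ m"
proof -
  have "\<forall>\<beta>. \<exists>m B. \<forall>x. norm (iter_partial \<beta> g x) \<le> B * (1 + norm x) ^ m"
    using assms by (simp add: slow_def)
  then obtain m B where mB: "\<And>\<beta> x. norm (iter_partial \<beta> g x) \<le> B \<beta> * (1 + norm x) ^ m \<beta>" by metis
  have B0: "0 \<le> B \<beta>" for \<beta>
    using order_trans[OF norm_ge_zero mB[of \<beta> 0]] by simp
  define L where "L = {\<beta> :: 'n list. length \<beta> \<le> M}"
  have fin: "finite L" unfolding L_def by (rule finite_lists_le)
  have "norm (iter_partial \<beta> g x) \<le> (\<Sum>\<gamma>\<in>L. B \<gamma>) * (1 + norm x) ^ (\<Sum>\<gamma>\<in>L. m \<gamma>)" if "length \<beta> \<le> M" for \<beta> x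
  proof -
    have "\<beta> \<in> L" using that by (simp add: L_def)
    have "B \<beta> * (1 + norm x) ^ m \<beta> \<le> (\<Sum>\<gamma>\<in>L. B \<gamma>) * (1 + norm x) ^ (\<Sum>\<gamma>\<in>L. m \<gamma>)"
      using \<open>\<beta> \<in> L\<close> fin B0 by (intro mult_mono power_increasing member_le_sum sum_nonneg) auto
    with mB[of \<beta> x] show ?thesis by simp
  qed
  moreover have "0 \<le> (\<Sum>\<gamma>\<in>L. B \<gamma>)" by (intro sum_nonneg B0)
  ultimately show ?thesis using that by blast
qed

text \<open>The growth exponent m of the multiplier is paid for by m additional powers of the weight
  on the other factor. The hypotheses concern a single point x, so they can be checked region by
  region.\<close>

lemma weighted_mult_bound:
  fixes g f :: "real^'n::finite \<Rightarrow> complex"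
  assumes "smooth g" "smooth f" "0 \<le> A"
    and "\<And>\<gamma>. length \<gamma> \<le> length \<beta> \<Longrightarrow> norm (iter_partial \<gamma> g x) \<le> A * (1 + norm x) ^ m"
    and "\<And>\<delta>. length \<delta> \<le> length \<beta> \<Longrightarrow> (1 + norm x) ^ (k + m) * norm (iter_partial \<delta> f x) \<le> D"
  shows "(1 + norm x) ^ k * norm (iter_partial \<beta> (\<lambda>x. g x * f x) x) \<le> 2 ^ length \<beta> * (A * D)"
proof -
  have "norm (iter_partial \<beta> (\<lambda>x. g x * f x) x) \<le> 2 ^ length \<beta> * (A * D / (1 + norm x) ^ k)"
  proof (rule norm_iter_partial_mult_le[OF assms(1,2)])
    fix \<gamma> \<delta> :: "'n list"
    assume l: "length \<gamma> + length \<delta> = length \<beta>"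
    have "norm (iter_partial \<gamma> g x) * norm (iter_partial \<delta> f x) \<le> A * (1 + norm x) ^ m * norm (iter_partial \<delta> f x)"
      using assms(4)[of \<gamma>] l by (intro mult_right_mono) auto
    also have "\<dots> = A * ((1 + norm x) ^ (k + m) * norm (iter_partial \<delta> f x)) / (1 + norm x) ^ k"
      by (simp add: power_add add_nonneg_eq_0_iff)
    also have "\<dots> \<le> A * D / (1 + norm x) ^ k"
      using assms(5)[of \<delta>] l assms(3) by (intro divide_right_mono mult_left_mono) auto
    finally show "norm (iter_partial \<gamma> g x) * norm (iter_partial \<delta> f x) \<le> A * D / (1 + norm x) ^ k" .
  qed
  from mult_left_mono[OF this, of "(1 + norm x) ^ k"] show ?thesis
    by (simp add: add_nonneg_eq_0_iff)
qed

lemma schwartz_slow_mult: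
  assumes "slow g" "f \<in> schwartz"
  shows "(\<lambda>x. g x * f x) \<in> schwartz"
proof (rule schwartzI)
  fix \<beta> :: "'a list" and k
  obtain m A where A: "0 \<le> A" "\<And>\<gamma> x. length \<gamma> \<le> length \<beta> \<Longrightarrow> norm (iter_partial \<gamma> g x) \<le> A * (1 + norm x) ^ m"
    by (rule slow_uniform[OF assms(1)]) blast
  have "(1 + norm x) ^ (k + m) * norm (iter_partial \<delta> f x) \<le> snorm (k + m + length \<beta>) f"
    if "length \<delta> \<le> length \<beta>" for \<delta> x
    by (rule order_trans[OF _ snorm_bound[OF assms(2), of \<delta> _ x]])
      (use that in \<open>auto intro!: mult_right_mono power_increasing\<close>)
  then show "\<exists>B. \<forall>x. (1 + norm x) ^ k * norm (iter_partial \<beta> (\<lambda>x. g x * f x) x) \<le> B"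
    using weighted_mult_bound[OF slow_smooth[OF assms(1)] schwartz_smooth[OF assms(2)] A(1) A(2)] by blast
qed (rule smooth_mult[OF slow_smooth[OF assms(1)] schwartz_smooth[OF assms(2)]])

lemma snorm_slow_mult:
  assumes "slow g"
  obtains M' C where "0 \<le> C" "\<And>f. f \<in> schwartz \<Longrightarrow> snorm M (\<lambda>x. g x * f x) \<le> C * snorm M' f"
proof -
  obtain m A where A: "0 \<le> A" "\<And>\<gamma> x. length \<gamma> \<le> M \<Longrightarrow> norm (iter_partial \<gamma> g x) \<le> A * (1 + norm x) ^ m"
    by (rule slow_uniform[OF assms(1)]) blast
  have "snorm M (\<lambda>x. g x * f x) \<le> (2 ^ M * A) * snorm (M + m) f" if f: "f \<in> schwartz" for f
  proof (rule snorm_leI)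
    fix \<beta> :: "'a list" and x
    assume "length \<beta> \<le> M"
    then have "(1 + norm x) ^ M * norm (iter_partial \<beta> (\<lambda>x. g x * f x) x) \<le> 2 ^ length \<beta> * (A * snorm (M + m) f)"
      by (intro weighted_mult_bound[OF slow_smooth[OF assms] schwartz_smooth[OF f] A(1) A(2)] snorm_bound f) auto
    also have "\<dots> \<le> 2 ^ M * (A * snorm (M + m) f)"
      using \<open>length \<beta> \<le> M\<close> A(1) snorm_nonneg[OF f] by (intro mult_right_mono power_increasing) auto
    finally show "(1 + norm x) ^ M * norm (iter_partial \<beta> (\<lambda>x. g x * f x) x) \<le> (2 ^ M * A) * snorm (M + m) f"
      by (simp add: mult_ac)
  qed
  then show ?thesis using that[of "2 ^ M * A" "M + m"] A(1) by auto
qed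

lemma slow_schwartz: "f \<in> schwartz \<Longrightarrow> slow f"
proof (rule slowI)
  fix \<beta> :: "'a list" assume f: "f \<in> schwartz"
  obtain B where "\<And>x. (1 + norm x) ^ 0 * norm (iter_partial \<beta> f x) \<le> B"
    by (rule schwartz_bounded[OF f]) blast
  then show "\<exists>m B. \<forall>x. norm (iter_partial \<beta> f x) \<le> B * (1 + norm x) ^ m"
    by (intro exI[of _ 0] exI[of _ B]) simp
qed (rule schwartz_smooth)

lemma schwartz_mult: "f \<in> schwartz \<Longrightarrow> g \<in> schwartz \<Longrightarrow> (\<lambda>x. f x * g x) \<in> schwartz"
  by (rule schwartz_slow_mult[OF slow_schwartz])

lemma slow_const: "slow (\<lambda>x::real^'n::finite. c)"
proof (rule slowI)
  fix \<beta> :: "'n list"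
  show "\<exists>m B. \<forall>x::real^'n. norm (iter_partial \<beta> (\<lambda>x. c) x) \<le> B * (1 + norm x) ^ m"
  proof (cases \<beta> rule: rev_cases)
    case Nil
    then show ?thesis by (intro exI[of _ 0] exI[of _ "norm c"]) simp
  next
    case (snoc ys y)
    have "partial_deriv y (\<lambda>x::real^'n. c) = (\<lambda>x. 0)" by (simp add: partial_deriv_def fun_eq_iff)
    then show ?thesis using snoc by (intro exI[of _ 0] exI[of _ 0]) (simp add: iter_partial_snoc)
  qed
qed simp

lemma slow_cis: "slow (\<lambda>x. cis (y \<bullet> x))"
proof (rule slowI[OF smooth_cis])
  fix \<beta> :: "'a list"
  show "\<exists>m B. \<forall>x. norm (iter_partial \<beta> (\<lambda>x. cis (y \<bullet> x)) x) \<le> B * (1 + norm x) ^ m"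
    by (rule exI[of _ 0], rule exI[of _ "norm y ^ length \<beta>"])
      (auto simp: iter_partial_cis norm_mult norm_imon_le)
qed

lemma slow_mult:
  fixes f g :: "real^'n::finite \<Rightarrow> complex"
  assumes "slow f" "slow g"
  shows "slow (\<lambda>x. f x * g x)"
proof (rule slowI)
  fix \<beta> :: "'n list"
  obtain m A where A: "0 \<le> A" "\<And>\<gamma> x. length \<gamma> \<le> length \<beta> \<Longrightarrow> norm (iter_partial \<gamma> f x) \<le> A * (1 + norm x) ^ m"
    by (rule slow_uniform[OF assms(1)]) blast
  obtain k D where D: "0 \<le> D" "\<And>\<gamma> x. length \<gamma> \<le> length \<beta> \<Longrightarrow> norm (iter_partial \<gamma> g x) \<le> D * (1 + norm x) ^ k"
    by (rule slow_uniform[OF assms(2)]) blast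
  have "norm (iter_partial \<beta> (\<lambda>x. f x * g x) x) \<le> 2 ^ length \<beta> * (A * (1 + norm x) ^ m * (D * (1 + norm x) ^ k))" for x
    by (rule norm_iter_partial_mult_le) (use assms A D in \<open>auto intro!: slow_smooth mult_mono\<close>)
  then show "\<exists>m B. \<forall>x. norm (iter_partial \<beta> (\<lambda>x. f x * g x) x) \<le> B * (1 + norm x) ^ m"
    by (intro exI[of _ "m + k"] exI[of _ "2 ^ length \<beta> * (A * D)"]) (simp add: power_add mult_ac)
qed (use assms in \<open>auto intro: smooth_mult slow_smooth\<close>)

lemma slow_diff:
  fixes f g :: "real^'n::finite \<Rightarrow> complex"
  assumes "slow f" "slow g"
  shows "slow (\<lambda>x. f x - g x)"
proof (rule slowI)
  fix \<beta> :: "'n list"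
  obtain m A where A: "0 \<le> A" "\<And>\<gamma> x. length \<gamma> \<le> length \<beta> \<Longrightarrow> norm (iter_partial \<gamma> f x) \<le> A * (1 + norm x) ^ m"
    by (rule slow_uniform[OF assms(1)]) blast
  obtain k D where D: "0 \<le> D" "\<And>\<gamma> x. length \<gamma> \<le> length \<beta> \<Longrightarrow> norm (iter_partial \<gamma> g x) \<le> D * (1 + norm x) ^ k"
    by (rule slow_uniform[OF assms(2)]) blast
  have "norm (iter_partial \<beta> (\<lambda>x. f x - g x) x) \<le> (A + D) * (1 + norm x) ^ (m + k)" for x
  proof -
    have "norm (iter_partial \<beta> f x - iter_partial \<beta> g x) \<le> A * (1 + norm x) ^ m + D * (1 + norm x) ^ k"
      by (intro order_trans[OF norm_triangle_ineq4] add_mono A D) auto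
    also have "\<dots> \<le> A * (1 + norm x) ^ (m + k) + D * (1 + norm x) ^ (m + k)"
      using A(1) D(1) by (intro add_mono mult_left_mono power_increasing) auto
    finally show ?thesis
      using assms by (simp add: iter_partial_diff slow_smooth algebra_simps)
  qed
  then show "\<exists>m B. \<forall>x. norm (iter_partial \<beta> (\<lambda>x. f x - g x) x) \<le> B * (1 + norm x) ^ m" by blast
qed (use assms in \<open>auto intro: smooth_diff slow_smooth\<close>)

lemma slow_coord: "slow (\<lambda>x::real^'n::finite. complex_of_real (x $ i))"
proof (rule slowI)
  show s: "smooth (\<lambda>x::real^'n. complex_of_real (x $ i))"
    by (rule smooth_bounded_linear[OF bounded_linear_of_real smooth_coord])
  fix \<beta> :: "'n list"
  have *: "((\<lambda>x::real^'n. complex_of_real (x $ i)) has_derivative (\<lambda>h. complex_of_real (h $ i))) (at x)" for x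
    by (intro bounded_linear.has_derivative[OF bounded_linear_of_real]
        bounded_linear.has_derivative[OF bounded_linear_vec_nth] has_derivative_ident)
  show "\<exists>m B. \<forall>x::real^'n. norm (iter_partial \<beta> (\<lambda>x. complex_of_real (x $ i)) x) \<le> B * (1 + norm x) ^ m"
  proof (cases \<beta> rule: rev_cases)
    case Nil
    have "\<bar>x $ i\<bar> \<le> 1 + norm x" for x :: "real^'n"
      using component_le_norm_cart[of x i] by simp
    then show ?thesis using Nil by (intro exI[of _ 1] exI[of _ 1]) simp
  next
    case (snoc ys y)
    have "partial_deriv y (\<lambda>x::real^'n. complex_of_real (x $ i)) = (\<lambda>x. complex_of_real (axis y 1 $ i))"
      by (rule ext) (rule partial_deriv_eqI[OF *])
    then show ?thesis using slow_const[of "complex_of_real (axis y 1 $ i)"]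
      unfolding slow_def snoc iter_partial_snoc by metis
  qed
qed

lemma slow_imon: "slow (imon \<beta>)"
proof (induction \<beta>)
  case Nil
  then show ?case using slow_const[of 1] by (simp add: imon_def[abs_def])
next
  case (Cons l \<beta>)
  have "imon (l # \<beta>) = (\<lambda>x. \<i> * complex_of_real (x $ l) * imon \<beta> x)"
    by (simp add: fun_eq_iff)
  then show ?case using slow_mult[OF slow_mult[OF slow_const[of \<i>] slow_coord[of l]] Cons] by simp
qed

lemma slow_scale:
  assumes "slow f" shows "slow (\<lambda>x. f (c *\<^sub>R x))"
proof (rule slowI)
  fix \<beta> :: "'a list"
  obtain m A where A: "0 \<le> A" "\<And>\<gamma> x. length \<gamma> \<le> length \<beta> \<Longrightarrow> norm (iter_partial \<gamma> f x) \<le> A * (1 + norm x) ^ m"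
    by (rule slow_uniform[OF assms(1)]) blast
  have "norm (iter_partial \<beta> (\<lambda>x. f (c *\<^sub>R x)) x) \<le> (\<bar>c\<bar> ^ length \<beta> * A * (1 + \<bar>c\<bar>) ^ m) * (1 + norm x) ^ m" for x
  proof -
    have "1 + \<bar>c\<bar> * norm x \<le> (1 + \<bar>c\<bar>) * (1 + norm x)" by (simp add: algebra_simps)
    then have "(1 + \<bar>c\<bar> * norm x) ^ m \<le> (1 + \<bar>c\<bar>) ^ m * (1 + norm x) ^ m"
      unfolding power_mult_distrib[symmetric] by (rule power_mono) auto
    then have "norm (iter_partial \<beta> f (c *\<^sub>R x)) \<le> A * ((1 + \<bar>c\<bar>) ^ m * (1 + norm x) ^ m)"
      using order_trans[OF A(2) mult_left_mono[OF _ A(1)], of \<beta> "c *\<^sub>R x"] by simp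
    from mult_left_mono[OF this, of "\<bar>c\<bar> ^ length \<beta>"] show ?thesis
      using slow_smooth[OF assms] by (simp add: iter_partial_scale power_abs mult_ac)
  qed
  then show "\<exists>m B. \<forall>x. norm (iter_partial \<beta> (\<lambda>x. f (c *\<^sub>R x)) x) \<le> B * (1 + norm x) ^ m" by blast
qed (use assms in \<open>auto intro: smooth_scale slow_smooth\<close>)

lemma norm_iter_partial_le_snorm:
  assumes "f \<in> schwartz" "length \<beta> \<le> M"
  shows "norm (iter_partial \<beta> f x) \<le> snorm M f"
proof -
  have "1 * norm (iter_partial \<beta> f x) \<le> (1 + norm x) ^ M * norm (iter_partial \<beta> f x)"
    by (intro mult_right_mono one_le_power) auto
  then show ?thesis using snorm_bound[OF assms, of x] by simp
qed

section \<open>Cut-off functions\<close>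

text \<open>The functions \<open>h n\<close> are successive derivatives of one another. Finite sums
  of terms \<open>h n (q x) * p x\<close> with smooth p form a class closed under partial
  derivatives.\<close>

lemma smooth_compose_chain:
  fixes h :: "nat \<Rightarrow> real \<Rightarrow> real" and q :: "real^'n::finite \<Rightarrow> real"
  assumes h: "\<And>n t. (h n has_real_derivative h (Suc n) t) (at t)" and q: "smooth q"
  shows "smooth (\<lambda>x. h n (q x))"
proof (rule smooth_coinduct[where W = "{f. \<exists>xs. (\<forall>(n, p)\<in>set xs. smooth p) \<and> f = (\<lambda>x. \<Sum>(n, p)\<leftarrow>xs. h n (q x) * p x)}"])
  show "(\<lambda>x. h n (q x)) \<in> {f. \<exists>xs. (\<forall>(n, p)\<in>set xs. smooth p) \<and> f = (\<lambda>x. \<Sum>(n, p)\<leftarrow>xs. h n (q x) * p x)}"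
    by (auto intro!: exI[of _ "[(n, \<lambda>x. 1)]"])
next
  have q': "(q has_derivative frechet_derivative q (at x)) (at x)" for x
    by (intro has_derivative_partial smooth_differentiable0 q)
  have *: "((\<lambda>x. \<Sum>(n, p)\<leftarrow>xs. h n (q x) * p x) has_derivative
      (\<lambda>v. \<Sum>(n, p)\<leftarrow>xs. h n (q x) * frechet_derivative p (at x) v + h (Suc n) (q x) * frechet_derivative q (at x) v * p x)) (at x)"
    if "\<forall>(n, p)\<in>set xs. smooth p" for xs x
    using that
  proof (induction xs)
    case (Cons np xs)
    obtain n p where np: "np = (n, p)" by fastforce
    have "((\<lambda>x. h n (q x)) has_derivative (\<lambda>v. h (Suc n) (q x) * frechet_derivative q (at x) v)) (at x)"
      using has_derivative_compose[OF q' h[unfolded has_field_derivative_def]] by simp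
    moreover have "(p has_derivative frechet_derivative p (at x)) (at x)"
      using Cons(2) np by (auto intro!: has_derivative_partial smooth_differentiable0)
    ultimately have "((\<lambda>x. h n (q x) * p x) has_derivative
        (\<lambda>v. h n (q x) * frechet_derivative p (at x) v + h (Suc n) (q x) * frechet_derivative q (at x) v * p x)) (at x)"
      by (rule has_derivative_mult)
    from has_derivative_add[OF this Cons(1)] Cons(2) show ?case by (simp add: np)
  qed auto
  fix f
  assume "f \<in> {f. \<exists>xs. (\<forall>(n, p)\<in>set xs. smooth p) \<and> f = (\<lambda>x. \<Sum>(n, p)\<leftarrow>xs. h n (q x) * p x)}"
  then obtain xs where xs: "\<forall>(n, p)\<in>set xs. smooth p" and f: "f = (\<lambda>x. \<Sum>(n, p)\<leftarrow>xs. h n (q x) * p x)"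
    unfolding mem_Collect_eq by (elim exE conjE)
  show "f differentiable (at x)" for x
    unfolding f using *[OF xs] by (auto simp: differentiable_def)
  fix i
  define ys where "ys = map (\<lambda>(n, p). (n, partial_deriv i p)) xs @ map (\<lambda>(n, p). (Suc n, \<lambda>x. partial_deriv i q x * p x)) xs"
  have "\<forall>(n, p)\<in>set ys. smooth p"
    using xs q by (auto simp: ys_def intro!: smooth_partial_deriv smooth_mult)
  moreover have "partial_deriv i f = (\<lambda>x. \<Sum>(n, p)\<leftarrow>ys. h n (q x) * p x)"
    unfolding f by (rule ext, subst partial_deriv_eqI[OF *[OF xs]])
      (auto simp: ys_def partial_deriv_def case_prod_unfold o_def sum_list_addf mult_ac)
  ultimately show "partial_deriv i f \<in> {f. \<exists>xs. (\<forall>(n, p)\<in>set xs. smooth p) \<and> f = (\<lambda>x. \<Sum>(n, p)\<leftarrow>xs. h n (q x) * p x)}"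
    unfolding mem_Collect_eq by (intro exI conjI)
qed

text \<open>The class of quotients of a smooth function by a power of f is closed under partial
  derivatives.\<close>

lemma smooth_inverse:
  fixes f :: "real^'n::finite \<Rightarrow> real"
  assumes f: "smooth f" and nz: "\<And>x. f x \<noteq> 0"
  shows "smooth (\<lambda>x. inverse (f x))"
proof (rule smooth_coinduct[where W = "{g. \<exists>p k. smooth p \<and> g = (\<lambda>x. p x * inverse (f x) ^ k)}"])
  show "(\<lambda>x. inverse (f x)) \<in> {g. \<exists>p k. smooth p \<and> g = (\<lambda>x. p x * inverse (f x) ^ k)}"
    by (auto intro!: exI[of _ "\<lambda>x. 1"] exI[of _ "1::nat"])
next
  fix g
  assume "g \<in> {g. \<exists>p k. smooth p \<and> g = (\<lambda>x. p x * inverse (f x) ^ k)}"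
  then obtain p and k :: nat where p: "smooth p" and g: "g = (\<lambda>x. p x * inverse (f x) ^ k)"
    unfolding mem_Collect_eq by (elim exE conjE)
  have *: "(g has_derivative (\<lambda>v. p x * (- real k * inverse (f x) ^ Suc k * frechet_derivative f (at x) v)
      + frechet_derivative p (at x) v * inverse (f x) ^ k)) (at x)" for x
  proof -
    have "((\<lambda>t. inverse t ^ k) has_real_derivative (- real k * inverse (f x) ^ Suc k)) (at (f x))"
      by (rule DERIV_cong[OF DERIV_power[OF DERIV_inverse[OF nz[of x]]]], cases k)
        (simp_all add: algebra_simps)
    then have "((\<lambda>x. inverse (f x) ^ k) has_derivative
        (\<lambda>v. - real k * inverse (f x) ^ Suc k * frechet_derivative f (at x) v)) (at x)"
      unfolding has_field_derivative_def
      by (rule has_derivative_compose[OF has_derivative_partial[OF smooth_differentiable0[OF f]]])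
    then show ?thesis unfolding g
      by (intro has_derivative_mult has_derivative_partial smooth_differentiable0 p)
  qed
  show "g differentiable (at x)" for x using * by (auto simp: differentiable_def)
  fix i
  define p' where "p' = (\<lambda>x. partial_deriv i p x * f x - real k * (p x * partial_deriv i f x))"
  have "smooth p'"
    unfolding p'_def by (intro smooth_diff smooth_mult smooth_cmult smooth_partial_deriv p f)
  moreover have "partial_deriv i g = (\<lambda>x. p' x * inverse (f x) ^ Suc k)"
  proof
    fix x
    have "p' x * inverse (f x) ^ Suc k = partial_deriv i p x * (f x * inverse (f x)) * inverse (f x) ^ k
        - real k * (p x * partial_deriv i f x) * inverse (f x) ^ Suc k"
      by (simp add: p'_def algebra_simps)
    then show "partial_deriv i g x = p' x * inverse (f x) ^ Suc k"
      using nz[of x] by (subst partial_deriv_eqI[OF *]) (simp add: partial_deriv_def mult_ac)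
  qed
  ultimately show "partial_deriv i g \<in> {g. \<exists>p k. smooth p \<and> g = (\<lambda>x. p x * inverse (f x) ^ k)}"
    unfolding mem_Collect_eq by (intro exI conjI)
qed

text \<open>With s = 1/t, differentiation in t is -s^2 times differentiation in s, so p(s) exp(-s)
  has derivative (p(s) - p'(s)) s^2 exp(-s).\<close>

primrec flat_exp_poly :: "nat \<Rightarrow> real poly" where
  "flat_exp_poly 0 = 1"
| "flat_exp_poly (Suc n) = (flat_exp_poly n - pderiv (flat_exp_poly n)) * [:0, 0, 1:]"

text \<open>The n-th derivative of the function that is exp (- 1 / t) for positive t and 0 otherwise.\<close>

definition flat_exp :: "nat \<Rightarrow> real \<Rightarrow> real" where
  "flat_exp n t = (if t > 0 then poly (flat_exp_poly n) (inverse t) * exp (- inverse t) else 0)"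

lemma poly_exp_tendsto_0: "((\<lambda>x. poly p x * exp (- x)) \<longlongrightarrow> (0::real)) at_top"
proof -
  have "((\<lambda>x. \<Sum>i\<le>degree p. coeff p i * (x ^ i / exp x)) \<longlongrightarrow> (\<Sum>i\<le>degree p. coeff p i * 0)) at_top"
    by (intro tendsto_sum tendsto_mult tendsto_const tendsto_power_div_exp_0)
  then show ?thesis
    by (simp add: poly_altdef exp_minus sum_distrib_right divide_inverse mult.assoc)
qed

lemma flat_exp_deriv: "(flat_exp n has_real_derivative flat_exp (Suc n) t) (at t)"
proof (cases t "0::real" rule: linorder_cases)
  case less
  have "((\<lambda>t. 0) has_real_derivative flat_exp (Suc n) t) (at t)"
    using less by (simp add: flat_exp_def)
  then show ?thesis
    by (rule has_field_derivative_transform_within_open[of _ _ _ "{..<0}"])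
      (use less in \<open>auto simp: flat_exp_def\<close>)
next
  case greater
  have i: "(inverse has_real_derivative - (inverse t ^ Suc (Suc 0))) (at t)"
    using greater by (intro DERIV_inverse) auto
  have "((\<lambda>t. poly (flat_exp_poly n) (inverse t) * exp (- inverse t)) has_real_derivative flat_exp (Suc n) t) (at t)"
    by (rule DERIV_cong[OF DERIV_mult[OF DERIV_chain2[OF poly_DERIV i] DERIV_chain2[OF DERIV_exp DERIV_minus[OF i]]]])
      (use greater in \<open>simp add: flat_exp_def algebra_simps\<close>)
  then show ?thesis
    by (rule has_field_derivative_transform_within_open[of _ _ _ "{0<..}"])
      (use greater in \<open>auto simp: flat_exp_def\<close>)
next
  case equal
  \<comment> \<open>In terms of s = 1/x the difference quotient at 0 is a polynomial in s times
    exp(-s), which tends to 0 as s grows.\<close>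
  have lim: "((\<lambda>x. flat_exp n x / x) \<longlongrightarrow> 0) (at_right 0)"
  proof -
    have "((\<lambda>x. poly (flat_exp_poly n * [:0, 1:]) (inverse x) * exp (- inverse x)) \<longlongrightarrow> 0) (at_right (0::real))"
      by (rule filterlim_compose[OF poly_exp_tendsto_0 filterlim_inverse_at_top_right])
    then show ?thesis
    proof (rule Lim_transform_eventually)
      show "\<forall>\<^sub>F x in at_right 0. poly (flat_exp_poly n * [:0, 1:]) (inverse x) * exp (- inverse x) = flat_exp n x / x"
        by (rule eventually_at_rightI[of 0 1]) (auto simp: flat_exp_def divide_inverse mult_ac)
    qed
  qed
  have "((\<lambda>x. flat_exp n x / x) \<longlongrightarrow> 0) (at_left 0)"
    by (rule tendsto_eventually, rule eventually_at_leftI[of "-1"]) (auto simp: flat_exp_def)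
  with lim have "((\<lambda>x. flat_exp n x / x) \<longlongrightarrow> 0) (at 0)"
    by (simp add: filterlim_at_split)
  then show ?thesis
    unfolding equal has_field_derivative_iff by (simp add: flat_exp_def)
qed

lemma flat_exp_pos: "flat_exp 0 t \<ge> 0" "flat_exp 0 t > 0 \<longleftrightarrow> t > 0" "t \<le> 0 \<Longrightarrow> flat_exp 0 t = 0"
  by (auto simp: flat_exp_def)

lemma compact_supp_schwartz:
  fixes f :: "real^'n::finite \<Rightarrow> complex"
  assumes "smooth f" and 0: "\<And>x. norm x > r \<Longrightarrow> f x = 0"
  shows "f \<in> schwartz"
proof (rule schwartzI[OF assms(1)])
  fix \<beta> :: "'n list" and m
  have "continuous_on (cball 0 r) (\<lambda>x. (1 + norm x) ^ m * norm (iter_partial \<beta> f x))"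
    by (intro continuous_intros smooth_continuous assms)
  then have "compact ((\<lambda>x. (1 + norm x) ^ m * norm (iter_partial \<beta> f x)) ` cball 0 r)"
    by (rule compact_continuous_image) auto
  from compact_imp_bounded[OF this] obtain B where
    B0: "\<And>y. y \<in> (\<lambda>x. (1 + norm x) ^ m * norm (iter_partial \<beta> f x)) ` cball 0 r \<Longrightarrow> norm y \<le> B"
    unfolding bounded_iff by blast
  have B: "(1 + norm x) ^ m * norm (iter_partial \<beta> f x) \<le> B" if "norm x \<le> r" for x
    using B0[OF imageI, of x] that by (simp add: norm_mult norm_power)
  have "(1 + norm x) ^ m * norm (iter_partial \<beta> f x) \<le> max B 0" for x
  proof (cases "norm x \<le> r")
    case False
    have "open (- cball 0 r :: (real^'n) set)" "x \<in> - cball 0 r" using False by auto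
    then have "iter_partial \<beta> f x = 0"
      by (rule iter_partial_zero_open) (auto intro: 0)
    then show ?thesis by simp
  qed (use B[of x] in auto)
  then show "\<exists>B. \<forall>x. (1 + norm x) ^ m * norm (iter_partial \<beta> f x) \<le> B" by blast
qed

lemma plateau:
  fixes x0 :: "real^'n::finite"
  assumes "0 < r" "r < s"
  obtains \<omega> :: "real^'n \<Rightarrow> complex" where "\<omega> \<in> schwartz"
    "\<And>x. x \<in> cball x0 r \<Longrightarrow> \<omega> x = 1" "\<And>x. x \<notin> ball x0 s \<Longrightarrow> \<omega> x = 0"
proof -
  define n2 where "n2 = (\<lambda>x::real^'n. \<Sum>i\<in>UNIV. (x $ i - x0 $ i) * (x $ i - x0 $ i))"
  have n2: "n2 x = (dist x0 x)\<^sup>2" for x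
    by (simp add: n2_def dist_norm norm_minus_commute[of x0] power2_norm_eq_inner inner_vec_def)
  have sn2: "smooth n2"
    unfolding n2_def by (intro smooth_sum smooth_mult smooth_diff smooth_coord smooth_const)
  \<comment> \<open>p is positive exactly inside the ball of radius s and q exactly outside the
    closed ball of radius r. As r < s they have no common zero, so p / (p + q) is smooth and has the
    required plateau.\<close>
  define p where "p = (\<lambda>x. flat_exp 0 (s\<^sup>2 - n2 x))"
  define q where "q = (\<lambda>x. flat_exp 0 (n2 x - r\<^sup>2))"
  have sp: "smooth p" and sq: "smooth q"
    unfolding p_def q_def
    by (intro smooth_compose_chain[of flat_exp] flat_exp_deriv smooth_diff smooth_const sn2)+
  have rs: "r\<^sup>2 < s\<^sup>2" using assms by (intro power_strict_mono) auto
  have pos: "p x + q x > 0" for x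
    using flat_exp_pos(1)[of "s\<^sup>2 - n2 x"] flat_exp_pos(1)[of "n2 x - r\<^sup>2"]
      flat_exp_pos(2)[of "s\<^sup>2 - n2 x"] flat_exp_pos(2)[of "n2 x - r\<^sup>2"] rs
    unfolding p_def q_def by linarith
  define c where "c = (\<lambda>x. p x * inverse (p x + q x))"
  have sc: "smooth c"
    unfolding c_def using pos by (intro smooth_mult smooth_inverse smooth_add sp sq) (metis less_irrefl)
  have c1: "c x = 1" if "x \<in> cball x0 r" for x
  proof -
    have "n2 x \<le> r\<^sup>2" using that unfolding n2 by (intro power_mono) auto
    then have "q x = 0" by (simp add: q_def flat_exp_pos)
    then show ?thesis using pos[of x] by (simp add: c_def)
  qed
  have c0: "c x = 0" if "x \<notin> ball x0 s" for x
  proof -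
    have "s\<^sup>2 \<le> n2 x" using that assms unfolding n2 by (intro power_mono) auto
    then have "p x = 0" by (simp add: p_def flat_exp_pos)
    then show ?thesis by (simp add: c_def)
  qed
  have "(\<lambda>x. complex_of_real (c x)) \<in> schwartz"
  proof (rule compact_supp_schwartz[of _ "norm x0 + s"])
    show "smooth (\<lambda>x. complex_of_real (c x))"
      by (rule smooth_bounded_linear[OF bounded_linear_of_real sc])
    fix x :: "real^'n" assume "norm x0 + s < norm x"
    then have "x \<notin> ball x0 s"
      using norm_triangle_ineq2[of x x0] by (auto simp: dist_norm norm_minus_commute)
    then show "complex_of_real (c x) = 0" by (simp add: c0)
  qed
  then show ?thesis using that c0 c1 by simp
qed

text \<open>The error lives where norm x \<ge> R, and there one spare power of the weight is worth a
  factor 1/R. Dilating the cut-off by R \<ge> 1 does not enlarge its derivatives.\<close>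

lemma schwartz_truncation:
  fixes \<omega> \<kappa> :: "real^'n::finite \<Rightarrow> complex"
  assumes \<omega>: "\<omega> \<in> schwartz" "\<And>x. norm x \<le> 1 \<Longrightarrow> \<omega> x = 1" and \<kappa>: "\<kappa> \<in> schwartz"
  obtains C where "\<And>R. R \<ge> 1 \<Longrightarrow> snorm M (\<lambda>x. \<kappa> x - \<omega> (inverse R *\<^sub>R x) * \<kappa> x) \<le> C / R"
proof -
  define g where "g = (\<lambda>x. 1 - \<omega> x)"
  have sg: "smooth g" unfolding g_def by (intro smooth_diff smooth_const schwartz_smooth \<omega>)
  have "slow g"
    unfolding g_def by (rule slow_diff[OF slow_const slow_schwartz[OF \<omega>(1)]])
  obtain m A where "0 \<le> A" and mA: "\<And>\<gamma> x. length \<gamma> \<le> M \<Longrightarrow> norm (iter_partial \<gamma> g x) \<le> A * (1 + norm x) ^ m"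
    by (rule slow_uniform[OF \<open>slow g\<close>]) blast
  \<comment> \<open>Up to order M the derivatives of g are bounded outright, so the product estimate
    below runs with growth exponent 0.\<close>
  obtain A where A: "0 \<le> A" "\<And>\<gamma> x. length \<gamma> \<le> M \<Longrightarrow> norm (iter_partial \<gamma> g x) \<le> A"
  proof -
    have "norm (iter_partial \<gamma> g x) \<le> 1 + snorm M \<omega>" if "length \<gamma> \<le> M" for \<gamma> x
    proof -
      have *: "norm (iter_partial \<gamma> \<omega> x) \<le> snorm M \<omega>"
        by (rule norm_iter_partial_le_snorm[OF \<omega>(1) that])
      have "norm (iter_partial \<gamma> (\<lambda>x::real^'n. 1::complex) x) \<le> 1"
      proof (cases \<gamma> rule: rev_cases)
        case (snoc ys y)
        have "partial_deriv y (\<lambda>x::real^'n. 1::complex) = (\<lambda>x. 0)" by (simp add: partial_deriv_def fun_eq_iff)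
        then show ?thesis using snoc by (simp add: iter_partial_snoc)
      qed auto
      with * show ?thesis
        unfolding g_def iter_partial_diff[OF smooth_const schwartz_smooth[OF \<omega>(1)]]
        by (intro order_trans[OF norm_triangle_ineq4] add_mono)
    qed
    then show ?thesis using that[of "1 + snorm M \<omega>"] snorm_nonneg[OF \<omega>(1)] by auto
  qed
  have "snorm M (\<lambda>x. \<kappa> x - \<omega> (inverse R *\<^sub>R x) * \<kappa> x) \<le> 2 ^ M * (A * snorm (Suc M) \<kappa>) / R" if R: "R \<ge> 1" for R
  proof (rule snorm_leI)
    fix \<beta> :: "'n list" and x :: "real^'n"
    assume l: "length \<beta> \<le> M"
    have eq: "(\<lambda>x. \<kappa> x - \<omega> (inverse R *\<^sub>R x) * \<kappa> x) = (\<lambda>x. g (inverse R *\<^sub>R x) * \<kappa> x)"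
      by (auto simp: g_def algebra_simps)
    have N0: "0 \<le> snorm (Suc M) \<kappa>" by (rule snorm_nonneg[OF \<kappa>])
    show "(1 + norm x) ^ M * norm (iter_partial \<beta> (\<lambda>x. \<kappa> x - \<omega> (inverse R *\<^sub>R x) * \<kappa> x) x)
        \<le> 2 ^ M * (A * snorm (Suc M) \<kappa>) / R"
    proof (cases "norm x < R")
      case True
      have "open (ball 0 R :: (real^'n) set)" "x \<in> ball 0 R" using True by auto
      then have "iter_partial \<beta> (\<lambda>x. \<kappa> x - \<omega> (inverse R *\<^sub>R x) * \<kappa> x) x = 0"
        by (rule iter_partial_zero_open) (use R \<omega>(2) in \<open>auto simp: field_simps\<close>)
      then show ?thesis using A(1) N0 R by simp
    next
      case False
      have "(1 + norm x) ^ M * norm (iter_partial \<beta> (\<lambda>x. g (inverse R *\<^sub>R x) * \<kappa> x) x)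
          \<le> 2 ^ length \<beta> * (A * (snorm (Suc M) \<kappa> / R))"
      proof (rule weighted_mult_bound[where m = 0, OF smooth_scale[OF sg] schwartz_smooth[OF \<kappa>] A(1)])
        fix \<gamma> :: "'n list" assume "length \<gamma> \<le> length \<beta>"
        have "norm (iter_partial \<gamma> (\<lambda>x. g (inverse R *\<^sub>R x)) x)
            = inverse R ^ length \<gamma> * norm (iter_partial \<gamma> g (inverse R *\<^sub>R x))"
          using R by (simp add: iter_partial_scale[OF sg])
        also have "\<dots> \<le> 1 * A"
          using \<open>length \<gamma> \<le> length \<beta>\<close> l R by (intro mult_mono power_le_one A) (auto simp: inverse_le_1_iff)
        finally show "norm (iter_partial \<gamma> (\<lambda>x. g (inverse R *\<^sub>R x)) x) \<le> A * (1 + norm x) ^ 0" by simp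
      next
        fix \<delta> :: "'n list" assume "length \<delta> \<le> length \<beta>"
        then have "(1 + norm x) * ((1 + norm x) ^ M * norm (iter_partial \<delta> \<kappa> x)) \<le> snorm (Suc M) \<kappa>"
          using snorm_bound[OF \<kappa>, of \<delta> "Suc M" x] l by (simp add: mult.assoc)
        moreover have "R * ((1 + norm x) ^ M * norm (iter_partial \<delta> \<kappa> x))
            \<le> (1 + norm x) * ((1 + norm x) ^ M * norm (iter_partial \<delta> \<kappa> x))"
          using False by (intro mult_right_mono) auto
        ultimately show "(1 + norm x) ^ (M + 0) * norm (iter_partial \<delta> \<kappa> x) \<le> snorm (Suc M) \<kappa> / R"
          using R by (simp add: field_simps)
      qed
      also have "\<dots> \<le> 2 ^ M * (A * (snorm (Suc M) \<kappa> / R))"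
        using l A(1) N0 R by (intro mult_right_mono power_increasing) auto
      finally show ?thesis unfolding eq by simp
    qed
  qed
  then show ?thesis using that by blast
qed

section \<open>Functions that are flat at the origin\<close>

text \<open>The finite-order counterpart, on the Fourier side, of the decay at the origin demanded
  in \<open>schwartz0\<close>. It consists of finitely many linear conditions.\<close>

definition flat_at_0 :: "nat \<Rightarrow> (real^'n::finite \<Rightarrow> complex) \<Rightarrow> bool" where
  "flat_at_0 k f \<longleftrightarrow> (\<forall>\<beta>. length \<beta> \<le> k \<longrightarrow> iter_partial \<beta> f 0 = 0)"

text \<open>Taylor estimate by induction on the number of missing derivatives: a derivative that
  vanishes at 0 is bounded by the next one through the mean value inequality. The operator norm is
  estimated by the sum of the partials, hence the factor \<open>CARD('n)\<close> at each
  step.\<close>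

lemma flat_bound:
  fixes f :: "real^'n::finite \<Rightarrow> complex"
  assumes f: "f \<in> schwartz" and flat: "flat_at_0 k f" and l: "length \<beta> + j = Suc k"
  shows "norm (iter_partial \<beta> f x) \<le> (real CARD('n) * norm x) ^ j * snorm (Suc k) f"
  using l
proof (induction j arbitrary: \<beta> x)
  case 0
  then show ?case using norm_iter_partial_le_snorm[OF f, of \<beta> "Suc k" x] by simp
next
  case (Suc j)
  let ?d = "real CARD('n)" and ?S = "snorm (Suc k) f"
  define B where "B = (?d * norm x) ^ j * ?S"
  have "norm (iter_partial \<beta> f x - iter_partial \<beta> f 0) \<le> (?d * B) * norm (x - 0)"
  proof (rule differentiable_bound[of "cball 0 (norm x)"])
    fix y :: "real^'n" assume y: "y \<in> cball 0 (norm x)"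
    have d: "iter_partial \<beta> f differentiable (at y)"
      by (rule smooth_differentiable[OF schwartz_smooth[OF f]])
    then show "(iter_partial \<beta> f has_derivative frechet_derivative (iter_partial \<beta> f) (at y)) (at y within cball 0 (norm x))"
      by (rule has_derivative_at_withinI[OF has_derivative_partial])
    have "norm (partial_deriv i (iter_partial \<beta> f) y) \<le> B" for i
    proof -
      have "norm (iter_partial (i # \<beta>) f y) \<le> (?d * norm y) ^ j * ?S"
        using Suc(2) by (intro Suc(1)) auto
      also have "\<dots> \<le> B"
        unfolding B_def using y by (intro mult_right_mono power_mono mult_left_mono snorm_nonneg f) auto
      finally show ?thesis by simp
    qed
    then have "norm (v $ i *\<^sub>R partial_deriv i (iter_partial \<beta> f) y) \<le> norm v * B" for v i
      by (auto simp: component_le_norm_cart intro!: mult_mono)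
    then have "norm (frechet_derivative (iter_partial \<beta> f) (at y) v) \<le> ?d * (norm v * B)" for v
      unfolding frechet_eq_partials[OF d] by (intro sum_norm_bound[THEN order_trans]) auto
    then show "onorm (frechet_derivative (iter_partial \<beta> f) (at y)) \<le> ?d * B"
      by (intro onorm_le) (simp add: mult_ac)
  qed auto
  moreover have "iter_partial \<beta> f 0 = 0"
    using flat Suc(2) by (simp add: flat_at_0_def)
  ultimately show ?case by (simp add: B_def mult_ac)
qed

section \<open>Integration on Euclidean space\<close>

lemma borel_measurable_vec_nth' [measurable]: "(\<lambda>x::real^'n::finite. x $ i) \<in> borel_measurable borel"
  by (rule borel_measurable_continuous_onI) (intro continuous_intros)

text \<open>Lebesgue measure is the product measure over \<open>Basis\<close>; the work consists in
  reindexing the basis vectors by the coordinates.\<close>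

lemma
  fixes g :: "'n::finite \<Rightarrow> real \<Rightarrow> 'b::{real_normed_field,banach,second_countable_topology}"
  assumes g: "\<And>i. integrable lborel (g i)"
  shows integrable_prod_coords: "integrable lborel (\<lambda>x::real^'n. \<Prod>i\<in>UNIV. g i (x $ i))"
    and integral_prod_coords: "(LINT x|lborel. (\<Prod>i\<in>UNIV. g i ((x::real^'n) $ i))) = (\<Prod>i\<in>UNIV. (LINT t|lborel. g i t))"
proof -
  interpret product_sigma_finite "\<lambda>b::real^'n. lborel :: real measure" ..
  define ax where "ax = (\<lambda>i::'n. axis i (1::real))"
  have inj: "inj ax" by (auto simp: ax_def inj_def axis_eq_axis)
  have Basis: "Basis = range ax" by (auto simp: ax_def Basis_vec_def)
  have bij: "bij_betw ax UNIV Basis" unfolding Basis by (rule inj_on_imp_bij_betw[OF inj])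
  define G where "G = (\<lambda>b. g (inv ax b))"
  have eq: "(\<Prod>i\<in>UNIV. g i (x $ i)) = (\<Prod>b\<in>Basis. G b (x \<bullet> b))" for x :: "real^'n"
    by (subst prod.reindex_bij_betw[OF bij, symmetric])
      (simp add: G_def inv_f_f[OF inj], simp add: ax_def inner_axis)
  have m: "(\<lambda>f. \<Sum>b\<in>Basis. f b *\<^sub>R b) \<in> measurable (\<Pi>\<^sub>M b\<in>(Basis::(real^'n) set). lborel) borel"
    by measurable
  have gm [measurable]: "g i \<in> borel_measurable borel" for i
    using borel_measurable_integrable[OF g, of i] by simp
  have meas: "(\<lambda>x::real^'n. \<Prod>i\<in>UNIV. g i (x $ i)) \<in> borel_measurable borel"
    by measurable
  have GG: "(\<Prod>i\<in>UNIV. g i ((\<Sum>b\<in>Basis. f b *\<^sub>R b :: real^'n) $ i)) = (\<Prod>b\<in>Basis. G b (f b))" for f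
    unfolding eq by (intro prod.cong refl) (simp add: inner_sum_left_Basis)
  show "integrable lborel (\<lambda>x::real^'n. \<Prod>i\<in>UNIV. g i (x $ i))"
    unfolding lborel_eq[where 'a = "real^'n"] integrable_distr_eq[OF m meas] GG
    by (rule product_integrable_prod) (auto simp: G_def g)
  have "(LINT x|lborel. (\<Prod>i\<in>UNIV. g i ((x::real^'n) $ i))) = (\<Prod>b\<in>Basis. (LINT t|lborel. G b t))"
    unfolding lborel_eq[where 'a = "real^'n"] integral_distr[OF m meas] GG
    by (rule product_integral_prod) (auto simp: G_def g)
  also have "\<dots> = (\<Prod>i\<in>UNIV. (LINT t|lborel. g i t))"
    by (subst prod.reindex_bij_betw[OF bij, symmetric]) (simp add: G_def inv_f_f[OF inj])
  finally show "(LINT x|lborel. (\<Prod>i\<in>UNIV. g i ((x::real^'n) $ i))) = (\<Prod>i\<in>UNIV. (LINT t|lborel. g i t))" .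
qed

text \<open>Diagonal substitutions serve both the rescaling of lattices and the anisotropic boxes,
  whose sides scale differently in different coordinates.\<close>

lemma
  fixes f :: "real^'n::finite \<Rightarrow> 'b::{banach,second_countable_topology}"
  assumes f [measurable]: "f \<in> borel_measurable borel" and c: "\<And>i. c i \<noteq> 0"
  shows integral_diag: "(LINT x|lborel. f (t + vec_lambda (\<lambda>i. c i * x $ i))) = (LINT x|lborel. f x) /\<^sub>R (\<Prod>i\<in>UNIV. \<bar>c i\<bar>)"
    and integrable_diag: "integrable lborel (\<lambda>x. f (t + vec_lambda (\<lambda>i. c i * x $ i))) \<longleftrightarrow> integrable lborel f"
proof -
  define T where "T = (\<lambda>x::real^'n. t + vec_lambda (\<lambda>i. c i * x $ i))"
  define ax where "ax = (\<lambda>i::'n. axis i (1::real))"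
  have inj: "inj ax" by (auto simp: ax_def inj_def axis_eq_axis)
  have Basis: "Basis = range ax" by (auto simp: ax_def Basis_vec_def)
  have bij: "bij_betw ax UNIV Basis" unfolding Basis by (rule inj_on_imp_bij_betw[OF inj])
  define C where "C = (\<lambda>b. c (inv ax b))"
  have C: "\<And>b. b \<in> Basis \<Longrightarrow> C b \<noteq> 0" using c by (simp add: C_def)
  have T: "T x = t + (\<Sum>b\<in>Basis. (C b * (x \<bullet> b)) *\<^sub>R b)" for x
  proof -
    have "(\<Sum>b\<in>Basis. (C b * (x \<bullet> b)) *\<^sub>R b) = (\<Sum>i\<in>UNIV. (c i * x $ i) *\<^sub>R axis i 1)"
      by (subst sum.reindex_bij_betw[OF bij, symmetric])
        (simp add: C_def inv_f_f[OF inj], simp add: ax_def inner_axis)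
    also have "\<dots> = vec_lambda (\<lambda>i. c i * x $ i)"
      using basis_expansion[of "vec_lambda (\<lambda>i. c i * x $ i)"] by (simp add: scalar_mult_eq_scaleR)
    finally show ?thesis by (simp add: T_def)
  qed
  have P: "(\<Prod>b\<in>Basis. \<bar>C b\<bar>) = (\<Prod>i\<in>UNIV. \<bar>c i\<bar>)"
    by (subst prod.reindex_bij_betw[OF bij, symmetric]) (simp add: C_def inv_f_f[OF inj])
  have pos: "(\<Prod>i\<in>UNIV. \<bar>c i\<bar>) > 0" using c by (intro prod_pos) simp
  have "T = (\<lambda>x. t + (\<Sum>b\<in>Basis. (C b * (x \<bullet> b)) *\<^sub>R b))" using T by blast
  with lborel_affine_euclidean[where c = C and t = t, OF C]
  have L: "lborel = density (distr lborel borel T) (\<lambda>_. ennreal (\<Prod>i\<in>UNIV. \<bar>c i\<bar>))"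
    by (simp add: P)
  have Tm [measurable]: "T \<in> measurable lborel borel"
    unfolding measurable_lborel2 T by (intro borel_measurable_continuous_onI continuous_intros)
  have "(LINT x|lborel. f x) = (\<Prod>i\<in>UNIV. \<bar>c i\<bar>) *\<^sub>R (LINT x|lborel. f (T x))"
    by (subst L, subst integral_density) (use pos in \<open>auto simp: integral_distr less_imp_le\<close>)
  then show "(LINT x|lborel. f (t + vec_lambda (\<lambda>i. c i * x $ i))) = (LINT x|lborel. f x) /\<^sub>R (\<Prod>i\<in>UNIV. \<bar>c i\<bar>)"
    using less_imp_neq[OF pos] by (simp add: T_def)
  have "integrable lborel f \<longleftrightarrow> integrable lborel (\<lambda>x. f (T x))"
  proof -
    have "integrable lborel f \<longleftrightarrow> integrable lborel (\<lambda>x. (\<Prod>i\<in>UNIV. \<bar>c i\<bar>) *\<^sub>R f (T x))"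
      by (subst L, subst integrable_density) (use pos in \<open>auto simp: integrable_distr_eq less_imp_le\<close>)
    moreover have "integrable lborel (\<lambda>x. f (T x))"
      if "integrable lborel (\<lambda>x. (\<Prod>i\<in>UNIV. \<bar>c i\<bar>) *\<^sub>R f (T x))"
      using integrable_scaleR_right[of "inverse (\<Prod>i\<in>UNIV. \<bar>c i\<bar>)", OF that] less_imp_neq[OF pos] by simp
    ultimately show ?thesis by auto
  qed
  then show "integrable lborel (\<lambda>x. f (t + vec_lambda (\<lambda>i. c i * x $ i))) \<longleftrightarrow> integrable lborel f"
    by (simp add: T_def)
qed

lemma vec_lambda_scale: "vec_lambda (\<lambda>i. c * x $ i) = c *\<^sub>R (x::real^'n)"
  by (simp add: vec_eq_iff)

lemma integral_scale:
  fixes f :: "real^'n::finite \<Rightarrow> 'b::{banach,second_countable_topology}"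
  assumes "f \<in> borel_measurable borel" "c \<noteq> 0"
  shows "(LINT x|lborel. f (t + c *\<^sub>R x)) = (LINT x|lborel. f x) /\<^sub>R \<bar>c\<bar> ^ CARD('n)"
  using integral_diag[OF assms(1), of "\<lambda>_. c" t] assms(2) by (simp add: vec_lambda_scale)

lemma integral_shift:
  fixes f :: "real^'n::finite \<Rightarrow> 'b::{banach,second_countable_topology}"
  assumes "f \<in> borel_measurable borel"
  shows "(LINT x|lborel. f (t + x)) = (LINT x|lborel. f x)"
  using integral_scale[OF assms, of 1 t] by simp

lemma integrable_shift:
  fixes f :: "real^'n::finite \<Rightarrow> 'b::{banach,second_countable_topology}"
  assumes "f \<in> borel_measurable borel"
  shows "integrable lborel (\<lambda>x. f (t + x)) \<longleftrightarrow> integrable lborel f"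
  using integrable_diag[OF assms, of "\<lambda>_. 1" t] by (simp add: vec_lambda_scale[of 1, simplified])

text \<open>A product of one-variable weights instead of a power of the norm: integrability follows
  coordinatewise, and a bounded shift changes it by a constant factor only.\<close>

definition wt :: "real^'n::finite \<Rightarrow> real" where
  "wt x = (\<Prod>i\<in>UNIV. inverse (1 + (x $ i)\<^sup>2))"

lemma integrable_wt: "integrable lborel wt"
proof -
  have "integrable lborel (\<lambda>x::real. inverse (1 + x\<^sup>2))"
    using integrable_inverse_1_plus_square by (simp add: set_integrable_def)
  then show ?thesis
    unfolding wt_def by (rule integrable_prod_coords)
qed

lemma wt_pos: "0 < wt x"
  unfolding wt_def by (intro prod_pos) (simp add: add_pos_nonneg)

text \<open>Each factor costs two powers of 1 + norm x, which is the origin of the exponent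
  \<open>2 * CARD('n)\<close> in all integrability bounds.\<close>

lemma wt_ge: "1 \<le> (1 + norm x) ^ (2 * CARD('n)) * wt (x::real^'n::finite)"
proof -
  have "1 + (x $ i)\<^sup>2 \<le> (1 + norm x)\<^sup>2" for i
  proof -
    have "(x $ i)\<^sup>2 \<le> (norm x)\<^sup>2"
      using power_mono[OF component_le_norm_cart[of x i], of 2] by simp
    then show ?thesis by (simp add: power2_sum add_increasing2)
  qed
  then have "(\<Prod>i\<in>(UNIV::'n set). 1 + (x $ i)\<^sup>2) \<le> (\<Prod>i\<in>(UNIV::'n set). (1 + norm x)\<^sup>2)"
    by (intro prod_mono) auto
  then have *: "(\<Prod>i\<in>UNIV. 1 + (x $ i)\<^sup>2) \<le> (1 + norm x) ^ (2 * CARD('n))"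
    by (simp add: power_mult)
  have pos: "(\<Prod>i\<in>UNIV. 1 + (x $ i)\<^sup>2) > 0" by (intro prod_pos) (simp add: add_pos_nonneg)
  have "wt x = inverse (\<Prod>i\<in>UNIV. 1 + (x $ i)\<^sup>2)"
    unfolding wt_def using prod_inversef[of "\<lambda>i. 1 + (x $ i)\<^sup>2" UNIV] by (simp add: o_def)
  then show ?thesis using * pos by (simp add: pos_le_divide_eq flip: divide_inverse)
qed

lemma decay_le_wt:
  fixes x :: "real^'n::finite"
  assumes "(1 + norm x) ^ (2 * CARD('n)) * a \<le> B" "0 \<le> a"
  shows "a \<le> B * wt x"
proof -
  have "a \<le> a * ((1 + norm x) ^ (2 * CARD('n)) * wt x)"
    using mult_left_mono[OF wt_ge assms(2), of x] by simp
  also have "\<dots> = ((1 + norm x) ^ (2 * CARD('n)) * a) * wt x" by (simp add: mult_ac)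
  also have "\<dots> \<le> B * wt x" using assms(1) wt_pos[of x] by (intro mult_right_mono) auto
  finally show ?thesis .
qed

definition wint :: "'n::finite itself \<Rightarrow> real" where
  "wint _ = (LINT x|lborel. wt (x::real^'n))"

lemma wint_nonneg: "0 \<le> wint TYPE('n::finite)"
  unfolding wint_def by (intro integral_nonneg_AE) (auto simp: wt_pos less_imp_le)

lemma integrable_le_wt:
  fixes f :: "real^'n::finite \<Rightarrow> 'b::{banach,second_countable_topology}"
  assumes "f \<in> borel_measurable borel" "\<And>x. norm (f x) \<le> B * wt x"
  shows "integrable lborel f" "norm (LINT x|lborel. f x) \<le> B * wint TYPE('n)"
proof -
  have i: "integrable lborel (\<lambda>x. B * wt x)" by (intro integrable_mult_right integrable_wt)
  show f: "integrable lborel f"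
    by (rule Bochner_Integration.integrable_bound[OF i])
      (use assms order_trans[OF assms(2) abs_ge_self] in auto)
  have "norm (LINT x|lborel. f x) \<le> (LINT x|lborel. B * wt (x::real^'n))"
    using Bochner_Integration.integral_mono[OF integrable_norm[OF f] i] assms(2)
    by (intro order_trans[OF Bochner_Integration.integral_norm_bound]) simp
  then show "norm (LINT x|lborel. f x) \<le> B * wint TYPE('n)"
    by (simp add: wint_def)
qed

lemma schwartz_borel: "f \<in> schwartz \<Longrightarrow> f \<in> borel_measurable borel"
  by (intro borel_measurable_continuous_onI smooth_continuous0 schwartz_smooth)

lemma schwartz_le_wt:
  fixes f :: "real^'n::finite \<Rightarrow> complex"
  assumes "f \<in> schwartz"
  shows "norm (f x) \<le> snorm (2 * CARD('n)) f * wt x"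
  by (rule decay_le_wt[OF norm_le_snorm[OF assms]]) auto

lemma schwartz_integrable: "f \<in> schwartz \<Longrightarrow> integrable lborel f"
  using integrable_le_wt(1)[OF schwartz_borel schwartz_le_wt] .

section \<open>The Fourier transform on the Schwartz class\<close>

text \<open>The common generalisation of the Fourier transform (s = - 1) and its inverse (s = 1).\<close>

definition FT :: "real \<Rightarrow> (real^'n::finite \<Rightarrow> complex) \<Rightarrow> real^'n \<Rightarrow> complex" where
  "FT s f \<xi> = complex_of_real ((2 * pi) powr (- (real CARD('n) / 2))) *
     (LINT x|lborel. f x * cis (s * (x \<bullet> \<xi>)))"

lemma fourier_FT: "fourier = FT (- 1)"
  by (simp add: fun_eq_iff fourier_def FT_def)

lemma inv_fourier_FT: "inv_fourier = FT 1"
  by (simp add: fun_eq_iff inv_fourier_def FT_def inner_commute)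

lemma FT_minus: "FT s f (- \<xi>) = FT (- s) f \<xi>"
  by (simp add: FT_def)

lemma borel_measurable_cis [measurable]: "cis \<in> borel_measurable borel"
  by (intro borel_measurable_continuous_onI continuous_intros)

lemma integrable_mult_cis:
  assumes "integrable M f" "g \<in> borel_measurable M"
  shows "integrable M (\<lambda>x. f x * cis (g x))"
  using assms
  by (intro Bochner_Integration.integrable_bound[OF assms(1)]) (auto simp: norm_mult)

lemma FT_integrable:
  "f \<in> schwartz \<Longrightarrow> integrable lborel (\<lambda>x. f x * cis (s * (x \<bullet> \<xi>)))"
  by (rule integrable_mult_cis[OF schwartz_integrable]) simp_all

definition FTc :: "'n::finite itself \<Rightarrow> real" where
  "FTc _ = (2 * pi) powr (- (real CARD('n) / 2))"

lemma FTc_pos: "0 < FTc TYPE('n::finite)"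
  by (simp add: FTc_def)

lemma norm_FT_le:
  fixes f :: "real^'n::finite \<Rightarrow> complex"
  assumes "f \<in> schwartz"
  shows "norm (FT s f \<xi>) \<le> FTc TYPE('n) * wint TYPE('n) * snorm (2 * CARD('n)) f"
proof -
  have "norm (LINT x|lborel. f x * cis (s * (x \<bullet> \<xi>))) \<le> snorm (2 * CARD('n)) f * wint TYPE('n)"
  proof (rule integrable_le_wt(2))
    show "(\<lambda>x. f x * cis (s * (x \<bullet> \<xi>))) \<in> borel_measurable borel"
      using FT_integrable[OF assms] by (auto dest: borel_measurable_integrable)
  qed (simp add: norm_mult schwartz_le_wt assms)
  from mult_left_mono[OF this, of "FTc TYPE('n)"] FTc_pos[where 'n = 'n]
  show ?thesis by (simp add: FT_def FTc_def norm_mult mult_ac)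
qed

lemma FT_add:
  "f \<in> schwartz \<Longrightarrow> g \<in> schwartz \<Longrightarrow> FT s (\<lambda>x. f x + g x) \<xi> = FT s f \<xi> + FT s g \<xi>"
  by (simp add: FT_def FT_integrable distrib_right distrib_left)

lemma FT_diff:
  "f \<in> schwartz \<Longrightarrow> g \<in> schwartz \<Longrightarrow> FT s (\<lambda>x. f x - g x) \<xi> = FT s f \<xi> - FT s g \<xi>"
  by (simp add: FT_def FT_integrable left_diff_distrib right_diff_distrib)

lemma FT_cmult: "FT s (\<lambda>x. c * f x) \<xi> = c * FT s f \<xi>"
  by (simp add: FT_def mult.assoc mult.left_commute)

lemma FT_sum:
  "(\<And>i. i \<in> I \<Longrightarrow> f i \<in> schwartz) \<Longrightarrow> FT s (\<lambda>x. \<Sum>i\<in>I. f i x) \<xi> = (\<Sum>i\<in>I. FT s (f i) \<xi>)"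
proof (induction I rule: infinite_finite_induct)
  case (insert i I)
  then show ?case by (simp add: FT_add schwartz_sum)
qed (simp_all add: FT_def)

lemma cis_remainder: "norm (cis t - 1 - \<i> * complex_of_real t) \<le> t\<^sup>2 / 2"
  using iexp_approx1[of t 1] by (simp add: cis_conv_exp numeral_2_eq_2 diff_diff_eq)

text \<open>A remainder of second order near x identifies the derivative. It serves for the Fourier
  transform of functions and for \<open>wave\<close> alike.\<close>

lemma has_derivative_quadratic:
  assumes D: "bounded_linear D"
    and r: "\<And>y. norm (y - x) \<le> 1 \<Longrightarrow> norm (f y - f x - D (y - x)) \<le> C * (norm (y - x))\<^sup>2"
  shows "(f has_derivative D) (at x)"
proof (rule has_derivativeI_sandwich[OF zero_less_one D])
  show "((\<lambda>y. C * norm (y - x)) \<longlongrightarrow> 0) (at x)"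
    by (auto intro!: tendsto_eq_intros)
  show "norm (f y - f x - D (y - x)) / norm (y - x) \<le> C * norm (y - x)"
    if "y \<noteq> x" "dist y x < 1" for y
    using r[of y] that by (simp add: dist_norm divide_le_eq power2_eq_square mult_ac)
qed

lemma schwartz_imon: "f \<in> schwartz \<Longrightarrow> (\<lambda>x. imon \<beta> (s *\<^sub>R x) * f x) \<in> schwartz"
  by (rule schwartz_slow_mult[OF slow_scale[OF slow_imon]])

lemma FT_has_derivative:
  fixes f :: "real^'n::finite \<Rightarrow> complex"
  assumes f: "f \<in> schwartz"
  shows "(FT s f has_derivative (\<lambda>v. \<Sum>i\<in>UNIV. v $ i *\<^sub>R FT s (\<lambda>x. imon [i] (s *\<^sub>R x) * f x) \<xi>)) (at \<xi>)"
proof (rule has_derivative_quadratic)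
  show "bounded_linear (\<lambda>v. \<Sum>i\<in>UNIV. v $ i *\<^sub>R FT s (\<lambda>x. imon [i] (s *\<^sub>R x) * f x) \<xi>)"
    by (intro bounded_linear_sum bounded_linear_scaleR_const bounded_linear_vec_nth)
  \<comment> \<open>Since \<open>imon [i,i] x\<close> is minus the square of the coordinate, g is
    -|x|^2 f, written so that it is visibly a Schwartz function. Its integral norm controls the
    second-order remainder of the phase.\<close>
  define g where "g = (\<lambda>x. (\<Sum>i\<in>UNIV. imon [i,i] x) * f x)"
  have g_eq: "g = (\<lambda>x. \<Sum>i\<in>UNIV. imon [i,i] (1 *\<^sub>R x) * f x)" by (simp add: g_def sum_distrib_right)
  have gS: "g \<in> schwartz" unfolding g_eq by (intro schwartz_sum schwartz_imon f)
  have gn: "norm (g x) = (norm x)\<^sup>2 * norm (f x)" for x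
  proof -
    have "(\<Sum>i\<in>UNIV. imon [i,i] x) = complex_of_real (- (norm x)\<^sup>2)"
      by (simp add: power2_norm_eq_inner inner_vec_def sum_negf mult_ac)
    then show ?thesis by (simp add: g_def norm_mult norm_power)
  qed
  define C where "C = FTc TYPE('n) * (s\<^sup>2 / 2 * (LINT x|lborel. norm (g x)))"
  fix \<zeta>
  define v where "v = \<zeta> - \<xi>"
  have i1: "integrable lborel (\<lambda>x. f x * cis (s * (x \<bullet> \<zeta>)))" "integrable lborel (\<lambda>x. f x * cis (s * (x \<bullet> \<xi>)))"
    by (rule FT_integrable[OF f])+
  have i2: "integrable lborel (\<lambda>x. v $ i *\<^sub>R (imon [i] (s *\<^sub>R x) * f x * cis (s * (x \<bullet> \<xi>))))" for i
    by (intro integrable_scaleR_right FT_integrable schwartz_imon f)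
  define E where "E = (\<lambda>x. f x * cis (s * (x \<bullet> \<zeta>)) - f x * cis (s * (x \<bullet> \<xi>))
        - (\<Sum>i\<in>UNIV. v $ i *\<^sub>R (imon [i] (s *\<^sub>R x) * f x * cis (s * (x \<bullet> \<xi>)))))"
  have iE: "integrable lborel E"
    unfolding E_def
    by (rule Bochner_Integration.integrable_diff[OF Bochner_Integration.integrable_diff[OF i1]
        Bochner_Integration.integrable_sum[OF i2]])
  have E_le: "norm (E x) \<le> s\<^sup>2 / 2 * (norm v)\<^sup>2 * norm (g x)" for x
  proof -
    have "(\<Sum>i\<in>UNIV. v $ i *\<^sub>R (imon [i] (s *\<^sub>R x) * f x * cis (s * (x \<bullet> \<xi>))))
       = f x * cis (s * (x \<bullet> \<xi>)) * (\<i> * complex_of_real (s * (x \<bullet> v)))"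
      by (simp add: inner_vec_def sum_distrib_left scaleR_conv_of_real[where 'a = complex] mult_ac)
    moreover have "cis (s * (x \<bullet> \<zeta>)) = cis (s * (x \<bullet> \<xi>)) * cis (s * (x \<bullet> v))"
      by (simp add: v_def cis_mult inner_diff_right algebra_simps)
    ultimately have eq: "f x * cis (s * (x \<bullet> \<zeta>)) - f x * cis (s * (x \<bullet> \<xi>))
        - (\<Sum>i\<in>UNIV. v $ i *\<^sub>R (imon [i] (s *\<^sub>R x) * f x * cis (s * (x \<bullet> \<xi>))))
       = f x * cis (s * (x \<bullet> \<xi>)) * (cis (s * (x \<bullet> v)) - 1 - \<i> * complex_of_real (s * (x \<bullet> v)))"
      by (simp add: algebra_simps)
    have "norm (cis (s * (x \<bullet> v)) - 1 - \<i> * complex_of_real (s * (x \<bullet> v))) \<le> (s * (x \<bullet> v))\<^sup>2 / 2"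
      by (rule cis_remainder)
    also have "\<dots> \<le> s\<^sup>2 * ((norm x)\<^sup>2 * (norm v)\<^sup>2) / 2"
      using power_mono[OF Cauchy_Schwarz_ineq2[of x v], of 2]
      by (intro divide_right_mono) (auto simp: power_mult_distrib intro!: mult_left_mono)
    finally have "norm (f x) * norm (cis (s * (x \<bullet> v)) - 1 - \<i> * complex_of_real (s * (x \<bullet> v)))
       \<le> norm (f x) * (s\<^sup>2 * ((norm x)\<^sup>2 * (norm v)\<^sup>2) / 2)"
      by (rule mult_left_mono) simp
    then show ?thesis
      unfolding eq gn E_def by (simp add: norm_mult mult_ac)
  qed
  have iG: "integrable lborel (\<lambda>x. s\<^sup>2 / 2 * (norm v)\<^sup>2 * norm (g x))"
    using integrable_norm[OF schwartz_integrable[OF gS]] by (rule integrable_mult_right)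
  have E_int: "norm (LINT x|lborel. E x) \<le> (LINT x|lborel. s\<^sup>2 / 2 * (norm v)\<^sup>2 * norm (g x))"
    by (rule order_trans[OF Bochner_Integration.integral_norm_bound
        Bochner_Integration.integral_mono[OF integrable_norm[OF iE] iG E_le]])
  have "FT s f \<zeta> - FT s f \<xi> - (\<Sum>i\<in>UNIV. v $ i *\<^sub>R FT s (\<lambda>x. imon [i] (s *\<^sub>R x) * f x) \<xi>)
     = complex_of_real (FTc TYPE('n)) * (LINT x|lborel. E x)"
    using i1 i2 by (simp add: E_def FT_def FTc_def right_diff_distrib sum_distrib_left del: imon_simps)
  then have "norm (FT s f \<zeta> - FT s f \<xi> - (\<Sum>i\<in>UNIV. v $ i *\<^sub>R FT s (\<lambda>x. imon [i] (s *\<^sub>R x) * f x) \<xi>))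
     = FTc TYPE('n) * norm (LINT x|lborel. E x)"
    using FTc_pos[where 'n = 'n] by (simp only: norm_mult) simp
  also have "\<dots> \<le> FTc TYPE('n) * (LINT x|lborel. s\<^sup>2 / 2 * (norm v)\<^sup>2 * norm (g x))"
    by (rule mult_left_mono[OF E_int less_imp_le[OF FTc_pos]])
  also have "\<dots> = C * (norm v)\<^sup>2" by (simp add: C_def mult_ac)
  finally show "norm (FT s f \<zeta> - FT s f \<xi> - (\<Sum>i\<in>UNIV. (\<zeta> - \<xi>) $ i *\<^sub>R FT s (\<lambda>x. imon [i] (s *\<^sub>R x) * f x) \<xi>))
      \<le> C * (norm (\<zeta> - \<xi>))\<^sup>2"
    by (simp only: v_def)
qed

section \<open>Differentiation and multiplication by coordinates under the transform\<close>

lemma partial_deriv_FT: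
  assumes "f \<in> schwartz"
  shows "partial_deriv i (FT s f) = FT s (\<lambda>x. imon [i] (s *\<^sub>R x) * f x)"
proof
  fix \<xi> :: "real^'a"
  have "partial_deriv i (FT s f) \<xi> = (\<Sum>l\<in>UNIV. axis i 1 $ l *\<^sub>R FT s (\<lambda>x. imon [l] (s *\<^sub>R x) * f x) \<xi>)"
    by (rule partial_deriv_eqI[OF FT_has_derivative[OF assms]])
  also have "\<dots> = (\<Sum>l\<in>UNIV. if l = i then FT s (\<lambda>x. imon [l] (s *\<^sub>R x) * f x) \<xi> else 0)"
    by (intro sum.cong refl) (auto simp: axis_def)
  finally show "partial_deriv i (FT s f) \<xi> = FT s (\<lambda>x. imon [i] (s *\<^sub>R x) * f x) \<xi>"
    by simp
qed

lemma iter_partial_FT: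
  assumes "f \<in> schwartz"
  shows "iter_partial \<beta> (FT s f) = FT s (\<lambda>x. imon \<beta> (s *\<^sub>R x) * f x)"
proof (induction \<beta>)
  case (Cons i \<beta>)
  show ?case
    unfolding iter_partial.simps Cons partial_deriv_FT[OF schwartz_imon[OF assms]]
    by (simp add: mult.assoc)
qed simp

lemma smooth_FT:
  assumes "f \<in> schwartz"
  shows "smooth (FT s f)"
  unfolding smooth_iff
proof (intro allI)
  fix \<beta> x
  show "iter_partial \<beta> (FT s f) differentiable (at x)"
    unfolding iter_partial_FT[OF assms] differentiable_def
    by (rule exI, rule FT_has_derivative[OF schwartz_imon[OF assms]])
qed

text \<open>Difference quotients have integral 0 by translation invariance, and dominated
  convergence passes this on to the derivative.\<close>

lemma integral_partial_deriv_0: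
  fixes g :: "real^'n::finite \<Rightarrow> complex"
  assumes g: "g \<in> schwartz"
  shows "(LINT x|lborel. partial_deriv i g x) = 0"
proof -
  define e :: "real^'n" where "e = axis i 1"
  have gd: "g differentiable (at x)" for x by (rule smooth_differentiable0[OF schwartz_smooth[OF g]])
  have hS: "partial_deriv i g \<in> schwartz" using schwartz_iter_partial[OF g, of "[i]"] by simp
  define S where "S = snorm (2 * CARD('n)) (partial_deriv i g)"
  have S0: "0 \<le> S" unfolding S_def by (rule snorm_nonneg[OF hS])
  define u where "u = (\<lambda>k x. real (Suc k) *\<^sub>R (g (x + (1 / real (Suc k)) *\<^sub>R e) - g x))"
  have ig: "integrable lborel g" by (rule schwartz_integrable[OF g])
  have gm [measurable]: "g \<in> borel_measurable borel" by (rule schwartz_borel[OF g])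
  have vd: "((\<lambda>t. g (x + t *\<^sub>R e)) has_vector_derivative partial_deriv i g (x + t *\<^sub>R e)) (at t within T)" for x t T
  proof -
    have "((\<lambda>t. x + t *\<^sub>R e) has_derivative (\<lambda>h. h *\<^sub>R e)) (at t within T)"
      by (auto intro!: derivative_eq_intros)
    from has_derivative_compose[OF this has_derivative_partial[OF gd]]
    show ?thesis
      by (simp add: has_vector_derivative_def e_def partial_deriv_def
        linear_scale[OF linear_frechet_derivative[OF gd]])
  qed
  have u0: "(LINT x|lborel. u k x) = 0" for k
  proof -
    have "(LINT x|lborel. g (x + (1 / real (Suc k)) *\<^sub>R e)) = (LINT x|lborel. g x)"
      using integral_shift[OF gm, of "(1 / real (Suc k)) *\<^sub>R e"] by (simp add: add.commute)
    moreover have "integrable lborel (\<lambda>x. g (x + (1 / real (Suc k)) *\<^sub>R e))"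
      using integrable_shift[OF gm, of "(1 / real (Suc k)) *\<^sub>R e"] ig by (simp add: add.commute)
    ultimately show ?thesis using ig by (simp add: u_def)
  qed
  have "(\<lambda>k. LINT x|lborel. u k x) \<longlonglongrightarrow> (LINT x|lborel. partial_deriv i g x)"
  proof (rule integral_dominated_convergence[where w = "\<lambda>x. 2 ^ (2 * CARD('n)) * S * wt x"])
    show "partial_deriv i g \<in> borel_measurable lborel" using schwartz_borel[OF hS] by simp
    show "u k \<in> borel_measurable lborel" for k unfolding u_def by measurable
    show "integrable lborel (\<lambda>x::real^'n. 2 ^ (2 * CARD('n)) * S * wt x)"
      by (intro integrable_mult_right integrable_wt)
    show "AE x in lborel. (\<lambda>k. u k x) \<longlonglongrightarrow> partial_deriv i g x"
    proof (rule AE_I2)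
      fix x
      have "filterlim (\<lambda>k. 1 / real (Suc k)) (at 0) sequentially"
        using LIMSEQ_inverse_real_of_nat by (auto simp: filterlim_at inverse_eq_divide)
      moreover have "((\<lambda>h. norm (g (x + h *\<^sub>R e) - g x - h *\<^sub>R partial_deriv i g x) / norm h) \<longlongrightarrow> 0) (at 0)"
        using vd[of x 0 UNIV] by (simp add: has_vector_derivative_def has_derivative_at)
      ultimately have "(\<lambda>k. norm (g (x + (1 / real (Suc k)) *\<^sub>R e) - g x - (1 / real (Suc k)) *\<^sub>R partial_deriv i g x)
          / norm (1 / real (Suc k))) \<longlonglongrightarrow> 0"
        by (rule filterlim_compose[rotated])
      moreover have "norm (g (x + (1 / real (Suc k)) *\<^sub>R e) - g x - (1 / real (Suc k)) *\<^sub>R partial_deriv i g x)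
          / norm (1 / real (Suc k)) = norm (u k x - partial_deriv i g x)" for k
      proof -
        have "u k x - partial_deriv i g x = real (Suc k) *\<^sub>R
            (g (x + (1 / real (Suc k)) *\<^sub>R e) - g x - (1 / real (Suc k)) *\<^sub>R partial_deriv i g x)"
          by (simp add: u_def scaleR_diff_right del: of_nat_Suc)
        then show ?thesis by (simp del: of_nat_Suc)
      qed
      ultimately have "(\<lambda>k. norm (u k x - partial_deriv i g x)) \<longlonglongrightarrow> 0" by simp
      then show "(\<lambda>k. u k x) \<longlonglongrightarrow> partial_deriv i g x"
        by (simp add: tendsto_norm_zero_iff LIM_zero_iff)
    qed
    show "AE x in lborel. norm (u k x) \<le> 2 ^ (2 * CARD('n)) * S * wt x" for k
    proof (rule AE_I2)
      fix x
      define h where "h = 1 / real (Suc k)"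
      have h: "0 < h" "h \<le> 1" by (auto simp: h_def)
      have "norm (g (x + h *\<^sub>R e) - g (x + 0 *\<^sub>R e)) \<le> (2 ^ (2 * CARD('n)) * S * wt x) * norm (h - 0)"
      proof (rule differentiable_bound[of "{0..h}"])
        fix t assume t: "t \<in> {0..h}"
        show "((\<lambda>t. g (x + t *\<^sub>R e)) has_derivative (\<lambda>v. v *\<^sub>R partial_deriv i g (x + t *\<^sub>R e))) (at t within {0..h})"
          using vd by (simp add: has_vector_derivative_def)
        define N where "N = norm (x + t *\<^sub>R e)"
        have "norm x \<le> N + norm (t *\<^sub>R e)"
          using norm_triangle_ineq4[of "x + t *\<^sub>R e" "t *\<^sub>R e"] by (simp add: N_def)
        also have "\<dots> \<le> N + 1" using t h by (simp add: e_def)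
        finally have "norm x \<le> N + 1" .
        moreover have "0 \<le> N" by (simp add: N_def)
        \<comment> \<open>The intermediate point lies within distance 1 of x. This factor 2 accounts
          for the power of 2 in the dominating function.\<close>
        ultimately have "1 + norm x \<le> 2 * (1 + norm (x + t *\<^sub>R e))"
          unfolding N_def[symmetric] by simp
        then have "(1 + norm x) ^ (2 * CARD('n)) \<le> 2 ^ (2 * CARD('n)) * (1 + norm (x + t *\<^sub>R e)) ^ (2 * CARD('n))"
          unfolding power_mult_distrib[symmetric] by (rule power_mono) simp
        then have "(1 + norm x) ^ (2 * CARD('n)) * norm (partial_deriv i g (x + t *\<^sub>R e))
           \<le> 2 ^ (2 * CARD('n)) * (1 + norm (x + t *\<^sub>R e)) ^ (2 * CARD('n)) * norm (partial_deriv i g (x + t *\<^sub>R e))"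
          by (rule mult_right_mono) simp
        also have "\<dots> \<le> 2 ^ (2 * CARD('n)) * S"
          using norm_le_snorm[OF hS, of "x + t *\<^sub>R e" "2 * CARD('n)"] unfolding S_def mult.assoc
          by (intro mult_left_mono) auto
        finally have "norm (partial_deriv i g (x + t *\<^sub>R e)) \<le> 2 ^ (2 * CARD('n)) * S * wt x"
          by (rule decay_le_wt) simp
        then show "onorm (\<lambda>v. v *\<^sub>R partial_deriv i g (x + t *\<^sub>R e)) \<le> 2 ^ (2 * CARD('n)) * S * wt x"
          by (intro onorm_le) (simp add: mult_left_mono mult.commute)
      qed (use h in auto)
      then have "norm (g (x + h *\<^sub>R e) - g x) * real (Suc k) \<le> 2 ^ (2 * CARD('n)) * S * wt x"
        by (simp add: h_def pos_le_divide_eq)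
      then show "norm (u k x) \<le> 2 ^ (2 * CARD('n)) * S * wt x"
        by (simp add: u_def norm_mult h_def mult.commute)
    qed
  qed
  then show ?thesis by (simp add: u0 LIMSEQ_const_iff)
qed

text \<open>Integration by parts: the derivative of f times a plane wave integrates to 0.\<close>

lemma FT_partial_deriv:
  assumes f: "f \<in> schwartz"
  shows "FT s (partial_deriv i f) \<xi> = imon [i] (- s *\<^sub>R \<xi>) * FT s f \<xi>"
proof -
  define g where "g = (\<lambda>x. cis ((s *\<^sub>R \<xi>) \<bullet> x) * f x)"
  have gS: "g \<in> schwartz" unfolding g_def by (rule schwartz_slow_mult[OF slow_cis f])
  have pS: "partial_deriv i f \<in> schwartz" using schwartz_iter_partial[OF f, of "[i]"] by simp
  have "partial_deriv i g x = partial_deriv i f x * cis (s * (x \<bullet> \<xi>)) + imon [i] (s *\<^sub>R \<xi>) * (f x * cis (s * (x \<bullet> \<xi>)))" for x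
    using fun_cong[OF iter_partial_mult[OF smooth_cis schwartz_smooth[OF f], of "[i]" "s *\<^sub>R \<xi>"], of x]
      fun_cong[OF iter_partial_cis[of "[i]" "s *\<^sub>R \<xi>"], of x]
    by (simp add: g_def inner_commute mult_ac)
  then have "(LINT x|lborel. partial_deriv i f x * cis (s * (x \<bullet> \<xi>)) + imon [i] (s *\<^sub>R \<xi>) * (f x * cis (s * (x \<bullet> \<xi>)))) = 0"
    using integral_partial_deriv_0[OF gS, of i] by simp
  then have "(LINT x|lborel. partial_deriv i f x * cis (s * (x \<bullet> \<xi>)))
      = - imon [i] (s *\<^sub>R \<xi>) * (LINT x|lborel. f x * cis (s * (x \<bullet> \<xi>)))"
    using FT_integrable[OF f] FT_integrable[OF pS] by (simp add: add_eq_0_iff)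
  then show ?thesis by (simp add: FT_def)
qed

lemma FT_iter_partial:
  assumes f: "f \<in> schwartz"
  shows "FT s (iter_partial \<beta> f) \<xi> = imon \<beta> (- s *\<^sub>R \<xi>) * FT s f \<xi>"
proof (induction \<beta>)
  case (Cons i \<beta>)
  then show ?case using FT_partial_deriv[OF schwartz_iter_partial[OF f]] by (simp add: mult.assoc)
qed simp

text \<open>Continuous linear operators on the Schwartz class; linearity is not recorded.\<close>

definition tame :: "((real^'n::finite \<Rightarrow> complex) \<Rightarrow> real^'n \<Rightarrow> complex) \<Rightarrow> bool" where
  "tame U \<longleftrightarrow> (\<forall>f\<in>schwartz. U f \<in> schwartz) \<and>
     (\<forall>M. \<exists>M' C. 0 \<le> C \<and> (\<forall>f\<in>schwartz. snorm M (U f) \<le> C * snorm M' f))"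

lemma tame_schwartz: "tame U \<Longrightarrow> f \<in> schwartz \<Longrightarrow> U f \<in> schwartz"
  by (simp add: tame_def)

lemma tameE:
  assumes "tame U"
  obtains M' C where "0 \<le> C" "\<And>f. f \<in> schwartz \<Longrightarrow> snorm M (U f) \<le> C * snorm M' f"
  using assms unfolding tame_def by blast

lemma tame_compose:
  assumes "tame U" "tame V"
  shows "tame (\<lambda>f. U (V f))"
  unfolding tame_def
proof (intro conjI allI ballI)
  show "U (V f) \<in> schwartz" if "f \<in> schwartz" for f
    by (rule tame_schwartz[OF assms(1) tame_schwartz[OF assms(2) that]])
  fix M
  obtain M1 C1 where 1: "0 \<le> C1" "\<And>f. f \<in> schwartz \<Longrightarrow> snorm M (U f) \<le> C1 * snorm M1 f"
    by (rule tameE[OF assms(1)]) blast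
  obtain M2 C2 where 2: "0 \<le> C2" "\<And>f. f \<in> schwartz \<Longrightarrow> snorm M1 (V f) \<le> C2 * snorm M2 f"
    by (rule tameE[OF assms(2)]) blast
  have "snorm M (U (V f)) \<le> (C1 * C2) * snorm M2 f" if "f \<in> schwartz" for f
    using order_trans[OF 1(2)[OF tame_schwartz[OF assms(2) that]] mult_left_mono[OF 2(2)[OF that] 1(1)]]
    by (simp add: mult.assoc)
  then show "\<exists>M' C. 0 \<le> C \<and> (\<forall>f\<in>schwartz. snorm M (U (V f)) \<le> C * snorm M' f)"
    using 1(1) 2(1) by (intro exI[of _ M2] exI[of _ "C1 * C2"]) auto
qed

lemma tame_slow_mult: "slow g \<Longrightarrow> tame (\<lambda>f x. g x * f x)"
  unfolding tame_def using schwartz_slow_mult snorm_slow_mult by metis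

text \<open>Each power of the weight is bounded by the sum of the moduli of the coordinates, and a
  coordinate times the transform is, up to a unimodular factor, the transform of a partial
  derivative.\<close>

lemma weighted_FT_le:
  assumes "\<bar>s\<bar> = 1"
  shows "\<exists>M' C. 0 \<le> C \<and> (\<forall>f\<in>schwartz. \<forall>\<xi>. (1 + norm \<xi>) ^ m * norm (FT s f (\<xi>::real^'n::finite)) \<le> C * snorm M' f)"
proof (induction m)
  case 0
  show ?case
    by (rule exI[of _ "2 * CARD('n)"], rule exI[of _ "FTc TYPE('n) * wint TYPE('n)"])
      (auto simp: norm_FT_le less_imp_le[OF FTc_pos] wint_nonneg)
next
  case (Suc m)
  then obtain M' C where C: "0 \<le> C"
    "\<And>f \<xi>. f \<in> schwartz \<Longrightarrow> (1 + norm \<xi>) ^ m * norm (FT s f (\<xi>::real^'n)) \<le> C * snorm M' f" by blast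
  have "(1 + norm \<xi>) ^ Suc m * norm (FT s f \<xi>) \<le> ((1 + real CARD('n)) * C) * snorm (M' + 1) f"
    if f: "f \<in> schwartz" for f and \<xi> :: "real^'n"
  proof -
    have pS: "partial_deriv i f \<in> schwartz" for i using schwartz_iter_partial[OF f, of "[i]"] by simp
    have "norm \<xi> \<le> (\<Sum>i\<in>UNIV. \<bar>\<xi> $ i\<bar>)" by (rule norm_le_l1_cart)
    then have "norm \<xi> * norm (FT s f \<xi>) \<le> (\<Sum>i\<in>UNIV. \<bar>\<xi> $ i\<bar>) * norm (FT s f \<xi>)" by (rule mult_right_mono) simp
    also have "\<dots> = (\<Sum>i\<in>UNIV. norm (FT s (partial_deriv i f) \<xi>))"
      using assms by (simp add: FT_partial_deriv[OF f] sum_distrib_right norm_mult abs_mult)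
    finally have "(1 + norm \<xi>) * norm (FT s f \<xi>) \<le> norm (FT s f \<xi>) + (\<Sum>i\<in>UNIV. norm (FT s (partial_deriv i f) \<xi>))"
      by (simp add: distrib_right)
    then have "(1 + norm \<xi>) ^ m * ((1 + norm \<xi>) * norm (FT s f \<xi>))
      \<le> (1 + norm \<xi>) ^ m * (norm (FT s f \<xi>) + (\<Sum>i\<in>UNIV. norm (FT s (partial_deriv i f) \<xi>)))"
      by (rule mult_left_mono) simp
    also have "\<dots> = (1 + norm \<xi>) ^ m * norm (FT s f \<xi>) + (\<Sum>i\<in>UNIV. (1 + norm \<xi>) ^ m * norm (FT s (partial_deriv i f) \<xi>))"
      by (simp add: distrib_left sum_distrib_left)
    also have "\<dots> \<le> C * snorm (M' + 1) f + (\<Sum>i\<in>(UNIV::'n set). C * snorm (M' + 1) f)"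
    proof (intro add_mono sum_mono)
      show "(1 + norm \<xi>) ^ m * norm (FT s f \<xi>) \<le> C * snorm (M' + 1) f"
        using order_trans[OF C(2)[OF f] mult_left_mono[OF snorm_mono[OF f] C(1)]] by simp
      show "(1 + norm \<xi>) ^ m * norm (FT s (partial_deriv i f) \<xi>) \<le> C * snorm (M' + 1) f" for i
        using order_trans[OF C(2)[OF pS] mult_left_mono[OF snorm_iter_partial_le[OF f, of M' "[i]", simplified] C(1)]] by simp
    qed
    finally show ?thesis by (simp add: algebra_simps)
  qed
  then show ?case using C(1) by (intro exI[of _ "M' + 1"] exI[of _ "(1 + real CARD('n)) * C"]) auto
qed

text \<open>A derivative of the transform is the transform of f times \<open>imon\<close>, so decay
  of the derivatives reduces to \<open>weighted_FT_le\<close>. Constants and orders are summed over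
  the finitely many multi-indices.\<close>

lemma tame_FT:
  assumes "\<bar>s\<bar> = 1"
  shows "tame (FT s :: (real^'n::finite \<Rightarrow> complex) \<Rightarrow> _)"
proof -
  have *: "\<exists>M' C. 0 \<le> C \<and> (\<forall>f\<in>schwartz. \<forall>\<xi>::real^'n. (1 + norm \<xi>) ^ m * norm (iter_partial \<beta> (FT s f) \<xi>) \<le> C * snorm M' f)" for \<beta> m
  proof -
    obtain M1 C1 where 1: "0 \<le> C1"
      "\<And>f \<xi>. f \<in> schwartz \<Longrightarrow> (1 + norm \<xi>) ^ m * norm (FT s f (\<xi>::real^'n)) \<le> C1 * snorm M1 f"
      using weighted_FT_le[OF assms] by blast
    obtain M2 C2 where 2: "0 \<le> C2" "\<And>f. f \<in> schwartz \<Longrightarrow> snorm M1 (\<lambda>x. imon \<beta> (s *\<^sub>R x) * f x) \<le> C2 * snorm M2 f"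
      by (rule snorm_slow_mult[OF slow_scale[OF slow_imon]]) blast
    have "(1 + norm \<xi>) ^ m * norm (iter_partial \<beta> (FT s f) \<xi>) \<le> (C1 * C2) * snorm M2 f"
      if "f \<in> schwartz" for f and \<xi> :: "real^'n"
      unfolding iter_partial_FT[OF that] mult.assoc
      by (rule order_trans[OF 1(2)[OF schwartz_imon[OF that]] mult_left_mono[OF 2(2)[OF that] 1(1)]])
    then show ?thesis using 1 2 by (intro exI[of _ M2] exI[of _ "C1 * C2"]) auto
  qed
  show ?thesis
    unfolding tame_def
  proof (intro conjI allI ballI)
    fix f :: "real^'n \<Rightarrow> complex" assume f: "f \<in> schwartz"
    show "FT s f \<in> schwartz" by (rule schwartzI[OF smooth_FT[OF f]]) (use * f in blast)
  next
    fix M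
    define L where "L = {\<beta> :: 'n list. length \<beta> \<le> M}"
    have fin: "finite L" unfolding L_def by (rule finite_lists_le)
    from * obtain M' C where C: "\<And>\<beta>. 0 \<le> C \<beta>" "\<And>\<beta> f (\<xi>::real^'n). f \<in> schwartz \<Longrightarrow>
        (1 + norm \<xi>) ^ M * norm (iter_partial \<beta> (FT s f) \<xi>) \<le> C \<beta> * snorm (M' \<beta>) f"
      by metis
    have "snorm M (FT s f) \<le> sum C L * snorm (sum M' L) f" if f: "f \<in> schwartz" for f :: "real^'n \<Rightarrow> complex"
    proof (rule snorm_leI)
      fix \<beta> :: "'n list" and x :: "real^'n" assume "length \<beta> \<le> M"
      then have \<beta>: "\<beta> \<in> L" by (simp add: L_def)
      have "C \<beta> * snorm (M' \<beta>) f \<le> sum C L * snorm (sum M' L) f"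
        using \<beta> fin C(1) by (intro mult_mono snorm_mono f member_le_sum sum_nonneg snorm_nonneg) auto
      then show "(1 + norm x) ^ M * norm (iter_partial \<beta> (FT s f) x) \<le> sum C L * snorm (sum M' L) f"
        using C(2)[OF f, of x \<beta>] by simp
    qed
    then show "\<exists>M' C. 0 \<le> C \<and> (\<forall>f\<in>schwartz. snorm M (FT s (f :: real^'n \<Rightarrow> complex)) \<le> C * snorm M' f)"
      using C(1) by (intro exI[of _ "sum M' L"] exI[of _ "sum C L"]) (auto intro: sum_nonneg)
  qed
qed

lemma schwartz_FT: "\<bar>s\<bar> = 1 \<Longrightarrow> f \<in> schwartz \<Longrightarrow> FT s f \<in> schwartz"
  by (rule tame_schwartz[OF tame_FT])

section \<open>Gaussians, Fubini and Fourier inversion\<close>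

definition gauss :: "real^'n::finite \<Rightarrow> real" where
  "gauss x = exp (- (norm x)\<^sup>2 / 2)"

text \<open>This is the characteristic function of the standard normal distribution, up to
  normalisation.\<close>

lemma gauss_1d:
  "integrable lborel (\<lambda>t::real. complex_of_real (exp (- t\<^sup>2 / 2)) * cis (t * u))"
  "(LINT t|lborel. complex_of_real (exp (- t\<^sup>2 / 2)) * cis (t * u)) = complex_of_real (sqrt (2 * pi) * exp (- u\<^sup>2 / 2))"
proof -
  have d: "exp (- t\<^sup>2 / 2) = sqrt (2 * pi) * std_normal_density t" for t
    by (simp add: std_normal_density_def)
  have "integrable lborel (\<lambda>t::real. complex_of_real (exp (- t\<^sup>2 / 2)))"
    unfolding d using integrable_std_normal_moment[of 0]
    by (intro integrable_of_real integrable_mult_right) simp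
  then show "integrable lborel (\<lambda>t::real. complex_of_real (exp (- t\<^sup>2 / 2)) * cis (t * u))"
    by (rule integrable_mult_cis) simp
  have "char std_normal_distribution u = (LINT t|lborel. std_normal_density t *\<^sub>R iexp (u * t))"
    unfolding char_def by (rule integral_density) auto
  then have *: "(LINT t|lborel. std_normal_density t *\<^sub>R iexp (u * t)) = complex_of_real (exp (- u\<^sup>2 / 2))"
    by (simp add: char_std_normal_distribution)
  have "(LINT t|lborel. complex_of_real (exp (- t\<^sup>2 / 2)) * cis (t * u))
      = (LINT t|lborel. complex_of_real (sqrt (2 * pi)) * (std_normal_density t *\<^sub>R iexp (u * t)))"
    unfolding d by (simp add: cis_conv_exp scaleR_conv_of_real mult_ac)
  also have "\<dots> = complex_of_real (sqrt (2 * pi)) * complex_of_real (exp (- u\<^sup>2 / 2))"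
    by (simp only: integral_mult_right_zero *)
  finally show "(LINT t|lborel. complex_of_real (exp (- t\<^sup>2 / 2)) * cis (t * u)) = complex_of_real (sqrt (2 * pi) * exp (- u\<^sup>2 / 2))"
    by simp
qed

text \<open>The phase has modulus 1, so integrability on the product space is that of the product of
  f and g, whatever p is.\<close>

lemma fubini_cis:
  fixes f g :: "real^'n::finite \<Rightarrow> complex"
  assumes f: "integrable lborel f" and g: "integrable lborel g"
    and p: "(\<lambda>(x, y). p x y) \<in> borel_measurable (lborel \<Otimes>\<^sub>M lborel)"
  shows "(LINT x|lborel. (LINT y|lborel. f x * g y * cis (p x y))) = (LINT y|lborel. (LINT x|lborel. f x * g y * cis (p x y)))"
proof -
  have [measurable]: "f \<in> borel_measurable borel" "g \<in> borel_measurable borel"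
    using f g by (auto dest: borel_measurable_integrable)
  note p[measurable]
  have "integrable (lborel \<Otimes>\<^sub>M lborel) (\<lambda>(x, y). f x * g y * cis (p x y))"
  proof (rule lborel_pair.Fubini_integrable)
    show "(\<lambda>(x, y). f x * g y * cis (p x y)) \<in> borel_measurable (lborel \<Otimes>\<^sub>M lborel)"
      using p by measurable
    show "integrable lborel (\<lambda>x. LINT y|lborel. norm (case (x, y) of (x, y) \<Rightarrow> f x * g y * cis (p x y)))"
      using f g by (simp add: norm_mult)
    show "AE x in lborel. integrable lborel (\<lambda>y. case (x, y) of (x, y) \<Rightarrow> f x * g y * cis (p x y))"
    proof (rule AE_I2)
      fix x
      have "(\<lambda>y. p x y) \<in> borel_measurable lborel"
        using measurable_compose[OF measurable_Pair1' p, of x] by simp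
      then show "integrable lborel (\<lambda>y. case (x, y) of (x, y) \<Rightarrow> f x * g y * cis (p x y))"
        using g by (auto intro!: integrable_mult_cis)
    qed
  qed
  from lborel_pair.Fubini_integral[OF this] show ?thesis by simp
qed

text \<open>The kernel is symmetric in its two variables, so the transform is its own transpose for
  the bilinear pairing.\<close>

lemma FT_duality:
  fixes f g :: "real^'n::finite \<Rightarrow> complex"
  assumes f: "integrable lborel f" and g: "integrable lborel g"
  shows "(LINT x|lborel. FT s f x * g x) = (LINT x|lborel. f x * FT s g x)"
proof -
  have "(LINT x|lborel. (LINT y|lborel. f x * g y * cis (s * (x \<bullet> y)))) = (LINT y|lborel. (LINT x|lborel. f x * g y * cis (s * (x \<bullet> y))))"
    by (rule fubini_cis[OF f g]) measurable
  moreover have "(LINT y|lborel. f x * g y * cis (s * (x \<bullet> y))) = f x * (LINT y|lborel. g y * cis (s * (y \<bullet> x)))" for x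
    by (simp add: mult.assoc inner_commute)
  moreover have "(LINT x|lborel. f x * g y * cis (s * (x \<bullet> y))) = (LINT x|lborel. f x * cis (s * (x \<bullet> y))) * g y" for y
    by (subst integral_mult_left_zero[symmetric]) (simp only: mult_ac)
  ultimately have "(LINT x|lborel. f x * (LINT y|lborel. g y * cis (s * (y \<bullet> x))))
      = (LINT y|lborel. (LINT x|lborel. f x * cis (s * (x \<bullet> y))) * g y)"
    by simp
  moreover have "(LINT x|lborel. FT s f x * g x)
      = complex_of_real (FTc TYPE('n)) * (LINT y|lborel. (LINT x|lborel. f x * cis (s * (x \<bullet> y))) * g y)"
    unfolding FT_def FTc_def mult.assoc by (rule integral_mult_right_zero)
  moreover have "(LINT x|lborel. f x * FT s g x)
      = complex_of_real (FTc TYPE('n)) * (LINT x|lborel. f x * (LINT y|lborel. g y * cis (s * (y \<bullet> x))))"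
    unfolding FT_def FTc_def mult.left_commute[of "f _"] by (rule integral_mult_right_zero)
  ultimately show ?thesis by simp
qed

lemma prod_cis: "(\<Prod>i\<in>A. cis (f i)) = cis (\<Sum>i\<in>A. f i)"
  by (induction A rule: infinite_finite_induct) (auto simp: cis_mult)

lemma
  fixes u :: "real^'n::finite"
  shows integrable_gauss: "integrable lborel (\<lambda>x. complex_of_real (gauss x) * cis (x \<bullet> u))"
    and integral_gauss: "(LINT x|lborel. complex_of_real (gauss x) * cis (x \<bullet> u)) = complex_of_real (gauss u) / complex_of_real (FTc TYPE('n))"
proof -
  have g: "gauss x = (\<Prod>i\<in>UNIV. exp (- (x $ i)\<^sup>2 / 2))" for x :: "real^'n"
  proof -
    have "- (norm x)\<^sup>2 / 2 = (\<Sum>i\<in>UNIV. - (x $ i)\<^sup>2 / 2)"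
      unfolding power2_norm_eq_inner inner_vec_def
      by (simp add: sum_negf power2_eq_square flip: sum_divide_distrib)
    then show ?thesis by (simp add: gauss_def exp_sum)
  qed
  have eq: "complex_of_real (gauss x) * cis (x \<bullet> u)
      = (\<Prod>i\<in>UNIV. complex_of_real (exp (- (x $ i)\<^sup>2 / 2)) * cis (x $ i * u $ i))" for x
    by (simp only: g prod.distrib prod_cis of_real_prod) (simp add: inner_vec_def)
  show "integrable lborel (\<lambda>x. complex_of_real (gauss x) * cis (x \<bullet> u))"
    unfolding eq by (rule integrable_prod_coords[OF gauss_1d(1)])
  have "sqrt (2 * pi) ^ CARD('n) = 1 / FTc TYPE('n)"
    by (simp add: FTc_def powr_minus_divide powr_half_sqrt[symmetric] powr_powr flip: powr_realpow)
  then have "complex_of_real (sqrt (2 * pi)) ^ CARD('n) = 1 / complex_of_real (FTc TYPE('n))"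
    by (metis of_real_1 of_real_divide of_real_power)
  then show "(LINT x|lborel. complex_of_real (gauss x) * cis (x \<bullet> u)) = complex_of_real (gauss u) / complex_of_real (FTc TYPE('n))"
    unfolding eq integral_prod_coords[OF gauss_1d(1)] gauss_1d(2) by (simp add: prod.distrib g)
qed

lemma gauss_le_1: "gauss x \<le> 1" and gauss_pos: "0 < gauss x" and gauss_0: "gauss 0 = 1"
  by (auto simp: gauss_def)

lemma continuous_gauss: "continuous_on S gauss"
  unfolding gauss_def by (intro continuous_intros) auto

lemma borel_measurable_gauss [measurable]: "gauss \<in> borel_measurable borel"
  by (intro borel_measurable_continuous_onI continuous_gauss)

text \<open>Gaussian regularisation: a slowly decaying Gaussian is inserted into the inverse
  integral, duality turns it into an approximate identity acting on f, and both sides converge as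
  the parameter tends to 0.\<close>

theorem FT_inversion:
  fixes f :: "real^'n::finite \<Rightarrow> complex"
  assumes f: "f \<in> schwartz" and s: "\<bar>s\<bar> = 1"
  shows "FT (- s) (FT s f) x = f x"
proof -
  define c where "c = complex_of_real (FTc TYPE('n))"
  have c0: "c \<noteq> 0" using FTc_pos[where 'n = 'n] by (simp add: c_def)
  define e where "e = (\<lambda>k. inverse (real (Suc k)))"
  have e0: "e \<longlonglongrightarrow> 0" unfolding e_def by (rule LIMSEQ_inverse_real_of_nat)
  have epos: "e k > 0" for k by (simp add: e_def)
  have fS: "FT s f \<in> schwartz" by (rule schwartz_FT[OF s f])
  have fi: "integrable lborel f" "integrable lborel (FT s f)"
    by (rule schwartz_integrable f fS)+
  have [measurable]: "f \<in> borel_measurable borel" "FT s f \<in> borel_measurable borel"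
    by (rule schwartz_borel f fS)+
  have ig: "integrable lborel (\<lambda>z. complex_of_real (gauss (z::real^'n)))"
    using integrable_gauss[of "0::real^'n"] by simp
  \<comment> \<open>Its transform is a Gaussian concentrated at x, of width proportional to e
    k.\<close>
  define h where "h = (\<lambda>k \<xi>. complex_of_real (gauss (e k *\<^sub>R \<xi>)) * cis (- s * (x \<bullet> \<xi>)))"
  have hi: "integrable lborel (h k)" for k
  proof -
    have "integrable lborel (\<lambda>\<xi>::real^'n. complex_of_real (gauss (e k *\<^sub>R \<xi>)))"
      using integrable_diag[of "\<lambda>z::real^'n. complex_of_real (gauss z)" "\<lambda>_. e k" 0] ig epos[of k]
      by (simp add: vec_lambda_scale less_imp_neq[symmetric])
    then show ?thesis unfolding h_def by (rule integrable_mult_cis) simp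
  qed
  have Fh: "FT s (h k) y = complex_of_real (gauss ((1 / e k) *\<^sub>R (y - x))) /\<^sub>R e k ^ CARD('n)" for k y
  proof -
    have "(LINT \<xi>|lborel. h k \<xi> * cis (s * (\<xi> \<bullet> y)))
      = (LINT \<xi>|lborel. complex_of_real (gauss (e k *\<^sub>R \<xi>)) * cis ((e k *\<^sub>R \<xi>) \<bullet> ((s / e k) *\<^sub>R (y - x))))"
      using epos[of k]
      by (intro Bochner_Integration.integral_cong refl)
        (simp add: h_def cis_mult inner_diff_right inner_commute algebra_simps less_imp_neq[symmetric])
    also have "\<dots> = (LINT z|lborel. complex_of_real (gauss z) * cis (z \<bullet> ((s / e k) *\<^sub>R (y - x)))) /\<^sub>R e k ^ CARD('n)"
      using integral_scale[of "\<lambda>z. complex_of_real (gauss z) * cis (z \<bullet> ((s / e k) *\<^sub>R (y - x)))" "e k" 0] epos[of k]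
      by (simp add: less_imp_neq[symmetric])
    also have "\<dots> = complex_of_real (gauss ((s / e k) *\<^sub>R (y - x))) / c /\<^sub>R e k ^ CARD('n)"
      unfolding integral_gauss c_def ..
    also have "gauss ((s / e k) *\<^sub>R (y - x)) = gauss ((1 / e k) *\<^sub>R (y - x))"
      using s by (simp add: gauss_def power_mult_distrib)
    finally show ?thesis using c0 by (simp add: FT_def c_def FTc_def)
  qed
  \<comment> \<open>After duality the substitution y = x + e k z removes the power of e k, leaving f
    near x averaged against a fixed Gaussian.\<close>
  have I: "(LINT \<xi>|lborel. FT s f \<xi> * h k \<xi>) = (LINT z|lborel. f (x + e k *\<^sub>R z) * complex_of_real (gauss z))" for k
  proof -
    have "(LINT \<xi>|lborel. FT s f \<xi> * h k \<xi>) = (LINT y|lborel. f y * FT s (h k) y)"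
      by (rule FT_duality[OF fi(1) hi])
    also have "\<dots> = (LINT y|lborel. f y * complex_of_real (gauss ((1 / e k) *\<^sub>R (y - x)))) /\<^sub>R e k ^ CARD('n)"
      by (simp add: Fh)
    also have "\<dots> = (LINT z|lborel. f (x + e k *\<^sub>R z) * complex_of_real (gauss z))"
      using integral_scale[of "\<lambda>y. f y * complex_of_real (gauss ((1 / e k) *\<^sub>R (y - x)))" "e k" x] epos[of k]
      by (simp add: less_imp_neq[symmetric])
    finally show ?thesis .
  qed
  have lim1: "(\<lambda>k. LINT \<xi>|lborel. FT s f \<xi> * h k \<xi>) \<longlonglongrightarrow> (LINT \<xi>|lborel. FT s f \<xi> * cis (- s * (x \<bullet> \<xi>)))"
  proof (rule integral_dominated_convergence[where w = "\<lambda>\<xi>. norm (FT s f \<xi>)"])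
    show "integrable lborel (\<lambda>\<xi>. norm (FT s f \<xi>))" by (rule integrable_norm[OF fi(2)])
    show "AE \<xi> in lborel. (\<lambda>k. FT s f \<xi> * h k \<xi>) \<longlonglongrightarrow> FT s f \<xi> * cis (- s * (x \<bullet> \<xi>))"
    proof (rule AE_I2)
      fix \<xi> :: "real^'n"
      have "(\<lambda>k. gauss (e k *\<^sub>R \<xi>)) \<longlonglongrightarrow> gauss (0 *\<^sub>R \<xi>)"
        by (rule continuous_on_tendsto_compose[OF continuous_gauss[of UNIV] tendsto_scaleR[OF e0 tendsto_const]]) auto
      then have "(\<lambda>k. FT s f \<xi> * (complex_of_real (gauss (e k *\<^sub>R \<xi>)) * cis (- s * (x \<bullet> \<xi>))))
          \<longlonglongrightarrow> FT s f \<xi> * (complex_of_real (gauss (0 *\<^sub>R \<xi>)) * cis (- s * (x \<bullet> \<xi>)))"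
        by (intro tendsto_mult tendsto_const tendsto_of_real)
      then show "(\<lambda>k. FT s f \<xi> * h k \<xi>) \<longlonglongrightarrow> FT s f \<xi> * cis (- s * (x \<bullet> \<xi>))"
        by (simp add: h_def gauss_0)
    qed
    show "AE \<xi> in lborel. norm (FT s f \<xi> * h k \<xi>) \<le> norm (FT s f \<xi>)" for k
      by (intro AE_I2) (simp add: h_def norm_mult abs_of_pos gauss_pos mult_left_le gauss_le_1)
  qed (simp_all add: h_def)
  obtain B where B: "\<And>y. norm (f y) \<le> B"
    using schwartz_bounded[OF f, of 0 "[]"] by auto
  have lim2: "(\<lambda>k. LINT z|lborel. f (x + e k *\<^sub>R z) * complex_of_real (gauss z)) \<longlonglongrightarrow> (LINT z|lborel. f x * complex_of_real (gauss (z::real^'n)))"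
  proof (rule integral_dominated_convergence[where w = "\<lambda>z. B * gauss z"])
    show "integrable lborel (\<lambda>z::real^'n. B * gauss z)"
      using integrable_norm[OF ig] by (simp add: abs_of_pos[OF gauss_pos])
    show "AE z in lborel. (\<lambda>k. f (x + e k *\<^sub>R z) * complex_of_real (gauss z)) \<longlonglongrightarrow> f x * complex_of_real (gauss z)"
    proof (rule AE_I2)
      fix z :: "real^'n"
      have "(\<lambda>k. f (x + e k *\<^sub>R z)) \<longlonglongrightarrow> f (x + 0 *\<^sub>R z)"
        by (rule continuous_on_tendsto_compose[OF smooth_continuous0[OF schwartz_smooth[OF f], of UNIV]
          tendsto_add[OF tendsto_const tendsto_scaleR[OF e0 tendsto_const]]]) auto
      then show "(\<lambda>k. f (x + e k *\<^sub>R z) * complex_of_real (gauss z)) \<longlonglongrightarrow> f x * complex_of_real (gauss z)"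
        by (auto intro!: tendsto_mult tendsto_const)
    qed
    show "AE z in lborel. norm (f (x + e k *\<^sub>R z) * complex_of_real (gauss z)) \<le> B * gauss z" for k
      by (intro AE_I2) (simp add: norm_mult abs_of_pos[OF gauss_pos] B mult_right_mono less_imp_le[OF gauss_pos])
  qed simp_all
  have "(LINT \<xi>|lborel. FT s f \<xi> * cis (- s * (x \<bullet> \<xi>))) = (LINT z|lborel. f x * complex_of_real (gauss (z::real^'n)))"
    using LIMSEQ_unique[OF lim1[unfolded I] lim2] .
  also have "\<dots> = f x / c"
    using integral_gauss[of "0::real^'n"] by (simp add: c_def gauss_0)
  finally have "c * (LINT \<xi>|lborel. FT s f \<xi> * cis (- s * (x \<bullet> \<xi>))) = f x"
    using c0 by simp
  then show ?thesis
    by (simp add: FT_def c_def FTc_def inner_commute)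
qed

section \<open>Lattice sums and Poisson summation\<close>

abbreviation Zn :: "(int^'n::finite) measure" where
  "Zn \<equiv> count_space UNIV"

definition ucube :: "(real^'n::finite) set" where
  "ucube = {x. \<forall>i. 0 \<le> x $ i \<and> x $ i < 1}"

lemma lattice_vec_nth [simp]: "lattice_vec n $ i = of_int (n $ i)"
  by (simp add: lattice_vec_def)

lemma lattice_vec_add: "lattice_vec (m + n) = lattice_vec m + lattice_vec n"
  by (simp add: vec_eq_iff)

lemma lattice_vec_0 [simp]: "lattice_vec 0 = 0"
  by (simp add: vec_eq_iff)

lemma ucube_shift_iff: "x - lattice_vec n \<in> ucube \<longleftrightarrow> n = vec_lambda (\<lambda>i. \<lfloor>x $ i\<rfloor>)"
proof -
  have "(0 \<le> x $ i - of_int (n $ i) \<and> x $ i - of_int (n $ i) < 1) \<longleftrightarrow> n $ i = \<lfloor>x $ i\<rfloor>" for i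
    using floor_eq_iff[of "x $ i" "n $ i"] by (auto simp: algebra_simps)
  then show ?thesis by (auto simp: ucube_def vec_eq_iff)
qed

lemma ucube_borel [measurable]: "(ucube :: (real^'n::finite) set) \<in> sets borel"
proof -
  have eq: "(ucube :: (real^'n) set) = (\<Inter>i\<in>UNIV. {x. 0 \<le> x $ i} \<inter> {x. x $ i < 1})"
    by (auto simp: ucube_def)
  have "{x::real^'n. 0 \<le> x $ i} \<in> sets borel" "{x::real^'n. x $ i < 1} \<in> sets borel" for i
    by measurable
  then show ?thesis unfolding eq by (intro sets.finite_INT sets.Int) auto
qed

interpretation Zn_lborel: pair_sigma_finite "count_space (UNIV :: (int^'n::finite) set)" "lborel :: (real^'n) measure"
  by (intro pair_sigma_finite.intro sigma_finite_measure_count_space lborel.sigma_finite_measure_axioms)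

interpretation lborel_Zn: pair_sigma_finite "lborel :: (real^'n::finite) measure" "count_space (UNIV :: (int^'n) set)"
  by (intro pair_sigma_finite.intro sigma_finite_measure_count_space lborel.sigma_finite_measure_axioms)

lemma integral_Zn_indicator:
  fixes h :: "'b::{banach,second_countable_topology}"
  shows "integrable Zn (\<lambda>n. indicator {m} n *\<^sub>R h)" "(LINT n|Zn. indicator {m} n *\<^sub>R h) = h"
  by auto

text \<open>For every x exactly one lattice index contributes, namely the vector of floors. The
  inner sum is therefore trivial and Fubini yields the rest.\<close>

lemma integrable_cubes_aux:
  fixes h :: "real^'n::finite \<Rightarrow> 'b::{banach,second_countable_topology}"
  assumes h: "integrable lborel h"
  shows "integrable (lborel \<Otimes>\<^sub>M Zn) (\<lambda>(x, n). indicator ucube (x - lattice_vec n) *\<^sub>R h x)"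
    "(LINT n|Zn. LINT x|lborel. indicator ucube (x - lattice_vec n) *\<^sub>R h x) = (LINT x|lborel. h x)"
    "integrable Zn (\<lambda>n. LINT x|lborel. indicator ucube (x - lattice_vec n) *\<^sub>R h x)"
proof -
  have [measurable]: "h \<in> borel_measurable borel" using h by (auto dest: borel_measurable_integrable)
  have ind: "indicator ucube (x - lattice_vec n) = (indicator {vec_lambda (\<lambda>i. \<lfloor>x $ i\<rfloor>)} n :: real)" for x :: "real^'n" and n
    by (simp add: indicator_def ucube_shift_iff)
  have "(\<lambda>(n, x). indicator ucube (x - lattice_vec n) *\<^sub>R h x) \<in> borel_measurable (Zn \<Otimes>\<^sub>M lborel)"
    by (rule measurable_pair_measure_countable1) auto
  from measurable_pair_swap[OF this]
  have m: "(\<lambda>(x, n). indicator ucube (x - lattice_vec n) *\<^sub>R h x) \<in> borel_measurable (lborel \<Otimes>\<^sub>M Zn)"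
    by simp
  show 1: "integrable (lborel \<Otimes>\<^sub>M Zn) (\<lambda>(x, n). indicator ucube (x - lattice_vec n) *\<^sub>R h x)"
  proof (rule lborel_Zn.Fubini_integrable[OF m])
    have "(LINT n|Zn. norm (indicator ucube (x - lattice_vec n) *\<^sub>R h x)) = norm (h x)" for x
    proof -
      have "norm (indicator ucube (x - lattice_vec n) *\<^sub>R h x)
          = indicator {vec_lambda (\<lambda>i. \<lfloor>x $ i\<rfloor>)} n *\<^sub>R norm (h x)" for n
        by (simp add: ind)
      then show ?thesis by (simp only: integral_Zn_indicator(2))
    qed
    then show "integrable lborel (\<lambda>x. LINT n|Zn. norm (case (x, n) of (x, n) \<Rightarrow> indicator ucube (x - lattice_vec n) *\<^sub>R h x))"
      using integrable_norm[OF h] by (simp only: prod.case)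
    show "AE x in lborel. integrable Zn (\<lambda>n. case (x, n) of (x, n) \<Rightarrow> indicator ucube (x - lattice_vec n) *\<^sub>R h x)"
      by (simp add: ind integral_Zn_indicator)
  qed
  show "(LINT n|Zn. LINT x|lborel. indicator ucube (x - lattice_vec n) *\<^sub>R h x) = (LINT x|lborel. h x)"
    using lborel_Zn.Fubini_integral[OF 1] by (simp add: ind integral_Zn_indicator)
  show "integrable Zn (\<lambda>n. LINT x|lborel. indicator ucube (x - lattice_vec n) *\<^sub>R h x)"
    using lborel_Zn.integrable_snd[OF 1] by simp
qed

lemma integral_cube_shift:
  fixes h :: "real^'n::finite \<Rightarrow> 'b::{banach,second_countable_topology}"
  assumes [measurable]: "h \<in> borel_measurable borel"
  shows "(LINT x|lborel. indicator ucube (x - lattice_vec n) *\<^sub>R h x)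
       = (LINT x|lborel. indicator ucube x *\<^sub>R h (x + lattice_vec n))"
  using integral_shift[of "\<lambda>x. indicator ucube (x - lattice_vec n) *\<^sub>R h x" "lattice_vec n"]
  by (simp add: add.commute)

text \<open>Both orders of summation and integration are recorded: the sum of cell integrals serves
  the Riemann sums, the integral of the folded function serves the Fourier coefficients of a
  periodisation.\<close>

lemma
  fixes h :: "real^'n::finite \<Rightarrow> 'b::{banach,second_countable_topology}"
  assumes h: "integrable lborel h"
  shows integrable_cubes: "integrable Zn (\<lambda>n. LINT x|lborel. indicator ucube x *\<^sub>R h (x + lattice_vec n))"
    and sum_integral_cubes: "(LINT n|Zn. LINT x|lborel. indicator ucube x *\<^sub>R h (x + lattice_vec n)) = (LINT x|lborel. h x)"
    and integral_sum_cubes: "(LINT x|lborel. LINT n|Zn. indicator ucube x *\<^sub>R h (x + lattice_vec n)) = (LINT x|lborel. h x)"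
proof -
  have [measurable]: "h \<in> borel_measurable borel" using h by (auto dest: borel_measurable_integrable)
  note aux = integrable_cubes_aux(2,3)[OF h, unfolded integral_cube_shift[OF \<open>h \<in> borel_measurable borel\<close>]]
  show "integrable Zn (\<lambda>n. LINT x|lborel. indicator ucube x *\<^sub>R h (x + lattice_vec n))"
    and s: "(LINT n|Zn. LINT x|lborel. indicator ucube x *\<^sub>R h (x + lattice_vec n)) = (LINT x|lborel. h x)"
    using aux by auto
  have m: "(\<lambda>(n, x). indicator ucube x *\<^sub>R h (x + lattice_vec n)) \<in> borel_measurable (Zn \<Otimes>\<^sub>M lborel)"
    by (rule measurable_pair_measure_countable1) auto
  have "integrable (Zn \<Otimes>\<^sub>M lborel) (\<lambda>(n, x). indicator ucube x *\<^sub>R h (x + lattice_vec n))"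
  proof (rule Zn_lborel.Fubini_integrable[OF m])
    have nm: "(\<lambda>x. norm (h x)) \<in> borel_measurable borel" by measurable
    have "integrable Zn (\<lambda>n. LINT x|lborel. indicator ucube x *\<^sub>R norm (h (x + lattice_vec n)))"
      using integrable_cubes_aux(3)[OF integrable_norm[OF h]] unfolding integral_cube_shift[OF nm] .
    then show "integrable Zn (\<lambda>n. LINT x|lborel. norm (case (n, x) of (n, x) \<Rightarrow> indicator ucube x *\<^sub>R h (x + lattice_vec n)))"
      by simp
    have "integrable lborel (\<lambda>x. indicator ucube x *\<^sub>R h (x + lattice_vec n))" for n
      using integrable_shift[of h "lattice_vec n"] h
      by (intro integrable_mult_indicator) (auto simp: add.commute)
    then show "AE n in Zn. integrable lborel (\<lambda>x. case (n, x) of (n, x) \<Rightarrow> indicator ucube x *\<^sub>R h (x + lattice_vec n))"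
      by simp
  qed
  from Zn_lborel.Fubini_integral[OF this] s
  show "(LINT x|lborel. LINT n|Zn. indicator ucube x *\<^sub>R h (x + lattice_vec n)) = (LINT x|lborel. h x)"
    by simp
qed

text \<open>Per coordinate, (x + y)^2 \<le> 2 x^2 + 2 y^2 with |y| \<le> 1 gives 1 + (x + y)^2 \<le>
  3 (1 + x^2).\<close>

lemma wt_shift_le:
  fixes x y :: "real^'n::finite"
  assumes "\<And>i. \<bar>y $ i\<bar> \<le> 1"
  shows "wt x \<le> 3 ^ CARD('n) * wt (x + y)"
proof -
  have "inverse (1 + (x $ i)\<^sup>2) \<le> 3 * inverse (1 + (x $ i + y $ i)\<^sup>2)" for i
  proof -
    have "(y $ i)\<^sup>2 \<le> 1" using assms[of i] by (simp add: abs_square_le_1)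
    moreover have "(x $ i + y $ i)\<^sup>2 \<le> 2 * (x $ i)\<^sup>2 + 2 * (y $ i)\<^sup>2"
      using zero_le_power2[of "x $ i - y $ i"] by (simp add: power2_sum power2_diff)
    moreover have "0 \<le> (x $ i)\<^sup>2" by simp
    ultimately have "1 + (x $ i + y $ i)\<^sup>2 \<le> 3 * (1 + (x $ i)\<^sup>2)" by argo
    moreover have "0 < 1 + (x $ i + y $ i)\<^sup>2" "0 < 1 + (x $ i)\<^sup>2" by (simp_all add: add_pos_nonneg)
    ultimately show ?thesis by (simp add: divide_simps)
  qed
  then have "wt x \<le> (\<Prod>i\<in>(UNIV::'n set). 3 * inverse (1 + (x $ i + y $ i)\<^sup>2))"
    unfolding wt_def by (intro prod_mono) (auto simp: add_nonneg_nonneg)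
  then show ?thesis by (simp add: wt_def prod.distrib)
qed

lemma lmeasure_ucube: "(LINT x|lborel. indicator ucube (x::real^'n::finite)) = (1::real)"
proof -
  have "indicator ucube x = (\<Prod>i\<in>UNIV. indicator {0..<1::real} (x $ i) :: real)" for x :: "real^'n"
  proof (cases "x \<in> ucube")
    case False
    then obtain i where "\<not> (0 \<le> x $ i \<and> x $ i < 1)" by (auto simp: ucube_def)
    then have "indicator {0..<1::real} (x $ i) = (0::real)" by auto
    then have "(\<Prod>i\<in>UNIV. indicator {0..<1::real} (x $ i) :: real) = 0" by (intro prod_zero) auto
    with False show ?thesis by simp
  qed (auto simp: ucube_def)
  then show ?thesis
    by (simp add: integral_prod_coords[where g = "\<lambda>_. indicator {0..<1::real} :: real \<Rightarrow> real"])
qed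

text \<open>On the cell with corner n the weight is at least a fixed multiple of its value at n, so
  the lattice sum is dominated by the convergent sum of cell integrals.\<close>

lemma integrable_wt_lattice: "integrable Zn (\<lambda>n. wt (lattice_vec n :: real^'n::finite))"
proof (rule Bochner_Integration.integrable_bound)
  have i: "integrable lborel (\<lambda>x::real^'n. 3 ^ CARD('n) * wt x)" by (intro integrable_mult_right integrable_wt)
  show "integrable Zn (\<lambda>n. LINT x|lborel. indicator ucube x *\<^sub>R (3 ^ CARD('n) * wt (x + lattice_vec n :: real^'n)))"
    by (rule integrable_cubes[OF i])
  show "AE n in Zn. norm (wt (lattice_vec n :: real^'n))
      \<le> norm (LINT x|lborel. indicator ucube x *\<^sub>R (3 ^ CARD('n) * wt (x + lattice_vec n :: real^'n)))"
  proof (rule AE_I2)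
    fix n :: "int^'n"
    have "(LINT x|lborel. indicator ucube (x::real^'n) * wt (lattice_vec n :: real^'n))
       \<le> (LINT x|lborel. indicator ucube x *\<^sub>R (3 ^ CARD('n) * wt (x + lattice_vec n :: real^'n)))"
    proof (rule Bochner_Integration.integral_mono)
      have "integrable lborel (indicator ucube :: real^'n \<Rightarrow> real)"
        using lmeasure_ucube[where 'n = 'n] not_integrable_integral_eq by (metis zero_neq_one)
      then show "integrable lborel (\<lambda>x. indicator ucube (x::real^'n) * wt (lattice_vec n :: real^'n))"
        by simp
      show "integrable lborel (\<lambda>x. indicator ucube x *\<^sub>R (3 ^ CARD('n) * wt (x + lattice_vec n :: real^'n)))"
        using integrable_shift[of "\<lambda>x::real^'n. 3 ^ CARD('n) * wt x" "lattice_vec n"] i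
        by (intro integrable_mult_indicator) (auto simp: add.commute dest: borel_measurable_integrable)
      show "indicator ucube x * wt (lattice_vec n) \<le> indicator ucube x *\<^sub>R (3 ^ CARD('n) * wt (x + lattice_vec n))" for x :: "real^'n"
      proof (cases "x \<in> ucube")
        case True
        then have "\<bar>x $ i\<bar> \<le> 1" for i by (auto simp: ucube_def abs_le_iff less_imp_le intro: order_trans[of _ 0])
        from wt_shift_le[of x, OF this, of "lattice_vec n"] True show ?thesis by (simp add: add.commute)
      qed simp
    qed
    then show "norm (wt (lattice_vec n :: real^'n))
      \<le> norm (LINT x|lborel. indicator ucube x *\<^sub>R (3 ^ CARD('n) * wt (x + lattice_vec n :: real^'n)))"
      using wt_pos[of "lattice_vec n :: real^'n"]
      unfolding integral_mult_left_zero lmeasure_ucube by simp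
  qed
qed simp

text \<open>Dominated convergence and Fubini are applied to integrals over the counting measure,
  while the claims are about unordered sums; this passes from the former to the latter.\<close>

lemma has_sum_Zn:
  fixes f :: "int^'n::finite \<Rightarrow> 'b::{banach,second_countable_topology}"
  assumes "integrable Zn f"
  shows "(f has_sum (LINT n|Zn. f n)) UNIV" "(\<lambda>n. norm (f n)) summable_on UNIV"
proof -
  have a: "Infinite_Set_Sum.abs_summable_on f UNIV" using assms by (simp add: Infinite_Set_Sum.abs_summable_on_def)
  then show s: "(\<lambda>n. norm (f n)) summable_on UNIV" using abs_summable_equivalent by blast
  then have "f summable_on UNIV" by (rule abs_summable_summable)
  moreover have "infsum f UNIV = (LINT n|Zn. f n)"
    using infsetsum_infsum[OF a] by (simp add: infsetsum_def)
  ultimately show "(f has_sum (LINT n|Zn. f n)) UNIV"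
    by (simp add: has_sum_infsum flip: \<open>infsum f UNIV = _\<close>)
qed

section \<open>Trigonometric polynomials and completeness of the exponentials\<close>

inductive trig_poly :: "(real^'n::finite \<Rightarrow> complex) \<Rightarrow> bool" where
  base: "trig_poly (\<lambda>x. c * cis (2 * pi * (lattice_vec m \<bullet> x)))"
| add: "trig_poly f \<Longrightarrow> trig_poly g \<Longrightarrow> trig_poly (\<lambda>x. f x + g x)"

lemma trig_poly_const: "trig_poly (\<lambda>x. c)"
  using trig_poly.base[of c 0] by simp

lemma trig_poly_mult:
  assumes "trig_poly f" "trig_poly g"
  shows "trig_poly (\<lambda>x. f x * g x)"
  using assms
proof (induction arbitrary: g)
  case (base c m g)
  from base show ?case
  proof (induction)
    case (base d k)
    have "(\<lambda>x. c * cis (2 * pi * (lattice_vec m \<bullet> x)) * (d * cis (2 * pi * (lattice_vec k \<bullet> x))))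
        = (\<lambda>x. (c * d) * cis (2 * pi * (lattice_vec (m + k) \<bullet> x)))"
      by (simp add: fun_eq_iff lattice_vec_add inner_add_left distrib_left cis_mult[symmetric] mult_ac)
    then show ?case using trig_poly.base[of "c * d" "m + k"] by (simp only:)
  next
    case (add f g)
    then show ?case unfolding distrib_left by (intro trig_poly.add)
  qed
next
  case (add f h g)
  then show ?case unfolding distrib_right by (intro trig_poly.add) auto
qed

lemma trig_poly_cmult: "trig_poly f \<Longrightarrow> trig_poly (\<lambda>x. c * f x)"
  by (rule trig_poly_mult[OF trig_poly_const])

lemma trig_poly_sum:
  "(\<And>i. i \<in> I \<Longrightarrow> trig_poly (f i)) \<Longrightarrow> trig_poly (\<lambda>x. \<Sum>i\<in>I. f i x)"
  by (induction I rule: infinite_finite_induct) (auto intro: trig_poly_const trig_poly.add)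

text \<open>Embeds the torus of period 1 into a complex vector space, so that Stone-Weierstrass
  applies on its compact image.\<close>

definition torus_map :: "real^'n::finite \<Rightarrow> complex^'n" where
  "torus_map x = vec_lambda (\<lambda>i. cis (2 * pi * x $ i))"

lemma torus_map_nth [simp]: "torus_map x $ i = cis (2 * pi * x $ i)"
  by (simp add: torus_map_def)

lemma continuous_torus_map: "continuous_on S torus_map"
  unfolding torus_map_def by (intro continuous_intros)

lemma torus_map_eq_iff: "torus_map x = torus_map y \<longleftrightarrow> (\<exists>n. y = x + lattice_vec n)"
proof
  assume eq: "torus_map x = torus_map y"
  have "\<exists>n::int. y $ i = x $ i + n" for i
  proof -
    have "cis (2 * pi * y $ i) = cis (2 * pi * x $ i)" using eq by (simp add: vec_eq_iff)
    then have "sin (2 * pi * y $ i) = sin (2 * pi * x $ i) \<and> cos (2 * pi * y $ i) = cos (2 * pi * x $ i)"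
      by (simp add: complex_eq_iff)
    then obtain n :: int where "2 * pi * y $ i = 2 * pi * x $ i + 2 * pi * n"
      unfolding sin_cos_eq_iff by blast
    then have "2 * pi * y $ i = 2 * pi * (x $ i + n)" by (simp add: distrib_left)
    then show ?thesis by auto
  qed
  then obtain n :: "'a \<Rightarrow> int" where "\<And>i. y $ i = x $ i + n i" by metis
  then have "y = x + lattice_vec (vec_lambda n)" by (simp add: vec_eq_iff)
  then show "\<exists>n. y = x + lattice_vec n" by blast
next
  assume "\<exists>n. y = x + lattice_vec n"
  then obtain n where n: "y = x + lattice_vec n" by blast
  have "cis (2 * pi * (x $ i + of_int (n $ i))) = cis (2 * pi * x $ i)" for i
    by (simp add: distrib_left flip: cis_mult)
  then show "torus_map x = torus_map y" by (simp add: vec_eq_iff n)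
qed

lemma torus_map_reduce: "\<exists>y\<in>ucube. torus_map y = torus_map x"
proof -
  define n where "n = vec_lambda (\<lambda>i. \<lfloor>x $ i\<rfloor>)"
  have "x - lattice_vec n \<in> ucube" by (simp add: ucube_shift_iff n_def)
  moreover have "torus_map (x - lattice_vec n) = torus_map x"
    unfolding torus_map_eq_iff by (rule exI[of _ n]) simp
  ultimately show ?thesis by blast
qed

lemma ucube_subset_cbox: "ucube \<subseteq> cbox 0 (vec_lambda (\<lambda>i. 1 :: real) :: real^'n::finite)"
  by (auto simp: ucube_def mem_box_cart less_imp_le)

text \<open>Continuity of the descended function: the preimage of a closed set is the image of a
  compact part of the closed unit box, hence closed.\<close>

lemma torus_descent:
  fixes q :: "real^'n::finite \<Rightarrow> complex"
  assumes cont: "continuous_on UNIV q" and per: "\<And>x n. q (x + lattice_vec n) = q x"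
  obtains Q where "continuous_on (range torus_map) Q" "\<And>x. Q (torus_map x) = q x"
    "compact (range (torus_map :: real^'n \<Rightarrow> complex^'n))"
proof -
  define B where "B = cbox 0 (vec_lambda (\<lambda>i. 1 :: real) :: real^'n)"
  define Q where "Q = (\<lambda>z. q (SOME x. torus_map x = z))"
  have Q: "Q (torus_map x) = q x" for x
  proof -
    have "torus_map (SOME y. torus_map y = torus_map x) = torus_map x"
      by (rule someI[of "\<lambda>y. torus_map y = torus_map x" x]) simp
    then obtain n where "x = (SOME y. torus_map y = torus_map x) + lattice_vec n"
      unfolding torus_map_eq_iff by blast
    then show ?thesis unfolding Q_def by (metis per)
  qed
  have rng: "range torus_map = torus_map ` B"
  proof -
    have "torus_map x \<in> torus_map ` B" for x :: "real^'n"
    proof -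
      obtain y where "y \<in> ucube" "torus_map y = torus_map x" using torus_map_reduce by blast
      then show ?thesis using ucube_subset_cbox unfolding B_def by (intro image_eqI[of _ _ y]) auto
    qed
    then show ?thesis by auto
  qed
  have cB: "compact B" by (simp add: B_def compact_cbox)
  have comp: "compact (range (torus_map :: real^'n \<Rightarrow> complex^'n))"
    unfolding rng by (intro compact_continuous_image continuous_torus_map cB)
  have "closed (Q -` C \<inter> range torus_map)" if "closed C" for C
  proof -
    have "Q -` C \<inter> range torus_map = torus_map ` (B \<inter> q -` C)"
      unfolding rng by (auto simp: Q)
    moreover have "closed (q -` C)" by (rule continuous_closed_vimage[OF that]) (use cont continuous_on_eq_continuous_at in blast)
    then have "compact (B \<inter> q -` C)" by (intro compact_Int_closed cB)
    then have "compact (torus_map ` (B \<inter> q -` C))"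
      by (intro compact_continuous_image continuous_torus_map)
    ultimately show ?thesis by (simp add: compact_imp_closed)
  qed
  then have "continuous_on (range torus_map) Q"
    by (subst continuous_on_closed_vimage) (auto simp: compact_imp_closed[OF comp])
  then show ?thesis using that Q comp by blast
qed

text \<open>Real and imaginary parts of the coordinates of \<open>torus_map\<close> are combinations
  of two exponentials, and trigonometric polynomials form an algebra.\<close>

lemma trig_poly_real_polynomial:
  fixes g :: "complex^'n::finite \<Rightarrow> real"
  assumes "real_polynomial_function g"
  shows "trig_poly (\<lambda>x. complex_of_real (g (torus_map x)))"
  using assms
proof induction
  case (linear f)
  interpret f: bounded_linear f by fact
  have z: "z = (\<Sum>i\<in>UNIV. Re (z $ i) *\<^sub>R axis i 1 + Im (z $ i) *\<^sub>R axis i \<i>)" for z :: "complex^'n"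
  proof -
    have "(\<Sum>i\<in>UNIV. Re (z $ i) *\<^sub>R axis i 1 + Im (z $ i) *\<^sub>R axis i \<i>) $ k = z $ k" for k
    proof -
      have "(\<Sum>i\<in>UNIV. Re (z $ i) *\<^sub>R axis i 1 + Im (z $ i) *\<^sub>R axis i \<i>) $ k
          = (\<Sum>i\<in>UNIV. if i = k then z $ k else 0)"
        unfolding sum_component
        by (intro sum.cong refl) (auto simp: axis_def complex_eq_iff)
      then show ?thesis by simp
    qed
    then show ?thesis by (simp add: vec_eq_iff)
  qed
  have f_eq: "f z = (\<Sum>i\<in>UNIV. Re (z $ i) * f (axis i 1) + Im (z $ i) * f (axis i \<i>))" for z
    by (subst z) (simp add: f.sum f.add f.scaleR)
  have e: "cis (2 * pi * (lattice_vec (axis i k) \<bullet> x)) = cis (2 * pi * (of_int k * x $ i))" for x :: "real^'n" and i k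
  proof -
    have "lattice_vec (axis i k) = axis i (of_int k)" by (auto simp: vec_eq_iff axis_def)
    then show ?thesis by (simp add: inner_axis')
  qed
  have re: "trig_poly (\<lambda>x::real^'n. complex_of_real (Re (cis (2 * pi * x $ i))))" for i
  proof -
    have "(\<lambda>x::real^'n. complex_of_real (Re (cis (2 * pi * x $ i))))
       = (\<lambda>x. 1/2 * cis (2 * pi * (lattice_vec (axis i 1) \<bullet> x)) + 1/2 * cis (2 * pi * (lattice_vec (axis i (-1)) \<bullet> x)))"
      unfolding e by (auto simp: fun_eq_iff complex_eq_iff)
    then show ?thesis by (simp only:) (intro trig_poly.intros)
  qed
  have im: "trig_poly (\<lambda>x::real^'n. complex_of_real (Im (cis (2 * pi * x $ i))))" for i
  proof -
    have "(\<lambda>x::real^'n. complex_of_real (Im (cis (2 * pi * x $ i))))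
       = (\<lambda>x. (-\<i>/2) * cis (2 * pi * (lattice_vec (axis i 1) \<bullet> x)) + (\<i>/2) * cis (2 * pi * (lattice_vec (axis i (-1)) \<bullet> x)))"
      unfolding e by (auto simp: fun_eq_iff complex_eq_iff)
    then show ?thesis by (simp only:) (intro trig_poly.intros)
  qed
  have "trig_poly (\<lambda>x. \<Sum>i\<in>UNIV. complex_of_real (Re (cis (2 * pi * x $ i))) * complex_of_real (f (axis i 1))
      + complex_of_real (Im (cis (2 * pi * x $ i))) * complex_of_real (f (axis i \<i>)))"
    by (intro trig_poly_sum trig_poly.add trig_poly_mult re im trig_poly_const)
  then show ?case by (subst f_eq) (simp del: cis.sel)
next
  case (const c)
  show ?case by (rule trig_poly_const)
next
  case (add f g)
  then show ?case by (simp add: trig_poly.add)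
next
  case (mult f g)
  then show ?case by (simp add: trig_poly_mult)
qed

lemma continuous_trig_poly: "trig_poly f \<Longrightarrow> continuous_on S f"
  by (induction rule: trig_poly.induct) (intro continuous_intros; simp)+

lemma integrable_ucube:
  fixes f :: "real^'n::finite \<Rightarrow> 'b::euclidean_space"
  assumes "continuous_on UNIV f"
  shows "integrable lborel (\<lambda>x. indicator ucube x *\<^sub>R f x)"
proof -
  have "integrable lborel (\<lambda>x. indicator (cbox 0 (vec_lambda (\<lambda>i. 1 :: real) :: real^'n)) x *\<^sub>R f x)"
    by (rule borel_integrable_compact[OF compact_cbox continuous_on_subset[OF assms subset_UNIV]])
  then have "integrable lborel (\<lambda>x. indicator ucube x *\<^sub>R (indicator (cbox 0 (vec_lambda (\<lambda>i. 1 :: real) :: real^'n)) x *\<^sub>R f x))"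
    by (rule integrable_mult_indicator[rotated]) simp
  moreover have "(\<lambda>x. indicator ucube x *\<^sub>R (indicator (cbox 0 (vec_lambda (\<lambda>i. 1 :: real) :: real^'n)) x *\<^sub>R f x))
      = (\<lambda>x. indicator ucube x *\<^sub>R f x)"
    using ucube_subset_cbox by (auto simp: indicator_def fun_eq_iff)
  ultimately show ?thesis by (simp only:)
qed

text \<open>The half-open cube and the closed box differ by a part of the boundary, which is
  negligible; on the closed box the vanishing theorem for continuous non-negative integrands
  applies.\<close>

lemma ucube_integral_eq_0_imp:
  fixes f :: "real^'n::finite \<Rightarrow> real"
  assumes cont: "continuous_on UNIV f" and nn: "\<And>x. 0 \<le> f x"
    and 0: "(LINT x|lborel. indicator ucube x * f x) = 0" and x: "x \<in> ucube"
  shows "f x = 0"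
proof -
  let ?b = "vec_lambda (\<lambda>i. 1 :: real) :: real^'n"
  have "((\<lambda>x. indicator ucube x * f x) has_integral 0) UNIV"
    using has_integral_integral_lborel[OF integrable_ucube[OF cont]] 0 by simp
  moreover have "(\<lambda>x. indicator ucube x * f x) = (\<lambda>x. if x \<in> ucube then f x else 0)"
    by (auto simp: fun_eq_iff)
  ultimately have "(f has_integral 0) ucube"
    by (simp add: has_integral_restrict_UNIV)
  moreover have "negligible {x \<in> ucube - cbox 0 ?b. f x \<noteq> 0}"
    using ucube_subset_cbox by (auto intro: negligible_subset[OF negligible_empty])
  moreover have "negligible {x \<in> cbox 0 ?b - ucube. f x \<noteq> 0}"
    by (rule negligible_subset[OF negligible_frontier_interval[of 0 ?b]])
      (auto simp: ucube_def mem_box_cart less_imp_le)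
  ultimately have "(f has_integral 0) (cbox 0 ?b)"
    using has_integral_spike_set_eq[of ucube "cbox 0 ?b" f 0] by blast
  then show ?thesis
    using x ucube_subset_cbox
    by (intro has_integral_0_cbox_imp_0[OF continuous_on_subset[OF cont subset_UNIV] nn])
      (auto simp: interval_ne_empty_cart)
qed

lemma integral_ucube_const:
  fixes c :: "'b::euclidean_space"
  shows "(LINT x|lborel. indicator ucube (x::real^'n::finite) *\<^sub>R c) = c"
proof -
  have "integrable lborel (\<lambda>x. indicator ucube (x::real^'n) *\<^sub>R (1::real))"
    by (intro integrable_ucube continuous_intros)
  then have "(LINT x|lborel. indicator ucube (x::real^'n) *\<^sub>R c) = (LINT x|lborel. indicator ucube (x::real^'n)) *\<^sub>R c"
    by (intro Bochner_Integration.integral_scaleR_left) simp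
  then show ?thesis by (simp only: lmeasure_ucube scaleR_one)
qed

text \<open>The integral factorises over the coordinates, and a coordinate with non-zero frequency
  contributes a full number of periods.\<close>

lemma integral_ucube_cis:
  fixes m :: "int^'n::finite"
  assumes "m \<noteq> 0"
  shows "(LINT x|lborel. indicator ucube x *\<^sub>R cis (2 * pi * (lattice_vec m \<bullet> x))) = 0"
proof -
  define g where "g = (\<lambda>(i::'n) t. indicator {0..<1::real} t *\<^sub>R cis (2 * pi * of_int (m $ i) * t))"
  have Icc: "integrable lborel (\<lambda>t. indicator {0..1::real} t *\<^sub>R cis (w * t))" for w
    by (intro borel_integrable_compact continuous_intros) auto
  have gi: "integrable lborel (g i)" for i
  proof -
    have "integrable lborel (\<lambda>t. indicator {0..<1::real} t *\<^sub>R (indicator {0..1::real} t *\<^sub>R cis (2 * pi * of_int (m $ i) * t)))"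
      by (rule integrable_mult_indicator[OF _ Icc]) simp
    moreover have "(\<lambda>t. indicator {0..<1::real} t *\<^sub>R (indicator {0..1::real} t *\<^sub>R cis (2 * pi * of_int (m $ i) * t))) = g i"
      by (auto simp: g_def fun_eq_iff indicator_def)
    ultimately show ?thesis by (simp only:)
  qed
  have eq: "indicator ucube x *\<^sub>R cis (2 * pi * (lattice_vec m \<bullet> x)) = (\<Prod>i\<in>UNIV. g i (x $ i))" for x :: "real^'n"
  proof (cases "x \<in> ucube")
    case True
    then show ?thesis
      by (auto simp: g_def ucube_def prod_cis inner_vec_def sum_distrib_left mult.assoc)
  next
    case False
    then obtain i where "\<not> (0 \<le> x $ i \<and> x $ i < 1)" by (auto simp: ucube_def)
    then have "g i (x $ i) = 0" by (auto simp: g_def)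
    then have "(\<Prod>i\<in>UNIV. g i (x $ i)) = 0" by (intro prod_zero) auto
    with False show ?thesis by simp
  qed
  obtain i where i: "m $ i \<noteq> 0" using assms by (auto simp: vec_eq_iff)
  define w where "w = 2 * pi * of_int (m $ i)"
  have w: "w \<noteq> 0" using i by (simp add: w_def)
  have "(LINT t|lborel. g i t) = (LINT t|lborel. indicator {0..1::real} t *\<^sub>R cis (w * t))"
  proof (rule integral_cong_AE)
    show "g i \<in> borel_measurable lborel" using gi by (rule borel_measurable_integrable)
    show "(\<lambda>t. indicator {0..1::real} t *\<^sub>R cis (w * t)) \<in> borel_measurable lborel"
      using Icc by (rule borel_measurable_integrable)
    show "AE t in lborel. g i t = indicator {0..1::real} t *\<^sub>R cis (w * t)"
      using AE_lborel_singleton[of "1::real"]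
      by eventually_elim (auto simp: g_def w_def indicator_def)
  qed
  also have "\<dots> = cis (w * 1) / (\<i> * complex_of_real w) - cis (w * 0) / (\<i> * complex_of_real w)"
  proof (rule integral_FTC_Icc)
    fix t :: real
    have "((\<lambda>z. exp (\<i> * complex_of_real w * z) / (\<i> * complex_of_real w)) has_field_derivative exp (\<i> * complex_of_real w * complex_of_real t)) (at (complex_of_real t))"
      using w by (auto intro!: derivative_eq_intros)
    from has_vector_derivative_real_field[OF this]
    show "((\<lambda>t. cis (w * t) / (\<i> * complex_of_real w)) has_vector_derivative cis (w * t)) (at t within {0..1})"
      by (simp add: cis_conv_exp mult.assoc)
  qed (auto intro!: continuous_intros)
  also have "cis (w * 1) = 1"
    by (simp add: w_def)
  finally have "(LINT t|lborel. g i t) = 0" by simp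
  then have "(\<Prod>i\<in>UNIV. (LINT t|lborel. g i t)) = 0" by (intro prod_zero) auto
  then show ?thesis unfolding eq by (simp add: integral_prod_coords[OF gi])
qed

lemma trig_poly_orthogonal:
  fixes q :: "real^'n::finite \<Rightarrow> complex"
  assumes "trig_poly f" and cont: "continuous_on UNIV q"
    and 0: "\<And>m. (LINT x|lborel. indicator ucube x *\<^sub>R (q x * cis (2 * pi * (lattice_vec m \<bullet> x)))) = 0"
  shows "(LINT x|lborel. indicator ucube x *\<^sub>R (q x * f x)) = 0"
  using assms(1)
proof induction
  case (base c m)
  have "(LINT x|lborel. indicator ucube x *\<^sub>R (q x * (c * cis (2 * pi * (lattice_vec m \<bullet> x)))))
     = (LINT x|lborel. c * (indicator ucube x *\<^sub>R (q x * cis (2 * pi * (lattice_vec m \<bullet> x)))))"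
    by (intro Bochner_Integration.integral_cong refl) simp
  then show ?case by (simp only: integral_mult_right_zero 0 mult_zero_right)
next
  case (add f g)
  have i: "integrable lborel (\<lambda>x. indicator ucube x *\<^sub>R (q x * h x))" if "trig_poly h" for h
    using continuous_trig_poly[OF that] by (intro integrable_ucube continuous_intros cont)
  have "(LINT x|lborel. indicator ucube x *\<^sub>R (q x * (f x + g x)))
     = (LINT x|lborel. indicator ucube x *\<^sub>R (q x * f x) + indicator ucube x *\<^sub>R (q x * g x))"
    by (simp add: distrib_left scaleR_add_right)
  also have "\<dots> = 0"
    using add i by (subst Bochner_Integration.integral_add) auto
  finally show ?case .
qed

text \<open>If a trigonometric polynomial f is within e of the conjugate of q, orthogonality
  replaces the integral of |q|^2 by that of q (cnj q - f), which is at most e times the integral of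
  |q|. Letting e tend to 0 gives q = 0.\<close>

lemma periodic_eq_0:
  fixes q :: "real^'n::finite \<Rightarrow> complex"
  assumes cont: "continuous_on UNIV q" and per: "\<And>x n. q (x + lattice_vec n) = q x"
    and 0: "\<And>m. (LINT x|lborel. indicator ucube x *\<^sub>R (q x * cis (2 * pi * (lattice_vec m \<bullet> x)))) = 0"
  shows "q x = 0"
proof -
  obtain Q where Q: "continuous_on (range torus_map) Q" "\<And>x. Q (torus_map x) = q x"
    and comp: "compact (range (torus_map :: real^'n \<Rightarrow> complex^'n))"
    by (rule torus_descent[OF cont per]) blast
  have contn: "continuous_on UNIV (\<lambda>x. norm (q x))" "continuous_on UNIV (\<lambda>x. (norm (q x))\<^sup>2)"
    by (intro continuous_intros cont)+
  define S where "S = (LINT x|lborel. indicator ucube x *\<^sub>R norm (q x))"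
  define I where "I = (LINT x|lborel. indicator ucube x *\<^sub>R (norm (q x))\<^sup>2)"
  have I0: "0 \<le> I" unfolding I_def by (intro integral_nonneg_AE) auto
  have S0: "0 \<le> S" unfolding S_def by (intro integral_nonneg_AE) auto
  have "I \<le> e * S" if "e > 0" for e
  proof -
    \<comment> \<open>Stone-Weierstrass is applied to the conjugate of the descended function, over
      the real algebra of polynomial functions.\<close>
    obtain g where g: "polynomial_function g" "\<And>z. z \<in> range torus_map \<Longrightarrow> norm (cnj (Q z) - g z) < e"
      using Stone_Weierstrass_polynomial_function[OF comp continuous_on_cnj[OF Q(1)] \<open>e > 0\<close>] by blast
    define f where "f = (\<lambda>x. g (torus_map x))"
    have "real_polynomial_function (Re \<circ> g)" "real_polynomial_function (Im \<circ> g)"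
      using g(1) by (auto simp: polynomial_function_def bounded_linear_Re bounded_linear_Im)
    from trig_poly.add[OF trig_poly_real_polynomial[OF this(1)]
        trig_poly_cmult[OF trig_poly_real_polynomial[OF this(2)], of \<i>]]
    have tp: "trig_poly f" by (simp add: f_def complex_eq[symmetric])
    have fe: "norm (cnj (q x) - f x) \<le> e" for x
      using g(2)[of "torus_map x"] by (simp add: Q(2) f_def less_imp_le)
    have i1: "integrable lborel (\<lambda>x. indicator ucube x *\<^sub>R (q x * cnj (q x)))"
      by (intro integrable_ucube continuous_intros cont)
    have i2: "integrable lborel (\<lambda>x. indicator ucube x *\<^sub>R (q x * f x))"
      using continuous_trig_poly[OF tp] by (intro integrable_ucube continuous_intros cont)
    have "complex_of_real I = (LINT x|lborel. indicator ucube x *\<^sub>R (q x * cnj (q x)))"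
      unfolding I_def by (subst integral_complex_of_real[symmetric])
        (intro Bochner_Integration.integral_cong refl, simp add: complex_norm_square[symmetric] scaleR_conv_of_real)
    also have "\<dots> = (LINT x|lborel. indicator ucube x *\<^sub>R (q x * cnj (q x)) - indicator ucube x *\<^sub>R (q x * f x))"
      using i1 i2 trig_poly_orthogonal[OF tp cont 0] by simp
    finally have "I = norm (LINT x|lborel. indicator ucube x *\<^sub>R (q x * cnj (q x)) - indicator ucube x *\<^sub>R (q x * f x))"
      using I0 by (metis abs_of_nonneg norm_of_real)
    also have "\<dots> \<le> (LINT x|lborel. e * (indicator ucube x *\<^sub>R norm (q x)))"
    proof (rule order_trans[OF Bochner_Integration.integral_norm_bound], rule Bochner_Integration.integral_mono)
      show "integrable lborel (\<lambda>x. norm (indicator ucube x *\<^sub>R (q x * cnj (q x)) - indicator ucube x *\<^sub>R (q x * f x)))"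
        by (rule integrable_norm[OF Bochner_Integration.integrable_diff[OF i1 i2]])
      show "integrable lborel (\<lambda>x. e * (indicator ucube x *\<^sub>R norm (q x)))"
        by (rule integrable_mult_right[OF integrable_ucube[OF contn(1)]])
      show "norm (indicator ucube x *\<^sub>R (q x * cnj (q x)) - indicator ucube x *\<^sub>R (q x * f x))
          \<le> e * (indicator ucube x *\<^sub>R norm (q x))" for x
      proof -
        have "norm (q x * cnj (q x) - q x * f x) = norm (q x) * norm (cnj (q x) - f x)"
          by (simp only: norm_mult[symmetric] right_diff_distrib)
        also have "\<dots> \<le> norm (q x) * e" by (rule mult_left_mono[OF fe]) simp
        finally show ?thesis by (cases "x \<in> ucube") (simp_all add: mult.commute)
      qed
    qed
    also have "\<dots> = e * S" unfolding S_def by (rule integral_mult_right_zero)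
    finally show ?thesis .
  qed
  then have "I \<le> 0"
  proof -
    have "((\<lambda>e. e * S) \<longlongrightarrow> 0 * S) (at_right 0)" by (intro tendsto_intros)
    then show ?thesis
      using \<open>\<And>e. e > 0 \<Longrightarrow> I \<le> e * S\<close>
      by (intro tendsto_lowerbound[of "\<lambda>e. e * S" _ "at_right 0"]) (auto simp: eventually_at_right_less eventually_at_filter)
  qed
  with I0 have "I = 0" by simp
  \<comment> \<open>Vanishing has been obtained on the unit cube only; a general point is moved
    there by periodicity.\<close>
  obtain y where y: "y \<in> ucube" "torus_map y = torus_map x" using torus_map_reduce by blast
  have "(norm (q y))\<^sup>2 = 0"
    by (rule ucube_integral_eq_0_imp[OF contn(2) _ _ y(1)]) (use \<open>I = 0\<close> in \<open>auto simp: I_def\<close>)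
  moreover have "q x = q y" using Q(2) y(2) by metis
  ultimately show ?thesis by simp
qed

text \<open>The periodisation has the transform of f at the lattice frequencies as Fourier
  coefficients. All but the zeroth vanish by assumption, so the periodisation is the constant given
  by the integral. No dual series has to be summed.\<close>

theorem poisson_unit:
  fixes f :: "real^'n::finite \<Rightarrow> complex"
  assumes cont: "continuous_on UNIV f" and bound: "\<And>x. norm (f x) \<le> B * wt x"
    and 0: "\<And>m. m \<noteq> 0 \<Longrightarrow> (LINT x|lborel. f x * cis (2 * pi * (lattice_vec m \<bullet> x))) = 0"
  shows "integrable Zn (\<lambda>n. f (lattice_vec n))" "(LINT n|Zn. f (lattice_vec n)) = (LINT x|lborel. f x)"
proof -
  have [measurable]: "f \<in> borel_measurable borel" by (rule borel_measurable_continuous_onI[OF cont])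
  have fi: "integrable lborel f" by (rule integrable_le_wt(1)[OF _ bound]) simp
  have B0: "0 \<le> B"
    using order_trans[OF norm_ge_zero bound[of 0]] wt_pos[of "0::real^'n"] by (simp add: zero_le_mult_iff)
  \<comment> \<open>One majorant for all points within a unit cube around x; it dominates the
    lattice sums in the continuity proof.\<close>
  have b1: "norm (f (x + y + lattice_vec n)) \<le> B * 3 ^ CARD('n) * wt (x + lattice_vec n)"
    if "\<And>i. \<bar>y $ i\<bar> \<le> 1" for x y n
  proof -
    have "wt (x + y + lattice_vec n) \<le> 3 ^ CARD('n) * wt (x + y + lattice_vec n + - y)"
      using that by (intro wt_shift_le) simp
    also have "x + y + lattice_vec n + - y = x + lattice_vec n" by simp
    finally have "B * wt (x + y + lattice_vec n) \<le> B * (3 ^ CARD('n) * wt (x + lattice_vec n))"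
      using B0 by (rule mult_left_mono)
    with bound[of "x + y + lattice_vec n"] show ?thesis by (simp add: mult.assoc)
  qed
  have iw0: "integrable Zn (\<lambda>n. wt (y + lattice_vec n))" if "y \<in> ucube" for y :: "real^'n"
  proof (rule Bochner_Integration.integrable_bound)
    show "integrable Zn (\<lambda>n. 3 ^ CARD('n) * wt (lattice_vec n :: real^'n))"
      by (intro integrable_mult_right integrable_wt_lattice)
    have "\<bar>(- y) $ i\<bar> \<le> 1" for i using that by (auto simp: ucube_def abs_le_iff less_imp_le intro: order_trans[of _ 0])
    from wt_shift_le[OF this, of "y + lattice_vec n" for n]
    show "AE n in Zn. norm (wt (y + lattice_vec n)) \<le> norm (3 ^ CARD('n) * wt (lattice_vec n :: real^'n))"
      by (auto simp: abs_of_pos[OF wt_pos] abs_mult)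
  qed simp
  \<comment> \<open>Subtracting the vector of floors reduces to the unit cube; the shift of the
    summation index is absorbed by a bijection.\<close>
  have iw: "integrable Zn (\<lambda>n. wt (x + lattice_vec n))" for x :: "real^'n"
  proof -
    define k where "k = vec_lambda (\<lambda>i. \<lfloor>x $ i\<rfloor>)"
    have "x - lattice_vec k \<in> ucube" by (simp add: ucube_shift_iff k_def)
    from iw0[OF this] have "integrable Zn (\<lambda>n. wt (x - lattice_vec k + lattice_vec n))" .
    moreover have "bij_betw (\<lambda>n. n + k) UNIV (UNIV :: (int^'n) set)"
      by (rule bij_betwI[of _ _ _ "\<lambda>n. n - k"]) auto
    ultimately have "integrable Zn (\<lambda>n. wt (x - lattice_vec k + lattice_vec (n + k)))"
      using integrable_bij_count_space[of "\<lambda>n. n + k" UNIV UNIV "\<lambda>n. wt (x - lattice_vec k + lattice_vec n)"] by simp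
    then show ?thesis by (simp add: lattice_vec_add algebra_simps)
  qed
  have ip: "integrable Zn (\<lambda>n. f (x + lattice_vec n))" for x
    by (rule Bochner_Integration.integrable_bound[OF integrable_mult_right[OF iw, of "B * 3 ^ CARD('n)" x]])
      (use b1[of 0 x] B0 in \<open>auto simp: abs_of_pos[OF wt_pos] abs_mult\<close>)
  define p where "p = (\<lambda>x. LINT n|Zn. f (x + lattice_vec n))"
  have pcont: "continuous_on UNIV p"
  proof (rule continuous_at_imp_continuous_on, rule ballI)
    fix x :: "real^'n"
    show "isCont p x"
      unfolding continuous_at_sequentially o_def
    proof (intro allI impI)
      fix X assume X: "X \<longlonglongrightarrow> x"
      then have "eventually (\<lambda>k. dist (X k) x < 1) sequentially" by (rule tendstoD) simp
      then obtain N where N: "\<And>k. k \<ge> N \<Longrightarrow> dist (X k) x < 1" by (auto simp: eventually_sequentially)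
      have "(\<lambda>k. p (X (k + N))) \<longlonglongrightarrow> p x"
        unfolding p_def
      proof (rule integral_dominated_convergence[where w = "\<lambda>n. B * 3 ^ CARD('n) * wt (x + lattice_vec n)"])
        show "integrable Zn (\<lambda>n. B * 3 ^ CARD('n) * wt (x + lattice_vec n))"
          by (intro integrable_mult_right iw)
        show "AE n in Zn. (\<lambda>k. f (X (k + N) + lattice_vec n)) \<longlonglongrightarrow> f (x + lattice_vec n)"
          by (intro AE_I2 continuous_on_tendsto_compose[OF cont] tendsto_add tendsto_const LIMSEQ_ignore_initial_segment X) auto
        show "AE n in Zn. norm (f (X (k + N) + lattice_vec n)) \<le> B * 3 ^ CARD('n) * wt (x + lattice_vec n)" for k
        proof (rule AE_I2)
          fix n
          have "\<bar>(X (k + N) - x) $ i\<bar> \<le> 1" for i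
            using component_le_norm_cart[of "X (k + N) - x" i] N[of "k + N"] by (simp add: dist_norm)
          from b1[OF this, of x n] show "norm (f (X (k + N) + lattice_vec n)) \<le> B * 3 ^ CARD('n) * wt (x + lattice_vec n)"
            by simp
        qed
      qed simp_all
      then show "(\<lambda>k. p (X k)) \<longlonglongrightarrow> p x" by (rule LIMSEQ_offset)
    qed
  qed
  have pper: "p (x + lattice_vec k) = p x" for x k
  proof -
    have "bij_betw (\<lambda>n. n + k) UNIV (UNIV :: (int^'n) set)"
      by (rule bij_betwI[of _ _ _ "\<lambda>n. n - k"]) auto
    then have "p x = (LINT n|Zn. f (x + lattice_vec (n + k)))"
      unfolding p_def using integral_bij_count_space[of "\<lambda>n. n + k" UNIV UNIV "\<lambda>n. f (x + lattice_vec n)"] by simp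
    then show ?thesis by (simp add: p_def lattice_vec_add add_ac)
  qed
  \<comment> \<open>Unfolding: the exponential has period 1 in every coordinate, so it can be taken
    inside the lattice sum.\<close>
  have coef: "(LINT x|lborel. indicator ucube x *\<^sub>R (p x * cis (2 * pi * (lattice_vec m \<bullet> x))))
     = (LINT x|lborel. f x * cis (2 * pi * (lattice_vec m \<bullet> x)))" for m
  proof -
    define h where "h = (\<lambda>x. f x * cis (2 * pi * (lattice_vec m \<bullet> x)))"
    have hi: "integrable lborel h" unfolding h_def by (rule integrable_mult_cis[OF fi]) simp
    have per: "cis (2 * pi * (lattice_vec m \<bullet> (x + lattice_vec n))) = cis (2 * pi * (lattice_vec m \<bullet> x))" for x :: "real^'n" and n
    proof -
      have "lattice_vec m \<bullet> (lattice_vec n :: real^'n) = of_int (\<Sum>i\<in>UNIV. m $ i * n $ i)"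
        by (simp add: inner_vec_def)
      then obtain j :: int where "lattice_vec m \<bullet> (lattice_vec n :: real^'n) = of_int j" by blast
      then show ?thesis
        by (simp add: inner_add_right distrib_left flip: cis_mult)
    qed
    have "indicator ucube x *\<^sub>R (p x * cis (2 * pi * (lattice_vec m \<bullet> x)))
       = (LINT n|Zn. indicator ucube x *\<^sub>R h (x + lattice_vec n))" for x
      unfolding h_def per p_def by simp
    then have "(LINT x|lborel. indicator ucube x *\<^sub>R (p x * cis (2 * pi * (lattice_vec m \<bullet> x))))
        = (LINT x|lborel. LINT n|Zn. indicator ucube x *\<^sub>R h (x + lattice_vec n))"
      by (simp only:)
    also have "\<dots> = (LINT x|lborel. h x)" by (rule integral_sum_cubes[OF hi])
    finally show ?thesis by (simp add: h_def)
  qed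
  define c where "c = (LINT x|lborel. f x)"
  have "p x - c = 0" for x
  proof (rule periodic_eq_0)
    show "continuous_on UNIV (\<lambda>x. p x - c)" by (intro continuous_intros pcont)
    show "p (x + lattice_vec n) - c = p x - c" for x n by (simp add: pper)
    fix m :: "int^'n"
    let ?e = "\<lambda>x::real^'n. cis (2 * pi * (lattice_vec m \<bullet> x))"
    have ce: "continuous_on UNIV ?e" by (intro continuous_intros)
    have "(LINT x|lborel. indicator ucube x *\<^sub>R ((p x - c) * ?e x))
       = (LINT x|lborel. indicator ucube x *\<^sub>R (p x * ?e x)) - (LINT x|lborel. indicator ucube x *\<^sub>R (c * ?e x))"
      by (subst Bochner_Integration.integral_diff[symmetric])
        (auto simp: left_diff_distrib scaleR_diff_right intro!: integrable_ucube continuous_intros pcont)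
    also have "(LINT x|lborel. indicator ucube x *\<^sub>R (p x * ?e x)) = (LINT x|lborel. indicator ucube x *\<^sub>R (c * ?e x))"
    proof (cases "m = 0")
      case True
      then show ?thesis using coef[of 0] integral_ucube_const[of c, where 'n = 'n] by (simp add: c_def)
    next
      case False
      have "(LINT x|lborel. indicator ucube x *\<^sub>R ?e x) = 0"
        by (rule integral_ucube_cis[OF False])
      moreover have "(LINT x|lborel. indicator ucube x *\<^sub>R (c * ?e x)) = c * (LINT x|lborel. indicator ucube x *\<^sub>R ?e x)"
        by (subst integral_mult_right_zero[symmetric]) (intro Bochner_Integration.integral_cong refl, simp)
      ultimately show ?thesis using coef[of m] 0[OF False] by simp
    qed
    finally show "(LINT x|lborel. indicator ucube x *\<^sub>R ((p x - c) * ?e x)) = 0" by simp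
  qed
  then have "p 0 = c" by simp
  then show "integrable Zn (\<lambda>n. f (lattice_vec n))" "(LINT n|Zn. f (lattice_vec n)) = (LINT x|lborel. f x)"
    using ip[of 0] by (simp_all add: p_def c_def)
qed

section \<open>Poisson summation on rectangular lattices\<close>

lemma diag_norm_le:
  fixes t :: "real^'n::finite"
  assumes c: "\<And>i. c i \<noteq> 0"
  obtains D where "1 \<le> D" "\<And>x. 1 + norm x \<le> D * (1 + norm (t + vec_lambda (\<lambda>i. c i * x $ i)))"
proof -
  define K where "K = (\<Sum>i\<in>UNIV. 1 / \<bar>c i\<bar>)"
  have K0: "0 \<le> K" unfolding K_def by (intro sum_nonneg) auto
  define D where "D = 1 + K + K * norm t"
  let ?T = "\<lambda>x. t + vec_lambda (\<lambda>i. c i * x $ i)"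
  have D: "1 + norm x \<le> D * (1 + norm (?T x))" for x
  proof -
    let ?y = "vec_lambda (\<lambda>i. c i * x $ i) :: real^'n"
    have "\<bar>x $ i\<bar> \<le> norm ?y * (1 / \<bar>c i\<bar>)" for i
      using component_le_norm_cart[of ?y i] c[of i] by (simp add: abs_mult pos_le_divide_eq mult.commute)
    then have "(\<Sum>i\<in>UNIV. \<bar>x $ i\<bar>) \<le> (\<Sum>i\<in>UNIV. norm ?y * (1 / \<bar>c i\<bar>))" by (intro sum_mono) auto
    with norm_le_l1_cart[of x] have "norm x \<le> norm ?y * K" by (simp add: K_def sum_distrib_left)
    also have "norm ?y \<le> norm (?T x) + norm t" using norm_triangle_ineq4[of "?T x" t] by simp
    finally have "norm x \<le> (norm (?T x) + norm t) * K" using K0 by (simp add: mult_right_mono)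
    then have "norm x \<le> K * norm (?T x) + K * norm t" by (simp add: algebra_simps)
    moreover have "0 \<le> K * (norm t * norm (?T x))" "0 \<le> norm (?T x)" using K0 by auto
    moreover have "D * (1 + norm (?T x)) = 1 + K + K * norm t + norm (?T x) + K * norm (?T x) + K * (norm t * norm (?T x))"
      by (simp add: D_def algebra_simps)
    ultimately show ?thesis using K0 by argo
  qed
  then show ?thesis using that[of D] K0 by (simp add: D_def)
qed

text \<open>A diagonal affine change of variables distorts 1 + norm x by at most a constant factor,
  so decay against \<open>wt\<close> survives.\<close>

lemma diag_decay:
  fixes f :: "real^'n::finite \<Rightarrow> 'b::real_normed_vector"
  assumes c: "\<And>i. c i \<noteq> 0" and f: "\<And>x. (1 + norm x) ^ (2 * CARD('n)) * norm (f x) \<le> S"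
  obtains B where "\<And>x. norm (f (t + vec_lambda (\<lambda>i. c i * x $ i))) \<le> B * wt x"
proof -
  let ?T = "\<lambda>x. t + vec_lambda (\<lambda>i. c i * x $ i)"
  obtain D where D1: "1 \<le> D" and D: "\<And>x. 1 + norm x \<le> D * (1 + norm (?T x))"
    by (rule diag_norm_le[of c t, OF c]) blast
  have "norm (f (?T x)) \<le> (D ^ (2 * CARD('n)) * S) * wt x" for x
  proof (rule decay_le_wt)
    have "(1 + norm x) ^ (2 * CARD('n)) \<le> D ^ (2 * CARD('n)) * (1 + norm (?T x)) ^ (2 * CARD('n))"
      unfolding power_mult_distrib[symmetric] by (rule power_mono[OF D]) simp
    then have "(1 + norm x) ^ (2 * CARD('n)) * norm (f (?T x))
        \<le> D ^ (2 * CARD('n)) * (1 + norm (?T x)) ^ (2 * CARD('n)) * norm (f (?T x))"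
      by (rule mult_right_mono) simp
    also have "\<dots> \<le> D ^ (2 * CARD('n)) * S"
      unfolding mult.assoc using D1 by (intro mult_left_mono f) auto
    finally show "(1 + norm x) ^ (2 * CARD('n)) * norm (f (?T x)) \<le> D ^ (2 * CARD('n)) * S" .
  qed simp
  then show ?thesis using that by blast
qed

lemma schwartz_diag_bound:
  fixes f :: "real^'n::finite \<Rightarrow> complex"
  assumes f: "f \<in> schwartz" and c: "\<And>i. c i \<noteq> 0"
  obtains B where "\<And>x. norm (f (t + vec_lambda (\<lambda>i. c i * x $ i))) \<le> B * wt x"
  by (rule diag_decay[of c f _ t, OF c norm_le_snorm[OF f]]) blast

lemma integrable_lattice:
  fixes f :: "real^'n::finite \<Rightarrow> 'b::{banach,second_countable_topology}"
  assumes "\<And>i. c i \<noteq> 0" "\<And>x. (1 + norm x) ^ (2 * CARD('n)) * norm (f x) \<le> S"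
  shows "integrable Zn (\<lambda>n. f (t + vec_lambda (\<lambda>i. c i * of_int (n $ i))))"
proof -
  obtain B where B: "\<And>x. norm (f (t + vec_lambda (\<lambda>i. c i * x $ i))) \<le> B * wt x"
    by (rule diag_decay[of c f S t, OF assms]) blast
  show ?thesis
  proof (rule Bochner_Integration.integrable_bound[OF integrable_mult_right[OF integrable_wt_lattice, of B]])
    show "AE n in Zn. norm (f (t + vec_lambda (\<lambda>i. c i * of_int (n $ i)))) \<le> norm (B * wt (lattice_vec n :: real^'n))"
      using B[of "lattice_vec _"] order_trans[OF _ abs_ge_self] by (intro AE_I2) fastforce
  qed simp
qed

lemma integrable_schwartz_lattice:
  fixes f :: "real^'n::finite \<Rightarrow> complex"
  assumes "f \<in> schwartz" "\<And>i. c i \<noteq> 0"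
  shows "integrable Zn (\<lambda>n. f (t + vec_lambda (\<lambda>i. c i * of_int (n $ i))))"
  by (rule integrable_lattice[OF assms(2) norm_le_snorm[OF assms(1)]])

text \<open>A shift t of the lattice multiplies the coefficients by phases only, so the vanishing
  condition does not mention it.\<close>

theorem poisson_diag:
  fixes f :: "real^'n::finite \<Rightarrow> complex"
  assumes f: "f \<in> schwartz" and c: "\<And>i. c i \<noteq> 0"
    and 0: "\<And>m. m \<noteq> 0 \<Longrightarrow> (LINT x|lborel. f x * cis (2 * pi * (lattice_vec m \<bullet> vec_lambda (\<lambda>i. x $ i / c i)))) = 0"
  shows "(LINT n|Zn. f (t + vec_lambda (\<lambda>i. c i * of_int (n $ i)))) = (LINT x|lborel. f x) /\<^sub>R (\<Prod>i\<in>UNIV. \<bar>c i\<bar>)"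
proof -
  let ?T = "\<lambda>x. t + vec_lambda (\<lambda>i. c i * x $ i)"
  obtain B where B: "\<And>x. norm (f (?T x)) \<le> B * wt x"
    by (rule schwartz_diag_bound[of f c t, OF f c]) blast
  have fm: "f \<in> borel_measurable borel" by (rule schwartz_borel[OF f])
  have "(LINT n|Zn. f (?T (lattice_vec n))) = (LINT x|lborel. f (?T x))"
  proof (rule poisson_unit(2)[OF _ B])
    show "continuous_on UNIV (\<lambda>x. f (?T x))"
      by (intro continuous_on_compose2[OF smooth_continuous0[OF schwartz_smooth[OF f], of UNIV]] continuous_intros) auto
    fix m :: "int^'n" assume m: "m \<noteq> 0"
    \<comment> \<open>The phase produced by the shift t.\<close>
    define u where "u = 2 * pi * (lattice_vec m \<bullet> vec_lambda (\<lambda>i. t $ i / c i))"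
    let ?g = "\<lambda>y. f y * cis (2 * pi * (lattice_vec m \<bullet> vec_lambda (\<lambda>i. y $ i / c i)))"
    have "vec_lambda (\<lambda>i. ?T x $ i / c i) = vec_lambda (\<lambda>i. t $ i / c i) + x" for x
      using c by (simp add: vec_eq_iff add_divide_distrib)
    then have *: "f (?T x) * cis (2 * pi * (lattice_vec m \<bullet> x)) = cis (- u) * ?g (?T x)" for x
      by (simp add: u_def inner_add_right distrib_left cis_mult)
    have "(LINT x|lborel. f (?T x) * cis (2 * pi * (lattice_vec m \<bullet> x))) = cis (- u) * (LINT x|lborel. ?g (?T x))"
      unfolding * by (rule integral_mult_right_zero)
    also have "(LINT x|lborel. ?g (?T x)) = 0"
    proof (subst integral_diag[OF _ c])
      have "continuous_on UNIV (\<lambda>y::real^'n. 2 * pi * (lattice_vec m \<bullet> vec_lambda (\<lambda>i. y $ i / c i)))"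
        using c by (intro continuous_intros) auto
      then have "(\<lambda>y::real^'n. 2 * pi * (lattice_vec m \<bullet> vec_lambda (\<lambda>i. y $ i / c i))) \<in> borel_measurable borel"
        by (rule borel_measurable_continuous_onI)
      then show "?g \<in> borel_measurable borel" using fm by measurable
    qed (simp add: 0[OF m])
    finally show "(LINT x|lborel. f (?T x) * cis (2 * pi * (lattice_vec m \<bullet> x))) = 0" by simp
  qed
  also have "\<dots> = (LINT x|lborel. f x) /\<^sub>R (\<Prod>i\<in>UNIV. \<bar>c i\<bar>)" by (rule integral_diag[OF fm c])
  finally show ?thesis by simp
qed

text \<open>Mean value inequality along the segment. One factor \<open>CARD('n)\<close> bounds the
  derivative by its partials, the other bounds norm v by h, and the power of 3 moves the weight from
  the intermediate point back to y.\<close>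

lemma schwartz_increment:
  fixes f :: "real^'n::finite \<Rightarrow> complex"
  assumes f: "f \<in> schwartz" and v: "\<And>i. \<bar>v $ i\<bar> \<le> h" and h: "h \<le> 1"
  shows "norm (f (y + v) - f y) \<le> (real CARD('n))\<^sup>2 * 3 ^ CARD('n) * snorm (2 * CARD('n) + 1) f * h * wt y"
proof -
  let ?d = "real CARD('n)" and ?S = "snorm (2 * CARD('n) + 1) f"
  have fd: "f differentiable (at x)" for x by (rule smooth_differentiable0[OF schwartz_smooth[OF f]])
  define B where "B = ?d * (?S * (3 ^ CARD('n) * wt y))"
  have S0: "0 \<le> ?S" by (rule snorm_nonneg[OF f])
  have "norm (f (y + v) - f y) \<le> B * norm (y + v - y)"
  proof (rule differentiable_bound[of "closed_segment y (y + v)"])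
    fix z assume "z \<in> closed_segment y (y + v)"
    then obtain \<tau> where \<tau>: "0 \<le> \<tau>" "\<tau> \<le> 1" "z = y + \<tau> *\<^sub>R v"
      by (auto simp: closed_segment_def algebra_simps)
    show "(f has_derivative frechet_derivative f (at z)) (at z within closed_segment y (y + v))"
      by (rule has_derivative_at_withinI[OF has_derivative_partial[OF fd]])
    have "\<bar>(- (\<tau> *\<^sub>R v)) $ i\<bar> \<le> 1" for i
      using mult_mono[of \<tau> 1 "\<bar>v $ i\<bar>" 1] \<tau> v[of i] h by (simp add: abs_mult)
    from wt_shift_le[OF this, of z] \<tau> have wz: "wt z \<le> 3 ^ CARD('n) * wt y" by simp
    have "norm (partial_deriv i f z) \<le> ?S * (3 ^ CARD('n) * wt y)" for i
    proof -
      have "(1 + norm z) ^ (2 * CARD('n)) * norm (partial_deriv i f z)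
          \<le> (1 + norm z) ^ (2 * CARD('n) + 1) * norm (partial_deriv i f z)"
        by (intro mult_right_mono power_increasing) auto
      also have "\<dots> \<le> ?S" using snorm_bound[OF f, of "[i]" "2 * CARD('n) + 1" z] by simp
      finally have "norm (partial_deriv i f z) \<le> ?S * wt z" by (rule decay_le_wt) simp
      also have "\<dots> \<le> ?S * (3 ^ CARD('n) * wt y)" by (rule mult_left_mono[OF wz S0])
      finally show ?thesis .
    qed
    then have "norm (u $ i *\<^sub>R partial_deriv i f z) \<le> norm u * (?S * (3 ^ CARD('n) * wt y))" for u i
      by (auto simp: component_le_norm_cart intro!: mult_mono)
    then have "norm (frechet_derivative f (at z) u) \<le> ?d * (norm u * (?S * (3 ^ CARD('n) * wt y)))" for u
      unfolding frechet_eq_partials[OF fd] by (intro sum_norm_bound[THEN order_trans]) auto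
    then show "onorm (frechet_derivative f (at z)) \<le> B"
      by (intro onorm_le) (simp add: B_def mult_ac)
  qed auto
  also have "\<dots> \<le> B * (?d * h)"
  proof (rule mult_left_mono)
    have "norm v \<le> (\<Sum>i\<in>UNIV. \<bar>v $ i\<bar>)" by (rule norm_le_l1_cart)
    also have "\<dots> \<le> (\<Sum>i\<in>(UNIV::'n set). h)" by (intro sum_mono v)
    finally show "norm (y + v - y) \<le> ?d * h" by simp
    show "0 \<le> B" using S0 wt_pos[of y] by (simp add: B_def)
  qed
  finally show ?thesis by (simp add: B_def power2_eq_square mult_ac)
qed

text \<open>The error on the cell at n is at most h times the integral of \<open>wt\<close> over
  that cell, and these integrals add up. The constant is an explicit seminorm of f, so that the
  error can be followed when f depends on a frequency.\<close>

theorem riemann_sum_error: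
  fixes f :: "real^'n::finite \<Rightarrow> complex"
  assumes f: "f \<in> schwartz" and h: "0 < h" "h \<le> 1"
  shows "norm ((LINT x|lborel. f x) - h ^ CARD('n) *\<^sub>R (LINT n|Zn. f (h *\<^sub>R lattice_vec n)))
    \<le> (real CARD('n))\<^sup>2 * 3 ^ CARD('n) * snorm (2 * CARD('n) + 1) f * wint TYPE('n) * h"
proof -
  let ?d = "CARD('n)"
  define A where "A = (real CARD('n))\<^sup>2 * 3 ^ CARD('n) * snorm (2 * CARD('n) + 1) f"
  have fm [measurable]: "f \<in> borel_measurable borel" by (rule schwartz_borel[OF f])
  have fi: "integrable lborel f" by (rule schwartz_integrable[OF f])
  have wm [measurable]: "(wt :: real^'n \<Rightarrow> real) \<in> borel_measurable borel"
    using borel_measurable_integrable[OF integrable_wt] by simp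
  have sc: "integrable lborel (\<lambda>x. g (h *\<^sub>R x))" "(LINT x|lborel. g (h *\<^sub>R x)) = (LINT x|lborel. g x) /\<^sub>R h ^ ?d"
    if "integrable lborel g" for g :: "real^'n \<Rightarrow> 'c::{banach,second_countable_topology}"
  proof -
    have [measurable]: "g \<in> borel_measurable borel" using borel_measurable_integrable[OF that] by simp
    show "integrable lborel (\<lambda>x. g (h *\<^sub>R x))"
      using integrable_diag[of g "\<lambda>_. h" 0] that h by (simp add: vec_lambda_scale)
    show "(LINT x|lborel. g (h *\<^sub>R x)) = (LINT x|lborel. g x) /\<^sub>R h ^ ?d"
      using integral_scale[of g h 0] h by simp
  qed
  \<comment> \<open>The cell integrals of f and of the weight after rescaling the lattice of step h
    to the integers; each sum equals a whole integral divided by the cell volume.\<close>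
  define I where "I = (\<lambda>n. LINT x|lborel. indicator ucube x *\<^sub>R f (h *\<^sub>R (x + lattice_vec n)))"
  define W where "W = (\<lambda>n. LINT x|lborel. indicator ucube x *\<^sub>R wt (h *\<^sub>R (x + lattice_vec n :: real^'n)))"
  have I: "integrable Zn I" "(LINT n|Zn. I n) = (LINT x|lborel. f x) /\<^sub>R h ^ ?d"
    unfolding I_def using integrable_cubes[OF sc(1)[OF fi]] sum_integral_cubes[OF sc(1)[OF fi]] sc(2)[OF fi] by simp_all
  have W: "integrable Zn W" "(LINT n|Zn. W n) = wint TYPE('n) /\<^sub>R h ^ ?d"
    unfolding W_def wint_def using integrable_cubes[OF sc(1)[OF integrable_wt]] sum_integral_cubes[OF sc(1)[OF integrable_wt]]
      sc(2)[OF integrable_wt] by simp_all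
  have F: "integrable Zn (\<lambda>n. f (h *\<^sub>R lattice_vec n))"
  proof -
    have "vec_lambda (\<lambda>i. h * of_int (n $ i)) = h *\<^sub>R lattice_vec n" for n :: "int^'n" by (simp add: vec_eq_iff)
    then show ?thesis using integrable_schwartz_lattice[OF f, of "\<lambda>_. h" 0] h by simp
  qed
  have D: "norm (I n - f (h *\<^sub>R lattice_vec n)) \<le> A * h * W n" for n
  proof -
    have iI: "integrable lborel (\<lambda>x. indicator ucube x *\<^sub>R f (h *\<^sub>R (x + lattice_vec n)))"
      by (intro integrable_ucube continuous_on_compose2[OF smooth_continuous0[OF schwartz_smooth[OF f], of UNIV]] continuous_intros) auto
    have ic: "integrable lborel (\<lambda>x. indicator ucube (x::real^'n) *\<^sub>R f (h *\<^sub>R lattice_vec n))"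
      by (intro integrable_ucube continuous_intros)
    have wc: "continuous_on UNIV (wt :: real^'n \<Rightarrow> real)"
      unfolding wt_def by (intro continuous_intros) (auto simp: add_nonneg_eq_0_iff)
    have "continuous_on UNIV (\<lambda>x. wt (h *\<^sub>R (x + lattice_vec n :: real^'n)))"
      by (rule continuous_on_compose2[OF wc _ subset_UNIV]) (intro continuous_intros)
    then have iw: "integrable lborel (\<lambda>x. indicator ucube x *\<^sub>R wt (h *\<^sub>R (x + lattice_vec n :: real^'n)))"
      by (rule integrable_ucube)
    have "f (h *\<^sub>R lattice_vec n) = (LINT x|lborel. indicator ucube (x::real^'n) *\<^sub>R f (h *\<^sub>R lattice_vec n))"
      by (rule integral_ucube_const[symmetric])
    then have "I n - f (h *\<^sub>R lattice_vec n) = (LINT x|lborel. indicator ucube x *\<^sub>R f (h *\<^sub>R (x + lattice_vec n))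
        - indicator ucube x *\<^sub>R f (h *\<^sub>R lattice_vec n))"
      using iI ic by (simp add: I_def)
    then have "norm (I n - f (h *\<^sub>R lattice_vec n)) = norm (LINT x|lborel. indicator ucube x *\<^sub>R f (h *\<^sub>R (x + lattice_vec n))
        - indicator ucube x *\<^sub>R f (h *\<^sub>R lattice_vec n))" by (rule arg_cong)
    also have "\<dots> \<le> (LINT x|lborel. A * h * (indicator ucube x *\<^sub>R wt (h *\<^sub>R (x + lattice_vec n))))"
    proof (rule order_trans[OF Bochner_Integration.integral_norm_bound], rule Bochner_Integration.integral_mono)
      show "integrable lborel (\<lambda>x. norm (indicator ucube x *\<^sub>R f (h *\<^sub>R (x + lattice_vec n)) - indicator ucube x *\<^sub>R f (h *\<^sub>R lattice_vec n)))"
        by (rule integrable_norm[OF Bochner_Integration.integrable_diff[OF iI ic]])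
      show "integrable lborel (\<lambda>x. A * h * (indicator ucube x *\<^sub>R wt (h *\<^sub>R (x + lattice_vec n))))"
        by (rule integrable_mult_right[OF iw])
      fix x :: "real^'n"
      show "norm (indicator ucube x *\<^sub>R f (h *\<^sub>R (x + lattice_vec n)) - indicator ucube x *\<^sub>R f (h *\<^sub>R lattice_vec n))
        \<le> A * h * (indicator ucube x *\<^sub>R wt (h *\<^sub>R (x + lattice_vec n)))"
      proof (cases "x \<in> ucube")
        case True
        then have "\<bar>(- (h *\<^sub>R x)) $ i\<bar> \<le> h" for i using h by (auto simp: ucube_def abs_mult mult_left_le less_imp_le)
        from schwartz_increment[OF f this h(2), of "h *\<^sub>R (x + lattice_vec n)"] True
        show ?thesis by (simp add: A_def scaleR_add_right norm_minus_commute)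
      qed simp
    qed
    also have "\<dots> = A * h * W n" unfolding W_def by (rule integral_mult_right_zero)
    finally show ?thesis .
  qed
  have "(LINT x|lborel. f x) - h ^ ?d *\<^sub>R (LINT n|Zn. f (h *\<^sub>R lattice_vec n))
     = h ^ ?d *\<^sub>R (LINT n|Zn. I n - f (h *\<^sub>R lattice_vec n))"
    using I F h by (simp add: scaleR_diff_right)
  then have "norm ((LINT x|lborel. f x) - h ^ ?d *\<^sub>R (LINT n|Zn. f (h *\<^sub>R lattice_vec n)))
     = h ^ ?d * norm (LINT n|Zn. I n - f (h *\<^sub>R lattice_vec n))"
    using h by simp
  also have "\<dots> \<le> h ^ ?d * (LINT n|Zn. A * h * W n)"
  proof (rule mult_left_mono, rule order_trans[OF Bochner_Integration.integral_norm_bound], rule Bochner_Integration.integral_mono)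
    show "integrable Zn (\<lambda>n. norm (I n - f (h *\<^sub>R lattice_vec n)))"
      by (rule integrable_norm[OF Bochner_Integration.integrable_diff[OF I(1) F]])
    show "integrable Zn (\<lambda>n. A * h * W n)" by (rule integrable_mult_right[OF W(1)])
  qed (use D h in auto)
  also have "\<dots> = A * wint TYPE('n) * h"
    using h W(2) by simp
  finally show ?thesis by (simp only: A_def)
qed

section \<open>Functionals\<close>

text \<open>Besides \<open>schwartz\<close> and \<open>schwartz0\<close> it covers the auxiliary
  spaces on which functionals are evaluated below: functions with flat transform, and functions
  whose transform lies in a given space.\<close>

definition sw_subspace :: "(real^'n::finite \<Rightarrow> complex) set \<Rightarrow> bool" where
  "sw_subspace V \<longleftrightarrow> V \<subseteq> schwartz \<and> (\<lambda>x. 0) \<in> V \<and>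
     (\<forall>f\<in>V. \<forall>g\<in>V. (\<lambda>x. f x + g x) \<in> V) \<and> (\<forall>c. \<forall>f\<in>V. (\<lambda>x. c * f x) \<in> V)"

lemma sw_subspace_schwartz: "sw_subspace schwartz"
  by (simp add: sw_subspace_def schwartz_add schwartz_cmult)

lemma sw_subspaceD:
  assumes "sw_subspace V"
  shows "f \<in> V \<Longrightarrow> f \<in> schwartz" "(\<lambda>x. 0) \<in> V"
    "f \<in> V \<Longrightarrow> g \<in> V \<Longrightarrow> (\<lambda>x. f x + g x) \<in> V" "f \<in> V \<Longrightarrow> (\<lambda>x. c * f x) \<in> V"
  using assms by (auto simp: sw_subspace_def)

lemma sw_subspace_sum:
  assumes "sw_subspace V"
  shows "(\<And>i. i \<in> I \<Longrightarrow> f i \<in> V) \<Longrightarrow> (\<lambda>x. \<Sum>i\<in>I. f i x) \<in> V"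
  by (induction I rule: infinite_finite_induct) (auto simp: sw_subspaceD[OF assms])

lemma sw_subspace_diff:
  assumes "sw_subspace V" "f \<in> V" "g \<in> V"
  shows "(\<lambda>x. f x - g x) \<in> V"
  using sw_subspaceD(3)[OF assms(1,2) sw_subspaceD(4)[OF assms(1,3), of "-1"]] by simp

lemma dualD:
  assumes "u \<in> dual V"
  shows "f \<in> V \<Longrightarrow> g \<in> V \<Longrightarrow> u (\<lambda>x. f x + g x) = u f + u g" "f \<in> V \<Longrightarrow> u (\<lambda>x. c * f x) = c * u f"
  using assms by (auto simp: dual_def)

lemma dual_bound:
  assumes "u \<in> dual V" "sw_subspace V"
  obtains M B where "0 \<le> B" "\<And>f. f \<in> V \<Longrightarrow> norm (u f) \<le> B * snorm M f"
proof -
  obtain M B where B: "\<And>f. f \<in> V \<Longrightarrow> norm (u f) \<le> B * snorm M f"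
    using assms(1) unfolding dual_def by blast
  have "norm (u f) \<le> max B 0 * snorm M f" if "f \<in> V" for f
    by (rule order_trans[OF B[OF that] mult_right_mono])
      (use snorm_nonneg[OF sw_subspaceD(1)[OF assms(2) that]] in auto)
  then show ?thesis using that[of "max B 0" M] by auto
qed

lemma dual_diff:
  assumes "u \<in> dual V" "sw_subspace V" "f \<in> V" "g \<in> V"
  shows "u (\<lambda>x. f x - g x) = u f - u g"
  using dualD(1)[OF assms(1,3) sw_subspaceD(4)[OF assms(2,4), of "-1"]] dualD(2)[OF assms(1,4), of "-1"]
  by simp

lemma dual_zero:
  assumes "u \<in> dual V" "sw_subspace V"
  shows "u (\<lambda>x. 0) = 0"
  using dual_diff[OF assms sw_subspaceD(2)[OF assms(2)] sw_subspaceD(2)[OF assms(2)]] by simp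

lemma dual_sum:
  assumes "u \<in> dual V" "sw_subspace V"
  shows "(\<And>i. i \<in> I \<Longrightarrow> f i \<in> V) \<Longrightarrow> u (\<lambda>x. \<Sum>i\<in>I. f i x) = (\<Sum>i\<in>I. u (f i))"
proof (induction I rule: infinite_finite_induct)
  case (insert i I)
  then show ?case
    by (simp add: dualD(1)[OF assms(1)] sw_subspace_sum[OF assms(2)])
qed (auto simp: dual_zero[OF assms])

lemma dualI:
  assumes "\<And>f g. f \<in> V \<Longrightarrow> g \<in> V \<Longrightarrow> u (\<lambda>x. f x + g x) = u f + u g"
    "\<And>c f. f \<in> V \<Longrightarrow> u (\<lambda>x. c * f x) = c * u f"
    "\<And>f. f \<in> V \<Longrightarrow> norm (u f) \<le> B * snorm M f"
  shows "u \<in> dual V"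
  unfolding dual_def mem_Collect_eq using assms by (intro conjI allI ballI exI[of _ M] exI[of _ B]) auto

lemma dual_compose_tame:
  assumes u: "u \<in> dual V" and V: "sw_subspace V" and U: "tame U" and UV: "\<And>f. f \<in> W \<Longrightarrow> U f \<in> V"
    and W: "W \<subseteq> schwartz"
    and add: "\<And>f g. f \<in> W \<Longrightarrow> g \<in> W \<Longrightarrow> U (\<lambda>x. f x + g x) = (\<lambda>x. U f x + U g x)"
    and cmult: "\<And>c f. f \<in> W \<Longrightarrow> U (\<lambda>x. c * f x) = (\<lambda>x. c * U f x)"
  shows "(\<lambda>f. u (U f)) \<in> dual W"
proof -
  obtain M B where B: "0 \<le> B" "\<And>f. f \<in> V \<Longrightarrow> norm (u f) \<le> B * snorm M f"
    by (rule dual_bound[OF u V]) blast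
  obtain M' C where C: "0 \<le> C" "\<And>f. f \<in> schwartz \<Longrightarrow> snorm M (U f) \<le> C * snorm M' f"
    by (rule tameE[OF U, where M = M]) blast
  show ?thesis
  proof (rule dualI)
    fix f assume f: "f \<in> W"
    show "norm (u (U f)) \<le> (B * C) * snorm M' f"
      using order_trans[OF B(2)[OF UV[OF f]] mult_left_mono[OF C(2) B(1)]] f W by (auto simp: mult.assoc)
  qed (simp_all add: add cmult dualD[OF u] UV)
qed

lemma dual_dist_fourier:
  assumes "g \<in> dual schwartz"
  shows "dist_fourier g \<in> dual schwartz"
proof -
  have "(\<lambda>\<theta>. g (FT (-1) \<theta>)) \<in> dual schwartz"
    by (rule dual_compose_tame[OF assms sw_subspace_schwartz tame_FT])
      (auto simp: schwartz_FT FT_add FT_cmult)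
  then show ?thesis by (simp add: dist_fourier_def[abs_def] fourier_FT)
qed

lemma dist_of_slow:
  fixes F :: "real^'n::finite \<Rightarrow> complex"
  assumes F: "slow F"
  shows "dist_of F \<in> dual schwartz" "\<theta> \<in> schwartz \<Longrightarrow> integrable lborel (\<lambda>x. F x * \<theta> x)"
proof -
  have i: "integrable lborel (\<lambda>x. F x * \<theta> x)" if "\<theta> \<in> schwartz" for \<theta>
    by (rule schwartz_integrable[OF schwartz_slow_mult[OF F that]])
  then show "\<theta> \<in> schwartz \<Longrightarrow> integrable lborel (\<lambda>x. F x * \<theta> x)" .
  obtain M' C where C: "0 \<le> C" "\<And>f. f \<in> schwartz \<Longrightarrow> snorm (2 * CARD('n)) (\<lambda>x. F x * f x) \<le> C * snorm M' f"
    by (rule snorm_slow_mult[OF F]) blast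
  show "dist_of F \<in> dual schwartz"
  proof (rule dualI)
    fix \<theta> assume \<theta>: "\<theta> \<in> (schwartz :: (real^'n \<Rightarrow> complex) set)"
    have S: "(\<lambda>x. F x * \<theta> x) \<in> schwartz" by (rule schwartz_slow_mult[OF F \<theta>])
    have "norm (dist_of F \<theta>) \<le> snorm (2 * CARD('n)) (\<lambda>x. F x * \<theta> x) * wint TYPE('n)"
      unfolding dist_of_def by (rule integrable_le_wt(2)[OF schwartz_borel[OF S] schwartz_le_wt[OF S]])
    also have "\<dots> \<le> (C * snorm M' \<theta>) * wint TYPE('n)"
      by (rule mult_right_mono[OF C(2)[OF \<theta>] wint_nonneg])
    finally show "norm (dist_of F \<theta>) \<le> (C * wint TYPE('n)) * snorm M' \<theta>" by (simp add: mult_ac)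
  qed (simp_all add: dist_of_def i distrib_left mult.left_commute)
qed

section \<open>Supports\<close>

lemma fun_supp_subset:
  assumes "closed S" "\<And>x. x \<notin> S \<Longrightarrow> f x = 0"
  shows "fun_supp f \<subseteq> S"
  unfolding fun_supp_def by (rule closure_minimal) (use assms in auto)

lemma fun_supp_notin: "x \<notin> fun_supp f \<Longrightarrow> f x = 0"
  using closure_subset[of "{x. f x \<noteq> 0}"] by (auto simp: fun_supp_def)

lemma closed_fun_supp: "closed (fun_supp f)"
  by (simp add: fun_supp_def)

lemma compact_fun_supp: "compact S \<Longrightarrow> fun_supp f \<subseteq> S \<Longrightarrow> compact (fun_supp f)"
  using compact_Int_closed[OF _ closed_fun_supp, of S f] by (simp add: Int_absorb1)

text \<open>Induction over the cover: a cut-off equal to 1 up to radius r and 0 beyond 2 r peels off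
  one ball. The peeled part is supported inside radius 3 r, where u vanishes, and the rest is
  supported in the remaining balls.\<close>

lemma dist_supp_vanish_cover:
  fixes u :: "'n::finite functional"
  assumes u: "u \<in> dual schwartz" and fin: "finite F"
    and F: "\<And>x r. (x, r) \<in> F \<Longrightarrow> 0 < r \<and> (\<forall>\<theta>\<in>schwartz. compact (fun_supp \<theta>) \<and> fun_supp \<theta> \<subseteq> ball x (3 * r) \<longrightarrow> u \<theta> = 0)"
    and \<theta>: "\<theta> \<in> schwartz" "compact (fun_supp \<theta>)" "fun_supp \<theta> \<subseteq> (\<Union>(x, r)\<in>F. ball x r)"
  shows "u \<theta> = 0"
  using fin F \<theta>
proof (induction F arbitrary: \<theta> rule: finite_induct)
  case empty
  then have "\<theta> = (\<lambda>x. 0)" by (intro ext fun_supp_notin) auto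
  then show ?case by (simp add: dual_zero[OF u sw_subspace_schwartz])
next
  case (insert p F)
  obtain x r where p: "p = (x, r)" by fastforce
  have r: "0 < r" and van: "\<And>\<theta>. \<theta> \<in> schwartz \<Longrightarrow> compact (fun_supp \<theta>) \<Longrightarrow> fun_supp \<theta> \<subseteq> ball x (3 * r) \<Longrightarrow> u \<theta> = 0"
    using insert.prems(1)[of x r] p by auto
  obtain \<omega> where \<omega>: "\<omega> \<in> schwartz" "\<And>y. y \<in> cball x r \<Longrightarrow> \<omega> y = 1" "\<And>y. y \<notin> ball x (2 * r) \<Longrightarrow> \<omega> y = (0::complex)"
    by (rule plateau[of r "2 * r" x]) (use r in auto)
  have S1: "(\<lambda>y. \<omega> y * \<theta> y) \<in> schwartz" by (rule schwartz_mult[OF \<omega>(1) insert.prems(2)])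
  have S2: "(\<lambda>y. \<theta> y - \<omega> y * \<theta> y) \<in> schwartz" by (rule schwartz_diff[OF insert.prems(2) S1])
  have sub1: "fun_supp (\<lambda>y. \<omega> y * \<theta> y) \<subseteq> fun_supp \<theta> \<inter> cball x (2 * r)"
    by (rule fun_supp_subset) (auto intro!: closed_Int closed_fun_supp simp: \<omega>(3) fun_supp_notin)
  have sub2: "fun_supp (\<lambda>y. \<theta> y - \<omega> y * \<theta> y) \<subseteq> fun_supp \<theta> \<inter> - ball x r"
    by (rule fun_supp_subset) (auto intro!: closed_Int closed_fun_supp simp: \<omega>(2) fun_supp_notin)
  have "u (\<lambda>y. \<omega> y * \<theta> y) = 0"
  proof (rule van[OF S1])
    show "compact (fun_supp (\<lambda>y. \<omega> y * \<theta> y))"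
      using sub1 by (intro compact_fun_supp[OF insert.prems(3)]) auto
    show "fun_supp (\<lambda>y. \<omega> y * \<theta> y) \<subseteq> ball x (3 * r)"
      using sub1 r by auto
  qed
  moreover have "u (\<lambda>y. \<theta> y - \<omega> y * \<theta> y) = 0"
  proof (rule insert.IH[OF _ S2])
    show "compact (fun_supp (\<lambda>y. \<theta> y - \<omega> y * \<theta> y))"
      using sub2 by (intro compact_fun_supp[OF insert.prems(3)]) auto
    show "fun_supp (\<lambda>y. \<theta> y - \<omega> y * \<theta> y) \<subseteq> (\<Union>(x, r)\<in>F. ball x r)"
      using sub2 insert.prems(4) p by auto
  qed (use insert.prems(1) in auto)
  ultimately show ?case
    using dual_diff[OF u sw_subspace_schwartz insert.prems(2) S1] by simp
qed

text \<open>Every point of the support of \<theta> has a ball on which u vanishes; a third of its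
  radius fits the covering lemma, and compactness leaves finitely many such balls.\<close>

lemma dist_supp_vanish_compact:
  fixes u :: "'n::finite functional"
  assumes u: "u \<in> dual schwartz" and \<theta>: "\<theta> \<in> schwartz" "compact (fun_supp \<theta>)" "fun_supp \<theta> \<inter> dist_supp u = {}"
  shows "u \<theta> = 0"
proof -
  have "\<exists>r>0. \<forall>\<theta>\<in>schwartz. compact (fun_supp \<theta>) \<and> fun_supp \<theta> \<subseteq> ball x (3 * r) \<longrightarrow> u \<theta> = 0" if "x \<in> fun_supp \<theta>" for x
  proof -
    have "x \<notin> dist_supp u" using that \<theta>(3) by auto
    then obtain U where U: "open U" "x \<in> U" "\<And>\<theta>. \<theta> \<in> schwartz \<Longrightarrow> compact (fun_supp \<theta>) \<Longrightarrow> fun_supp \<theta> \<subseteq> U \<Longrightarrow> u \<theta> = 0"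
      unfolding dist_supp_def by blast
    obtain e where "e > 0" "ball x e \<subseteq> U" using U(1,2) open_contains_ball by blast
    then show ?thesis using U(3) by (intro exI[of _ "e / 3"]) auto
  qed
  then obtain r where r: "\<And>x. x \<in> fun_supp \<theta> \<Longrightarrow> 0 < r x"
    "\<And>x \<theta>'. x \<in> fun_supp \<theta> \<Longrightarrow> \<theta>' \<in> schwartz \<Longrightarrow> compact (fun_supp \<theta>') \<Longrightarrow> fun_supp \<theta>' \<subseteq> ball x (3 * r x) \<Longrightarrow> u \<theta>' = 0"
    by metis
  obtain X where X: "finite X" "X \<subseteq> fun_supp \<theta>" "fun_supp \<theta> \<subseteq> (\<Union>x\<in>X. ball x (r x))"
    by (rule compactE_image[OF \<theta>(2), of "fun_supp \<theta>" "\<lambda>x. ball x (r x)"]) (use r(1) in auto)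
  show ?thesis
  proof (rule dist_supp_vanish_cover[OF u, of "(\<lambda>x. (x, r x)) ` X"])
    show "fun_supp \<theta> \<subseteq> (\<Union>(x, r)\<in>(\<lambda>x. (x, r x)) ` X. ball x r)" using X(3) by auto
  qed (use X r \<theta> in auto)
qed

text \<open>Vanishing on a neighbourhood is assumed because u may involve derivatives.
  Multiplication by a dilated plateau makes the support compact, with an error O(1/R) in the
  seminorm that dominates u.\<close>

lemma dist_supp_vanish:
  fixes u :: "'n::finite functional"
  assumes u: "u \<in> dual schwartz" and \<theta>: "\<theta> \<in> schwartz" and U: "open U" "dist_supp u \<subseteq> U" "\<And>x. x \<in> U \<Longrightarrow> \<theta> x = 0"
  shows "u \<theta> = 0"
proof -
  obtain \<omega> :: "real^'n \<Rightarrow> complex" where \<omega>: "\<omega> \<in> schwartz" "\<And>y. y \<in> cball 0 1 \<Longrightarrow> \<omega> y = 1" "\<And>y. y \<notin> ball 0 2 \<Longrightarrow> \<omega> y = (0::complex)"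
    by (rule plateau[of 1 2 0]) auto
  obtain M B where B: "0 \<le> B" "\<And>f. f \<in> schwartz \<Longrightarrow> norm (u f) \<le> B * snorm M f"
    by (rule dual_bound[OF u sw_subspace_schwartz]) blast
  obtain C where C: "\<And>R. R \<ge> 1 \<Longrightarrow> snorm M (\<lambda>x. \<theta> x - \<omega> (inverse R *\<^sub>R x) * \<theta> x) \<le> C / R"
    by (rule schwartz_truncation[OF \<omega>(1) _ \<theta>, of M]) (use \<omega>(2) in auto)
  have le: "norm (u \<theta>) \<le> B * (C / R)" if R: "R \<ge> 1" for R
  proof -
    have S: "(\<lambda>x. \<omega> (inverse R *\<^sub>R x) * \<theta> x) \<in> schwartz"
      by (rule schwartz_slow_mult[OF slow_scale[OF slow_schwartz[OF \<omega>(1)]] \<theta>])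
    have sub: "fun_supp (\<lambda>x. \<omega> (inverse R *\<^sub>R x) * \<theta> x) \<subseteq> cball 0 (2 * R) \<inter> - U"
    proof (rule fun_supp_subset)
      fix x :: "real^'n" assume "x \<notin> cball 0 (2 * R) \<inter> - U"
      moreover have "\<omega> (inverse R *\<^sub>R x) = 0" if "x \<notin> cball 0 (2 * R)"
        using that R by (intro \<omega>(3)) (simp add: not_less inverse_eq_divide pos_le_divide_eq)
      ultimately show "\<omega> (inverse R *\<^sub>R x) * \<theta> x = 0" using U(3) by auto
    qed (use U(1) in auto)
    have "u (\<lambda>x. \<omega> (inverse R *\<^sub>R x) * \<theta> x) = 0"
    proof (rule dist_supp_vanish_compact[OF u S])
      show "compact (fun_supp (\<lambda>x. \<omega> (inverse R *\<^sub>R x) * \<theta> x))"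
        using sub by (intro compact_fun_supp[OF compact_cball]) auto
    qed (use sub U(2) in auto)
    then have "u \<theta> = u (\<lambda>x. \<theta> x - \<omega> (inverse R *\<^sub>R x) * \<theta> x)"
      using dual_diff[OF u sw_subspace_schwartz \<theta> S] by simp
    also have "norm \<dots> \<le> B * snorm M (\<lambda>x. \<theta> x - \<omega> (inverse R *\<^sub>R x) * \<theta> x)"
      by (rule B(2)[OF schwartz_diff[OF \<theta> S]])
    also have "\<dots> \<le> B * (C / R)" by (rule mult_left_mono[OF C[OF R] B(1)])
    finally show ?thesis .
  qed
  have "((\<lambda>R. B * (C / R)) \<longlongrightarrow> 0) at_top"
    by (intro tendsto_mult_right_zero tendsto_divide_0[OF tendsto_const] filterlim_at_top_imp_at_infinity filterlim_ident)
  moreover have "eventually (\<lambda>R. norm (u \<theta>) \<le> B * (C / R)) at_top"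
    using eventually_ge_at_top[of 1] by eventually_elim (rule le)
  ultimately have "norm (u \<theta>) \<le> 0"
    by (rule tendsto_lowerbound) simp
  then show ?thesis by simp
qed

section \<open>Superpositions of plane waves\<close>

lemma iter_partial_const: "\<beta> \<noteq> [] \<Longrightarrow> iter_partial \<beta> (\<lambda>x. c) = (\<lambda>x. 0)"
proof (cases \<beta> rule: rev_cases)
  case (snoc ys y)
  have "partial_deriv y (\<lambda>x. c) = (\<lambda>x. 0)" by (simp add: partial_deriv_def fun_eq_iff)
  then show ?thesis using snoc by (simp add: iter_partial_snoc)
qed simp

section \<open>Applying a functional to plane waves: smoothness in the frequency\<close>

lemma norm_cis_minus_1: "norm (cis t - 1) \<le> \<bar>t\<bar>"
  using iexp_approx1[of t 0] by (simp add: cis_conv_exp)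

definition wave_rem :: "real^'n::finite \<Rightarrow> real^'n \<Rightarrow> complex" where
  "wave_rem v \<xi> = cis (v \<bullet> \<xi>) - 1 - \<i> * complex_of_real (v \<bullet> \<xi>)"

lemma smooth_inner: "smooth (\<lambda>\<xi>::real^'n::finite. complex_of_real (v \<bullet> \<xi>))"
proof -
  have "smooth (\<lambda>\<xi>::real^'n. \<Sum>i\<in>UNIV. v $ i * \<xi> $ i)"
    by (intro smooth_sum smooth_cmult smooth_coord)
  from smooth_bounded_linear[OF bounded_linear_of_real this] show ?thesis
    by (simp add: inner_vec_def)
qed

lemma smooth_wave_rem: "smooth (wave_rem v)"
  unfolding wave_rem_def[abs_def] by (intro smooth_diff smooth_cis smooth_const smooth_cmult smooth_inner)

lemma partial_wave_rem:
  "partial_deriv l (wave_rem v) = (\<lambda>\<xi>. \<i> * complex_of_real (v $ l) * (cis (v \<bullet> \<xi>) - 1))"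
proof
  fix \<xi>
  have "((\<lambda>\<xi>. \<i> * complex_of_real (v \<bullet> \<xi>)) has_derivative (\<lambda>h. \<i> * complex_of_real (v \<bullet> h))) (at \<xi>)"
    by (intro bounded_linear.has_derivative[OF bounded_linear_mult_right]
        bounded_linear.has_derivative[OF bounded_linear_of_real]
        bounded_linear.has_derivative[OF bounded_linear_inner_right] has_derivative_ident)
  from has_derivative_diff[OF has_derivative_diff[OF cis_linear_has_derivative has_derivative_const] this]
  have "(wave_rem v has_derivative (\<lambda>h. \<i> * complex_of_real (v \<bullet> h) * cis (v \<bullet> \<xi>) - 0 - \<i> * complex_of_real (v \<bullet> h))) (at \<xi>)"
    unfolding wave_rem_def[abs_def] .
  from partial_deriv_eqI[OF this, of l]
  show "partial_deriv l (wave_rem v) \<xi> = \<i> * complex_of_real (v $ l) * (cis (v \<bullet> \<xi>) - 1)"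
    by (simp add: inner_axis algebra_simps)
qed

text \<open>Smallness of second order in v must survive differentiation in \<xi>. Up to the first
  derivative it comes from Taylor's formula, at the price of powers of norm \<xi>; from the second
  on each differentiation itself supplies a factor v, and norm v \<le> 1 absorbs the
  surplus.\<close>

lemma wave_rem_bound:
  assumes "norm v \<le> 1"
  shows "norm (iter_partial \<beta> (wave_rem v) \<xi>) \<le> (norm v)\<^sup>2 * (1 + norm \<xi>) ^ 2"
proof -
  have ge: "a * 1 \<le> a * (1 + norm \<xi>) ^ 2" if "0 \<le> a" for a
    using that by (intro mult_left_mono one_le_power) auto
  have n1: "norm \<xi> \<le> (1 + norm \<xi>) ^ 2"
    by (simp add: power2_sum add_increasing2 field_simps)
  have n2: "(norm \<xi>)\<^sup>2 \<le> (1 + norm \<xi>) ^ 2" by (intro power_mono) auto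
  have cs: "\<bar>v \<bullet> \<xi>\<bar> \<le> norm v * norm \<xi>" by (rule Cauchy_Schwarz_ineq2)
  show ?thesis
  proof (cases \<beta> rule: rev_cases)
    case Nil
    have "norm (wave_rem v \<xi>) \<le> (v \<bullet> \<xi>)\<^sup>2 / 2"
      unfolding wave_rem_def by (rule cis_remainder)
    also have "\<dots> \<le> (v \<bullet> \<xi>)\<^sup>2" by simp
    also have "\<dots> \<le> (norm v * norm \<xi>)\<^sup>2"
      using power_mono[OF cs, of 2] by simp
    also have "\<dots> \<le> (norm v)\<^sup>2 * (1 + norm \<xi>) ^ 2"
      unfolding power_mult_distrib by (rule mult_left_mono[OF n2]) simp
    finally show ?thesis using Nil by simp
  next
    case (snoc ys l)
    have eq: "iter_partial \<beta> (wave_rem v) = (\<lambda>\<xi>. \<i> * complex_of_real (v $ l) * iter_partial ys (\<lambda>\<xi>. cis (v \<bullet> \<xi>) - 1) \<xi>)"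
      unfolding snoc iter_partial_snoc partial_wave_rem
      by (rule iter_partial_cmult) (intro smooth_diff smooth_cis smooth_const)
    have "norm (iter_partial ys (\<lambda>\<xi>. cis (v \<bullet> \<xi>) - 1) \<xi>) \<le> norm v * (1 + norm \<xi>) ^ 2"
    proof (cases "ys = []")
      case True
      have "norm (cis (v \<bullet> \<xi>) - 1) \<le> norm v * norm \<xi>"
        using order_trans[OF norm_cis_minus_1 cs] .
      also have "\<dots> \<le> norm v * (1 + norm \<xi>) ^ 2" by (rule mult_left_mono[OF n1]) simp
      finally show ?thesis using True by simp
    next
      case False
      have "iter_partial ys (\<lambda>\<xi>. cis (v \<bullet> \<xi>) - 1) \<xi> = imon ys v * cis (v \<bullet> \<xi>)"
        using iter_partial_const[OF False, of "1::complex"]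
        by (simp add: iter_partial_diff smooth_cis iter_partial_cis)
      then have "norm (iter_partial ys (\<lambda>\<xi>. cis (v \<bullet> \<xi>) - 1) \<xi>) \<le> norm v ^ length ys"
        using norm_imon_le by (simp add: norm_mult)
      also have "\<dots> \<le> norm v ^ 1" using assms False by (intro power_decreasing) (auto simp: Suc_le_eq)
      also have "\<dots> \<le> norm v * (1 + norm \<xi>) ^ 2" using ge[of "norm v"] by simp
      finally show ?thesis .
    qed
    then have "norm (v $ l) * norm (iter_partial ys (\<lambda>\<xi>. cis (v \<bullet> \<xi>) - 1) \<xi>) \<le> norm v * (norm v * (1 + norm \<xi>) ^ 2)"
      by (intro mult_mono) (auto simp: component_le_norm_cart)
    then show ?thesis by (simp add: eq norm_mult power2_eq_square mult.assoc)
  qed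
qed

text \<open>Up to normalisation, the inverse Fourier transform of the distribution u multiplied by
  f, evaluated at x.\<close>

definition wave :: "'n::finite functional \<Rightarrow> (real^'n \<Rightarrow> complex) \<Rightarrow> real^'n \<Rightarrow> complex" where
  "wave u f x = u (\<lambda>\<xi>. f \<xi> * cis (x \<bullet> \<xi>))"

lemma schwartz_cis: "f \<in> schwartz \<Longrightarrow> (\<lambda>\<xi>. f \<xi> * cis (x \<bullet> \<xi>)) \<in> schwartz"
  using schwartz_slow_mult[OF slow_cis, of f x] by (simp add: mult.commute)

text \<open>Modulation costs a power of the frequency equal to the order of the seminorm. This is
  the source of the polynomial growth of \<open>wave\<close>.\<close>

lemma snorm_cis_le:
  assumes f: "f \<in> schwartz"
  shows "snorm M (\<lambda>\<xi>. f \<xi> * cis (x \<bullet> \<xi>)) \<le> 2 ^ M * (1 + norm x) ^ M * snorm M f"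
proof (rule snorm_leI)
  fix \<beta> :: "'a list" and \<xi> :: "real^'a"
  assume l: "length \<beta> \<le> M"
  have "(1 + norm \<xi>) ^ M * norm (iter_partial \<beta> (\<lambda>\<xi>. cis (x \<bullet> \<xi>) * f \<xi>) \<xi>) \<le> 2 ^ length \<beta> * ((1 + norm x) ^ M * snorm M f)"
  proof (rule weighted_mult_bound[where m = 0, OF smooth_cis schwartz_smooth[OF f]])
    fix \<gamma> :: "'a list" assume "length \<gamma> \<le> length \<beta>"
    have "norm (iter_partial \<gamma> (\<lambda>\<xi>. cis (x \<bullet> \<xi>)) \<xi>) \<le> norm x ^ length \<gamma>"
      using norm_imon_le by (simp add: iter_partial_cis norm_mult)
    also have "\<dots> \<le> (1 + norm x) ^ length \<gamma>" by (intro power_mono) auto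
    also have "\<dots> \<le> (1 + norm x) ^ M" using l \<open>length \<gamma> \<le> length \<beta>\<close> by (intro power_increasing) auto
    finally show "norm (iter_partial \<gamma> (\<lambda>\<xi>. cis (x \<bullet> \<xi>)) \<xi>) \<le> (1 + norm x) ^ M * (1 + norm \<xi>) ^ 0" by simp
  next
    fix \<delta> :: "'a list" assume "length \<delta> \<le> length \<beta>"
    then show "(1 + norm \<xi>) ^ (M + 0) * norm (iter_partial \<delta> f \<xi>) \<le> snorm M f"
      using l by (simp add: snorm_bound[OF f])
  qed simp
  also have "\<dots> \<le> 2 ^ M * ((1 + norm x) ^ M * snorm M f)"
    using l snorm_nonneg[OF f] by (intro mult_right_mono power_increasing) auto
  finally show "(1 + norm \<xi>) ^ M * norm (iter_partial \<beta> (\<lambda>\<xi>. f \<xi> * cis (x \<bullet> \<xi>)) \<xi>) \<le> 2 ^ M * (1 + norm x) ^ M * snorm M f"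
    by (simp add: mult_ac)
qed

text \<open>The remainder is u applied to \<open>wave_rem\<close> times the modulated f, and the
  seminorm dominating u is of second order in v.\<close>

lemma wave_has_derivative:
  fixes u :: "'n::finite functional"
  assumes u: "u \<in> dual schwartz" and f: "f \<in> schwartz"
  shows "(wave u f has_derivative (\<lambda>v. \<Sum>i\<in>UNIV. v $ i *\<^sub>R wave u (\<lambda>\<xi>. imon [i] \<xi> * f \<xi>) x)) (at x)"
proof -
  obtain M B where B: "0 \<le> B" "\<And>f. f \<in> schwartz \<Longrightarrow> norm (u f) \<le> B * snorm M f"
    by (rule dual_bound[OF u sw_subspace_schwartz]) blast
  define g where "g = (\<lambda>\<xi>. f \<xi> * cis (x \<bullet> \<xi>))"
  have g: "g \<in> schwartz" unfolding g_def by (rule schwartz_cis[OF f])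
  define C where "C = 2 ^ M * snorm (M + 2) g"
  have fi: "(\<lambda>\<xi>. imon [i] \<xi> * f \<xi>) \<in> schwartz" for i by (rule schwartz_slow_mult[OF slow_imon f])
  show ?thesis
  proof (rule has_derivative_quadratic[where C = "B * C"])
    show "bounded_linear (\<lambda>v. \<Sum>i\<in>UNIV. v $ i *\<^sub>R wave u (\<lambda>\<xi>. imon [i] \<xi> * f \<xi>) x)"
      by (intro bounded_linear_sum bounded_linear_scaleR_const bounded_linear_vec_nth)
    fix y :: "real^'n" assume y: "norm (y - x) \<le> 1"
    define v where "v = y - x"
    have "(\<Sum>i\<in>UNIV. v $ i *\<^sub>R wave u (\<lambda>\<xi>. imon [i] \<xi> * f \<xi>) x)
        = (\<Sum>i\<in>UNIV. u (\<lambda>\<xi>. complex_of_real (v $ i) * (imon [i] \<xi> * f \<xi> * cis (x \<bullet> \<xi>))))"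
      unfolding wave_def by (simp only: dualD(2)[OF u schwartz_cis[OF fi]] scaleR_conv_of_real)
    also have "\<dots> = u (\<lambda>\<xi>. \<Sum>i\<in>UNIV. complex_of_real (v $ i) * (imon [i] \<xi> * f \<xi> * cis (x \<bullet> \<xi>)))"
      by (rule dual_sum[OF u sw_subspace_schwartz, symmetric]) (intro schwartz_cmult schwartz_cis fi)
    also have "(\<lambda>\<xi>. \<Sum>i\<in>UNIV. complex_of_real (v $ i) * (imon [i] \<xi> * f \<xi> * cis (x \<bullet> \<xi>))) = (\<lambda>\<xi>. \<i> * complex_of_real (v \<bullet> \<xi>) * g \<xi>)"
      by (auto simp: g_def inner_vec_def sum_distrib_left sum_distrib_right mult_ac fun_eq_iff)
    finally have s: "(\<Sum>i\<in>UNIV. v $ i *\<^sub>R wave u (\<lambda>\<xi>. imon [i] \<xi> * f \<xi>) x) = u (\<lambda>\<xi>. \<i> * complex_of_real (v \<bullet> \<xi>) * g \<xi>)" .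
    have S1: "(\<lambda>\<xi>. \<i> * complex_of_real (v \<bullet> \<xi>) * g \<xi>) \<in> schwartz"
    proof -
      have "(\<lambda>\<xi>. \<Sum>i\<in>UNIV. complex_of_real (v $ i) * (imon [i] \<xi> * g \<xi>)) \<in> schwartz"
        by (intro schwartz_sum schwartz_cmult schwartz_slow_mult[OF slow_imon g])
      moreover have "(\<lambda>\<xi>. \<Sum>i\<in>UNIV. complex_of_real (v $ i) * (imon [i] \<xi> * g \<xi>)) = (\<lambda>\<xi>. \<i> * complex_of_real (v \<bullet> \<xi>) * g \<xi>)"
        by (auto simp: inner_vec_def sum_distrib_left sum_distrib_right mult_ac fun_eq_iff)
      ultimately show ?thesis by (simp only:)
    qed
    have e: "wave_rem v \<xi> * g \<xi> = f \<xi> * cis (y \<bullet> \<xi>) - g \<xi> - \<i> * complex_of_real (v \<bullet> \<xi>) * g \<xi>" for \<xi>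
    proof -
      have "cis (y \<bullet> \<xi>) = cis (v \<bullet> \<xi>) * cis (x \<bullet> \<xi>)" by (simp add: v_def inner_diff_left cis_mult)
      then show ?thesis by (simp add: wave_rem_def g_def algebra_simps)
    qed
    have "u (\<lambda>\<xi>. wave_rem v \<xi> * g \<xi>) = wave u f y - wave u f x - u (\<lambda>\<xi>. \<i> * complex_of_real (v \<bullet> \<xi>) * g \<xi>)"
      unfolding e wave_def
      by (subst dual_diff[OF u sw_subspace_schwartz schwartz_diff[OF schwartz_cis[OF f] g] S1],
          subst dual_diff[OF u sw_subspace_schwartz schwartz_cis[OF f] g]) (simp add: g_def)
    then have "wave u f y - wave u f x - (\<Sum>i\<in>UNIV. v $ i *\<^sub>R wave u (\<lambda>\<xi>. imon [i] \<xi> * f \<xi>) x) = u (\<lambda>\<xi>. wave_rem v \<xi> * g \<xi>)"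
      by (simp only: s)
    moreover have "norm (u (\<lambda>\<xi>. wave_rem v \<xi> * g \<xi>)) \<le> B * (C * (norm v)\<^sup>2)"
    proof (rule order_trans[OF B(2) mult_left_mono[OF _ B(1)]])
      show "(\<lambda>\<xi>. wave_rem v \<xi> * g \<xi>) \<in> schwartz"
        unfolding e by (intro schwartz_diff schwartz_cis f g S1)
      show "snorm M (\<lambda>\<xi>. wave_rem v \<xi> * g \<xi>) \<le> C * (norm v)\<^sup>2"
      proof (rule snorm_leI)
        fix \<beta> :: "'n list" and \<xi> :: "real^'n"
        assume l: "length \<beta> \<le> M"
        have "(1 + norm \<xi>) ^ M * norm (iter_partial \<beta> (\<lambda>\<xi>. wave_rem v \<xi> * g \<xi>) \<xi>) \<le> 2 ^ length \<beta> * ((norm v)\<^sup>2 * snorm (M + 2) g)"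
          using y l
          by (intro weighted_mult_bound[where m = 2] smooth_wave_rem schwartz_smooth g wave_rem_bound snorm_bound)
            (auto simp: v_def)
        also have "\<dots> \<le> 2 ^ M * ((norm v)\<^sup>2 * snorm (M + 2) g)"
          using l snorm_nonneg[OF g] by (intro mult_right_mono power_increasing) auto
        finally show "(1 + norm \<xi>) ^ M * norm (iter_partial \<beta> (\<lambda>\<xi>. wave_rem v \<xi> * g \<xi>) \<xi>) \<le> C * (norm v)\<^sup>2"
          by (simp add: C_def mult_ac)
      qed
    qed
    ultimately show "norm (wave u f y - wave u f x - (\<Sum>i\<in>UNIV. (y - x) $ i *\<^sub>R wave u (\<lambda>\<xi>. imon [i] \<xi> * f \<xi>) x)) \<le> B * C * (norm (y - x))\<^sup>2"
      by (simp only: v_def mult.assoc)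
  qed
qed

lemma partial_wave:
  fixes u :: "'n::finite functional"
  assumes "u \<in> dual schwartz" "f \<in> schwartz"
  shows "partial_deriv i (wave u f) = wave u (\<lambda>\<xi>. imon [i] \<xi> * f \<xi>)"
proof
  fix x
  have "partial_deriv i (wave u f) x = (\<Sum>l\<in>UNIV. axis i 1 $ l *\<^sub>R wave u (\<lambda>\<xi>. imon [l] \<xi> * f \<xi>) x)"
    by (rule partial_deriv_eqI[OF wave_has_derivative[OF assms]])
  also have "\<dots> = (\<Sum>l\<in>UNIV. if l = i then wave u (\<lambda>\<xi>. imon [l] \<xi> * f \<xi>) x else 0)"
    by (intro sum.cong refl) (auto simp: axis_def)
  finally show "partial_deriv i (wave u f) x = wave u (\<lambda>\<xi>. imon [i] \<xi> * f \<xi>) x" by simp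
qed

lemma slow_wave:
  fixes u :: "'n::finite functional"
  assumes u: "u \<in> dual schwartz" and f: "f \<in> schwartz"
  shows "slow (wave u f)"
proof -
  have it: "iter_partial \<beta> (wave u f) = wave u (\<lambda>\<xi>. imon \<beta> \<xi> * f \<xi>)" for \<beta>
  proof (induction \<beta>)
    case (Cons i \<beta>)
    show ?case unfolding iter_partial.simps Cons
      by (subst partial_wave[OF u schwartz_slow_mult[OF slow_imon f]]) (simp add: mult.assoc)
  qed simp
  have S: "(\<lambda>\<xi>. imon \<beta> \<xi> * f \<xi>) \<in> schwartz" for \<beta> by (rule schwartz_slow_mult[OF slow_imon f])
  obtain M B where B: "0 \<le> B" "\<And>f. f \<in> schwartz \<Longrightarrow> norm (u f) \<le> B * snorm M f"
    by (rule dual_bound[OF u sw_subspace_schwartz]) blast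
  show ?thesis
  proof (rule slowI)
    show "smooth (wave u f)"
      unfolding smooth_iff it differentiable_def
      by (intro allI exI) (rule wave_has_derivative[OF u S])
    fix \<beta> :: "'n list"
    have "norm (iter_partial \<beta> (wave u f) x) \<le> (B * (2 ^ M * snorm M (\<lambda>\<xi>. imon \<beta> \<xi> * f \<xi>))) * (1 + norm x) ^ M" for x
      using order_trans[OF B(2)[OF schwartz_cis[OF S]] mult_left_mono[OF snorm_cis_le[OF S] B(1)], of \<beta> x]
      by (simp add: it wave_def mult_ac)
    then show "\<exists>m C. \<forall>x. norm (iter_partial \<beta> (wave u f) x) \<le> C * (1 + norm x) ^ m" by blast
  qed
qed

section \<open>Applying a functional termwise to superpositions of plane waves\<close>

lemma has_sum_tail_bound:
  fixes f :: "'a \<Rightarrow> 'b::banach"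
  assumes f: "(f has_sum S) UNIV" and w: "(w has_sum W) UNIV" and le: "\<And>n. norm (f n) \<le> w n" and E: "finite E"
  shows "norm (S - sum f E) \<le> W - sum w E"
proof -
  have "(f has_sum (S - sum f E)) (UNIV - E)"
    by (rule has_sum_Diff[OF f has_sum_finite[OF E]]) simp
  moreover have "(w has_sum (W - sum w E)) (UNIV - E)"
    by (rule has_sum_Diff[OF w has_sum_finite[OF E]]) simp
  ultimately show ?thesis using le
    by (rule norm_infsum_le)
qed

lemma iter_partial_wave_sum:
  fixes v :: "'a \<Rightarrow> real^'n::finite"
  assumes "smooth \<psi>"
  shows "iter_partial \<gamma> (\<lambda>\<xi>. \<psi> \<xi> - (\<Sum>n\<in>E. c n * cis (v n \<bullet> \<xi>)))
     = (\<lambda>\<xi>. iter_partial \<gamma> \<psi> \<xi> - (\<Sum>n\<in>E. c n * (imon \<gamma> (v n) * cis (v n \<bullet> \<xi>))))"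
proof -
  have s: "smooth (\<lambda>\<xi>. c n * cis (v n \<bullet> \<xi>))" for n by (intro smooth_cmult smooth_cis)
  show ?thesis
    by (simp add: iter_partial_diff[OF assms smooth_sum[OF s]] iter_partial_sum[OF s]
        iter_partial_cmult[OF smooth_cis] iter_partial_cis)
qed

text \<open>The constant A allows for waves that reproduce \<psi> only approximately on \<Omega>, as
  a Riemann sum does; an exact series has A = 0. For a finite set E of frequencies, the derivatives
  up to order M of \<psi> minus the partial sum are bounded by A plus the tail of the weighted
  coefficients; off \<Omega> all derivatives of f vanish. Continuity of u turns this into a bound,
  and E exhausts the index set.\<close>

theorem superposition:
  fixes c :: "'a \<Rightarrow> complex" and v :: "'a \<Rightarrow> real^'n::finite"
  assumes u: "u \<in> dual V" and V: "sw_subspace V"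
    and B: "0 \<le> B" "\<And>f. f \<in> V \<Longrightarrow> norm (u f) \<le> B * snorm M f"
    and f: "f \<in> schwartz" and \<psi>: "smooth \<psi>" and f\<psi>: "(\<lambda>\<xi>. f \<xi> * \<psi> \<xi>) \<in> V"
    and fv: "\<And>n. (\<lambda>\<xi>. f \<xi> * cis (v n \<bullet> \<xi>)) \<in> V"
    and w: "(\<lambda>n. norm (c n) * (1 + norm (v n)) ^ M) summable_on UNIV"
    and out: "\<And>\<xi> \<gamma>. \<xi> \<notin> \<Omega> \<Longrightarrow> iter_partial \<gamma> f \<xi> = 0"
    and app: "\<And>\<xi> \<gamma>. \<xi> \<in> \<Omega> \<Longrightarrow> length \<gamma> \<le> M \<Longrightarrow>
      \<exists>S. ((\<lambda>n. c n * (imon \<gamma> (v n) * cis (v n \<bullet> \<xi>))) has_sum S) UNIV \<and> norm (iter_partial \<gamma> \<psi> \<xi> - S) \<le> A * (1 + norm \<xi>) ^ k"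
    and A: "0 \<le> A"
  shows "(\<lambda>n. norm (c n * u (\<lambda>\<xi>. f \<xi> * cis (v n \<bullet> \<xi>)))) summable_on UNIV"
    and "norm (u (\<lambda>\<xi>. f \<xi> * \<psi> \<xi>) - (\<Sum>\<^sub>\<infinity>n. c n * u (\<lambda>\<xi>. f \<xi> * cis (v n \<bullet> \<xi>)))) \<le> B * (2 ^ M * (A * snorm (M + k) f))"
proof -
  define W where "W = (\<lambda>n. norm (c n) * (1 + norm (v n)) ^ M)"
  define U where "U = (\<lambda>n. c n * u (\<lambda>\<xi>. f \<xi> * cis (v n \<bullet> \<xi>)))"
  have Wsum: "(W has_sum infsum W UNIV) UNIV" using w by (simp add: W_def)
  have U_le: "norm (U n) \<le> (B * 2 ^ M * snorm M f) * W n" for n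
  proof -
    have "norm (u (\<lambda>\<xi>. f \<xi> * cis (v n \<bullet> \<xi>))) \<le> B * (2 ^ M * (1 + norm (v n)) ^ M * snorm M f)"
      by (rule order_trans[OF B(2)[OF fv] mult_left_mono[OF snorm_cis_le[OF f] B(1)]])
    from mult_left_mono[OF this, of "norm (c n)"] show ?thesis
      by (simp add: U_def W_def norm_mult mult_ac)
  qed
  have sU: "(\<lambda>n. norm (U n)) summable_on UNIV"
    by (rule summable_on_comparison_test[OF summable_on_cmult_right[OF w[folded W_def]]]) (use U_le in auto)
  then show "(\<lambda>n. norm (c n * u (\<lambda>\<xi>. f \<xi> * cis (v n \<bullet> \<xi>)))) summable_on UNIV"
    by (simp only: U_def)
  have "(U has_sum infsum U UNIV) UNIV"
    using abs_summable_summable[OF sU] by simp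
  then have limU: "(sum U \<longlongrightarrow> infsum U UNIV) (finite_subsets_at_top UNIV)"
    by (simp add: has_sum_def)
  have limW: "(sum W \<longlongrightarrow> infsum W UNIV) (finite_subsets_at_top UNIV)"
    using Wsum by (simp add: has_sum_def)
  define N where "N = snorm (M + k) f"
  have N0: "0 \<le> N" unfolding N_def by (rule snorm_nonneg[OF f])
  have le: "norm (u (\<lambda>\<xi>. f \<xi> * \<psi> \<xi>) - sum U E) \<le> B * (2 ^ M * ((A + (infsum W UNIV - sum W E)) * N))"
    if E: "finite E" for E
  proof -
    \<comment> \<open>The tail controls the omitted waves for all \<xi> and all multi-indices up to
      order M at once, since \<open>imon\<close> is dominated by the weight in W.\<close>
    define \<tau> where "\<tau> = infsum W UNIV - sum W E"
    define D where "D = (\<lambda>\<xi>. \<psi> \<xi> - (\<Sum>n\<in>E. c n * cis (v n \<bullet> \<xi>)))"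
    have \<tau>0: "0 \<le> \<tau>"
      unfolding \<tau>_def using has_sum_tail_bound[OF has_sum_0[of UNIV "\<lambda>n. 0::real"] Wsum _ E] by (auto simp: W_def)
    have sD: "smooth D" unfolding D_def by (intro smooth_diff \<psi> smooth_sum smooth_cmult smooth_cis)
    have sV: "(\<lambda>\<xi>. \<Sum>n\<in>E. c n * (f \<xi> * cis (v n \<bullet> \<xi>))) \<in> V"
      by (intro sw_subspace_sum[OF V] sw_subspaceD(4)[OF V] fv)
    have eq: "(\<lambda>\<xi>. D \<xi> * f \<xi>) = (\<lambda>\<xi>. f \<xi> * \<psi> \<xi> - (\<Sum>n\<in>E. c n * (f \<xi> * cis (v n \<bullet> \<xi>))))"
    proof
      fix \<xi>
      have "(\<Sum>n\<in>E. c n * cis (v n \<bullet> \<xi>)) * f \<xi> = (\<Sum>n\<in>E. c n * (f \<xi> * cis (v n \<bullet> \<xi>)))"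
        unfolding sum_distrib_right by (intro sum.cong refl) (simp only: mult_ac)
      then show "D \<xi> * f \<xi> = f \<xi> * \<psi> \<xi> - (\<Sum>n\<in>E. c n * (f \<xi> * cis (v n \<bullet> \<xi>)))"
        by (simp add: D_def left_diff_distrib mult.commute[of "\<psi> \<xi>"])
    qed
    have DV: "(\<lambda>\<xi>. D \<xi> * f \<xi>) \<in> V" unfolding eq by (rule sw_subspace_diff[OF V f\<psi> sV])
    have "u (\<lambda>\<xi>. \<Sum>n\<in>E. c n * (f \<xi> * cis (v n \<bullet> \<xi>))) = sum U E"
      unfolding U_def by (simp add: dual_sum[OF u V] sw_subspaceD(4)[OF V] fv dualD(2)[OF u fv])
    then have "u (\<lambda>\<xi>. f \<xi> * \<psi> \<xi>) - sum U E = u (\<lambda>\<xi>. D \<xi> * f \<xi>)"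
      unfolding eq by (simp add: dual_diff[OF u V f\<psi> sV])
    also have "norm \<dots> \<le> B * snorm M (\<lambda>\<xi>. D \<xi> * f \<xi>)" by (rule B(2)[OF DV])
    also have "\<dots> \<le> B * (2 ^ M * ((A + \<tau>) * N))"
    proof (rule mult_left_mono[OF snorm_leI B(1)])
      fix \<beta> :: "'n list" and \<xi> :: "real^'n"
      assume l: "length \<beta> \<le> M"
      show "(1 + norm \<xi>) ^ M * norm (iter_partial \<beta> (\<lambda>\<xi>. D \<xi> * f \<xi>) \<xi>) \<le> 2 ^ M * ((A + \<tau>) * N)"
      proof (cases "\<xi> \<in> \<Omega>")
        case True
        have "(1 + norm \<xi>) ^ M * norm (iter_partial \<beta> (\<lambda>\<xi>. D \<xi> * f \<xi>) \<xi>) \<le> 2 ^ length \<beta> * ((A + \<tau>) * N)"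
        proof (rule weighted_mult_bound[where m = k, OF sD schwartz_smooth[OF f]])
          show "0 \<le> A + \<tau>" using A \<tau>0 by simp
          fix \<gamma> :: "'n list" assume \<gamma>: "length \<gamma> \<le> length \<beta>"
          obtain S where S: "((\<lambda>n. c n * (imon \<gamma> (v n) * cis (v n \<bullet> \<xi>))) has_sum S) UNIV"
            "norm (iter_partial \<gamma> \<psi> \<xi> - S) \<le> A * (1 + norm \<xi>) ^ k"
            using app[OF True, of \<gamma>] \<gamma> l by auto
          have "norm (S - (\<Sum>n\<in>E. c n * (imon \<gamma> (v n) * cis (v n \<bullet> \<xi>)))) \<le> \<tau>"
            unfolding \<tau>_def
          proof (rule has_sum_tail_bound[OF S(1) Wsum _ E])
            fix n
            have "norm (imon \<gamma> (v n)) \<le> norm (v n) ^ length \<gamma>" by (rule norm_imon_le)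
            also have "\<dots> \<le> (1 + norm (v n)) ^ length \<gamma>" by (intro power_mono) auto
            also have "\<dots> \<le> (1 + norm (v n)) ^ M" using \<gamma> l by (intro power_increasing) auto
            finally show "norm (c n * (imon \<gamma> (v n) * cis (v n \<bullet> \<xi>))) \<le> W n"
              by (simp add: W_def norm_mult mult_left_mono)
          qed
          also have "\<tau> \<le> \<tau> * (1 + norm \<xi>) ^ k"
            using mult_left_mono[OF one_le_power \<tau>0, of "1 + norm \<xi>" k] by simp
          finally have "norm (S - (\<Sum>n\<in>E. c n * (imon \<gamma> (v n) * cis (v n \<bullet> \<xi>)))) \<le> \<tau> * (1 + norm \<xi>) ^ k" .
          with S(2) have "norm ((iter_partial \<gamma> \<psi> \<xi> - S) + (S - (\<Sum>n\<in>E. c n * (imon \<gamma> (v n) * cis (v n \<bullet> \<xi>)))))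
              \<le> A * (1 + norm \<xi>) ^ k + \<tau> * (1 + norm \<xi>) ^ k"
            by (intro norm_triangle_le add_mono)
          then show "norm (iter_partial \<gamma> D \<xi>) \<le> (A + \<tau>) * (1 + norm \<xi>) ^ k"
            by (simp add: D_def iter_partial_wave_sum[OF \<psi>] distrib_right)
        next
          fix \<delta> :: "'n list" assume "length \<delta> \<le> length \<beta>"
          then show "(1 + norm \<xi>) ^ (M + k) * norm (iter_partial \<delta> f \<xi>) \<le> N"
            unfolding N_def using l by (intro snorm_bound[OF f]) auto
        qed
        also have "\<dots> \<le> 2 ^ M * ((A + \<tau>) * N)"
          using l A \<tau>0 N0 by (intro mult_right_mono power_increasing) auto
        finally show ?thesis .
      next
        case False
        have "norm (iter_partial \<beta> (\<lambda>\<xi>. D \<xi> * f \<xi>) \<xi>) \<le> 2 ^ length \<beta> * 0"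
          by (rule norm_iter_partial_mult_le[OF sD schwartz_smooth[OF f]]) (simp add: out[OF False])
        then show ?thesis using A \<tau>0 N0 by simp
      qed
    qed
    finally show ?thesis by (simp add: \<tau>_def)
  qed
  \<comment> \<open>As E grows the tail of W disappears and only A is left.\<close>
  have "norm (u (\<lambda>\<xi>. f \<xi> * \<psi> \<xi>) - infsum U UNIV) \<le> B * (2 ^ M * ((A + (infsum W UNIV - infsum W UNIV)) * N))"
  proof (rule tendsto_le[of "finite_subsets_at_top UNIV"])
    show "((\<lambda>E. B * (2 ^ M * ((A + (infsum W UNIV - sum W E)) * N))) \<longlongrightarrow> B * (2 ^ M * ((A + (infsum W UNIV - infsum W UNIV)) * N))) (finite_subsets_at_top UNIV)"
      by (intro tendsto_intros limW)
    show "((\<lambda>E. norm (u (\<lambda>\<xi>. f \<xi> * \<psi> \<xi>) - sum U E)) \<longlongrightarrow> norm (u (\<lambda>\<xi>. f \<xi> * \<psi> \<xi>) - infsum U UNIV)) (finite_subsets_at_top UNIV)"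
      by (intro tendsto_intros limU)
    show "\<forall>\<^sub>F E in finite_subsets_at_top UNIV. norm (u (\<lambda>\<xi>. f \<xi> * \<psi> \<xi>) - sum U E) \<le> B * (2 ^ M * ((A + (infsum W UNIV - sum W E)) * N))"
      using le by (auto intro: eventually_finite_subsets_at_top_weakI)
  qed simp
  then show "norm (u (\<lambda>\<xi>. f \<xi> * \<psi> \<xi>) - (\<Sum>\<^sub>\<infinity>n. c n * u (\<lambda>\<xi>. f \<xi> * cis (v n \<bullet> \<xi>)))) \<le> B * (2 ^ M * (A * snorm (M + k) f))"
    by (simp add: U_def N_def)
qed

lemma summable_lattice_weighted:
  fixes f :: "real^'n::finite \<Rightarrow> complex"
  assumes f: "f \<in> schwartz" and c: "\<And>i. c i \<noteq> 0"
  shows "(\<lambda>n. norm (f (t + vec_lambda (\<lambda>i. c i * of_int (n $ i)))) *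
    (1 + norm (t + vec_lambda (\<lambda>i. c i * of_int (n $ i)))) ^ M) summable_on UNIV"
proof -
  have "(1 + norm x) ^ (2 * CARD('n)) * norm (norm (f x) * (1 + norm x) ^ M) \<le> snorm (2 * CARD('n) + M) f" for x
    using norm_le_snorm[OF f, of x "2 * CARD('n) + M"] by (simp add: power_add mult_ac)
  from integrable_lattice[of c "\<lambda>x. norm (f x) * (1 + norm x) ^ M" _ t, OF c this]
  have "integrable Zn (\<lambda>n. norm (f (t + vec_lambda (\<lambda>i. c i * of_int (n $ i)))) *
    (1 + norm (t + vec_lambda (\<lambda>i. c i * of_int (n $ i)))) ^ M)" .
  from has_sum_imp_summable[OF has_sum_Zn(1)[OF this]] show ?thesis .
qed

lemma scaled_lattice: "0 + vec_lambda (\<lambda>i. h * of_int (n $ i)) = h *\<^sub>R lattice_vec n"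
  by (simp add: vec_eq_iff)

text \<open>Pulls u out of an integral. \<open>FT 1 \<theta>\<close> is replaced by a Riemann sum of
  step h, a superposition of plane waves to which u applies termwise. The same quadrature rule is
  applied to \<open>wave u f\<close> times \<theta>; both errors are O(h), and h tends to 0.\<close>

theorem integral_wave:
  fixes u :: "'n::finite functional"
  assumes u: "u \<in> dual schwartz" and f: "f \<in> schwartz" and \<theta>: "\<theta> \<in> schwartz"
  shows "complex_of_real (FTc TYPE('n)) * (LINT x|lborel. wave u f x * \<theta> x) = u (\<lambda>\<xi>. f \<xi> * FT 1 \<theta> \<xi>)"
proof -
  let ?d = "CARD('n)" and ?c = "FTc TYPE('n)"
  obtain M B where B: "0 \<le> B" "\<And>f. f \<in> schwartz \<Longrightarrow> norm (u f) \<le> B * snorm M f"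
    by (rule dual_bound[OF u sw_subspace_schwartz]) blast
  define L where "L = {\<gamma> :: 'n list. length \<gamma> \<le> M}"
  have finL: "finite L" unfolding L_def by (rule finite_lists_le)
  \<comment> \<open>A common bound for all derivatives of the transform up to order M, each of which
    brings a factor \<open>imon\<close> under the integral.\<close>
  define N0 where "N0 = (\<Sum>\<gamma>\<in>L. snorm (2 * ?d + 1) (\<lambda>x. imon \<gamma> x * \<theta> x))"
  have Sg: "(\<lambda>x. imon \<gamma> x * \<theta> x) \<in> schwartz" for \<gamma> by (rule schwartz_slow_mult[OF slow_imon \<theta>])
  have N00: "0 \<le> N0" unfolding N0_def by (intro sum_nonneg snorm_nonneg Sg)
  define K where "K = (real ?d)\<^sup>2 * 3 ^ ?d"
  have K0: "0 \<le> K" by (simp add: K_def)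
  define A where "A = ?c * (K * (2 ^ (2 * ?d + 1) * N0) * wint TYPE('n))"
  have A0: "0 \<le> A" using N00 K0 FTc_pos[where 'n = 'n] wint_nonneg[where 'n = 'n] by (simp add: A_def)
  define g where "g = (\<lambda>x. wave u f x * \<theta> x)"
  have g: "g \<in> schwartz" unfolding g_def by (rule schwartz_slow_mult[OF slow_wave[OF u f] \<theta>])
  define C1 where "C1 = B * (2 ^ M * (A * snorm (M + (2 * ?d + 1)) f))"
  define C2 where "C2 = ?c * (K * snorm (2 * ?d + 1) g * wint TYPE('n))"
  have le: "norm (u (\<lambda>\<xi>. f \<xi> * FT 1 \<theta> \<xi>) - complex_of_real ?c * (LINT x|lborel. g x)) \<le> (C1 + C2) * h"
    if h: "0 < h" "h \<le> 1" for h
  proof -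
    \<comment> \<open>Normalisation of the transform times the volume of a cell of side h.\<close>
    define a where "a = ?c * h ^ ?d"
    have a0: "0 < a" using h FTc_pos[where 'n = 'n] by (simp add: a_def)
    define v where "v = (\<lambda>n::int^'n. h *\<^sub>R lattice_vec n)"
    define c where "c = (\<lambda>n. complex_of_real a * \<theta> (v n))"
    have int: "integrable Zn (\<lambda>n. F (v n))" if "F \<in> schwartz" for F :: "real^'n \<Rightarrow> complex"
      using integrable_schwartz_lattice[OF that, of "\<lambda>_. h" 0] h unfolding scaled_lattice v_def by simp
    have r: "norm (u (\<lambda>\<xi>. f \<xi> * FT 1 \<theta> \<xi>) - (\<Sum>\<^sub>\<infinity>n. c n * u (\<lambda>\<xi>. f \<xi> * cis (v n \<bullet> \<xi>))))
        \<le> B * (2 ^ M * (A * h * snorm (M + (2 * ?d + 1)) f))"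
    proof (rule superposition(2)[OF u sw_subspace_schwartz B f, where \<Omega> = UNIV])
      show "smooth (FT 1 \<theta>)" by (rule smooth_FT[OF \<theta>])
      show "(\<lambda>\<xi>. f \<xi> * FT 1 \<theta> \<xi>) \<in> schwartz" by (rule schwartz_mult[OF f schwartz_FT[OF _ \<theta>]]) simp
      show "(\<lambda>\<xi>. f \<xi> * cis (v n \<bullet> \<xi>)) \<in> schwartz" for n by (rule schwartz_cis[OF f])
      have "(\<lambda>n. a * (norm (\<theta> (v n)) * (1 + norm (v n)) ^ M)) summable_on UNIV"
        using summable_lattice_weighted[OF \<theta>, of "\<lambda>_. h" 0 M] h
        unfolding scaled_lattice v_def by (intro summable_on_cmult_right) simp
      then show "(\<lambda>n. norm (c n) * (1 + norm (v n)) ^ M) summable_on UNIV"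
        using a0 by (simp add: c_def norm_mult mult_ac)
      show "0 \<le> A * h" using A0 h by simp
      fix \<xi> :: "real^'n" and \<gamma> :: "'n list"
      assume \<gamma>: "length \<gamma> \<le> M"
      \<comment> \<open>Modulation by \<xi> makes the quadrature error grow like a power of 1 + norm
        \<xi>; the exponent k in \<open>superposition\<close> makes room for this.\<close>
      define F where "F = (\<lambda>x. imon \<gamma> x * \<theta> x * cis (\<xi> \<bullet> x))"
      have F: "F \<in> schwartz" unfolding F_def by (rule schwartz_cis[OF Sg])
      have "snorm (2 * ?d + 1) F \<le> 2 ^ (2 * ?d + 1) * (1 + norm \<xi>) ^ (2 * ?d + 1) * snorm (2 * ?d + 1) (\<lambda>x. imon \<gamma> x * \<theta> x)"
        unfolding F_def by (rule snorm_cis_le[OF Sg])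
      also have "\<dots> \<le> 2 ^ (2 * ?d + 1) * (1 + norm \<xi>) ^ (2 * ?d + 1) * N0"
        unfolding N0_def using \<gamma> by (intro mult_left_mono member_le_sum snorm_nonneg Sg finL) (auto simp: L_def)
      finally have nF: "snorm (2 * ?d + 1) F \<le> 2 ^ (2 * ?d + 1) * (1 + norm \<xi>) ^ (2 * ?d + 1) * N0" .
      have "norm ((LINT x|lborel. F x) - h ^ ?d *\<^sub>R (LINT n|Zn. F (v n))) \<le> K * snorm (2 * ?d + 1) F * wint TYPE('n) * h"
        unfolding v_def K_def by (rule riemann_sum_error[OF F h])
      also have "\<dots> \<le> K * (2 ^ (2 * ?d + 1) * (1 + norm \<xi>) ^ (2 * ?d + 1) * N0) * wint TYPE('n) * h"
        using K0 h by (intro mult_right_mono mult_left_mono nF wint_nonneg) auto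
      finally have rF: "norm ((LINT x|lborel. F x) - h ^ ?d *\<^sub>R (LINT n|Zn. F (v n)))
          \<le> K * (2 ^ (2 * ?d + 1) * (1 + norm \<xi>) ^ (2 * ?d + 1) * N0) * wint TYPE('n) * h" .
      have "((\<lambda>n. complex_of_real a * F (v n)) has_sum (complex_of_real a * (LINT n|Zn. F (v n)))) UNIV"
        by (rule has_sum_cmult_right[OF has_sum_Zn(1)[OF int[OF F]]])
      moreover have "complex_of_real a * F (v n) = c n * (imon \<gamma> (v n) * cis (v n \<bullet> \<xi>))" for n
        by (simp add: F_def c_def inner_commute mult_ac)
      moreover have "iter_partial \<gamma> (FT 1 \<theta>) \<xi> - complex_of_real a * (LINT n|Zn. F (v n))
          = complex_of_real ?c * ((LINT x|lborel. F x) - h ^ ?d *\<^sub>R (LINT n|Zn. F (v n)))"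
      proof -
        have "iter_partial \<gamma> (FT 1 \<theta>) \<xi> = complex_of_real ?c * (LINT x|lborel. F x)"
          by (simp add: iter_partial_FT[OF \<theta>] FT_def FTc_def F_def inner_commute)
        then show ?thesis by (simp add: a_def right_diff_distrib scaleR_conv_of_real mult.assoc)
      qed
      then have "norm (iter_partial \<gamma> (FT 1 \<theta>) \<xi> - complex_of_real a * (LINT n|Zn. F (v n)))
          \<le> ?c * (K * (2 ^ (2 * ?d + 1) * (1 + norm \<xi>) ^ (2 * ?d + 1) * N0) * wint TYPE('n) * h)"
        using mult_left_mono[OF rF less_imp_le[OF FTc_pos[where 'n = 'n]]] FTc_pos[where 'n = 'n] by (simp add: norm_mult)
      moreover have "?c * (K * (2 ^ (2 * ?d + 1) * (1 + norm \<xi>) ^ (2 * ?d + 1) * N0) * wint TYPE('n) * h) = A * h * (1 + norm \<xi>) ^ (2 * ?d + 1)"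
        by (simp only: A_def mult_ac)
      ultimately show "\<exists>S. ((\<lambda>n. c n * (imon \<gamma> (v n) * cis (v n \<bullet> \<xi>))) has_sum S) UNIV \<and>
          norm (iter_partial \<gamma> (FT 1 \<theta>) \<xi> - S) \<le> A * h * (1 + norm \<xi>) ^ (2 * ?d + 1)"
        by (intro exI[of _ "complex_of_real a * (LINT n|Zn. F (v n))"]) (simp only: simp_thms)
    qed auto
    have "(\<Sum>\<^sub>\<infinity>n. c n * u (\<lambda>\<xi>. f \<xi> * cis (v n \<bullet> \<xi>))) = complex_of_real a * (LINT n|Zn. g (v n))"
    proof -
      have "((\<lambda>n. complex_of_real a * g (v n)) has_sum (complex_of_real a * (LINT n|Zn. g (v n)))) UNIV"
        by (rule has_sum_cmult_right[OF has_sum_Zn(1)[OF int[OF g]]])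
      then show ?thesis by (simp add: infsumI c_def g_def wave_def mult_ac)
    qed
    with r have r1: "norm (u (\<lambda>\<xi>. f \<xi> * FT 1 \<theta> \<xi>) - complex_of_real a * (LINT n|Zn. g (v n))) \<le> C1 * h"
      by (simp add: C1_def mult_ac)
    \<comment> \<open>The second use of the quadrature error: the sampled values of
      \<open>wave u f\<close> times \<theta> return to an integral.\<close>
    have "norm ((LINT x|lborel. g x) - h ^ ?d *\<^sub>R (LINT n|Zn. g (v n))) \<le> K * snorm (2 * ?d + 1) g * wint TYPE('n) * h"
      unfolding v_def K_def by (rule riemann_sum_error[OF g h])
    from mult_left_mono[OF this less_imp_le[OF FTc_pos[where 'n = 'n]]]
    have "norm (complex_of_real ?c * ((LINT x|lborel. g x) - h ^ ?d *\<^sub>R (LINT n|Zn. g (v n)))) \<le> C2 * h"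
      using FTc_pos[where 'n = 'n] by (simp add: norm_mult C2_def mult_ac)
    moreover have "complex_of_real ?c * ((LINT x|lborel. g x) - h ^ ?d *\<^sub>R (LINT n|Zn. g (v n)))
        = complex_of_real ?c * (LINT x|lborel. g x) - complex_of_real a * (LINT n|Zn. g (v n))"
      by (simp add: a_def right_diff_distrib scaleR_conv_of_real mult.assoc)
    ultimately have r2: "norm (complex_of_real ?c * (LINT x|lborel. g x) - complex_of_real a * (LINT n|Zn. g (v n))) \<le> C2 * h"
      by simp
    show ?thesis
      using norm_diff_triangle_le[OF r1, of "complex_of_real ?c * (LINT x|lborel. g x)" "C2 * h"] r2
      by (simp add: norm_minus_commute distrib_right)
  qed
  have "norm (u (\<lambda>\<xi>. f \<xi> * FT 1 \<theta> \<xi>) - complex_of_real ?c * (LINT x|lborel. g x)) \<le> 0"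
  proof (rule tendsto_lowerbound[of "\<lambda>h. (C1 + C2) * h" _ "at_right 0"])
    show "((\<lambda>h. (C1 + C2) * h) \<longlongrightarrow> 0) (at_right 0)"
      by (auto intro!: tendsto_eq_intros)
    show "\<forall>\<^sub>F h in at_right 0. norm (u (\<lambda>\<xi>. f \<xi> * FT 1 \<theta> \<xi>) - complex_of_real ?c * (LINT x|lborel. g x)) \<le> (C1 + C2) * h"
      by (rule eventually_at_rightI[of 0 1]) (auto intro!: le)
  qed simp
  then show ?thesis by (simp add: g_def)
qed

section \<open>Sampling of band-limited distributions\<close>

lemma FT_modulate:
  assumes "s * s = 1"
  shows "FT s (\<lambda>\<xi>. f \<xi> * cis (x \<bullet> \<xi>)) y = FT s f (y + s *\<^sub>R x)"
proof -
  have "cis (x \<bullet> \<xi>) * cis (s * (\<xi> \<bullet> y)) = cis (s * (\<xi> \<bullet> (y + s *\<^sub>R x)))" for \<xi>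
  proof -
    have "s * (\<xi> \<bullet> (y + s *\<^sub>R x)) = s * (\<xi> \<bullet> y) + (s * s) * (x \<bullet> \<xi>)"
      by (simp add: inner_add_right inner_commute algebra_simps)
    then show ?thesis using assms by (simp add: cis_mult add.commute)
  qed
  then show ?thesis by (simp add: FT_def mult.assoc)
qed

lemma FT_inversion_fun: "f \<in> schwartz \<Longrightarrow> \<bar>s\<bar> = 1 \<Longrightarrow> FT (- s) (FT s f) = f"
  by (rule ext) (rule FT_inversion)

text \<open>For spectra in a box of half-widths r the product of G and H has no frequency at
  non-zero multiples of the side lengths 2 r. Poisson summation with spacing pi / r therefore turns
  its integral into the sampled sum. The offset t is free, which later accommodates the translation
  part of T_j.\<close>

theorem sampling:
  fixes g :: "'n::finite functional" and h :: "real^'n \<Rightarrow> complex" and p r :: "'n \<Rightarrow> real"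
  defines "Bx \<equiv> {x. \<forall>i. \<bar>x $ i - p i\<bar> \<le> r i}"
  assumes g: "g \<in> dual schwartz" and h: "h \<in> schwartz" and r: "\<And>i. r i > 0"
    and sg: "dist_supp (dist_fourier g) \<subseteq> Bx" and sh: "fun_supp (fourier h) \<subseteq> Bx"
  obtains G where "slow G" "given_by g G"
    "\<And>t. sums_in schwartz (\<lambda>n. dist_of (\<lambda>x. complex_of_real (\<Prod>i\<in>UNIV. pi / r i) *
        G (t + vec_lambda (\<lambda>i. - (pi / r i) * of_int (n $ i))) *
        h (x - (t + vec_lambda (\<lambda>i. - (pi / r i) * of_int (n $ i)))))) UNIV (dist_of (dist_conv g h))"
proof -
  let ?c = "complex_of_real (FTc TYPE('n))"
  have c0: "?c \<noteq> 0" using FTc_pos[where 'n = 'n] by simp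
  define u where "u = dist_fourier g"
  have u: "u \<in> dual schwartz" unfolding u_def by (rule dual_dist_fourier[OF g])
  have ug: "u \<kappa> = g (FT (-1) \<kappa>)" for \<kappa> by (simp add: u_def dist_fourier_def fourier_FT)
  have closed: "closed Bx"
    unfolding Bx_def by (intro closed_Collect_all closed_Collect_le continuous_intros)
  have "norm x \<le> (\<Sum>i\<in>UNIV. \<bar>p i\<bar> + r i)" if "x \<in> Bx" for x
  proof -
    have "\<bar>x $ i\<bar> \<le> \<bar>p i\<bar> + r i" for i using that unfolding Bx_def by (smt (verit) mem_Collect_eq)
    then show ?thesis by (intro order_trans[OF norm_le_l1_cart] sum_mono) auto
  qed
  then obtain R where R: "\<And>x. x \<in> Bx \<Longrightarrow> norm x < R" "0 < R"
    using r by (intro that[of "1 + (\<Sum>i\<in>UNIV. \<bar>p i\<bar> + r i)"]) (smt (verit) sum_nonneg)+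
  obtain \<omega> :: "real^'n \<Rightarrow> complex" where \<omega>: "\<omega> \<in> schwartz" "\<And>x. x \<in> cball 0 R \<Longrightarrow> \<omega> x = 1"
    by (rule plateau[of R "R + 1" 0]) (use R(2) in auto)
  \<comment> \<open>1 - \<omega> vanishes on the ball of radius R, an open set that contains the
    support of u.\<close>
  have cut: "u (\<lambda>\<xi>. \<omega> \<xi> * \<kappa> \<xi>) = u \<kappa>" if \<kappa>: "\<kappa> \<in> schwartz" for \<kappa>
  proof -
    have S: "(\<lambda>\<xi>. \<omega> \<xi> * \<kappa> \<xi>) \<in> schwartz" by (rule schwartz_mult[OF \<omega>(1) \<kappa>])
    have "u (\<lambda>\<xi>. \<kappa> \<xi> - \<omega> \<xi> * \<kappa> \<xi>) = 0"
      by (rule dist_supp_vanish[OF u schwartz_diff[OF \<kappa> S], of "ball 0 R"])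
        (use sg R(1) in \<open>auto simp: u_def[symmetric] \<omega>(2)\<close>)
    then show ?thesis using dual_diff[OF u sw_subspace_schwartz \<kappa> S] by simp
  qed
  \<comment> \<open>By inversion and \<open>integral_wave\<close> this smooth function represents
    g.\<close>
  define G where "G = (\<lambda>x. ?c * wave u \<omega> x)"
  have G: "slow G" unfolding G_def by (intro slow_mult slow_const slow_wave u \<omega>(1))
  have gG: "g \<theta> = (LINT x|lborel. G x * \<theta> x)" if \<theta>: "\<theta> \<in> schwartz" for \<theta>
  proof -
    have \<theta>S: "FT 1 \<theta> \<in> schwartz" by (rule schwartz_FT[OF _ \<theta>]) simp
    have "g \<theta> = u (FT 1 \<theta>)" using FT_inversion_fun[OF \<theta>, of 1] by (simp add: ug)
    also have "\<dots> = u (\<lambda>\<xi>. \<omega> \<xi> * FT 1 \<theta> \<xi>)" by (rule cut[OF \<theta>S, symmetric])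
    also have "\<dots> = ?c * (LINT x|lborel. wave u \<omega> x * \<theta> x)" by (rule integral_wave[OF u \<omega>(1) \<theta>, symmetric])
    also have "\<dots> = (LINT x|lborel. G x * \<theta> x)" by (simp add: G_def mult.assoc)
    finally show ?thesis .
  qed
  have given: "given_by g G"
    unfolding given_by_def dist_of_def using gG dist_of_slow(2)[OF G] by auto
  define fh where "fh = FT (-1) h"
  have fh: "fh \<in> schwartz" unfolding fh_def by (rule schwartz_FT[OF _ h]) simp
  have fh_inv: "FT 1 fh = h" unfolding fh_def using FT_inversion_fun[OF h, of "-1"] by simp
  have fh0: "fh \<xi> = 0" if "\<xi> \<notin> Bx" for \<xi>
    using that sh fun_supp_notin[of \<xi> fh] by (auto simp: fh_def fourier_FT)
  have conv: "dist_conv g h = wave u fh"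
  proof
    fix x
    have "FT (-1) (\<lambda>\<xi>. fh \<xi> * cis (x \<bullet> \<xi>)) = (\<lambda>y. h (x - y))"
    proof
      fix y
      have "FT (-1) (\<lambda>\<xi>. fh \<xi> * cis (x \<bullet> \<xi>)) y = FT (-1) fh (- (x - y))"
        by (subst FT_modulate) simp_all
      then show "FT (-1) (\<lambda>\<xi>. fh \<xi> * cis (x \<bullet> \<xi>)) y = h (x - y)"
        by (simp only: FT_minus) (simp add: fh_inv)
    qed
    then show "dist_conv g h x = wave u fh x" by (simp add: dist_conv_def wave_def ug)
  qed
  \<comment> \<open>The negative sign yields the sample points in the form of the claim; only the
    modulus enters the cell volume.\<close>
  define c where "c = (\<lambda>i. - (pi / r i))"
  have cnz: "c i \<noteq> 0" for i using r[of i] by (simp add: c_def)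
  have absc: "(\<Prod>i\<in>UNIV. \<bar>c i\<bar>) = (\<Prod>i\<in>UNIV. pi / r i)"
    using r by (intro prod.cong refl) (simp add: c_def abs_of_pos)
  have cpos: "(\<Prod>i\<in>UNIV. \<bar>c i\<bar>) > 0" using cnz by (intro prod_pos) simp
  have sums: "sums_in schwartz (\<lambda>n. dist_of (\<lambda>x. complex_of_real (\<Prod>i\<in>UNIV. \<bar>c i\<bar>) *
        G (t + vec_lambda (\<lambda>i. c i * of_int (n $ i))) *
        h (x - (t + vec_lambda (\<lambda>i. c i * of_int (n $ i)))))) UNIV (dist_of (dist_conv g h))" for t
    unfolding sums_in_def
  proof (intro conjI ballI)
    show "dist_of (dist_conv g h) \<in> dual schwartz"
      unfolding conv by (rule dist_of_slow(1)[OF slow_wave[OF u fh]])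
    fix \<theta> :: "real^'n \<Rightarrow> complex" assume \<theta>: "\<theta> \<in> schwartz"
    have \<theta>S: "FT 1 \<theta> \<in> schwartz" by (rule schwartz_FT[OF _ \<theta>]) simp
    define X where "X = (\<lambda>\<xi>. fh \<xi> * FT 1 \<theta> \<xi>)"
    have X: "X \<in> schwartz" unfolding X_def by (rule schwartz_mult[OF fh \<theta>S])
    \<comment> \<open>Up to the constant, H y is the integral of h (x - y) against \<theta>, so
      testing the convolution with \<theta> amounts to applying g to H.\<close>
    define H where "H = FT (-1) X"
    have H: "H \<in> schwartz" unfolding H_def by (rule schwartz_FT[OF _ X]) simp
    have HX: "FT 1 H = X" unfolding H_def using FT_inversion_fun[OF X, of "-1"] by simp
    have H_eq: "H y = ?c * (LINT x|lborel. h (x - y) * \<theta> x)" for y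
    proof -
      have e: "FT 1 (\<lambda>\<xi>. fh \<xi> * cis ((- y) \<bullet> \<xi>)) x = h (x - y)" for x
        by (subst FT_modulate) (simp_all add: fh_inv)
      have "(LINT x|lborel. h (x - y) * \<theta> x) = (LINT \<xi>|lborel. (fh \<xi> * cis ((- y) \<bullet> \<xi>)) * FT 1 \<theta> \<xi>)"
        unfolding e[symmetric]
        by (rule FT_duality[OF schwartz_integrable[OF schwartz_cis[OF fh]] schwartz_integrable[OF \<theta>]])
      also have "\<dots> = (LINT \<xi>|lborel. X \<xi> * cis (- 1 * (\<xi> \<bullet> y)))"
        by (simp add: X_def inner_commute mult_ac)
      finally show ?thesis by (simp only: H_def FT_def FTc_def)
    qed
    define F where "F = (\<lambda>x. G x * H x)"
    have F: "F \<in> schwartz" unfolding F_def by (rule schwartz_slow_mult[OF G H])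
    have target: "dist_of (dist_conv g h) \<theta> = (LINT x|lborel. F x) / ?c"
    proof -
      have "?c * dist_of (dist_conv g h) \<theta> = u X"
        unfolding dist_of_def conv X_def by (rule integral_wave[OF u fh \<theta>])
      also have "\<dots> = g H" by (simp add: ug H_def)
      also have "\<dots> = (LINT x|lborel. F x)" unfolding F_def by (rule gG[OF H])
      finally show ?thesis using c0 by (simp add: field_simps)
    qed
    have orth: "(LINT x|lborel. F x * cis (2 * pi * (lattice_vec m \<bullet> vec_lambda (\<lambda>i. x $ i / c i)))) = 0" if m: "m \<noteq> 0" for m
    proof -
      \<comment> \<open>The frequency dual to the spacing pi / r: a multiple of the full side length
        in each coordinate.\<close>
      define \<zeta> where "\<zeta> = (vec_lambda (\<lambda>i. 2 * r i * of_int (m $ i)) :: real^'n)"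
      obtain k where k: "m $ k \<noteq> 0" using m by (auto simp: vec_eq_iff)
      have ph: "2 * pi * (lattice_vec m \<bullet> vec_lambda (\<lambda>i. x $ i / c i)) = - 1 * (x \<bullet> \<zeta>)" for x
      proof -
        have "2 * pi * (of_int (m $ i) * (x $ i / c i)) = - (x $ i * (2 * r i * of_int (m $ i)))" for i
          using r[of i] by (simp add: c_def)
        then show ?thesis
          by (simp add: inner_vec_def sum_distrib_left \<zeta>_def sum_negf)
      qed
      \<comment> \<open>At \<tau> = 1 the box and its translate may share a face. For \<tau> > 1
        they are disjoint, because in coordinate k they are shifted by more than 2 r k; then the
        shifted X vanishes on a neighbourhood of the support of u.\<close>
      have van: "FT (-1) F (\<tau> *\<^sub>R \<zeta>) = 0" if \<tau>: "\<tau> > 1" for \<tau>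
      proof -
        define HH where "HH = (\<lambda>x. H x * cis ((- \<tau> *\<^sub>R \<zeta>) \<bullet> x))"
        have HH: "HH \<in> schwartz" unfolding HH_def by (rule schwartz_cis[OF H])
        have HHS: "FT 1 HH \<in> schwartz" by (rule schwartz_FT[OF _ HH]) simp
        have FHH: "FT 1 HH \<xi> = X (\<xi> - \<tau> *\<^sub>R \<zeta>)" for \<xi>
          unfolding HH_def by (subst FT_modulate) (simp_all add: HX)
        have "(LINT x|lborel. F x * cis (-1 * (x \<bullet> (\<tau> *\<^sub>R \<zeta>)))) = (LINT x|lborel. G x * HH x)"
          by (simp add: F_def HH_def inner_commute mult.assoc)
        also have "\<dots> = g HH" by (rule gG[OF HH, symmetric])
        also have "\<dots> = u (FT 1 HH)" using FT_inversion_fun[OF HH, of 1] by (simp add: ug)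
        also have "\<dots> = 0"
        proof (rule dist_supp_vanish[OF u HHS])
          show "open {\<xi>. \<xi> - \<tau> *\<^sub>R \<zeta> \<notin> Bx}"
          proof -
            have "open ((\<lambda>\<xi>. \<xi> - \<tau> *\<^sub>R \<zeta>) -` (- Bx))"
              using closed by (intro open_vimage continuous_intros) (simp add: open_Compl)
            then show ?thesis by (simp add: vimage_def)
          qed
          show "dist_supp u \<subseteq> {\<xi>. \<xi> - \<tau> *\<^sub>R \<zeta> \<notin> Bx}"
          proof
            fix \<xi> assume "\<xi> \<in> dist_supp u"
            then have "\<xi> \<in> Bx" using sg by (auto simp: u_def)
            show "\<xi> \<in> {\<xi>. \<xi> - \<tau> *\<^sub>R \<zeta> \<notin> Bx}"
            proof (rule ccontr)
              assume "\<not> ?thesis"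
              then have "\<xi> - \<tau> *\<^sub>R \<zeta> \<in> Bx" by simp
              with \<open>\<xi> \<in> Bx\<close> have "\<bar>\<xi> $ k - p k\<bar> \<le> r k" "\<bar>(\<xi> - \<tau> *\<^sub>R \<zeta>) $ k - p k\<bar> \<le> r k"
                unfolding Bx_def by blast+
              then have "\<bar>\<tau> * (2 * r k * of_int (m $ k))\<bar> \<le> 2 * r k" by (simp add: \<zeta>_def)
              then have "(2 * r k) * (\<tau> * \<bar>of_int (m $ k)\<bar>) \<le> (2 * r k) * 1"
                using \<tau> r[of k] by (simp add: abs_mult mult_ac)
              then have "\<tau> * \<bar>of_int (m $ k)\<bar> \<le> 1" using r[of k] by (simp only: mult_le_cancel_left_pos)
              moreover have "1 \<le> \<bar>real_of_int (m $ k)\<bar>" using k by linarith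
              then have "\<tau> * 1 \<le> \<tau> * \<bar>of_int (m $ k)\<bar>" using \<tau> by (intro mult_left_mono) auto
              ultimately show False using \<tau> by simp
            qed
          qed
          fix \<xi> assume "\<xi> \<in> {\<xi>. \<xi> - \<tau> *\<^sub>R \<zeta> \<notin> Bx}"
          then show "FT 1 HH \<xi> = 0" using fh0 by (simp add: FHH X_def)
        qed
        finally show ?thesis by (simp add: FT_def)
      qed
      \<comment> \<open>The case of a shared face follows by letting \<tau> decrease to 1, the
        transform of the Schwartz function F being continuous.\<close>
      have "continuous_on UNIV (\<lambda>\<tau>. FT (-1) F (\<tau> *\<^sub>R \<zeta>))"
        by (rule continuous_on_compose2[OF smooth_continuous0[OF smooth_FT[OF F]] _ subset_UNIV]) (intro continuous_intros)
      then have "((\<lambda>\<tau>. FT (-1) F (\<tau> *\<^sub>R \<zeta>)) \<longlongrightarrow> FT (-1) F (1 *\<^sub>R \<zeta>)) (at 1)"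
        unfolding continuous_on_eq_continuous_at[OF open_UNIV] isCont_def by blast
      then have "((\<lambda>\<tau>. FT (-1) F (\<tau> *\<^sub>R \<zeta>)) \<longlongrightarrow> FT (-1) F (1 *\<^sub>R \<zeta>)) (at_right 1)"
        by (rule Lim_at_imp_Lim_at_within)
      moreover have "((\<lambda>\<tau>. FT (-1) F (\<tau> *\<^sub>R \<zeta>)) \<longlongrightarrow> 0) (at_right 1)"
        by (rule tendsto_eventually) (auto simp: eventually_at_right_less van intro!: eventually_at_rightI[of 1 2])
      ultimately have "FT (-1) F \<zeta> = 0"
        using tendsto_unique[OF trivial_limit_at_right_real] by fastforce
      then show ?thesis unfolding ph using c0 by (simp add: FT_def FTc_def)
    qed
    let ?y = "\<lambda>n. t + vec_lambda (\<lambda>i. c i * of_int (n $ i))"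
    have "((\<lambda>n. F (?y n)) has_sum ((LINT x|lborel. F x) /\<^sub>R (\<Prod>i\<in>UNIV. \<bar>c i\<bar>))) UNIV"
      using has_sum_Zn(1)[OF integrable_schwartz_lattice[of F c t, OF F cnz]] poisson_diag[of F c t, OF F cnz orth] by simp
    from has_sum_cmult_right[OF this, of "complex_of_real (\<Prod>i\<in>UNIV. \<bar>c i\<bar>) / ?c"]
    have "((\<lambda>n. complex_of_real (\<Prod>i\<in>UNIV. \<bar>c i\<bar>) / ?c * F (?y n)) has_sum dist_of (dist_conv g h) \<theta>) UNIV"
    proof -
      have "complex_of_real q / ?c * ((LINT x|lborel. F x) /\<^sub>R q) = dist_of (dist_conv g h) \<theta>" if "q > 0" for q
        using that by (simp add: target scaleR_conv_of_real)
      from this[OF cpos] show ?thesis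
        using \<open>((\<lambda>n. complex_of_real (\<Prod>i\<in>UNIV. \<bar>c i\<bar>) / ?c * F (?y n)) has_sum _) UNIV\<close> by (simp only:)
    qed
    moreover have "dist_of (\<lambda>x. complex_of_real (\<Prod>i\<in>UNIV. \<bar>c i\<bar>) * G (?y n) * h (x - ?y n)) \<theta>
        = complex_of_real (\<Prod>i\<in>UNIV. \<bar>c i\<bar>) / ?c * F (?y n)" for n
    proof -
      have "dist_of (\<lambda>x. complex_of_real (\<Prod>i\<in>UNIV. \<bar>c i\<bar>) * G (?y n) * h (x - ?y n)) \<theta>
          = complex_of_real (\<Prod>i\<in>UNIV. \<bar>c i\<bar>) * G (?y n) * (LINT x|lborel. h (x - ?y n) * \<theta> x)"
        unfolding dist_of_def mult.assoc by (simp only: integral_mult_right_zero)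
      then show ?thesis using c0 by (simp add: F_def H_eq)
    qed
    ultimately show "((\<lambda>n. dist_of (\<lambda>x. complex_of_real (\<Prod>i\<in>UNIV. \<bar>c i\<bar>) * G (?y n) * h (x - ?y n)) \<theta>) has_sum dist_of (dist_conv g h) \<theta>) UNIV"
      by (simp only:)
  qed
  show ?thesis
    by (rule that[OF G given]) (use sums in \<open>simp add: absc\<close>, simp add: c_def)
qed

section \<open>Schwartz functions whose Fourier transform is flat at the origin\<close>

lemma schwartz0_schwartz: "\<theta> \<in> schwartz0 \<Longrightarrow> \<theta> \<in> schwartz"
  by (simp add: schwartz0_def)

lemma schwartz0E:
  assumes "\<theta> \<in> schwartz0"
  obtains B where "\<And>\<beta> \<xi>. length \<beta> \<le> M \<Longrightarrow> \<xi> \<noteq> 0 \<Longrightarrow>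
    norm (iter_partial \<beta> (FT (-1) \<theta>) \<xi>) * (norm \<xi> ^ M + inverse (norm \<xi> ^ M)) \<le> B"
  using assms unfolding schwartz0_def fourier_FT by blast

lemma schwartz0I:
  assumes "\<theta> \<in> schwartz"
    "\<And>M. \<exists>B. \<forall>\<beta> \<xi>. length \<beta> \<le> M \<longrightarrow> \<xi> \<noteq> 0 \<longrightarrow>
      norm (iter_partial \<beta> (FT (-1) \<theta>) \<xi>) * (norm \<xi> ^ M + inverse (norm \<xi> ^ M)) \<le> B"
  shows "\<theta> \<in> schwartz0"
  using assms by (simp add: schwartz0_def fourier_FT)

lemma pw_nonneg: "0 \<le> norm \<xi> ^ M + inverse (norm \<xi> ^ M)"
  by simp

lemma sw_subspace_schwartz0: "sw_subspace (schwartz0 :: (real^'n::finite \<Rightarrow> complex) set)"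
  unfolding sw_subspace_def
proof (intro conjI ballI allI subsetI)
  show "(\<lambda>x. 0) \<in> (schwartz0 :: (real^'n \<Rightarrow> complex) set)"
  proof (rule schwartz0I)
    have z: "FT (-1) (\<lambda>x::real^'n. 0) = (\<lambda>x. 0)" by (simp add: FT_def fun_eq_iff)
    show "\<exists>B. \<forall>\<beta> \<xi>. length \<beta> \<le> M \<longrightarrow> \<xi> \<noteq> 0 \<longrightarrow>
      norm (iter_partial \<beta> (FT (-1) (\<lambda>x::real^'n. 0)) \<xi>) * (norm \<xi> ^ M + inverse (norm \<xi> ^ M)) \<le> B" for M
      unfolding z by auto
  qed simp
next
  fix f g :: "real^'n \<Rightarrow> complex" assume f: "f \<in> schwartz0" and g: "g \<in> schwartz0"
  note fS = schwartz0_schwartz[OF f] and gS = schwartz0_schwartz[OF g]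
  show "(\<lambda>x. f x + g x) \<in> schwartz0"
  proof (rule schwartz0I[OF schwartz_add[OF fS gS]])
    fix M
    obtain B where B: "\<And>\<beta> \<xi>. length \<beta> \<le> M \<Longrightarrow> \<xi> \<noteq> 0 \<Longrightarrow>
      norm (iter_partial \<beta> (FT (-1) f) \<xi>) * (norm \<xi> ^ M + inverse (norm \<xi> ^ M)) \<le> B"
      by (rule schwartz0E[OF f, of M]) blast
    obtain D where D: "\<And>\<beta> \<xi>. length \<beta> \<le> M \<Longrightarrow> \<xi> \<noteq> 0 \<Longrightarrow>
      norm (iter_partial \<beta> (FT (-1) g) \<xi>) * (norm \<xi> ^ M + inverse (norm \<xi> ^ M)) \<le> D"
      by (rule schwartz0E[OF g, of M]) blast
    have F: "FT (-1) (\<lambda>x. f x + g x) = (\<lambda>\<xi>. FT (-1) f \<xi> + FT (-1) g \<xi>)"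
      by (rule ext) (rule FT_add[OF fS gS])
    have "norm (iter_partial \<beta> (FT (-1) (\<lambda>x. f x + g x)) \<xi>) * (norm \<xi> ^ M + inverse (norm \<xi> ^ M)) \<le> B + D"
      if "length \<beta> \<le> M" "\<xi> \<noteq> 0" for \<beta> \<xi>
      using mult_right_mono[OF norm_triangle_ineq[of "iter_partial \<beta> (FT (-1) f) \<xi>" "iter_partial \<beta> (FT (-1) g) \<xi>"] pw_nonneg[of \<xi> M]]
        B[OF that] D[OF that]
      unfolding F iter_partial_add[OF smooth_FT[OF fS] smooth_FT[OF gS]] by (simp add: distrib_right)
    then show "\<exists>B. \<forall>\<beta> \<xi>. length \<beta> \<le> M \<longrightarrow> \<xi> \<noteq> 0 \<longrightarrow>
      norm (iter_partial \<beta> (FT (-1) (\<lambda>x. f x + g x)) \<xi>) * (norm \<xi> ^ M + inverse (norm \<xi> ^ M)) \<le> B" by blast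
  qed
next
  fix c and f :: "real^'n \<Rightarrow> complex" assume f: "f \<in> schwartz0"
  note fS = schwartz0_schwartz[OF f]
  show "(\<lambda>x. c * f x) \<in> schwartz0"
  proof (rule schwartz0I[OF schwartz_cmult[OF fS]])
    fix M
    obtain B where B: "\<And>\<beta> \<xi>. length \<beta> \<le> M \<Longrightarrow> \<xi> \<noteq> 0 \<Longrightarrow>
      norm (iter_partial \<beta> (FT (-1) f) \<xi>) * (norm \<xi> ^ M + inverse (norm \<xi> ^ M)) \<le> B"
      by (rule schwartz0E[OF f, of M]) blast
    have F: "FT (-1) (\<lambda>x. c * f x) = (\<lambda>\<xi>. c * FT (-1) f \<xi>)"
      by (rule ext) (rule FT_cmult)
    have "norm (iter_partial \<beta> (FT (-1) (\<lambda>x. c * f x)) \<xi>) * (norm \<xi> ^ M + inverse (norm \<xi> ^ M)) \<le> norm c * B"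
      if "length \<beta> \<le> M" "\<xi> \<noteq> 0" for \<beta> \<xi>
      using mult_left_mono[OF B[OF that], of "norm c"]
      unfolding F iter_partial_cmult[OF smooth_FT[OF fS]] by (simp add: norm_mult mult.assoc)
    then show "\<exists>B. \<forall>\<beta> \<xi>. length \<beta> \<le> M \<longrightarrow> \<xi> \<noteq> 0 \<longrightarrow>
      norm (iter_partial \<beta> (FT (-1) (\<lambda>x. c * f x)) \<xi>) * (norm \<xi> ^ M + inverse (norm \<xi> ^ M)) \<le> B" by blast
  qed
qed (rule schwartz0_schwartz)

text \<open>If \<kappa> vanishes near 0, the negative powers in the weight are bounded wherever they
  count, and Schwartz decay takes care of the positive ones.\<close>

lemma FT_in_schwartz0:
  fixes \<kappa> :: "real^'n::finite \<Rightarrow> complex"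
  assumes \<kappa>: "\<kappa> \<in> schwartz" and e: "0 < e" and 0: "\<And>\<xi>. norm \<xi> < e \<Longrightarrow> \<kappa> \<xi> = 0"
  shows "FT (-1) \<kappa> \<in> schwartz0"
proof (rule schwartz0I)
  show S: "FT (-1) \<kappa> \<in> schwartz" by (rule schwartz_FT[OF _ \<kappa>]) simp
  fix M
  define f where "f = FT (-1) (FT (-1) \<kappa>)"
  have f: "f \<in> schwartz" unfolding f_def by (rule schwartz_FT[OF _ S]) simp
  \<comment> \<open>Two transforms of the same sign compose to a reflection, which preserves balls
    around 0.\<close>
  have "f \<xi> = \<kappa> (- \<xi>)" for \<xi>
    using FT_minus[of 1 "FT (-1) \<kappa>" \<xi>] FT_inversion[OF \<kappa>, of "-1" "- \<xi>"] by (simp add: f_def)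
  then have f0: "iter_partial \<beta> f \<xi> = 0" if "norm \<xi> < e" for \<beta> \<xi>
    using that by (intro iter_partial_zero_open[of "ball 0 e"]) (auto intro: 0)
  have "norm (iter_partial \<beta> f \<xi>) * (norm \<xi> ^ M + inverse (norm \<xi> ^ M)) \<le> snorm M f + snorm M f * inverse (e ^ M)"
    if l: "length \<beta> \<le> M" for \<beta> \<xi>
  proof (cases "norm \<xi> < e")
    case True
    then show ?thesis using f0 snorm_nonneg[OF f] e by simp
  next
    case False
    have "norm (iter_partial \<beta> f \<xi>) * norm \<xi> ^ M \<le> norm (iter_partial \<beta> f \<xi>) * (1 + norm \<xi>) ^ M"
      by (intro mult_left_mono power_mono) auto
    also have "\<dots> \<le> snorm M f" using snorm_bound[OF f l, of \<xi>] by (simp add: mult.commute)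
    finally have 1: "norm (iter_partial \<beta> f \<xi>) * norm \<xi> ^ M \<le> snorm M f" .
    have "inverse (norm \<xi> ^ M) \<le> inverse (e ^ M)"
      using False e by (intro le_imp_inverse_le power_mono) auto
    then have "norm (iter_partial \<beta> f \<xi>) * inverse (norm \<xi> ^ M) \<le> snorm M f * inverse (e ^ M)"
      by (intro mult_mono norm_iter_partial_le_snorm[OF f l] snorm_nonneg[OF f]) auto
    with 1 show ?thesis by (simp add: distrib_left)
  qed
  then show "\<exists>B. \<forall>\<beta> \<xi>. length \<beta> \<le> M \<longrightarrow> \<xi> \<noteq> 0 \<longrightarrow>
      norm (iter_partial \<beta> (FT (-1) (FT (-1) \<kappa>)) \<xi>) * (norm \<xi> ^ M + inverse (norm \<xi> ^ M)) \<le> B"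
    unfolding f_def by blast
qed

text \<open>The weight forces the derivatives to be O(|\<xi>|^M) near 0, and continuity determines
  their value there. Passing to \<open>FT 1\<close> is only a reflection of the Fourier
  transform.\<close>

lemma schwartz0_flat:
  fixes \<theta> :: "real^'n::finite \<Rightarrow> complex"
  assumes \<theta>: "\<theta> \<in> schwartz0"
  shows "flat_at_0 k (FT 1 \<theta>)"
  unfolding flat_at_0_def
proof (intro allI impI)
  fix \<beta> :: "'n list"
  have S: "\<theta> \<in> schwartz" by (rule schwartz0_schwartz[OF \<theta>])
  define F where "F = FT (-1) \<theta>"
  have sF: "smooth F" unfolding F_def by (rule smooth_FT[OF S])
  have "FT 1 \<theta> = (\<lambda>\<xi>. F ((-1) *\<^sub>R \<xi>))"
    by (rule ext) (simp add: F_def FT_minus)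
  then have eq: "iter_partial \<beta> (FT 1 \<theta>) 0 = (-1) ^ length \<beta> *\<^sub>R iter_partial \<beta> F 0"
    by (simp only: iter_partial_scale[OF sF]) simp
  \<comment> \<open>The exponent must be positive and the order must admit \<beta> in the bound; the
    successor of its length does both.\<close>
  define M where "M = Suc (length \<beta>)"
  obtain B where B: "\<And>\<gamma> \<xi>. length \<gamma> \<le> M \<Longrightarrow> \<xi> \<noteq> 0 \<Longrightarrow>
    norm (iter_partial \<gamma> F \<xi>) * (norm \<xi> ^ M + inverse (norm \<xi> ^ M)) \<le> B"
    unfolding F_def by (rule schwartz0E[OF \<theta>, of M]) blast
  have le: "norm (iter_partial \<beta> F \<xi>) \<le> B * norm \<xi> ^ M" if "\<xi> \<noteq> 0" for \<xi>
  proof -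
    have "norm (iter_partial \<beta> F \<xi>) * inverse (norm \<xi> ^ M) \<le> B"
      using B[of \<beta> \<xi>] that mult_left_mono[of "inverse (norm \<xi> ^ M)" "norm \<xi> ^ M + inverse (norm \<xi> ^ M)" "norm (iter_partial \<beta> F \<xi>)"]
      by (simp add: M_def)
    then show ?thesis using that by (simp add: pos_divide_le_eq flip: divide_inverse)
  qed
  have "isCont (\<lambda>\<xi>. norm (iter_partial \<beta> F \<xi>)) 0"
    using smooth_continuous[OF sF, of UNIV \<beta>] by (intro continuous_intros) (simp add: continuous_on_eq_continuous_at)
  then have "((\<lambda>\<xi>. norm (iter_partial \<beta> F \<xi>)) \<longlongrightarrow> norm (iter_partial \<beta> F 0)) (at 0)"
    by (simp add: isCont_def)
  moreover have "((\<lambda>\<xi>::real^'n. B * norm \<xi> ^ M) \<longlongrightarrow> B * norm (0::real^'n) ^ M) (at 0)"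
    by (intro tendsto_mult tendsto_const tendsto_power) (rule tendsto_norm[OF tendsto_ident_at])
  moreover have "\<forall>\<^sub>F \<xi> in at 0. norm (iter_partial \<beta> F \<xi>) \<le> B * norm \<xi> ^ M"
    by (auto simp: eventually_at_filter le)
  ultimately have "norm (iter_partial \<beta> F 0) \<le> B * norm (0::real^'n) ^ M"
    by (intro tendsto_le[of "at (0::real^'n)"]) auto
  then show "iter_partial \<beta> (FT 1 \<theta>) 0 = 0" by (simp add: eq M_def)
qed

text \<open>The weight of \<open>schwartz0\<close> and of \<open>uniformly_moderate_growth\<close>,
  as a function of the norm.\<close>

definition pw :: "nat \<Rightarrow> real \<Rightarrow> real" where
  "pw M t = t ^ M + inverse (t ^ M)"

lemma pw_ge_1: "0 < t \<Longrightarrow> 1 \<le> pw M t"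
proof (cases "t \<ge> 1")
  case True
  then have "1 \<le> t ^ M" by (rule one_le_power)
  then show ?thesis using True by (simp add: pw_def add_increasing2)
next
  case False
  assume "0 < t"
  then have "t ^ M \<le> 1" using False by (intro power_le_one) auto
  then have "1 \<le> inverse (t ^ M)" using \<open>0 < t\<close> by (intro one_le_inverse) auto
  then show ?thesis using \<open>0 < t\<close> by (simp add: pw_def add_increasing)
qed

lemma pw_mono:
  assumes t: "0 < t" and le: "M \<le> L"
  shows "pw M t \<le> 2 * pw L t"
proof (cases "t \<ge> 1")
  case True
  have "t ^ M \<le> t ^ L" using True le by (intro power_increasing)
  moreover have "inverse (t ^ M) \<le> 1" using True by (simp add: inverse_le_1_iff)
  moreover have "1 \<le> t ^ L" using True by (rule one_le_power)
  moreover have "0 \<le> inverse (t ^ L)" using t by simp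
  ultimately show ?thesis unfolding pw_def by argo
next
  case False
  have "inverse (t ^ M) \<le> inverse (t ^ L)" using False le t by (intro le_imp_inverse_le power_decreasing) auto
  moreover have "t ^ M \<le> 1" using False t by (intro power_le_one) auto
  moreover have "1 \<le> inverse (t ^ L)" using False t by (intro one_le_inverse power_le_one) auto
  moreover have "0 \<le> t ^ L" using t by simp
  ultimately show ?thesis unfolding pw_def by argo
qed

lemma pw_mult: "0 < t \<Longrightarrow> pw M t * pw M t \<le> 3 * pw (2 * M) t"
proof -
  assume t: "0 < t"
  have "t ^ (2 * M) = t ^ M * t ^ M" by (simp add: mult_2 power_add)
  then have "pw M t * pw M t = pw (2 * M) t + 2"
    using t by (simp add: pw_def algebra_simps)
  then show ?thesis using pw_ge_1[OF t, of "2 * M"] by simp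
qed

section \<open>Partitions of unity\<close>

text \<open>Isolates what the summation over j uses of the concrete covering: open sets off the
  origin with bounded overlap, carrying a square partition with controlled derivatives.\<close>

locale square_partition =
  fixes J :: "'j set" and Q :: "'j \<Rightarrow> (real^'n::finite) set" and \<phi> :: "'j \<Rightarrow> real^'n \<Rightarrow> real"
  assumes openQ: "\<And>j. j \<in> J \<Longrightarrow> open (Q j)"
    and adm: "admissible_covering J Q"
    and sw: "\<And>j. j \<in> J \<Longrightarrow> (\<lambda>\<xi>. complex_of_real (\<phi> j \<xi>)) \<in> schwartz"
    and suppQ: "\<And>j. j \<in> J \<Longrightarrow> fun_supp (\<phi> j) \<subseteq> Q j"
    and square: "\<And>\<xi>. \<xi> \<noteq> 0 \<Longrightarrow> ((\<lambda>j. (\<phi> j \<xi>)\<^sup>2) has_sum 1) J"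
    and growth: "uniformly_moderate_growth J \<phi>"
begin

definition sq :: "'j \<Rightarrow> real^'n \<Rightarrow> complex" where
  "sq j \<xi> = complex_of_real (\<phi> j \<xi>) * complex_of_real (\<phi> j \<xi>)"

definition sqs :: "'j set \<Rightarrow> real^'n \<Rightarrow> complex" where
  "sqs E \<xi> = (\<Sum>j\<in>E. sq j \<xi>)"

lemma sq_schwartz: "j \<in> J \<Longrightarrow> sq j \<in> schwartz"
  unfolding sq_def[abs_def] by (intro schwartz_mult sw)

lemma sqs_schwartz: "E \<subseteq> J \<Longrightarrow> sqs E \<in> schwartz"
  unfolding sqs_def[abs_def] by (intro schwartz_sum sq_schwartz) auto

lemma phi_zero: "j \<in> J \<Longrightarrow> \<xi> \<notin> Q j \<Longrightarrow> \<phi> j \<xi> = 0"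
  using suppQ fun_supp_notin by blast

lemma sq_iter_zero:
  assumes "j \<in> J" "\<xi> \<notin> Q j"
  shows "iter_partial \<beta> (sq j) \<xi> = 0"
proof (rule iter_partial_zero_open[of "- fun_supp (\<phi> j)"])
  show "sq j y = 0" if "y \<in> - fun_supp (\<phi> j)" for y
    using that fun_supp_notin[of y "\<phi> j"] by (simp add: sq_def)
qed (use assms suppQ closed_fun_supp in auto)

lemma Q_nonzero: "j \<in> J \<Longrightarrow> 0 \<notin> Q j"
  using adm unfolding admissible_covering_def by blast

lemma Q_cover: "\<xi> \<noteq> 0 \<Longrightarrow> \<exists>j\<in>J. \<xi> \<in> Q j"
  using adm unfolding admissible_covering_def by blast

lemma overlap:
  obtains N where "\<And>j. j \<in> J \<Longrightarrow> finite {i\<in>J. Q i \<inter> Q j \<noteq> {}} \<and> card {i\<in>J. Q i \<inter> Q j \<noteq> {}} \<le> N"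
  using adm unfolding admissible_covering_def by blast

text \<open>Squaring multiplies two growth bounds, which doubles the exponent of the weight.\<close>

lemma sq_bound:
  obtains L A where "0 \<le> A" "\<And>j \<beta> \<xi>. j \<in> J \<Longrightarrow> length \<beta> \<le> K \<Longrightarrow> \<xi> \<noteq> 0 \<Longrightarrow> norm (iter_partial \<beta> (sq j) \<xi>) \<le> A * pw L (norm \<xi>)"
proof -
  define S where "S = {\<beta> :: 'n list. length \<beta> \<le> K}"
  have finS: "finite S" unfolding S_def by (rule finite_lists_le)
  have "\<forall>\<beta>. \<exists>(M::nat) B. \<forall>j\<in>J. \<forall>\<xi>. \<xi> \<noteq> 0 \<longrightarrow> \<bar>iter_partial \<beta> (\<phi> j) \<xi>\<bar> \<le> B * pw M (norm \<xi>)"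
    using growth by (simp add: uniformly_moderate_growth_def pw_def)
  then obtain M B where MB: "\<And>\<beta> j \<xi>. j \<in> J \<Longrightarrow> \<xi> \<noteq> 0 \<Longrightarrow> \<bar>iter_partial \<beta> (\<phi> j) \<xi>\<bar> \<le> B \<beta> * pw (M \<beta>) (norm \<xi>)"
    by metis
  define L where "L = (\<Sum>\<beta>\<in>S. M \<beta>)"
  define A where "A = (\<Sum>\<beta>\<in>S. 2 * \<bar>B \<beta>\<bar>)"
  have A0: "0 \<le> A" unfolding A_def by (intro sum_nonneg) auto
  have phi: "norm (iter_partial \<beta> (\<lambda>\<xi>. complex_of_real (\<phi> j \<xi>)) \<xi>) \<le> A * pw L (norm \<xi>)"
    if j: "j \<in> J" and l: "length \<beta> \<le> K" and \<xi>: "\<xi> \<noteq> 0" for j \<beta> \<xi>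
  proof -
    have "smooth (\<lambda>\<xi>. Re (complex_of_real (\<phi> j \<xi>)))"
      by (rule smooth_bounded_linear[OF bounded_linear_Re schwartz_smooth[OF sw[OF j]]])
    then have "smooth (\<phi> j)" by simp
    then have "norm (iter_partial \<beta> (\<lambda>\<xi>. complex_of_real (\<phi> j \<xi>)) \<xi>) = \<bar>iter_partial \<beta> (\<phi> j) \<xi>\<bar>"
      by (simp add: iter_partial_bounded_linear[OF bounded_linear_of_real])
    also have "\<dots> \<le> B \<beta> * pw (M \<beta>) (norm \<xi>)" by (rule MB[OF j \<xi>])
    also have "\<dots> \<le> \<bar>B \<beta>\<bar> * (2 * pw L (norm \<xi>))"
    proof (intro mult_mono pw_mono)
      show "M \<beta> \<le> L" unfolding L_def using l finS by (intro member_le_sum) (auto simp: S_def)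
    qed (use \<xi> in \<open>auto simp: pw_def\<close>)
    also have "\<dots> \<le> A * pw L (norm \<xi>)"
    proof -
      have "2 * \<bar>B \<beta>\<bar> \<le> A" unfolding A_def using l finS by (intro member_le_sum) (auto simp: S_def)
      then have "2 * \<bar>B \<beta>\<bar> * pw L (norm \<xi>) \<le> A * pw L (norm \<xi>)"
        by (rule mult_right_mono) (simp add: pw_def)
      then show ?thesis by (simp add: mult_ac)
    qed
    finally show ?thesis .
  qed
  have "norm (iter_partial \<beta> (sq j) \<xi>) \<le> (2 ^ K * (A * A * 3)) * pw (2 * L) (norm \<xi>)"
    if j: "j \<in> J" and l: "length \<beta> \<le> K" and \<xi>: "\<xi> \<noteq> 0" for j \<beta> \<xi>
  proof -
    note s = schwartz_smooth[OF sw[OF j]]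
    have pn: "0 \<le> pw L (norm \<xi>)" for L by (simp add: pw_def)
    have "norm (iter_partial \<beta> (\<lambda>\<xi>. complex_of_real (\<phi> j \<xi>) * complex_of_real (\<phi> j \<xi>)) \<xi>)
        \<le> 2 ^ length \<beta> * ((A * pw L (norm \<xi>)) * (A * pw L (norm \<xi>)))"
      using l j \<xi> A0 pn by (intro norm_iter_partial_mult_le[OF s s] mult_mono phi) auto
    also have "\<dots> \<le> 2 ^ K * ((A * pw L (norm \<xi>)) * (A * pw L (norm \<xi>)))"
      using l A0 pn by (intro mult_right_mono power_increasing) auto
    also have "\<dots> = 2 ^ K * (A * A) * (pw L (norm \<xi>) * pw L (norm \<xi>))" by (simp add: mult_ac)
    also have "\<dots> \<le> 2 ^ K * (A * A) * (3 * pw (2 * L) (norm \<xi>))"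
      using A0 \<xi> by (intro mult_left_mono pw_mult) auto
    finally show ?thesis by (simp add: sq_def[abs_def] mult_ac)
  qed
  then show ?thesis using that[of "2 ^ K * (A * A * 3)" "2 * L"] A0 by simp
qed

text \<open>At a point of \<open>Q j0\<close> only the at most N sets that meet \<open>Q j0\<close>
  contribute, so the bound is independent of E.\<close>

lemma sqs_bound:
  obtains L A where "0 \<le> A" "\<And>E \<beta> \<xi>. finite E \<Longrightarrow> E \<subseteq> J \<Longrightarrow> length \<beta> \<le> K \<Longrightarrow> \<xi> \<noteq> 0 \<Longrightarrow>
    norm (iter_partial \<beta> (sqs E) \<xi>) \<le> A * pw L (norm \<xi>)"
proof -
  obtain L A where A: "0 \<le> A" "\<And>j \<beta> \<xi>. j \<in> J \<Longrightarrow> length \<beta> \<le> K \<Longrightarrow> \<xi> \<noteq> 0 \<Longrightarrow> norm (iter_partial \<beta> (sq j) \<xi>) \<le> A * pw L (norm \<xi>)"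
    by (rule sq_bound[of K]) blast
  obtain N where N: "\<And>j. j \<in> J \<Longrightarrow> finite {i\<in>J. Q i \<inter> Q j \<noteq> {}} \<and> card {i\<in>J. Q i \<inter> Q j \<noteq> {}} \<le> N"
    by (rule overlap) blast
  have "norm (iter_partial \<beta> (sqs E) \<xi>) \<le> (real N * A) * pw L (norm \<xi>)"
    if E: "finite E" "E \<subseteq> J" and l: "length \<beta> \<le> K" and \<xi>: "\<xi> \<noteq> 0" for E \<beta> \<xi>
  proof -
    obtain j0 where j0: "j0 \<in> J" "\<xi> \<in> Q j0" using Q_cover[OF \<xi>] by blast
    define F where "F = {j\<in>E. \<xi> \<in> Q j}"
    have sub: "F \<subseteq> {i\<in>J. Q i \<inter> Q j0 \<noteq> {}}" using E j0 by (auto simp: F_def)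
    have cF: "card F \<le> N"
      using card_mono[OF _ sub] N[OF j0(1)] by simp
    have "iter_partial \<beta> (sqs E) \<xi> = (\<Sum>j\<in>E. iter_partial \<beta> (sq j) \<xi>)"
      unfolding sqs_def[abs_def] using E by (subst iter_partial_sum) (auto intro!: schwartz_smooth sq_schwartz)
    also have "\<dots> = (\<Sum>j\<in>F. iter_partial \<beta> (sq j) \<xi>)"
      using E by (intro sum.mono_neutral_right) (auto simp: F_def intro: sq_iter_zero)
    also have "norm \<dots> \<le> (\<Sum>j\<in>F. A * pw L (norm \<xi>))"
      using E l \<xi> by (intro sum_norm_le A(2)) (auto simp: F_def)
    also have "\<dots> = real (card F) * (A * pw L (norm \<xi>))" by simp
    also have "\<dots> \<le> real N * (A * pw L (norm \<xi>))"
      using cF A(1) by (intro mult_right_mono) (auto simp: pw_def)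
    finally show ?thesis by (simp add: mult.assoc)
  qed
  then show ?thesis using that[of "real N * A" L] A(1) by simp
qed

lemma sqs_eq_1:
  assumes i: "i \<in> J" and \<xi>: "\<xi> \<in> Q i" and E: "finite E" "E \<subseteq> J" "{j\<in>J. Q j \<inter> Q i \<noteq> {}} \<subseteq> E"
  shows "sqs E \<xi> = 1"
proof -
  have "\<xi> \<noteq> 0" using \<xi> Q_nonzero[OF i] by auto
  have "((\<lambda>j. (\<phi> j \<xi>)\<^sup>2) has_sum 1) E"
  proof (rule has_sum_cong_neutral[THEN iffD1, OF _ _ _ square[OF \<open>\<xi> \<noteq> 0\<close>]])
    fix j assume "j \<in> J - E"
    then have "\<xi> \<notin> Q j" using E(3) \<xi> by auto
    then show "(\<phi> j \<xi>)\<^sup>2 = 0" using phi_zero[of j \<xi>] \<open>j \<in> J - E\<close> by simp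
  qed (use E in auto)
  then have "(\<Sum>j\<in>E. (\<phi> j \<xi>)\<^sup>2) = 1"
    using has_sum_finite[OF E(1), of "\<lambda>j. (\<phi> j \<xi>)\<^sup>2"] has_sum_unique by blast
  moreover have "sqs E \<xi> = complex_of_real (\<Sum>j\<in>E. (\<phi> j \<xi>)\<^sup>2)"
    by (simp add: sqs_def sq_def power2_eq_square)
  ultimately show ?thesis by simp
qed

text \<open>Near 0 flatness to order L + M leaves t^(L+1) against the t^(-L) of the multiplier,
  where t = norm \<xi>; at infinity one spare order of the seminorm has the same effect. The
  surviving factor t / (1 + t)^2 is small at both ends, which lets equality on annuli imply
  convergence in the seminorm.\<close>

lemma flat_mult_bound:
  fixes D \<psi> :: "real^'n \<Rightarrow> complex"
  assumes D: "smooth D" and A: "0 \<le> A" "\<And>\<gamma>. length \<gamma> \<le> M \<Longrightarrow> norm (iter_partial \<gamma> D \<xi>) \<le> A * pw L (norm \<xi>)"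
    and \<psi>: "\<psi> \<in> schwartz" "flat_at_0 (L + M) \<psi>" and l: "length \<beta> \<le> M" and \<xi>: "\<xi> \<noteq> 0"
  shows "(1 + norm \<xi>) ^ M * norm (iter_partial \<beta> (\<lambda>\<xi>. D \<xi> * \<psi> \<xi>) \<xi>)
    \<le> (2 ^ M * 2 ^ M * 8 * A * real CARD('n) ^ (L + M + 1)) * snorm (L + M + 1) \<psi> * (norm \<xi> / (1 + norm \<xi>)\<^sup>2)"
proof -
  let ?d = "real CARD('n)" and ?S = "snorm (L + M + 1) \<psi>" and ?t = "norm \<xi>"
  have d1: "1 \<le> ?d" by (simp add: Suc_le_eq)
  have S0: "0 \<le> ?S" by (rule snorm_nonneg[OF \<psi>(1)])
  have t: "0 < ?t" using \<xi> by simp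
  have dp: "1 \<le> ?d ^ (L + M + 1)" using d1 by (rule one_le_power)
  have pn: "0 \<le> pw L ?t" by (simp add: pw_def)
  show ?thesis
  proof (cases "?t \<le> 1")
    case True
    have pl: "pw L ?t \<le> 2 * inverse (?t ^ L)"
    proof -
      have "?t ^ L \<le> 1" using True t by (intro power_le_one) auto
      moreover have "1 \<le> inverse (?t ^ L)" using True t by (intro one_le_inverse power_le_one) auto
      ultimately show ?thesis unfolding pw_def by argo
    qed
    have \<delta>: "norm (iter_partial \<delta> \<psi> \<xi>) \<le> ?d ^ (L + M + 1) * ?t ^ (L + 1) * ?S" if "length \<delta> \<le> M" for \<delta>
    proof -
      \<comment> \<open>The available power of t shrinks with the number of derivatives falling on
        \<psi>; even for M of them L + 1 powers remain.\<close>
      define j where "j = Suc (L + M) - length \<delta>"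
      have j: "length \<delta> + j = Suc (L + M)" "L + 1 \<le> j" "j \<le> L + M + 1" using that by (auto simp: j_def)
      have "norm (iter_partial \<delta> \<psi> \<xi>) \<le> (?d * ?t) ^ j * snorm (Suc (L + M)) \<psi>"
        by (rule flat_bound[OF \<psi> j(1)])
      also have "(?d * ?t) ^ j \<le> ?d ^ (L + M + 1) * ?t ^ (L + 1)"
        unfolding power_mult_distrib using j d1 True t
        by (intro mult_mono power_increasing power_decreasing) auto
      finally show ?thesis using S0 by (simp add: mult_right_mono)
    qed
    have "norm (iter_partial \<beta> (\<lambda>\<xi>. D \<xi> * \<psi> \<xi>) \<xi>) \<le> 2 ^ length \<beta> * ((A * pw L ?t) * (?d ^ (L + M + 1) * ?t ^ (L + 1) * ?S))"
      using l A pn S0 d1 t by (intro norm_iter_partial_mult_le[OF D schwartz_smooth[OF \<psi>(1)]] mult_mono A(2) \<delta>) auto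
    also have "\<dots> \<le> 2 ^ M * ((A * (2 * inverse (?t ^ L))) * (?d ^ (L + M + 1) * ?t ^ (L + 1) * ?S))"
    proof (rule mult_mono)
      show "A * pw L ?t * (?d ^ (L + M + 1) * ?t ^ (L + 1) * ?S)
          \<le> A * (2 * inverse (?t ^ L)) * (?d ^ (L + M + 1) * ?t ^ (L + 1) * ?S)"
        using S0 by (intro mult_right_mono[OF mult_left_mono[OF pl A(1)]]) auto
    qed (use l A(1) pn S0 in auto)
    also have "\<dots> = 2 ^ M * (2 * A * ?d ^ (L + M + 1) * ?S * ?t)"
      using t by (simp add: divide_inverse)
    finally have "(1 + ?t) ^ M * norm (iter_partial \<beta> (\<lambda>\<xi>. D \<xi> * \<psi> \<xi>) \<xi>) \<le> 2 ^ M * (2 ^ M * (2 * A * ?d ^ (L + M + 1) * ?S * ?t))"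
      using True t by (intro mult_mono power_mono) auto
    also have "\<dots> = (2 ^ M * 2 ^ M * 2 * A * ?d ^ (L + M + 1) * ?S) * ?t" by (simp add: mult_ac)
    also have "\<dots> \<le> (2 ^ M * 2 ^ M * 2 * A * ?d ^ (L + M + 1) * ?S) * (4 * (?t / (1 + ?t)\<^sup>2))"
    proof (rule mult_left_mono)
      have "(1 + ?t)\<^sup>2 \<le> 2\<^sup>2" using True by (intro power_mono) auto
      then have "?t * (1 + ?t)\<^sup>2 \<le> ?t * 4" by (intro mult_left_mono) auto
      moreover have "0 < (1 + ?t)\<^sup>2" by (intro zero_less_power add_pos_nonneg) auto
      ultimately show "?t \<le> 4 * (?t / (1 + ?t)\<^sup>2)" by (simp add: pos_le_divide_eq mult.commute)
    qed (use A(1) S0 d1 in auto)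
    finally show ?thesis by (simp add: mult_ac)
  next
    case False
    have pl: "pw L ?t \<le> 2 * (1 + ?t) ^ L"
    proof -
      have "?t ^ L \<le> (1 + ?t) ^ L" by (intro power_mono) auto
      moreover have "inverse (?t ^ L) \<le> 1" using False by (simp add: inverse_le_1_iff)
      moreover have "1 \<le> (1 + ?t) ^ L" by (intro one_le_power) auto
      ultimately show ?thesis unfolding pw_def by argo
    qed
    have "(1 + ?t) ^ M * norm (iter_partial \<beta> (\<lambda>\<xi>. D \<xi> * \<psi> \<xi>) \<xi>) \<le> 2 ^ length \<beta> * ((2 * A) * (?S / (1 + ?t)))"
    proof (rule weighted_mult_bound[where m = L, OF D schwartz_smooth[OF \<psi>(1)]])
      show "0 \<le> 2 * A" using A(1) by simp
      show "norm (iter_partial \<gamma> D \<xi>) \<le> 2 * A * (1 + ?t) ^ L" if "length \<gamma> \<le> length \<beta>" for \<gamma>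
        using A(2)[of \<gamma>] mult_left_mono[OF pl A(1)] that l by simp
      show "(1 + ?t) ^ (M + L) * norm (iter_partial \<delta> \<psi> \<xi>) \<le> ?S / (1 + ?t)" if "length \<delta> \<le> length \<beta>" for \<delta>
        using snorm_bound[OF \<psi>(1), of \<delta> "L + M + 1" \<xi>] that l
        by (simp add: pos_le_divide_eq add_pos_nonneg add.commute[of M] mult_ac)
    qed
    also have "\<dots> \<le> 2 ^ M * ((2 * A) * (?S / (1 + ?t)))"
      using l A(1) S0 by (intro mult_right_mono power_increasing) auto
    also have "\<dots> \<le> 2 ^ M * ((2 * A) * (?S * (2 * (?t / (1 + ?t)\<^sup>2))))"
    proof (intro mult_left_mono)
      have "1 / (1 + ?t) \<le> 2 * (?t / (1 + ?t)\<^sup>2)"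
      proof -
        have "(1 + ?t) * (1 + ?t) \<le> (2 * ?t) * (1 + ?t)" using False by (intro mult_right_mono) auto
        then show ?thesis using False by (simp add: divide_simps power2_eq_square add_nonneg_eq_0_iff)
      qed
      from mult_left_mono[OF this S0] show "?S / (1 + ?t) \<le> ?S * (2 * (?t / (1 + ?t)\<^sup>2))" by simp
    qed (use A(1) in auto)
    also have "\<dots> = (2 ^ M * 1 * 4 * A * 1) * ?S * (?t / (1 + ?t)\<^sup>2)" by simp
    also have "\<dots> \<le> (2 ^ M * 2 ^ M * 8 * A * ?d ^ (L + M + 1)) * ?S * (?t / (1 + ?t)\<^sup>2)"
      using A(1) S0 dp by (intro mult_right_mono mult_mono) auto
    finally show ?thesis .
  qed
qed

end

text \<open>Bounds for all finite subsums control the positive and the negative terms separately,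
  for real and imaginary parts: 2 B each, 4 B in total.\<close>

lemma bounded_sums_imp_abs_summable:
  fixes a :: "'a \<Rightarrow> complex"
  assumes B: "\<And>E. finite E \<Longrightarrow> E \<subseteq> I \<Longrightarrow> norm (sum a E) \<le> B"
  shows "a summable_on I"
proof -
  have real: "(\<Sum>j\<in>E. \<bar>f j\<bar>) \<le> 2 * B"
    if fB: "\<And>E. finite E \<Longrightarrow> E \<subseteq> I \<Longrightarrow> \<bar>sum f E\<bar> \<le> B" and E: "finite E" "E \<subseteq> I" for f :: "'a \<Rightarrow> real" and E
  proof -
    define P where "P = {j\<in>E. f j \<ge> 0}"
    have "(\<Sum>j\<in>E. \<bar>f j\<bar>) = (\<Sum>j\<in>P. \<bar>f j\<bar>) + (\<Sum>j\<in>E - P. \<bar>f j\<bar>)"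
      using E by (subst sum.subset_diff[of P E]) (auto simp: P_def)
    also have "(\<Sum>j\<in>P. \<bar>f j\<bar>) = sum f P" by (intro sum.cong refl) (simp add: P_def)
    also have "(\<Sum>j\<in>E - P. \<bar>f j\<bar>) = (\<Sum>j\<in>E - P. - f j)" by (intro sum.cong refl) (auto simp: P_def)
    also have "sum f P + (\<Sum>j\<in>E - P. - f j) = sum f P - sum f (E - P)" by (simp add: sum_negf)
    also have "\<dots> \<le> 2 * B"
    proof -
      have "\<bar>sum f P\<bar> \<le> B" "\<bar>sum f (E - P)\<bar> \<le> B" using E by (auto intro!: fB simp: P_def)
      then show ?thesis by linarith
    qed
    finally show ?thesis .
  qed
  have "(\<Sum>j\<in>E. norm (a j)) \<le> 4 * B" if E: "finite E" "E \<subseteq> I" for E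
  proof -
    have "(\<Sum>j\<in>E. norm (a j)) \<le> (\<Sum>j\<in>E. \<bar>Re (a j)\<bar>) + (\<Sum>j\<in>E. \<bar>Im (a j)\<bar>)"
      unfolding sum.distrib[symmetric] by (intro sum_mono cmod_le)
    moreover have "(\<Sum>j\<in>E. \<bar>Re (a j)\<bar>) \<le> 2 * B"
    proof (rule real[OF _ E])
      fix F assume "finite F" "F \<subseteq> I"
      then show "\<bar>\<Sum>j\<in>F. Re (a j)\<bar> \<le> B" using abs_Re_le_cmod[of "sum a F"] B[of F] by simp
    qed
    moreover have "(\<Sum>j\<in>E. \<bar>Im (a j)\<bar>) \<le> 2 * B"
    proof (rule real[OF _ E])
      fix F assume "finite F" "F \<subseteq> I"
      then show "\<bar>\<Sum>j\<in>F. Im (a j)\<bar> \<le> B" using abs_Im_le_cmod[of "sum a F"] B[of F] by simp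
    qed
    ultimately show ?thesis by simp
  qed
  then have "(\<lambda>j. norm (a j)) summable_on I"
    by (intro nonneg_bdd_above_summable_on) (auto simp: bdd_above_def)
  then show ?thesis by (rule abs_summable_summable)
qed

section \<open>Approximation of the identity by partial sums of the multipliers\<close>

context square_partition
begin

text \<open>Outside the annulus between \<eta> and 1/\<eta> the factor t / (1 + t)^2 is at most
  \<eta>, and inside it the product vanishes. The premise \<eta> < 1 in the vanishing hypothesis
  makes \<eta> = 1 an unconditional bound.\<close>

lemma snorm_flat_le:
  fixes D \<psi> :: "real^'n \<Rightarrow> complex"
  assumes D: "smooth D" and A: "0 \<le> A" "\<And>\<gamma> \<xi>. length \<gamma> \<le> M \<Longrightarrow> \<xi> \<noteq> 0 \<Longrightarrow> norm (iter_partial \<gamma> D \<xi>) \<le> A * pw L (norm \<xi>)"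
    and \<psi>: "\<psi> \<in> schwartz" "flat_at_0 (L + M) \<psi>"
    and vanish: "\<And>\<beta> \<xi>. \<xi> \<noteq> 0 \<Longrightarrow> \<eta> \<le> norm \<xi> \<Longrightarrow> norm \<xi> \<le> inverse \<eta> \<Longrightarrow> \<eta> < 1 \<Longrightarrow> iter_partial \<beta> (\<lambda>\<xi>. D \<xi> * \<psi> \<xi>) \<xi> = 0"
    and \<eta>: "0 < \<eta>" "\<eta> \<le> 1"
  shows "snorm M (\<lambda>\<xi>. D \<xi> * \<psi> \<xi>) \<le> (2 ^ M * 2 ^ M * 8 * A * real CARD('n) ^ (L + M + 1)) * snorm (L + M + 1) \<psi> * \<eta>"
proof (rule snorm_leI)
  fix \<beta> :: "'n list" and \<xi> :: "real^'n"
  assume l: "length \<beta> \<le> M"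
  define C where "C = (2 ^ M * 2 ^ M * 8 * A * real CARD('n) ^ (L + M + 1)) * snorm (L + M + 1) \<psi>"
  have C0: "0 \<le> C" using A(1) snorm_nonneg[OF \<psi>(1)] by (simp add: C_def)
  let ?t = "norm \<xi>"
  have "(1 + ?t) ^ M * norm (iter_partial \<beta> (\<lambda>\<xi>. D \<xi> * \<psi> \<xi>) \<xi>) \<le> C * \<eta>"
  proof (cases "\<xi> = 0")
    case True
    have "norm (iter_partial \<beta> (\<lambda>\<xi>. D \<xi> * \<psi> \<xi>) 0) \<le> 2 ^ length \<beta> * 0"
      by (rule norm_iter_partial_mult_le[OF D schwartz_smooth[OF \<psi>(1)]]) (use \<psi>(2) l in \<open>auto simp: flat_at_0_def\<close>)
    then show ?thesis using True C0 \<eta> by simp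
  next
    case False
    have "(1 + ?t) ^ M * norm (iter_partial \<beta> (\<lambda>\<xi>. D \<xi> * \<psi> \<xi>) \<xi>) \<le> C * (?t / (1 + ?t)\<^sup>2)"
      unfolding C_def by (rule flat_mult_bound[OF D A(1) _ \<psi> l False]) (rule A(2)[OF _ False])
    moreover have "?t / (1 + ?t)\<^sup>2 \<le> \<eta> \<or> iter_partial \<beta> (\<lambda>\<xi>. D \<xi> * \<psi> \<xi>) \<xi> = 0"
    proof -
      have pos: "0 < (1 + ?t)\<^sup>2" by (intro zero_less_power add_pos_nonneg) auto
      have e1: "?t / (1 + ?t)\<^sup>2 \<le> 1"
        unfolding pos_divide_le_eq[OF pos] by (simp add: power2_sum)
      consider "\<eta> = 1" | "\<eta> < 1" "?t < \<eta>" | "\<eta> < 1" "inverse \<eta> < ?t" | "\<eta> < 1" "\<eta> \<le> ?t" "?t \<le> inverse \<eta>"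
        using \<eta> by fastforce
      then show ?thesis
      proof cases
        case 1
        then show ?thesis using e1 by simp
      next
        case 2
        have "?t * 1 \<le> ?t * (1 + ?t)\<^sup>2" by (intro mult_left_mono one_le_power) auto
        then have "?t / (1 + ?t)\<^sup>2 \<le> ?t" by (simp add: pos_divide_le_eq[OF pos])
        then show ?thesis using 2 by simp
      next
        case 3
        then have "1 < \<eta> * ?t" using \<eta> by (simp add: inverse_eq_divide pos_divide_less_eq mult.commute)
        then have "1 * ?t \<le> (\<eta> * ?t) * ?t" by (intro mult_right_mono) auto
        also have "\<dots> \<le> \<eta> * (1 + ?t)\<^sup>2"
          unfolding mult.assoc power2_eq_square using \<eta>(1) by (intro mult_left_mono mult_mono) auto
        finally show ?thesis by (simp add: pos_divide_le_eq[OF pos])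
      next
        case 4
        then show ?thesis using vanish[OF False, of \<beta>] by simp
      qed
    qed
    ultimately show ?thesis
      using C0 \<eta>(1) mult_left_mono[of "?t / (1 + ?t)\<^sup>2" \<eta> C] by auto
  qed
  then show "(1 + ?t) ^ M * norm (iter_partial \<beta> (\<lambda>\<xi>. D \<xi> * \<psi> \<xi>) \<xi>)
      \<le> (2 ^ M * 2 ^ M * 8 * A * real CARD('n) ^ (L + M + 1)) * snorm (L + M + 1) \<psi> * \<eta>"
    by (simp only: C_def)
qed

text \<open>The annulus is compact, so finitely many covering sets suffice; E0 consists of all their
  neighbours. Once these are included, the sum of squares is 1 on open sets covering the annulus,
  and all derivatives of the difference vanish there.\<close>

lemma annulus_eq_1:
  assumes \<eta>: "0 < \<eta>"
  obtains E0 where "finite E0" "E0 \<subseteq> J"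
    "\<And>E \<beta> (\<xi>::real^'n) \<psi>. finite E \<Longrightarrow> E0 \<subseteq> E \<Longrightarrow> E \<subseteq> J \<Longrightarrow> \<eta> \<le> norm \<xi> \<Longrightarrow> norm \<xi> \<le> inverse \<eta> \<Longrightarrow>
       iter_partial \<beta> (\<lambda>\<xi>::real^'n. (1 - sqs E \<xi>) * \<psi> \<xi>) \<xi> = 0"
proof -
  define K where "K = {\<xi>::real^'n. \<eta> \<le> norm \<xi> \<and> norm \<xi> \<le> inverse \<eta>}"
  have "closed {\<xi>::real^'n. \<eta> \<le> norm \<xi>}" by (intro closed_Collect_le continuous_intros)
  moreover have "K = {\<xi>. \<eta> \<le> norm \<xi>} \<inter> cball 0 (inverse \<eta>)" by (auto simp: K_def)
  ultimately have K: "compact K" by (simp add: closed_Int_compact)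
  have KQ: "K \<subseteq> (\<Union>j\<in>J. Q j)"
  proof
    fix \<xi> assume "\<xi> \<in> K"
    then have "\<xi> \<noteq> 0" using \<eta> unfolding K_def by auto
    from Q_cover[OF this] show "\<xi> \<in> (\<Union>j\<in>J. Q j)" by blast
  qed
  obtain I where I: "I \<subseteq> J" "finite I" "K \<subseteq> (\<Union>j\<in>I. Q j)"
    by (rule compactE_image[OF K _ KQ, of thesis]) (use openQ in auto)
  define E0 where "E0 = (\<Union>i\<in>I. {j\<in>J. Q j \<inter> Q i \<noteq> {}})"
  obtain N where N: "\<And>j. j \<in> J \<Longrightarrow> finite {i\<in>J. Q i \<inter> Q j \<noteq> {}} \<and> card {i\<in>J. Q i \<inter> Q j \<noteq> {}} \<le> N"
    by (rule overlap) blast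
  show ?thesis
  proof (rule that)
    show "finite E0" unfolding E0_def using I N by blast
    show "E0 \<subseteq> J" unfolding E0_def by blast
    fix E \<beta> and \<psi> :: "real^'n \<Rightarrow> complex" and \<xi> :: "real^'n"
    assume E: "finite E" "E0 \<subseteq> E" "E \<subseteq> J" and \<xi>: "\<eta> \<le> norm \<xi>" "norm \<xi> \<le> inverse \<eta>"
    obtain i where i: "i \<in> I" "\<xi> \<in> Q i" using I(3) \<xi> by (auto simp: K_def)
    have "i \<in> J" using i I by auto
    have sub: "{j\<in>J. Q j \<inter> Q i \<noteq> {}} \<subseteq> E" using E(2) i by (auto simp: E0_def)
    show "iter_partial \<beta> (\<lambda>\<xi>. (1 - sqs E \<xi>) * \<psi> \<xi>) \<xi> = 0"
      by (rule iter_partial_zero_open[OF openQ[OF \<open>i \<in> J\<close>] i(2)])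
        (simp add: sqs_eq_1[OF \<open>i \<in> J\<close> _ E(1,3) sub])
  qed
qed

text \<open>The required order of flatness is L + M, where L is the growth exponent of the
  multipliers' derivatives up to order M. Boundedness is uniform in E, while convergence is along
  finite sets for each fixed \<psi>.\<close>

theorem sqs_approx:
  obtains K C M' where "0 \<le> C"
    "\<And>E (\<psi> :: real^'n \<Rightarrow> complex). finite E \<Longrightarrow> E \<subseteq> J \<Longrightarrow> \<psi> \<in> schwartz \<Longrightarrow> flat_at_0 K \<psi> \<Longrightarrow> snorm M (\<lambda>\<xi>. sqs E \<xi> * \<psi> \<xi>) \<le> C * snorm M' \<psi>"
    "\<And>(\<psi> :: real^'n \<Rightarrow> complex) e. \<psi> \<in> schwartz \<Longrightarrow> flat_at_0 K \<psi> \<Longrightarrow> 0 < e \<Longrightarrow> \<exists>E0. finite E0 \<and> E0 \<subseteq> J \<and>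
       (\<forall>E. finite E \<longrightarrow> E0 \<subseteq> E \<longrightarrow> E \<subseteq> J \<longrightarrow> snorm M (\<lambda>\<xi>. \<psi> \<xi> - sqs E \<xi> * \<psi> \<xi>) \<le> e)"
proof -
  obtain L A where A: "0 \<le> A" "\<And>E \<beta> \<xi>. finite E \<Longrightarrow> E \<subseteq> J \<Longrightarrow> length \<beta> \<le> M \<Longrightarrow> \<xi> \<noteq> 0 \<Longrightarrow>
    norm (iter_partial \<beta> (sqs E) \<xi>) \<le> A * pw L (norm \<xi>)"
    by (rule sqs_bound[of M]) blast
  have s: "smooth (sqs E)" if "E \<subseteq> J" for E by (rule schwartz_smooth[OF sqs_schwartz[OF that]])
  have s1: "smooth (\<lambda>\<xi>. 1 - sqs E \<xi>)" if "E \<subseteq> J" for E by (intro smooth_diff smooth_const s that)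
  have A1: "norm (iter_partial \<beta> (\<lambda>\<xi>. 1 - sqs E \<xi>) \<xi>) \<le> (A + 1) * pw L (norm \<xi>)"
    if "finite E" "E \<subseteq> J" "length \<beta> \<le> M" "\<xi> \<noteq> 0" for E \<beta> \<xi>
  proof -
    have "norm (iter_partial \<beta> (\<lambda>\<xi>::real^'n. 1::complex) \<xi>) \<le> pw L (norm \<xi>)"
      using iter_partial_const[of \<beta> "1::complex"] pw_ge_1[of "norm \<xi>" L] that(4)
      by (cases "\<beta> = []") (auto simp: pw_def)
    with A(2)[OF that] show ?thesis
      unfolding iter_partial_diff[OF smooth_const s[OF that(2)]]
      by (intro order_trans[OF norm_triangle_ineq4]) (simp add: distrib_right)
  qed
  define C where "C = 2 ^ M * 2 ^ M * 8 * (A + 1) * real CARD('n) ^ (L + M + 1)"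
  have C0: "0 \<le> C" using A(1) by (simp add: C_def)
  show ?thesis
  proof (rule that[of C "L + M" "L + M + 1"])
    show "0 \<le> C" by (rule C0)
    fix E and \<psi> :: "real^'n \<Rightarrow> complex" assume E: "finite E" "E \<subseteq> J" and \<psi>: "\<psi> \<in> schwartz" "flat_at_0 (L + M) \<psi>"
    have "snorm M (\<lambda>\<xi>. sqs E \<xi> * \<psi> \<xi>) \<le> (2 ^ M * 2 ^ M * 8 * (A + 1) * real CARD('n) ^ (L + M + 1)) * snorm (L + M + 1) \<psi> * 1"
    proof (rule snorm_flat_le[OF s[OF E(2)] _ _ \<psi>])
      show "norm (iter_partial \<gamma> (sqs E) \<xi>) \<le> (A + 1) * pw L (norm \<xi>)" if "length \<gamma> \<le> M" "\<xi> \<noteq> 0" for \<gamma> \<xi>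
        using A(2)[OF E that] by (rule order_trans) (simp add: pw_def distrib_right)
    qed (use A(1) in auto)
    then show "snorm M (\<lambda>\<xi>. sqs E \<xi> * \<psi> \<xi>) \<le> C * snorm (L + M + 1) \<psi>" by (simp add: C_def)
  next
    fix \<psi> :: "real^'n \<Rightarrow> complex" and e :: real
    assume \<psi>: "\<psi> \<in> schwartz" "flat_at_0 (L + M) \<psi>" and e: "0 < e"
    define S where "S = C * snorm (L + M + 1) \<psi>"
    have S0: "0 \<le> S" using C0 snorm_nonneg[OF \<psi>(1)] by (simp add: S_def)
    \<comment> \<open>Chosen so that \<open>S * \<eta>\<close> is at most e; adding 1 covers the
      case S = 0.\<close>
    define \<eta> where "\<eta> = min 1 (e / (S + 1))"
    have \<eta>: "0 < \<eta>" "\<eta> \<le> 1" using S0 e by (auto simp: \<eta>_def)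
    have S\<eta>: "S * \<eta> \<le> e"
    proof -
      have "S * \<eta> \<le> (S + 1) * (e / (S + 1))" using S0 e by (intro mult_mono) (auto simp: \<eta>_def)
      then show ?thesis using S0 by simp
    qed
    obtain E0 where E0: "finite E0" "E0 \<subseteq> J"
      "\<And>E \<beta> \<xi> \<psi>. finite E \<Longrightarrow> E0 \<subseteq> E \<Longrightarrow> E \<subseteq> J \<Longrightarrow> \<eta> \<le> norm \<xi> \<Longrightarrow> norm \<xi> \<le> inverse \<eta> \<Longrightarrow>
       iter_partial \<beta> (\<lambda>\<xi>. (1 - sqs E \<xi>) * \<psi> \<xi>) \<xi> = 0"
      using annulus_eq_1[OF \<eta>(1)] by blast
    have "snorm M (\<lambda>\<xi>. \<psi> \<xi> - sqs E \<xi> * \<psi> \<xi>) \<le> e" if E: "finite E" "E0 \<subseteq> E" "E \<subseteq> J" for E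
    proof -
      have "snorm M (\<lambda>\<xi>. (1 - sqs E \<xi>) * \<psi> \<xi>) \<le> (2 ^ M * 2 ^ M * 8 * (A + 1) * real CARD('n) ^ (L + M + 1)) * snorm (L + M + 1) \<psi> * \<eta>"
        by (rule snorm_flat_le[OF s1[OF E(3)] _ _ \<psi> _ \<eta>]) (use A(1) A1[OF E(1,3)] E0(3)[OF E] in auto)
      then show ?thesis using S\<eta> by (simp add: S_def C_def left_diff_distrib)
    qed
    then show "\<exists>E0. finite E0 \<and> E0 \<subseteq> J \<and>
       (\<forall>E. finite E \<longrightarrow> E0 \<subseteq> E \<longrightarrow> E \<subseteq> J \<longrightarrow> snorm M (\<lambda>\<xi>. \<psi> \<xi> - sqs E \<xi> * \<psi> \<xi>) \<le> e)"
      using E0(1,2) by blast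
  qed
qed

text \<open>The transpose of the Fourier multiplier with symbol phi_j squared: composing a
  functional with \<open>piece j\<close> multiplies its Fourier transform by this symbol.\<close>

definition piece :: "'j \<Rightarrow> (real^'n \<Rightarrow> complex) \<Rightarrow> real^'n \<Rightarrow> complex" where
  "piece j \<theta> = FT (-1) (\<lambda>\<xi>. sq j \<xi> * FT 1 \<theta> \<xi>)"

lemma phi_zero_near_0:
  assumes "j \<in> J"
  obtains e where "0 < e" "\<And>\<xi>. norm \<xi> < e \<Longrightarrow> \<phi> j \<xi> = 0"
proof -
  have "0 \<in> - fun_supp (\<phi> j)" using Q_nonzero[OF assms] suppQ[OF assms] by auto
  moreover have "open (- fun_supp (\<phi> j))" by (intro open_Compl closed_fun_supp)
  ultimately obtain e where "0 < e" "ball 0 e \<subseteq> - fun_supp (\<phi> j)" using open_contains_ball by blast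
  show ?thesis
  proof (rule that[OF \<open>0 < e\<close>])
    fix \<xi> :: "real^'n" assume "norm \<xi> < e"
    then show "\<phi> j \<xi> = 0"
      using \<open>ball 0 e \<subseteq> _\<close> by (intro fun_supp_notin) auto
  qed
qed

lemma piece_schwartz0:
  assumes j: "j \<in> J" and \<theta>: "\<theta> \<in> schwartz"
  shows "piece j \<theta> \<in> schwartz0"
proof -
  obtain e where e: "0 < e" "\<And>\<xi>. norm \<xi> < e \<Longrightarrow> \<phi> j \<xi> = 0" by (rule phi_zero_near_0[OF j]) blast
  have "FT 1 \<theta> \<in> schwartz" by (rule schwartz_FT[OF _ \<theta>]) simp
  then have "(\<lambda>\<xi>. sq j \<xi> * FT 1 \<theta> \<xi>) \<in> schwartz" by (rule schwartz_mult[OF sq_schwartz[OF j]])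
  then show ?thesis
    unfolding piece_def using e by (intro FT_in_schwartz0) (auto simp: sq_def)
qed

lemma piece_add: "j \<in> J \<Longrightarrow> f \<in> schwartz \<Longrightarrow> g \<in> schwartz \<Longrightarrow> piece j (\<lambda>x. f x + g x) = (\<lambda>x. piece j f x + piece j g x)"
  unfolding piece_def
  by (rule ext) (simp add: FT_add schwartz_FT schwartz_mult sq_schwartz distrib_left)

lemma piece_cmult: "piece j (\<lambda>x. c * f x) = (\<lambda>x. c * piece j f x)"
  unfolding piece_def by (rule ext) (simp add: FT_cmult mult.left_commute)

lemma tame_piece: "j \<in> J \<Longrightarrow> tame (piece j)"
proof -
  assume j: "j \<in> J"
  have "tame (\<lambda>\<theta>. FT (-1) (\<lambda>\<xi>. sq j \<xi> * FT 1 \<theta> \<xi>))"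
    by (rule tame_compose[OF tame_FT[of "-1"] tame_compose[OF tame_slow_mult[OF slow_schwartz[OF sq_schwartz[OF j]]] tame_FT[of 1]]]) simp_all
  then show ?thesis by (simp add: piece_def[abs_def])
qed

lemma dual_piece:
  assumes f: "f \<in> dual V" and V: "sw_subspace V" "schwartz0 \<subseteq> V" and j: "j \<in> J"
  shows "(\<lambda>\<theta>. f (piece j \<theta>)) \<in> dual schwartz"
  by (rule dual_compose_tame[OF f V(1) tame_piece[OF j]])
    (use V(2) piece_schwartz0[OF j] piece_add[OF j] piece_cmult in auto)

lemma sum_piece:
  assumes f: "f \<in> dual V" and V: "sw_subspace V" "schwartz0 \<subseteq> V" and E: "E \<subseteq> J" and \<theta>: "\<theta> \<in> schwartz"
  shows "(\<Sum>j\<in>E. f (piece j \<theta>)) = f (FT (-1) (\<lambda>\<xi>. sqs E \<xi> * FT 1 \<theta> \<xi>))"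
    and "FT (-1) (\<lambda>\<xi>. sqs E \<xi> * FT 1 \<theta> \<xi>) \<in> schwartz0"
proof -
  have S: "FT 1 \<theta> \<in> schwartz" by (rule schwartz_FT[OF _ \<theta>]) simp
  have "FT (-1) (\<lambda>\<xi>. \<Sum>j\<in>E. sq j \<xi> * FT 1 \<theta> \<xi>) x = (\<Sum>j\<in>E. piece j \<theta> x)" for x
    unfolding piece_def using E by (intro FT_sum schwartz_mult S sq_schwartz) auto
  then have eq: "FT (-1) (\<lambda>\<xi>. sqs E \<xi> * FT 1 \<theta> \<xi>) = (\<lambda>x. \<Sum>j\<in>E. piece j \<theta> x)"
    by (simp add: sqs_def sum_distrib_right fun_eq_iff)
  show "FT (-1) (\<lambda>\<xi>. sqs E \<xi> * FT 1 \<theta> \<xi>) \<in> schwartz0"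
    unfolding eq using E by (intro sw_subspace_sum[OF sw_subspace_schwartz0] piece_schwartz0 \<theta>) auto
  show "(\<Sum>j\<in>E. f (piece j \<theta>)) = f (FT (-1) (\<lambda>\<xi>. sqs E \<xi> * FT 1 \<theta> \<xi>))"
    unfolding eq using E V(2) piece_schwartz0[OF _ \<theta>] by (intro dual_sum[OF f V(1), symmetric]) auto
qed

text \<open>The seminorm dominating f determines, through continuity of the transforms, a seminorm
  on the Fourier side, and this determines K. V stays general because the result is applied to a
  functional on \<open>schwartz0\<close> and to its extensions to \<open>schwartz\<close>.\<close>

theorem piece_sums:
  assumes f: "f \<in> dual V" and V: "sw_subspace V" "schwartz0 \<subseteq> V"
  obtains K M C where "0 \<le> C"
    "\<And>E \<theta>. finite E \<Longrightarrow> E \<subseteq> J \<Longrightarrow> \<theta> \<in> schwartz \<Longrightarrow> flat_at_0 K (FT 1 \<theta>) \<Longrightarrow> norm (\<Sum>j\<in>E. f (piece j \<theta>)) \<le> C * snorm M \<theta>"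
    "\<And>\<theta>. \<theta> \<in> V \<Longrightarrow> flat_at_0 K (FT 1 \<theta>) \<Longrightarrow> ((\<lambda>j. f (piece j \<theta>)) has_sum f \<theta>) J"
proof -
  obtain M0 B where B: "0 \<le> B" "\<And>g. g \<in> V \<Longrightarrow> norm (f g) \<le> B * snorm M0 g"
    by (rule dual_bound[OF f V(1)]) blast
  have tF: "tame (FT (-1) :: (real^'n \<Rightarrow> complex) \<Rightarrow> _)" "tame (FT 1 :: (real^'n \<Rightarrow> complex) \<Rightarrow> _)"
    using tame_FT[of "-1"] tame_FT[of 1] by simp_all
  obtain M1 C1 where C1: "0 \<le> C1" "\<And>g::real^'n \<Rightarrow> complex. g \<in> schwartz \<Longrightarrow> snorm M0 (FT (-1) g) \<le> C1 * snorm M1 g"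
    by (rule tameE[OF tF(1), of M0]) blast
  obtain K C2 M2 where C2: "0 \<le> C2"
    "\<And>E (\<psi> :: real^'n \<Rightarrow> complex). finite E \<Longrightarrow> E \<subseteq> J \<Longrightarrow> \<psi> \<in> schwartz \<Longrightarrow> flat_at_0 K \<psi> \<Longrightarrow> snorm M1 (\<lambda>\<xi>. sqs E \<xi> * \<psi> \<xi>) \<le> C2 * snorm M2 \<psi>"
    "\<And>(\<psi> :: real^'n \<Rightarrow> complex) e. \<psi> \<in> schwartz \<Longrightarrow> flat_at_0 K \<psi> \<Longrightarrow> 0 < e \<Longrightarrow> \<exists>E0. finite E0 \<and> E0 \<subseteq> J \<and>
       (\<forall>E. finite E \<longrightarrow> E0 \<subseteq> E \<longrightarrow> E \<subseteq> J \<longrightarrow> snorm M1 (\<lambda>\<xi>. \<psi> \<xi> - sqs E \<xi> * \<psi> \<xi>) \<le> e)"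
    by (rule sqs_approx[of M1]) (rule that; assumption)
  obtain M3 C3 where C3: "0 \<le> C3" "\<And>g::real^'n \<Rightarrow> complex. g \<in> schwartz \<Longrightarrow> snorm M2 (FT 1 g) \<le> C3 * snorm M3 g"
    by (rule tameE[OF tF(2), of M2]) blast
  have FS: "FT 1 \<theta> \<in> schwartz" if "\<theta> \<in> schwartz" for \<theta> :: "real^'n \<Rightarrow> complex" by (rule schwartz_FT[OF _ that]) simp
  show ?thesis
  proof (rule that[of "B * C1 * C2 * C3" K M3])
    show "0 \<le> B * C1 * C2 * C3" using B C1 C2 C3 by simp
    fix E and \<theta> :: "real^'n \<Rightarrow> complex"
    assume E: "finite E" "E \<subseteq> J" and \<theta>: "\<theta> \<in> schwartz" and fl: "flat_at_0 K (FT 1 \<theta>)"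
    have pS: "(\<lambda>\<xi>. sqs E \<xi> * FT 1 \<theta> \<xi>) \<in> schwartz" by (rule schwartz_mult[OF sqs_schwartz[OF E(2)] FS[OF \<theta>]])
    have "norm (\<Sum>j\<in>E. f (piece j \<theta>)) \<le> B * snorm M0 (FT (-1) (\<lambda>\<xi>. sqs E \<xi> * FT 1 \<theta> \<xi>))"
      unfolding sum_piece(1)[OF f V E(2) \<theta>] using sum_piece(2)[OF f V E(2) \<theta>] V(2) by (intro B(2)) auto
    also have "\<dots> \<le> B * (C1 * (C2 * (C3 * snorm M3 \<theta>)))"
      using B(1) C1(1) C2(1)
      by (intro mult_left_mono order_trans[OF C1(2)[OF pS]] order_trans[OF C2(2)[OF E FS[OF \<theta>] fl]] C3(2)[OF \<theta>]) auto
    finally show "norm (\<Sum>j\<in>E. f (piece j \<theta>)) \<le> B * C1 * C2 * C3 * snorm M3 \<theta>" by (simp add: mult.assoc)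
  next
    fix \<theta> assume \<theta>V: "\<theta> \<in> V" and fl: "flat_at_0 K (FT 1 \<theta>)"
    have \<theta>: "\<theta> \<in> schwartz" by (rule sw_subspaceD(1)[OF V(1) \<theta>V])
    show "((\<lambda>j. f (piece j \<theta>)) has_sum f \<theta>) J"
      unfolding has_sum_def tendsto_iff
    proof (intro allI impI)
      fix e :: real assume e: "0 < e"
      \<comment> \<open>Adding 1 keeps the divisor in e' positive.\<close>
      define D where "D = B * C1 + 1"
      define e' where "e' = e / (2 * D)"
      have bc: "0 < D" using B(1) C1(1) by (simp add: D_def add_nonneg_pos)
      have e': "0 < e'" using e bc by (simp add: e'_def)
      have e'2: "B * (C1 * e') < e"
      proof -
        have "B * (C1 * e') \<le> D * e'" using e' by (simp add: D_def distrib_right)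
        also have "\<dots> = e / 2" using bc by (simp add: e'_def)
        finally show ?thesis using e by simp
      qed
      obtain E0 where E0: "finite E0" "E0 \<subseteq> J"
        "\<And>E. finite E \<Longrightarrow> E0 \<subseteq> E \<Longrightarrow> E \<subseteq> J \<Longrightarrow> snorm M1 (\<lambda>\<xi>. FT 1 \<theta> \<xi> - sqs E \<xi> * FT 1 \<theta> \<xi>) \<le> e'"
        using C2(3)[OF FS[OF \<theta>] fl e'] by blast
      have "dist (\<Sum>j\<in>E. f (piece j \<theta>)) (f \<theta>) < e" if E: "finite E" "E0 \<subseteq> E" "E \<subseteq> J" for E
      proof -
        have pS: "(\<lambda>\<xi>. sqs E \<xi> * FT 1 \<theta> \<xi>) \<in> schwartz" by (rule schwartz_mult[OF sqs_schwartz[OF E(3)] FS[OF \<theta>]])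
        have pV: "FT (-1) (\<lambda>\<xi>. sqs E \<xi> * FT 1 \<theta> \<xi>) \<in> V" using sum_piece(2)[OF f V E(3) \<theta>] V(2) by auto
        have eq: "FT (-1) (\<lambda>\<xi>. FT 1 \<theta> \<xi> - sqs E \<xi> * FT 1 \<theta> \<xi>) = (\<lambda>x. \<theta> x - FT (-1) (\<lambda>\<xi>. sqs E \<xi> * FT 1 \<theta> \<xi>) x)"
          using FT_inversion[OF \<theta>, of 1] by (auto simp: fun_eq_iff FT_diff[OF FS[OF \<theta>] pS])
        have "f \<theta> - (\<Sum>j\<in>E. f (piece j \<theta>)) = f (FT (-1) (\<lambda>\<xi>. FT 1 \<theta> \<xi> - sqs E \<xi> * FT 1 \<theta> \<xi>))"
          unfolding eq sum_piece(1)[OF f V E(3) \<theta>] by (rule dual_diff[OF f V(1) \<theta>V pV, symmetric])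
        also have "norm \<dots> \<le> B * snorm M0 (FT (-1) (\<lambda>\<xi>. FT 1 \<theta> \<xi> - sqs E \<xi> * FT 1 \<theta> \<xi>))"
          by (rule B(2)) (unfold eq, rule sw_subspace_diff[OF V(1) \<theta>V pV])
        also have "\<dots> \<le> B * (C1 * e')"
          using B(1) C1(1) by (intro mult_left_mono order_trans[OF C1(2)[OF schwartz_diff[OF FS[OF \<theta>] pS]]] E0(3)[OF E]) auto
        finally show ?thesis using e'2 by (simp only: dist_norm norm_minus_commute[of "sum _ _"])
      qed
      with E0(1,2) show "\<forall>\<^sub>F E in finite_subsets_at_top J. dist (\<Sum>j\<in>E. f (piece j \<theta>)) (f \<theta>) < e"
        unfolding eventually_finite_subsets_at_top by blast
    qed
  qed
qed

end

section \<open>Expansion of a single piece\<close>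

text \<open>Poisson summation for the transform of Y. Its integrals at the non-zero dual frequencies
  are values of Y at \<xi> shifted by multiples of the side lengths, and such points have left the
  open box.\<close>

lemma fourier_series:
  fixes Y :: "real^'n::finite \<Rightarrow> complex" and p r :: "'n \<Rightarrow> real"
  assumes Y: "Y \<in> schwartz" and r: "\<And>i. 0 < r i"
    and 0: "\<And>x. \<not> (\<forall>i. \<bar>x $ i - p i\<bar> < r i) \<Longrightarrow> Y x = 0"
    and \<xi>: "\<And>i. \<bar>\<xi> $ i - p i\<bar> < r i"
  shows "((\<lambda>n. FT 1 Y (vec_lambda (\<lambda>i. pi / r i * of_int (n $ i))) * cis (- vec_lambda (\<lambda>i. pi / r i * of_int (n $ i)) \<bullet> \<xi>))
    has_sum (Y \<xi> / complex_of_real (FTc TYPE('n) * (\<Prod>i\<in>UNIV. pi / r i)))) UNIV"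
proof -
  let ?C = "complex_of_real (FTc TYPE('n))"
  have C0: "?C \<noteq> 0" using FTc_pos[where 'n = 'n] by simp
  \<comment> \<open>After this modulation the integral of X is Y \<xi> up to normalisation.\<close>
  define X where "X = (\<lambda>v. FT 1 Y v * cis ((- \<xi>) \<bullet> v))"
  have FY: "FT 1 Y \<in> schwartz" by (rule schwartz_FT[OF _ Y]) simp
  have X: "X \<in> schwartz" unfolding X_def by (rule schwartz_cis[OF FY])
  have int: "(LINT v|lborel. FT 1 Y v * cis (-1 * (v \<bullet> x))) = Y x / ?C" for x
  proof -
    have "FT (-1) (FT 1 Y) x = Y x" by (rule FT_inversion[OF Y]) simp
    then have "?C * (LINT v|lborel. FT 1 Y v * cis (-1 * (v \<bullet> x))) = Y x"
      by (simp only: FT_def[of "-1"] FTc_def)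
    then show ?thesis using C0 by (simp add: nonzero_eq_divide_eq mult.commute)
  qed
  have cnz: "pi / r i \<noteq> 0" for i using r[of i] by simp
  have orth: "(LINT v|lborel. X v * cis (2 * pi * (lattice_vec m \<bullet> vec_lambda (\<lambda>i. v $ i / (pi / r i))))) = 0"
    if m: "m \<noteq> 0" for m :: "int^'n"
  proof -
    define \<zeta> where "\<zeta> = (vec_lambda (\<lambda>i. 2 * r i * of_int (m $ i)) :: real^'n)"
    obtain k where k: "m $ k \<noteq> 0" using m by (auto simp: vec_eq_iff)
    have ph: "2 * pi * (lattice_vec m \<bullet> vec_lambda (\<lambda>i. v $ i / (pi / r i))) = v \<bullet> \<zeta>" for v :: "real^'n"
      by (simp add: inner_vec_def lattice_vec_def sum_distrib_left \<zeta>_def mult_ac)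
    have "(LINT v|lborel. X v * cis (v \<bullet> \<zeta>)) = (LINT v|lborel. FT 1 Y v * cis (-1 * (v \<bullet> (\<xi> - \<zeta>))))"
    proof (rule Bochner_Integration.integral_cong[OF refl])
      fix v
      have "cis ((- \<xi>) \<bullet> v) * cis (v \<bullet> \<zeta>) = cis (-1 * (v \<bullet> (\<xi> - \<zeta>)))"
        by (simp add: cis_mult inner_diff_right inner_commute)
      then show "X v * cis (v \<bullet> \<zeta>) = FT 1 Y v * cis (-1 * (v \<bullet> (\<xi> - \<zeta>)))"
        by (simp only: X_def mult.assoc)
    qed
    also have "\<dots> = Y (\<xi> - \<zeta>) / ?C" by (rule int)
    also have "Y (\<xi> - \<zeta>) = 0"
    proof (rule 0)
      show "\<not> (\<forall>i. \<bar>(\<xi> - \<zeta>) $ i - p i\<bar> < r i)"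
      proof
        assume "\<forall>i. \<bar>(\<xi> - \<zeta>) $ i - p i\<bar> < r i"
        then have "\<bar>(\<xi> - \<zeta>) $ k - p k\<bar> < r k" by blast
        with \<xi>[of k] have "\<bar>\<zeta> $ k\<bar> < 2 * r k" by simp
        then have "2 * r k * \<bar>of_int (m $ k)\<bar> < 2 * r k * 1" using r[of k] by (simp add: \<zeta>_def abs_mult)
        then have "\<bar>real_of_int (m $ k)\<bar> < 1" using r[of k] by (simp only: mult_less_cancel_left_pos)
        then show False using k by linarith
      qed
    qed
    finally show ?thesis unfolding ph by simp
  qed
  have pos: "0 < (\<Prod>i\<in>UNIV. pi / r i)" using r by (intro prod_pos) simp
  have "(\<Prod>i\<in>UNIV. \<bar>pi / r i\<bar>) = (\<Prod>i\<in>UNIV. pi / r i)"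
    using r by (intro prod.cong refl) (simp add: abs_of_pos)
  moreover have "(LINT v|lborel. X v) = Y \<xi> / ?C"
    using int[of \<xi>] by (simp add: X_def inner_commute)
  ultimately have "((\<lambda>n. X (0 + vec_lambda (\<lambda>i. pi / r i * of_int (n $ i)))) has_sum (Y \<xi> / ?C) /\<^sub>R (\<Prod>i\<in>UNIV. pi / r i)) UNIV"
    using has_sum_Zn(1)[OF integrable_schwartz_lattice[of X "\<lambda>i. pi / r i" 0, OF X cnz]]
      poisson_diag[of X "\<lambda>i. pi / r i" 0, OF X cnz orth] by simp
  moreover have "(Y \<xi> / ?C) /\<^sub>R (\<Prod>i\<in>UNIV. pi / r i) = Y \<xi> / complex_of_real (FTc TYPE('n) * (\<Prod>i\<in>UNIV. pi / r i))"
    by (simp add: scaleR_conv_of_real divide_inverse mult_ac)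
  ultimately show ?thesis by (simp add: X_def inner_commute)
qed

text \<open>One factor \<phi> carries the plane waves, the other belongs to the function that is
  expanded. On the support of \<phi> the Fourier series reproduces
  \<open>\<phi> \<xi> * \<psi> \<xi>\<close> with all its derivatives, so the superposition is
  exact.\<close>

theorem frame_expansion:
  fixes \<phi> \<theta> :: "real^'n::finite \<Rightarrow> complex" and p r :: "'n \<Rightarrow> real"
  assumes f: "f \<in> dual V" and V: "sw_subspace V"
    and \<phi>: "\<phi> \<in> schwartz" and \<phi>V: "\<And>\<kappa>. slow \<kappa> \<Longrightarrow> FT (-1) (\<lambda>\<xi>. \<phi> \<xi> * \<kappa> \<xi>) \<in> V"
    and r: "\<And>i. 0 < r i" and supp: "fun_supp \<phi> \<subseteq> {x. \<forall>i. \<bar>x $ i - p i\<bar> < r i}"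
    and \<psi>: "\<psi> \<in> schwartz"
  defines "v \<equiv> \<lambda>n. vec_lambda (\<lambda>i. pi / r i * of_int (n $ i))"
  shows "((\<lambda>n. complex_of_real (FTc TYPE('n) * (\<Prod>i\<in>UNIV. pi / r i)) * FT 1 (\<lambda>\<xi>. \<phi> \<xi> * \<psi> \<xi>) (v n) *
      f (FT (-1) (\<lambda>\<xi>. \<phi> \<xi> * cis (- v n \<bullet> \<xi>)))) has_sum f (FT (-1) (\<lambda>\<xi>. \<phi> \<xi> * (\<phi> \<xi> * \<psi> \<xi>)))) UNIV"
proof -
  \<comment> \<open>Moves the problem to the Fourier side: u is f after the transform, and W is the
    space on which f may then be evaluated.\<close>
  define W where "W = {g \<in> schwartz. FT (-1) g \<in> V}"
  define u where "u = (\<lambda>g. f (FT (-1) g))"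
  have FTadd: "FT (-1) (\<lambda>x. g x + h x) = (\<lambda>x. FT (-1) g x + FT (-1) h x)" if "g \<in> schwartz" "h \<in> schwartz" for g h :: "real^'n \<Rightarrow> complex"
    by (rule ext) (rule FT_add[OF that])
  have FTmult: "FT (-1) (\<lambda>x. c * g x) = (\<lambda>x. c * FT (-1) g x)" for c and g :: "real^'n \<Rightarrow> complex"
    by (rule ext) (rule FT_cmult)
  have FT0: "FT (-1) (\<lambda>x::real^'n. 0) = (\<lambda>x. 0)" by (simp add: FT_def fun_eq_iff)
  have W: "sw_subspace W"
    unfolding sw_subspace_def W_def mem_Collect_eq
    using sw_subspaceD[OF V] by (auto simp: FTadd FTmult FT0 schwartz_add schwartz_cmult)
  have tF: "tame (FT (-1) :: (real^'n \<Rightarrow> complex) \<Rightarrow> _)" using tame_FT[of "-1"] by simp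
  have u: "u \<in> dual W"
    unfolding u_def by (rule dual_compose_tame[OF f V tF]) (auto simp: W_def FTadd FTmult)
  obtain M B where B: "0 \<le> B" "\<And>g. g \<in> W \<Longrightarrow> norm (u g) \<le> B * snorm M g"
    by (rule dual_bound[OF u W]) blast
  define Y where "Y = (\<lambda>\<xi>. \<phi> \<xi> * \<psi> \<xi>)"
  have Y: "Y \<in> schwartz" unfolding Y_def by (rule schwartz_mult[OF \<phi> \<psi>])
  have FY: "FT 1 Y \<in> schwartz" by (rule schwartz_FT[OF _ Y]) simp
  define D where "D = complex_of_real (FTc TYPE('n) * (\<Prod>i\<in>UNIV. pi / r i))"
  have D0: "D \<noteq> 0"
  proof -
    have "0 < FTc TYPE('n) * (\<Prod>i\<in>UNIV. pi / r i)" using r by (intro mult_pos_pos FTc_pos prod_pos) simp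
    then show ?thesis unfolding D_def by (metis of_real_eq_0_iff less_irrefl)
  qed
  define c where "c = (\<lambda>n. D * FT 1 Y (v n))"
  have cnz: "pi / r i \<noteq> 0" for i using r[of i] by simp
  have Yout: "iter_partial \<gamma> Y \<xi> = 0" if "\<xi> \<notin> fun_supp \<phi>" for \<gamma> \<xi>
    by (rule iter_partial_zero_open[of "- fun_supp \<phi>"])
      (use that closed_fun_supp fun_supp_notin[of _ \<phi>] in \<open>auto simp: Y_def open_Compl\<close>)
  have \<phi>out: "iter_partial \<gamma> \<phi> \<xi> = 0" if "\<xi> \<notin> fun_supp \<phi>" for \<gamma> \<xi>
    by (rule iter_partial_zero_open[of "- fun_supp \<phi>"])
      (use that closed_fun_supp fun_supp_notin[of _ \<phi>] in \<open>auto simp: open_Compl\<close>)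
  have sum: "(\<lambda>n. norm (c n) * (1 + norm (- v n)) ^ M) summable_on UNIV"
  proof -
    have "(\<lambda>n. norm (FT 1 Y (v n)) * (1 + norm (v n)) ^ M) summable_on UNIV"
      using summable_lattice_weighted[of "FT 1 Y" "\<lambda>i. pi / r i" 0 M, OF FY cnz] by (simp add: v_def)
    from summable_on_cmult_right[OF this, of "norm D"] show ?thesis
      by (simp add: c_def norm_mult mult.assoc)
  qed
  have W1: "(\<lambda>\<xi>. \<phi> \<xi> * Y \<xi>) \<in> W"
    unfolding W_def using schwartz_mult[OF \<phi> Y] \<phi>V[OF slow_schwartz[OF Y]] by blast
  have W2: "(\<lambda>\<xi>. \<phi> \<xi> * cis (- v n \<bullet> \<xi>)) \<in> W" for n
    unfolding W_def using schwartz_cis[OF \<phi>, of "- v n"] \<phi>V[OF slow_cis, of "- v n"] by blast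
  \<comment> \<open>A derivative of Y is again supported in the box, and its coefficients are those
    of Y times \<open>imon\<close>; so one series theorem serves all multi-indices.\<close>
  have app: "\<exists>S. ((\<lambda>n. c n * (imon \<gamma> (- v n) * cis (- v n \<bullet> \<xi>))) has_sum S) UNIV \<and>
      norm (iter_partial \<gamma> Y \<xi> - S) \<le> 0 * (1 + norm \<xi>) ^ 0" if \<xi>: "\<xi> \<in> fun_supp \<phi>" for \<xi> \<gamma>
  proof -
    have Y\<gamma>: "iter_partial \<gamma> Y \<in> schwartz" by (rule schwartz_iter_partial[OF Y])
    have in_box: "\<bar>\<xi> $ i - p i\<bar> < r i" for i using \<xi> supp by auto
    have 0: "iter_partial \<gamma> Y x = 0" if "\<not> (\<forall>i. \<bar>x $ i - p i\<bar> < r i)" for x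
      by (rule Yout) (use that supp in auto)
    have "((\<lambda>n. D * (FT 1 (iter_partial \<gamma> Y) (v n) * cis (- v n \<bullet> \<xi>))) has_sum D * (iter_partial \<gamma> Y \<xi> / D)) UNIV"
      unfolding v_def D_def by (rule has_sum_cmult_right[OF fourier_series[OF Y\<gamma> r 0 in_box]])
    moreover have "D * (FT 1 (iter_partial \<gamma> Y) (v n) * cis (- v n \<bullet> \<xi>)) = c n * (imon \<gamma> (- v n) * cis (- v n \<bullet> \<xi>))" for n
      by (simp add: FT_iter_partial[OF Y] c_def mult_ac)
    ultimately have "((\<lambda>n. c n * (imon \<gamma> (- v n) * cis (- v n \<bullet> \<xi>))) has_sum iter_partial \<gamma> Y \<xi>) UNIV"
      using nonzero_mult_div_cancel_left[OF D0] by (simp only: times_divide_eq_right)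
    then show ?thesis by (intro exI[of _ "iter_partial \<gamma> Y \<xi>"]) simp
  qed
  note sup = superposition[OF u W B \<phi> schwartz_smooth[OF Y] W1 W2 sum \<phi>out app order_refl]
  have "((\<lambda>n. c n * u (\<lambda>\<xi>. \<phi> \<xi> * cis (- v n \<bullet> \<xi>))) has_sum (\<Sum>\<^sub>\<infinity>n. c n * u (\<lambda>\<xi>. \<phi> \<xi> * cis (- v n \<bullet> \<xi>)))) UNIV"
    by (rule has_sum_infsum[OF abs_summable_summable[OF sup(1)]])
  moreover have "u (\<lambda>\<xi>. \<phi> \<xi> * Y \<xi>) = (\<Sum>\<^sub>\<infinity>n. c n * u (\<lambda>\<xi>. \<phi> \<xi> * cis (- v n \<bullet> \<xi>)))"
    using sup(2) by simp
  ultimately show ?thesis by (simp add: u_def c_def Y_def D_def)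
qed

section \<open>Correction by polynomials\<close>

lemma dual_functional_add:
  assumes u: "u \<in> dual V" and v: "v \<in> dual V" and V: "sw_subspace V"
  shows "(\<lambda>\<theta>. u \<theta> + v \<theta>) \<in> dual V"
proof -
  obtain M B where B: "0 \<le> B" "\<And>f. f \<in> V \<Longrightarrow> norm (u f) \<le> B * snorm M f"
    by (rule dual_bound[OF u V]) blast
  obtain N C where C: "0 \<le> C" "\<And>f. f \<in> V \<Longrightarrow> norm (v f) \<le> C * snorm N f"
    by (rule dual_bound[OF v V]) blast
  show ?thesis
  proof (rule dualI)
    fix f assume f: "f \<in> V"
    have S: "f \<in> schwartz" by (rule sw_subspaceD(1)[OF V f])
    have "norm (u f + v f) \<le> B * snorm M f + C * snorm N f"
      by (rule order_trans[OF norm_triangle_ineq add_mono[OF B(2)[OF f] C(2)[OF f]]])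
    also have "\<dots> \<le> B * snorm (M + N) f + C * snorm (M + N) f"
      by (intro add_mono mult_left_mono snorm_mono[OF S] B(1) C(1)) auto
    finally show "norm (u f + v f) \<le> (B + C) * snorm (M + N) f" by (simp add: distrib_right)
  qed (simp_all add: dualD[OF u] dualD[OF v] distrib_left)
qed

lemma dual_functional_cmult:
  assumes u: "u \<in> dual V" and V: "sw_subspace V"
  shows "(\<lambda>\<theta>. c * u \<theta>) \<in> dual V"
proof -
  obtain M B where B: "0 \<le> B" "\<And>f. f \<in> V \<Longrightarrow> norm (u f) \<le> B * snorm M f"
    by (rule dual_bound[OF u V]) blast
  show ?thesis
  proof (rule dualI)
    fix f assume f: "f \<in> V"
    show "norm (c * u f) \<le> (norm c * B) * snorm M f"
      using mult_left_mono[OF B(2)[OF f], of "norm c"] by (simp add: norm_mult mult.assoc)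
  qed (simp_all add: dualD[OF u] distrib_left)
qed

lemma dual_functional_sum:
  assumes "\<And>i. i \<in> I \<Longrightarrow> u i \<in> dual V" and V: "sw_subspace V"
  shows "(\<lambda>\<theta>. \<Sum>i\<in>I. u i \<theta>) \<in> dual V"
proof -
  have 0: "(\<lambda>\<theta>. 0) \<in> dual V" by (rule dualI[of _ _ 0 0]) auto
  show ?thesis using assms(1)
  proof (induction I rule: infinite_finite_induct)
    case (insert i I)
    then show ?case using dual_functional_add[OF _ _ V, of "u i"] by simp
  qed (auto simp: 0)
qed

lemma tame_diff:
  assumes U: "tame U" and V: "tame V"
  shows "tame (\<lambda>f x. U f x - V f x)"
  unfolding tame_def
proof (intro conjI allI ballI)
  show "(\<lambda>x. U f x - V f x) \<in> schwartz" if "f \<in> schwartz" for f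
    by (rule schwartz_diff[OF tame_schwartz[OF U that] tame_schwartz[OF V that]])
  fix M
  obtain A B where A: "0 \<le> B" "\<And>f. f \<in> schwartz \<Longrightarrow> snorm M (U f) \<le> B * snorm A f"
    by (rule tameE[OF U, where M = M]) blast
  obtain C D where C: "0 \<le> D" "\<And>f. f \<in> schwartz \<Longrightarrow> snorm M (V f) \<le> D * snorm C f"
    by (rule tameE[OF V, where M = M]) blast
  have "snorm M (\<lambda>x. U f x - V f x) \<le> (B + D) * snorm (A + C) f" if f: "f \<in> schwartz" for f
  proof -
    have "snorm M (\<lambda>x. U f x - V f x) \<le> B * snorm A f + D * snorm C f"
      by (rule order_trans[OF snorm_diff[OF tame_schwartz[OF U f] tame_schwartz[OF V f]] add_mono[OF A(2)[OF f] C(2)[OF f]]])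
    also have "\<dots> \<le> B * snorm (A + C) f + D * snorm (A + C) f"
      by (intro add_mono mult_left_mono snorm_mono[OF f] A(1) C(1)) auto
    finally show ?thesis by (simp add: distrib_right)
  qed
  then show "\<exists>M' C. 0 \<le> C \<and> (\<forall>f\<in>schwartz. snorm M (\<lambda>x. U f x - V f x) \<le> C * snorm M' f)"
    using A(1) C(1) by (intro exI[of _ "A + C"] exI[of _ "B + D"]) auto
qed

lemma tame_rank_one:
  assumes u: "u \<in> dual schwartz" and w: "w \<in> schwartz"
  shows "tame (\<lambda>f x. u f * w x)"
  unfolding tame_def
proof (intro conjI allI ballI)
  show "(\<lambda>x. u f * w x) \<in> schwartz" for f by (rule schwartz_cmult[OF w])
  fix M
  obtain N B where B: "0 \<le> B" "\<And>f. f \<in> schwartz \<Longrightarrow> norm (u f) \<le> B * snorm N f"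
    by (rule dual_bound[OF u sw_subspace_schwartz]) blast
  have "snorm M (\<lambda>x. u f * w x) \<le> (B * snorm M w) * snorm N f" if f: "f \<in> schwartz" for f
    using order_trans[OF snorm_cmult[OF w] mult_right_mono[OF B(2)[OF f] snorm_nonneg[OF w]]]
    by (simp add: mult_ac)
  then show "\<exists>M' C. 0 \<le> C \<and> (\<forall>f\<in>schwartz. snorm M (\<lambda>x. u f * w x) \<le> C * snorm M' f)"
    using B(1) snorm_nonneg[OF w] by (intro exI[of _ N] exI[of _ "B * snorm M w"]) auto
qed

lemma tame_minus_finite_rank:
  fixes w :: "'a \<Rightarrow> real^'b::finite \<Rightarrow> complex"
  assumes "finite L" "\<And>\<beta>. \<beta> \<in> L \<Longrightarrow> u \<beta> \<in> dual schwartz" "\<And>\<beta>. \<beta> \<in> L \<Longrightarrow> w \<beta> \<in> schwartz"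
  shows "tame (\<lambda>\<theta> x. \<theta> x - (\<Sum>\<beta>\<in>L. u \<beta> \<theta> * w \<beta> x))"
  using assms
proof (induction L rule: finite_induct)
  case empty
  have "\<exists>M' C. 0 \<le> C \<and> (\<forall>f\<in>schwartz. snorm M f \<le> C * snorm M' (f :: real^'b::finite \<Rightarrow> complex))" for M
    by (intro exI[of _ M] exI[of _ 1]) simp
  then show ?case by (simp add: tame_def)
next
  case (insert \<beta> L)
  have "tame (\<lambda>\<theta> x. (\<theta> x - (\<Sum>\<beta>\<in>L. u \<beta> \<theta> * w \<beta> x)) - u \<beta> \<theta> * w \<beta> x)"
    by (rule tame_diff) (use insert in \<open>auto intro: tame_rank_one\<close>)
  then show ?case using insert(1,2) by (simp add: algebra_simps)
qed

text \<open>The functionals may be linearly dependent, as are moments indexed by permuted lists, so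
  a dual basis need not exist. They are added one at a time: either the new one already annihilates
  all corrected functions, or a corrected function can be normalised to absorb it.\<close>

lemma annihilating_correction:
  fixes u :: "'a \<Rightarrow> 'n::finite functional"
  assumes "finite L" "\<And>\<beta>. \<beta> \<in> L \<Longrightarrow> u \<beta> \<in> dual schwartz"
  shows "\<exists>w. (\<forall>\<beta>\<in>L. w \<beta> \<in> schwartz) \<and>
    (\<forall>\<theta>\<in>schwartz. \<forall>\<gamma>\<in>L. u \<gamma> (\<lambda>x. \<theta> x - (\<Sum>\<beta>\<in>L. u \<beta> \<theta> * w \<beta> x)) = 0)"
  using assms
proof (induction L rule: finite_induct)
  case empty
  then show ?case by simp
next
  case (insert a L)
  from insert(3)[OF insert(4)[OF insertI2]] obtain w where w: "\<And>\<beta>. \<beta> \<in> L \<Longrightarrow> w \<beta> \<in> schwartz"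
    and van: "\<And>\<theta> \<gamma>. \<theta> \<in> schwartz \<Longrightarrow> \<gamma> \<in> L \<Longrightarrow> u \<gamma> (\<lambda>x. \<theta> x - (\<Sum>\<beta>\<in>L. u \<beta> \<theta> * w \<beta> x)) = 0"
    by blast
  have ua: "u a \<in> dual schwartz" and u: "\<And>\<beta>. \<beta> \<in> L \<Longrightarrow> u \<beta> \<in> dual schwartz" using insert(4) by auto
  define F where "F = (\<lambda>\<theta> x. \<theta> x - (\<Sum>\<beta>\<in>L. u \<beta> \<theta> * w \<beta> x))"
  have F: "F \<theta> \<in> schwartz" if "\<theta> \<in> schwartz" for \<theta>
    unfolding F_def by (intro schwartz_diff that schwartz_sum schwartz_cmult w)
  have vanF: "u \<gamma> (F \<theta>) = 0" if "\<theta> \<in> schwartz" "\<gamma> \<in> L" for \<gamma> \<theta>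
    using van[OF that] by (simp add: F_def)
  have uaF: "u a (F \<theta>) = u a \<theta> - (\<Sum>\<beta>\<in>L. u \<beta> \<theta> * u a (w \<beta>))" if \<theta>: "\<theta> \<in> schwartz" for \<theta>
    unfolding F_def
    by (simp add: dual_diff[OF ua sw_subspace_schwartz \<theta>] schwartz_sum schwartz_cmult w
        dual_sum[OF ua sw_subspace_schwartz] dualD(2)[OF ua])
  \<comment> \<open>In the dependent case e = 0, otherwise e is a corrected function with
    \<open>u a e = 1\<close>; the stated equation covers both.\<close>
  have "\<exists>e\<in>schwartz. (\<forall>\<gamma>\<in>L. u \<gamma> e = 0) \<and> (\<forall>\<theta>\<in>schwartz. u a (F \<theta>) * u a e = u a (F \<theta>))"
  proof (cases "\<forall>\<theta>\<in>schwartz. u a (F \<theta>) = 0")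
    case True
    then show ?thesis
      using dual_zero[OF u sw_subspace_schwartz] sw_subspaceD(2)[OF sw_subspace_schwartz]
      by (intro bexI[of _ "\<lambda>x. 0"]) auto
  next
    case False
    then obtain \<theta>0 where \<theta>0: "\<theta>0 \<in> schwartz" "u a (F \<theta>0) \<noteq> 0" by blast
    show ?thesis
      by (intro bexI[of _ "\<lambda>x. inverse (u a (F \<theta>0)) * F \<theta>0 x"] schwartz_cmult F \<theta>0(1))
        (use \<theta>0 in \<open>auto simp: dualD(2)[OF ua F] dualD(2)[OF u F] vanF\<close>)
  qed
  then obtain e where e: "e \<in> schwartz" "\<And>\<gamma>. \<gamma> \<in> L \<Longrightarrow> u \<gamma> e = 0"
    "\<And>\<theta>. \<theta> \<in> schwartz \<Longrightarrow> u a (F \<theta>) * u a e = u a (F \<theta>)" by blast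
  \<comment> \<open>\<open>u a (F \<theta>)\<close> is \<open>u a \<theta>\<close> minus a
    combination of the other functionals; collecting coefficients writes the two-step correction as
    a single sum over the enlarged set.\<close>
  define w' where "w' = (\<lambda>\<beta> x. if \<beta> = a then e x else w \<beta> x - u a (w \<beta>) * e x)"
  have w': "w' a = e" "\<And>\<beta>. \<beta> \<in> L \<Longrightarrow> w' \<beta> = (\<lambda>x. w \<beta> x - u a (w \<beta>) * e x)"
    using insert(2) by (auto simp: w'_def fun_eq_iff)
  have eq: "(\<lambda>x. \<theta> x - (\<Sum>\<beta>\<in>insert a L. u \<beta> \<theta> * w' \<beta> x)) = (\<lambda>x. F \<theta> x - u a (F \<theta>) * e x)"
    if \<theta>: "\<theta> \<in> schwartz" for \<theta>
  proof
    fix x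
    have "(\<Sum>\<beta>\<in>L. u \<beta> \<theta> * w' \<beta> x) = (\<Sum>\<beta>\<in>L. u \<beta> \<theta> * w \<beta> x) - (\<Sum>\<beta>\<in>L. u \<beta> \<theta> * u a (w \<beta>)) * e x"
      by (simp add: w'(2) right_diff_distrib sum_subtractf sum_distrib_right mult.assoc)
    then show "\<theta> x - (\<Sum>\<beta>\<in>insert a L. u \<beta> \<theta> * w' \<beta> x) = F \<theta> x - u a (F \<theta>) * e x"
      using insert(1,2) unfolding uaF[OF \<theta>] by (simp add: w'(1) F_def algebra_simps)
  qed
  have res: "u \<gamma> (\<lambda>x. F \<theta> x - u a (F \<theta>) * e x) = 0" if \<theta>: "\<theta> \<in> schwartz" and \<gamma>: "\<gamma> \<in> insert a L" for \<theta> \<gamma>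
  proof -
    have ug: "u \<gamma> \<in> dual schwartz" using \<gamma> insert(4) by blast
    have "u \<gamma> (\<lambda>x. F \<theta> x - u a (F \<theta>) * e x) = u \<gamma> (F \<theta>) - u a (F \<theta>) * u \<gamma> e"
      by (simp add: dual_diff[OF ug sw_subspace_schwartz F[OF \<theta>] schwartz_cmult[OF e(1)]] dualD(2)[OF ug e(1)])
    also have "\<dots> = 0" using \<gamma> vanF[OF \<theta>] e(2) e(3)[OF \<theta>] by auto
    finally show ?thesis .
  qed
  show ?case
  proof (intro exI[of _ w'] conjI ballI)
    show "w' \<beta> \<in> schwartz" if "\<beta> \<in> insert a L" for \<beta>
      using that w'(1) w'(2)[of \<beta>] e(1) w by (auto intro!: schwartz_diff schwartz_cmult)
    show "u \<gamma> (\<lambda>x. \<theta> x - (\<Sum>\<beta>\<in>insert a L. u \<beta> \<theta> * w' \<beta> x)) = 0" if "\<theta> \<in> schwartz" "\<gamma> \<in> insert a L" for \<theta> \<gamma>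
      unfolding eq[OF that(1)] by (rule res[OF that])
  qed
qed

lemma polynomial_function_imon: "polynomial_function (\<lambda>x. c * imon \<beta> (x::real^'n::finite))"
proof (induction \<beta> arbitrary: c)
  case (Cons i \<beta>)
  have "polynomial_function (\<lambda>x::real^'n. (x $ i) *\<^sub>R ((c * \<i>) * imon \<beta> x))"
    by (intro polynomial_function_mult Cons polynomial_function_bounded_linear bounded_linear_vec_nth)
  then show ?case by (simp add: scaleR_conv_of_real mult_ac)
qed simp

text \<open>A derivative of \<open>FT 1 \<theta>\<close> at 0 is a moment of \<theta>, hence a
  pairing with a polynomial. Flatness is thus reached by a finite-rank correction whose functionals
  are polynomials, which is how polynomials enter the result.\<close>

lemma flattening:
  obtains q :: "'n list \<Rightarrow> real^'n::finite \<Rightarrow> complex" and w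
  where "\<And>\<beta> c. polynomial_function (\<lambda>x. c * q \<beta> x)" "\<And>\<beta>. slow (q \<beta>)"
    "\<And>\<beta>. length \<beta> \<le> K \<Longrightarrow> w \<beta> \<in> schwartz"
    "\<And>\<theta>. \<theta> \<in> schwartz \<Longrightarrow> flat_at_0 K (FT 1 (\<lambda>x. \<theta> x - (\<Sum>\<beta> | length \<beta> \<le> K. dist_of (q \<beta>) \<theta> * w \<beta> x)))"
    "\<And>\<theta> \<beta>. \<theta> \<in> schwartz \<Longrightarrow> flat_at_0 K (FT 1 \<theta>) \<Longrightarrow> length \<beta> \<le> K \<Longrightarrow> dist_of (q \<beta>) \<theta> = 0"
proof -
  define q where "q = (\<lambda>\<beta> (x::real^'n). complex_of_real (FTc TYPE('n)) * imon \<beta> x)"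
  have ev: "dist_of (q \<beta>) \<theta> = iter_partial \<beta> (FT 1 \<theta>) 0" if "\<theta> \<in> schwartz" for \<beta> \<theta>
    unfolding iter_partial_FT[OF that] by (simp add: FT_def FTc_def q_def dist_of_def mult.assoc)
  have slow: "slow (q \<beta>)" for \<beta> unfolding q_def by (intro slow_mult slow_const slow_imon)
  define L where "L = {\<beta> :: 'n list. length \<beta> \<le> K}"
  have "finite L" unfolding L_def by (rule finite_lists_le)
  from annihilating_correction[of L "\<lambda>\<beta>. dist_of (q \<beta>)", OF this dist_of_slow(1)[OF slow]]
  obtain w where w: "\<And>\<beta>. \<beta> \<in> L \<Longrightarrow> w \<beta> \<in> schwartz"
    and van: "\<And>\<theta> \<gamma>. \<theta> \<in> schwartz \<Longrightarrow> \<gamma> \<in> L \<Longrightarrow> dist_of (q \<gamma>) (\<lambda>x. \<theta> x - (\<Sum>\<beta>\<in>L. dist_of (q \<beta>) \<theta> * w \<beta> x)) = 0"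
    by blast
  show ?thesis
  proof (rule that[of q w])
    show "polynomial_function (\<lambda>x. c * q \<beta> x)" for \<beta> c
      using polynomial_function_imon[of "c * complex_of_real (FTc TYPE('n))" \<beta>] by (simp add: q_def mult.assoc)
    show "slow (q \<beta>)" for \<beta> by (rule slow)
    show "w \<beta> \<in> schwartz" if "length \<beta> \<le> K" for \<beta> using w that by (simp add: L_def)
    show "flat_at_0 K (FT 1 (\<lambda>x. \<theta> x - (\<Sum>\<beta> | length \<beta> \<le> K. dist_of (q \<beta>) \<theta> * w \<beta> x)))" if \<theta>: "\<theta> \<in> schwartz" for \<theta>
      unfolding flat_at_0_def L_def[symmetric]
    proof (intro allI impI)
      fix \<gamma> :: "'n list" assume "length \<gamma> \<le> K"
      then have \<gamma>: "\<gamma> \<in> L" by (simp add: L_def)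
      have S: "(\<lambda>x. \<theta> x - (\<Sum>\<beta>\<in>L. dist_of (q \<beta>) \<theta> * w \<beta> x)) \<in> schwartz"
        by (intro schwartz_diff \<theta> schwartz_sum schwartz_cmult w)
      show "iter_partial \<gamma> (FT 1 (\<lambda>x. \<theta> x - (\<Sum>\<beta>\<in>L. dist_of (q \<beta>) \<theta> * w \<beta> x))) 0 = 0"
        using van[OF \<theta> \<gamma>] unfolding ev[OF S, of \<gamma>] .
    qed
    show "dist_of (q \<beta>) \<theta> = 0" if "\<theta> \<in> schwartz" "flat_at_0 K (FT 1 \<theta>)" "length \<beta> \<le> K" for \<theta> \<beta>
      using that by (simp add: ev flat_at_0_def)
  qed
qed

lemma dist_of_lincomb:
  assumes "\<And>\<beta>. \<beta> \<in> L \<Longrightarrow> slow (q \<beta>)" and \<theta>: "\<theta> \<in> schwartz"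
  shows "dist_of (\<lambda>x. \<Sum>\<beta>\<in>L. c \<beta> * q \<beta> x) \<theta> = (\<Sum>\<beta>\<in>L. c \<beta> * dist_of (q \<beta>) \<theta>)"
proof -
  have "dist_of (\<lambda>x. \<Sum>\<beta>\<in>L. c \<beta> * q \<beta> x) \<theta> = (LINT x|lborel. (\<Sum>\<beta>\<in>L. c \<beta> * (q \<beta> x * \<theta> x)))"
    by (simp add: dist_of_def sum_distrib_right mult.assoc)
  also have "\<dots> = (\<Sum>\<beta>\<in>L. (LINT x|lborel. c \<beta> * (q \<beta> x * \<theta> x)))"
    by (intro Bochner_Integration.integral_sum integrable_mult_right dist_of_slow(2)[OF assms])
  finally show ?thesis by (simp add: dist_of_def)
qed

lemma schwartz0_subset: "schwartz0 \<subseteq> schwartz"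
  by (auto simp: schwartz0_def)

section \<open>Extension to tempered distributions and the corrected limit\<close>

context square_partition
begin

text \<open>A function with finitely flat transform has all its pieces in \<open>schwartz0\<close>,
  so f applies to each of them and the sum defines a functional on such functions. A general
  Schwartz function is flattened beforehand; on \<open>schwartz0\<close> the moments vanish and
  nothing changes.\<close>

theorem extension:
  fixes f :: "'n functional"
  assumes f: "f \<in> dual schwartz0"
  shows "\<exists>f'\<in>dual schwartz. \<forall>\<theta>\<in>schwartz0. f' \<theta> = f \<theta>"
proof -
  obtain K M C where K: "0 \<le> C"
    "\<And>E \<theta>. finite E \<Longrightarrow> E \<subseteq> J \<Longrightarrow> \<theta> \<in> schwartz \<Longrightarrow> flat_at_0 K (FT 1 \<theta>) \<Longrightarrow> norm (\<Sum>j\<in>E. f (piece j \<theta>)) \<le> C * snorm M \<theta>"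
    "\<And>\<theta>. \<theta> \<in> schwartz0 \<Longrightarrow> flat_at_0 K (FT 1 \<theta>) \<Longrightarrow> ((\<lambda>j. f (piece j \<theta>)) has_sum f \<theta>) J"
    by (rule piece_sums[OF f sw_subspace_schwartz0 order_refl]) (rule that; assumption)
  obtain q :: "'n list \<Rightarrow> real^'n \<Rightarrow> complex" and w
  where q: "\<And>\<beta>. slow (q \<beta>)" and w: "\<And>\<beta>. length \<beta> \<le> K \<Longrightarrow> w \<beta> \<in> schwartz"
    and flat: "\<And>\<theta>. \<theta> \<in> schwartz \<Longrightarrow> flat_at_0 K (FT 1 (\<lambda>x. \<theta> x - (\<Sum>\<beta> | length \<beta> \<le> K. dist_of (q \<beta>) \<theta> * w \<beta> x)))"
    and flat0: "\<And>\<theta> \<beta>. \<theta> \<in> schwartz \<Longrightarrow> flat_at_0 K (FT 1 \<theta>) \<Longrightarrow> length \<beta> \<le> K \<Longrightarrow> dist_of (q \<beta>) \<theta> = 0"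
    by (rule flattening[of K]) (rule that; assumption)
  define L where "L = {\<beta> :: 'n list. length \<beta> \<le> K}"
  have L: "finite L" unfolding L_def by (rule finite_lists_le)
  define F where "F = (\<lambda>\<theta> x. \<theta> x - (\<Sum>\<beta>\<in>L. dist_of (q \<beta>) \<theta> * w \<beta> x))"
  have tF: "tame F"
    unfolding F_def by (rule tame_minus_finite_rank[OF L dist_of_slow(1)[OF q]]) (simp add: L_def w)
  define W where "W = {\<theta> :: real^'n \<Rightarrow> complex. \<theta> \<in> schwartz \<and> flat_at_0 K (FT 1 \<theta>)}"
  have FTadd: "FT 1 (\<lambda>x. g x + h x) = (\<lambda>x. FT 1 g x + FT 1 h x)" if "g \<in> schwartz" "h \<in> schwartz" for g h :: "real^'n \<Rightarrow> complex"
    by (rule ext) (rule FT_add[OF that])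
  have FTmult: "FT 1 (\<lambda>x. c * g x) = (\<lambda>x. c * FT 1 g x)" for c and g :: "real^'n \<Rightarrow> complex"
    by (rule ext) (rule FT_cmult)
  have FT0: "FT 1 (\<lambda>x::real^'n. 0) = (\<lambda>x. 0)" by (simp add: FT_def fun_eq_iff)
  have W: "sw_subspace W"
    unfolding sw_subspace_def W_def mem_Collect_eq flat_at_0_def
    using sw_subspaceD(2)[OF sw_subspace_schwartz]
    by (auto simp: FTadd FTmult FT0 schwartz_add schwartz_cmult iter_partial_add iter_partial_cmult smooth_FT iter_partial_zero_open[OF open_UNIV])
  define u where "u = (\<lambda>\<theta>. \<Sum>\<^sub>\<infinity>j\<in>J. f (piece j \<theta>))"
  have sm: "(\<lambda>j. f (piece j \<theta>)) summable_on J" if \<theta>: "\<theta> \<in> W" for \<theta>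
    by (rule bounded_sums_imp_abs_summable[of J _ "C * snorm M \<theta>"]) (use \<theta> K(2) in \<open>simp add: W_def\<close>)
  have pS: "piece j \<theta> \<in> schwartz0" if "j \<in> J" "\<theta> \<in> W" for j \<theta>
    using piece_schwartz0 that by (simp add: W_def)
  have u: "u \<in> dual W"
  proof (rule dualI)
    fix g h assume g: "g \<in> W" and h: "h \<in> W"
    have "u (\<lambda>x. g x + h x) = (\<Sum>\<^sub>\<infinity>j\<in>J. f (piece j g) + f (piece j h))"
      unfolding u_def using g h by (intro infsum_cong) (simp add: piece_add W_def dualD(1)[OF f] piece_schwartz0)
    then show "u (\<lambda>x. g x + h x) = u g + u h"
      using infsum_add[OF sm[OF g] sm[OF h]] by (simp add: u_def)
  next
    fix c g assume g: "g \<in> W"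
    have "u (\<lambda>x. c * g x) = (\<Sum>\<^sub>\<infinity>j\<in>J. c * f (piece j g))"
      unfolding u_def using g by (intro infsum_cong) (simp add: piece_cmult W_def dualD(2)[OF f] piece_schwartz0)
    then show "u (\<lambda>x. c * g x) = c * u g"
      using infsum_cmult_right[of c "\<lambda>j. f (piece j g)" J] sm[OF g] by (simp add: u_def)
  next
    fix g assume g: "g \<in> W"
    have "((\<lambda>j. f (piece j g)) has_sum u g) J" unfolding u_def by (rule has_sum_infsum[OF sm[OF g]])
    then have "((\<lambda>E. norm (\<Sum>j\<in>E. f (piece j g))) \<longlongrightarrow> norm (u g)) (finite_subsets_at_top J)"
      unfolding has_sum_def by (rule tendsto_norm)
    then show "norm (u g) \<le> C * snorm M g"
    proof (rule tendsto_upperbound)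
      show "\<forall>\<^sub>F E in finite_subsets_at_top J. norm (\<Sum>j\<in>E. f (piece j g)) \<le> C * snorm M g"
        by (rule eventually_finite_subsets_at_top_weakI) (use g K(2) in \<open>simp add: W_def\<close>)
    qed simp
  qed
  have FW: "F \<theta> \<in> W" if "\<theta> \<in> schwartz" for \<theta>
    using flat[OF that] tame_schwartz[OF tF that] by (simp add: W_def F_def L_def)
  have d: "dist_of (q \<beta>) \<in> dual schwartz" for \<beta> by (rule dist_of_slow(1)[OF q])
  have "(\<lambda>\<theta>. u (F \<theta>)) \<in> dual schwartz"
  proof (rule dual_compose_tame[OF u W tF FW order_refl])
    fix g h :: "real^'n \<Rightarrow> complex" assume "g \<in> schwartz" "h \<in> schwartz"
    then show "F (\<lambda>x. g x + h x) = (\<lambda>x. F g x + F h x)"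
      by (simp add: F_def dualD(1)[OF d] distrib_right sum.distrib fun_eq_iff)
  next
    fix c and g :: "real^'n \<Rightarrow> complex" assume "g \<in> schwartz"
    then show "F (\<lambda>x. c * g x) = (\<lambda>x. c * F g x)"
      by (simp add: F_def dualD(2)[OF d] right_diff_distrib sum_distrib_left mult.assoc fun_eq_iff)
  qed
  moreover have "u (F \<theta>) = f \<theta>" if \<theta>: "\<theta> \<in> schwartz0" for \<theta>
  proof -
    have S: "\<theta> \<in> schwartz" by (rule schwartz0_schwartz[OF \<theta>])
    have "F \<theta> = \<theta>" using flat0[OF S schwartz0_flat[OF \<theta>]] by (simp add: F_def L_def)
    moreover have "u \<theta> = f \<theta>" unfolding u_def by (rule infsumI[OF K(3)[OF \<theta> schwartz0_flat[OF \<theta>]]])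
    ultimately show ?thesis by simp
  qed
  ultimately show ?thesis by (intro bexI[of _ "\<lambda>\<theta>. u (F \<theta>)"] ballI)
qed

text \<open>Cutting the transform of w off near the origin changes no piece with index in J', and
  the modified function is flat to every order, so \<open>piece_sums\<close> applies to it.\<close>

lemma summable_away_from_0:
  assumes f: "f \<in> dual schwartz" and J': "J' \<subseteq> J" and e: "0 < e" "\<And>j \<xi>. j \<in> J' \<Longrightarrow> norm \<xi> < e \<Longrightarrow> \<phi> j \<xi> = 0"
    and w: "w \<in> schwartz"
  shows "(\<lambda>j. f (piece j w)) summable_on J'"
proof -
  obtain K M C where K: "0 \<le> C"
    "\<And>E \<theta>. finite E \<Longrightarrow> E \<subseteq> J \<Longrightarrow> \<theta> \<in> schwartz \<Longrightarrow> flat_at_0 K (FT 1 \<theta>) \<Longrightarrow> norm (\<Sum>j\<in>E. f (piece j \<theta>)) \<le> C * snorm M \<theta>"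
    "\<And>\<theta>. \<theta> \<in> schwartz \<Longrightarrow> flat_at_0 K (FT 1 \<theta>) \<Longrightarrow> ((\<lambda>j. f (piece j \<theta>)) has_sum f \<theta>) J"
    by (rule piece_sums[OF f sw_subspace_schwartz schwartz0_subset]) (rule that; assumption)
  obtain \<omega> :: "real^'n \<Rightarrow> complex" where \<omega>: "\<omega> \<in> schwartz"
    "\<And>x. x \<in> cball 0 (e / 2) \<Longrightarrow> \<omega> x = 1" "\<And>x. x \<notin> ball 0 e \<Longrightarrow> \<omega> x = 0"
    by (rule plateau[of "e / 2" e 0]) (use e(1) in auto)
  have Fw: "FT 1 w \<in> schwartz" by (rule schwartz_FT[OF _ w]) simp
  \<comment> \<open>The plateau \<omega> is 1 near 0, which makes k vanish there, and 0 beyond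
    radius e, where k keeps the values of the transform.\<close>
  define k where "k = (\<lambda>\<xi>. FT 1 w \<xi> - \<omega> \<xi> * FT 1 w \<xi>)"
  have k: "k \<in> schwartz" unfolding k_def by (intro schwartz_diff schwartz_mult Fw \<omega>(1))
  define w' where "w' = FT (-1) k"
  have w': "w' \<in> schwartz" unfolding w'_def by (rule schwartz_FT[OF _ k]) simp
  have Fw': "FT 1 w' = k" unfolding w'_def using FT_inversion_fun[OF k, of "-1"] by simp
  have "iter_partial \<beta> k 0 = 0" for \<beta>
    by (rule iter_partial_zero_open[of "ball 0 (e / 2)"]) (use e(1) in \<open>auto simp: k_def \<omega>(2)\<close>)
  then have "flat_at_0 K (FT 1 w')" by (simp add: Fw' flat_at_0_def)
  from has_sum_imp_summable[OF K(3)[OF w' this]] J'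
  have "(\<lambda>j. f (piece j w')) summable_on J'" by (rule summable_on_subset_banach)
  moreover have "piece j w' = piece j w" if j: "j \<in> J'" for j
  proof -
    have "sq j \<xi> * k \<xi> = sq j \<xi> * FT 1 w \<xi>" for \<xi>
      using e(2)[OF j, of \<xi>] \<omega>(3)[of \<xi>] by (cases "norm \<xi> < e") (auto simp: sq_def k_def)
    then show ?thesis by (simp only: piece_def Fw')
  qed
  ultimately show ?thesis by (simp cong: summable_on_cong)
qed

text \<open>The sums over the flattened function converge. They differ from the original sums by
  moments of \<theta>, with sums of \<open>f (piece (\<sigma> i) (w \<beta>))\<close> as
  coefficients. The part over i \<le> 0 comes with no convergence guarantee and is cancelled by
  \<open>p k\<close>; the part over i > 0 converges and is moved into p'. Hence the correction
  depends on k alone.\<close>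

theorem corrected_limit:
  fixes \<sigma> :: "int \<Rightarrow> 'j"
  assumes f: "f \<in> dual schwartz" and \<sigma>: "bij_betw \<sigma> UNIV J"
    and e: "0 < e" "\<And>i \<xi>. 0 < i \<Longrightarrow> norm \<xi> < e \<Longrightarrow> \<phi> (\<sigma> i) \<xi> = 0"
  obtains p p' L where "\<And>k::nat. polynomial_function (p k)" "polynomial_function p'"
    "tends_in schwartz (\<lambda>(k, m) \<theta>. (\<Sum>i\<in>{- int k..int m}. f (piece (\<sigma> i) \<theta>)) + dist_of (p k) \<theta>) L (sequentially \<times>\<^sub>F sequentially)"
    "\<And>\<theta>. \<theta> \<in> schwartz \<Longrightarrow> f \<theta> = L \<theta> + dist_of p' \<theta>"
proof -
  obtain K M C where K: "0 \<le> C"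
    "\<And>E \<theta>. finite E \<Longrightarrow> E \<subseteq> J \<Longrightarrow> \<theta> \<in> schwartz \<Longrightarrow> flat_at_0 K (FT 1 \<theta>) \<Longrightarrow> norm (\<Sum>j\<in>E. f (piece j \<theta>)) \<le> C * snorm M \<theta>"
    "\<And>\<theta>. \<theta> \<in> schwartz \<Longrightarrow> flat_at_0 K (FT 1 \<theta>) \<Longrightarrow> ((\<lambda>j. f (piece j \<theta>)) has_sum f \<theta>) J"
    by (rule piece_sums[OF f sw_subspace_schwartz schwartz0_subset]) (rule that; assumption)
  obtain q :: "'n list \<Rightarrow> real^'n \<Rightarrow> complex" and w
  where poly: "\<And>\<beta> c. polynomial_function (\<lambda>x. c * q \<beta> x)"
    and q: "\<And>\<beta>. slow (q \<beta>)" and w: "\<And>\<beta>. length \<beta> \<le> K \<Longrightarrow> w \<beta> \<in> schwartz"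
    and flat: "\<And>\<theta>. \<theta> \<in> schwartz \<Longrightarrow> flat_at_0 K (FT 1 (\<lambda>x. \<theta> x - (\<Sum>\<beta> | length \<beta> \<le> K. dist_of (q \<beta>) \<theta> * w \<beta> x)))"
    by (rule flattening[of K]) (rule that; assumption)
  define L where "L = {\<beta> :: 'n list. length \<beta> \<le> K}"
  have L: "finite L" unfolding L_def by (rule finite_lists_le)
  have wL: "w \<beta> \<in> schwartz" if "\<beta> \<in> L" for \<beta> using w that by (simp add: L_def)
  let ?l = "\<lambda>\<beta> \<theta>. dist_of (q \<beta>) \<theta>"
  define g where "g = (\<lambda>i \<theta>. f (piece (\<sigma> i) \<theta>))"
  have \<sigma>J: "\<sigma> i \<in> J" for i using \<sigma> by (auto simp: bij_betw_def)
  have g: "g i \<in> dual schwartz" for i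
    unfolding g_def by (rule dual_piece[OF f sw_subspace_schwartz _ \<sigma>J]) (auto simp: schwartz0_schwartz)
  define F where "F = (\<lambda>\<theta> x. \<theta> x - (\<Sum>\<beta>\<in>L. ?l \<beta> \<theta> * w \<beta> x))"
  have sumS: "(\<lambda>x. \<Sum>\<beta>\<in>L. ?l \<beta> \<theta> * w \<beta> x) \<in> schwartz" for \<theta> by (intro schwartz_sum schwartz_cmult wL)
  have split: "u (F \<theta>) = u \<theta> - (\<Sum>\<beta>\<in>L. ?l \<beta> \<theta> * u (w \<beta>))" if u: "u \<in> dual schwartz" and \<theta>: "\<theta> \<in> schwartz" for u \<theta>
    unfolding F_def
    by (simp add: dual_diff[OF u sw_subspace_schwartz \<theta> sumS] schwartz_cmult wL dual_sum[OF u sw_subspace_schwartz] dualD(2)[OF u])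
  \<comment> \<open>Index 0 is grouped with the negative ones, the gap at the origin being assumed
    for positive indices only.\<close>
  define A where "A = (\<lambda>k \<beta>. \<Sum>i\<in>{- int k..0}. g i (w \<beta>))"
  define s where "s = (\<lambda>\<beta>. \<Sum>\<^sub>\<infinity>i\<in>{0<..}. g i (w \<beta>))"
  have s_lim: "(\<lambda>m. \<Sum>i\<in>{0<..int m}. g i (w \<beta>)) \<longlonglongrightarrow> s \<beta>" if \<beta>: "\<beta> \<in> L" for \<beta>
  proof -
    have "(\<lambda>j. f (piece j (w \<beta>))) summable_on \<sigma> ` {0<..}"
      by (rule summable_away_from_0[OF f _ e(1) _ wL[OF \<beta>]]) (use \<sigma>J e(2) in auto)
    moreover have "inj_on \<sigma> {0<..}" using \<sigma> by (auto simp: bij_betw_def inj_on_def)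
    ultimately have "(\<lambda>i. g i (w \<beta>)) summable_on {0<..}"
      by (simp add: summable_on_reindex o_def g_def)
    then have "(sum (\<lambda>i. g i (w \<beta>)) \<longlongrightarrow> s \<beta>) (finite_subsets_at_top {0<..})"
      unfolding s_def by (rule has_sum_infsum[unfolded has_sum_def])
    \<comment> \<open>These intervals exhaust the positive integers, so the unordered sum is also
      the limit along them.\<close>
    moreover have "filterlim (\<lambda>m. {0<..int m}) (finite_subsets_at_top {0<..}) sequentially"
      unfolding filterlim_finite_subsets_at_top
    proof (intro allI impI)
      fix X :: "int set" assume X: "finite X \<and> X \<subseteq> {0<..}"
      then obtain b where b: "\<And>x. x \<in> X \<Longrightarrow> x \<le> b" by (meson bdd_above_finite bdd_above_def)
      show "\<forall>\<^sub>F m in sequentially. finite {0<..int m} \<and> X \<subseteq> {0<..int m} \<and> {0<..int m} \<subseteq> {0<..}"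
        using eventually_ge_at_top[of "nat b"]
      proof eventually_elim
        case (elim m)
        show ?case
        proof (intro conjI subsetI)
          fix x assume "x \<in> X"
          then show "x \<in> {0<..int m}" using X b[of x] elim by auto
        qed auto
      qed
    qed
    ultimately show ?thesis by (rule filterlim_compose)
  qed
  have F_lim: "((\<lambda>(k, m). \<Sum>i\<in>{- int k..int m}. g i (F \<theta>)) \<longlongrightarrow> f (F \<theta>)) (sequentially \<times>\<^sub>F sequentially)" if \<theta>: "\<theta> \<in> schwartz" for \<theta>
  proof -
    have FS: "F \<theta> \<in> schwartz" unfolding F_def by (rule schwartz_diff[OF \<theta> sumS])
    have "((\<lambda>j. f (piece j (F \<theta>))) has_sum f (F \<theta>)) J"
      using K(3)[OF FS] flat[OF \<theta>] by (simp add: F_def L_def)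
    then have "((\<lambda>i. g i (F \<theta>)) has_sum f (F \<theta>)) UNIV"
      unfolding g_def using has_sum_reindex_bij_betw[OF \<sigma>, of "\<lambda>j. f (piece j (F \<theta>))"] by simp
    then have "(sum (\<lambda>i. g i (F \<theta>)) \<longlongrightarrow> f (F \<theta>)) (finite_subsets_at_top UNIV)" by (simp add: has_sum_def)
    moreover have "filterlim (\<lambda>(k, m). {- int k..int m}) (finite_subsets_at_top UNIV) (sequentially \<times>\<^sub>F sequentially)"
      unfolding filterlim_finite_subsets_at_top
    proof (intro allI impI)
      fix X :: "int set" assume X: "finite X \<and> X \<subseteq> UNIV"
      then obtain b where b: "\<And>x. x \<in> X \<Longrightarrow> x \<le> b" by (meson bdd_above_finite bdd_above_def)
      obtain c where c: "\<And>x. x \<in> X \<Longrightarrow> c \<le> x" using X by (meson bdd_below_finite bdd_below_def)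
      have "\<forall>\<^sub>F (k, m) in sequentially \<times>\<^sub>F sequentially. nat (- c) \<le> k \<and> nat b \<le> m"
        unfolding eventually_prod_sequentially by (intro exI[of _ "nat (- c) + nat b"]) auto
      then show "\<forall>\<^sub>F y in sequentially \<times>\<^sub>F sequentially. finite (case y of (k, m) \<Rightarrow> {- int k..int m}) \<and>
          X \<subseteq> (case y of (k, m) \<Rightarrow> {- int k..int m}) \<and> (case y of (k, m) \<Rightarrow> {- int k..int m}) \<subseteq> UNIV"
      proof eventually_elim
        case (elim y)
        obtain k m where y: "y = (k, m)" by fastforce
        have "X \<subseteq> {- int k..int m}"
        proof
          fix x assume "x \<in> X"
          then show "x \<in> {- int k..int m}" using b[of x] c[of x] elim by (simp add: y) linarith
        qed
        then show ?case by (simp add: y)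
      qed
    qed
    ultimately have "((\<lambda>y. sum (\<lambda>i. g i (F \<theta>)) (case y of (k, m) \<Rightarrow> {- int k..int m})) \<longlongrightarrow> f (F \<theta>)) (sequentially \<times>\<^sub>F sequentially)"
      by (rule filterlim_compose)
    then show ?thesis by (simp add: split_def)
  qed
  \<comment> \<open>\<open>p k\<close> removes the block from -k to 0. The fixed coefficients f (w
    \<beta>) - s \<beta> go into p', so the limit U is f minus the functional of p'.\<close>
  define p where "p = (\<lambda>k x. \<Sum>\<beta>\<in>L. (- A k \<beta>) * q \<beta> x)"
  define p' where "p' = (\<lambda>x. \<Sum>\<beta>\<in>L. (f (w \<beta>) - s \<beta>) * q \<beta> x)"
  define U where "U = (\<lambda>\<theta>. f \<theta> + (\<Sum>\<beta>\<in>L. (s \<beta> - f (w \<beta>)) * ?l \<beta> \<theta>))"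
  have dp: "dist_of (p k) \<theta> = (\<Sum>\<beta>\<in>L. - A k \<beta> * ?l \<beta> \<theta>)" if "\<theta> \<in> schwartz" for k \<theta>
    unfolding p_def by (rule dist_of_lincomb[OF q that])
  have dp': "dist_of p' \<theta> = (\<Sum>\<beta>\<in>L. (f (w \<beta>) - s \<beta>) * ?l \<beta> \<theta>)" if "\<theta> \<in> schwartz" for \<theta>
    unfolding p'_def by (rule dist_of_lincomb[OF q that])
  show ?thesis
  proof (rule that[of p p' U])
    show "polynomial_function (p k)" for k unfolding p_def by (intro polynomial_function_sum L poly)
    show "polynomial_function p'" unfolding p'_def by (intro polynomial_function_sum L poly)
    show "f \<theta> = U \<theta> + dist_of p' \<theta>" if "\<theta> \<in> schwartz" for \<theta>
      unfolding dp'[OF that] U_def by (simp add: sum.distrib[symmetric] algebra_simps)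
    show "tends_in schwartz (\<lambda>(k, m) \<theta>. (\<Sum>i\<in>{- int k..int m}. f (piece (\<sigma> i) \<theta>)) + dist_of (p k) \<theta>) U (sequentially \<times>\<^sub>F sequentially)"
      unfolding tends_in_def
    proof (intro conjI ballI)
      show "U \<in> dual schwartz"
        unfolding U_def
        by (intro dual_functional_add dual_functional_sum dual_functional_cmult f dist_of_slow(1)[OF q] sw_subspace_schwartz)
      fix \<theta> :: "real^'n \<Rightarrow> complex" assume \<theta>: "\<theta> \<in> schwartz"
      \<comment> \<open>Exact for every k and m: \<open>p k\<close> cancels the moment terms of the
        indices up to 0, and only the convergent block remains.\<close>
      have eq: "(\<Sum>i\<in>{- int k..int m}. g i \<theta>) + dist_of (p k) \<theta> = (\<Sum>i\<in>{- int k..int m}. g i (F \<theta>)) + (\<Sum>\<beta>\<in>L. ?l \<beta> \<theta> * (\<Sum>i\<in>{0<..int m}. g i (w \<beta>)))" for k m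
      proof -
        have "(\<Sum>i\<in>{- int k..int m}. g i (w \<beta>)) = A k \<beta> + (\<Sum>i\<in>{0<..int m}. g i (w \<beta>))" for \<beta>
        proof -
          have "{- int k..int m} = {- int k..0} \<union> {0<..int m}" by auto
          then show ?thesis unfolding A_def by (simp only:) (rule sum.union_disjoint; auto)
        qed
        then have e: "(\<Sum>\<beta>\<in>L. ?l \<beta> \<theta> * (\<Sum>i\<in>{- int k..int m}. g i (w \<beta>))) = (\<Sum>\<beta>\<in>L. ?l \<beta> \<theta> * (\<Sum>i\<in>{0<..int m}. g i (w \<beta>))) - dist_of (p k) \<theta>"
          unfolding dp[OF \<theta>] by (simp add: distrib_left sum.distrib sum_negf mult.commute)
        have "(\<Sum>i\<in>{- int k..int m}. g i (F \<theta>)) = (\<Sum>i\<in>{- int k..int m}. g i \<theta>) - (\<Sum>i\<in>{- int k..int m}. \<Sum>\<beta>\<in>L. ?l \<beta> \<theta> * g i (w \<beta>))"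
          by (simp add: split[OF g \<theta>] sum_subtractf)
        also have "(\<Sum>i\<in>{- int k..int m}. \<Sum>\<beta>\<in>L. ?l \<beta> \<theta> * g i (w \<beta>)) = (\<Sum>\<beta>\<in>L. ?l \<beta> \<theta> * (\<Sum>i\<in>{- int k..int m}. g i (w \<beta>)))"
          by (subst sum.swap) (simp add: sum_distrib_left)
        finally show ?thesis unfolding e by simp
      qed
      have lim2: "((\<lambda>y. \<Sum>\<beta>\<in>L. ?l \<beta> \<theta> * (\<Sum>i\<in>{0<..int (snd y)}. g i (w \<beta>))) \<longlongrightarrow> (\<Sum>\<beta>\<in>L. ?l \<beta> \<theta> * s \<beta>)) (sequentially \<times>\<^sub>F sequentially)"
        by (intro tendsto_sum tendsto_mult tendsto_const filterlim_compose[OF s_lim filterlim_snd])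
      have "((\<lambda>y. (case y of (k, m) \<Rightarrow> \<Sum>i\<in>{- int k..int m}. g i (F \<theta>)) + (\<Sum>\<beta>\<in>L. ?l \<beta> \<theta> * (\<Sum>i\<in>{0<..int (snd y)}. g i (w \<beta>))))
         \<longlongrightarrow> f (F \<theta>) + (\<Sum>\<beta>\<in>L. ?l \<beta> \<theta> * s \<beta>)) (sequentially \<times>\<^sub>F sequentially)"
        by (rule tendsto_add[OF F_lim[OF \<theta>] lim2])
      moreover have "f (F \<theta>) + (\<Sum>\<beta>\<in>L. ?l \<beta> \<theta> * s \<beta>) = U \<theta>"
        unfolding split[OF f \<theta>] U_def by (simp add: left_diff_distrib sum_subtractf mult.commute[of "dist_of _ _"])
      moreover have "(\<lambda>y. (case y of (k, m) \<Rightarrow> \<Sum>i\<in>{- int k..int m}. g i (F \<theta>)) + (\<Sum>\<beta>\<in>L. ?l \<beta> \<theta> * (\<Sum>i\<in>{0<..int (snd y)}. g i (w \<beta>))))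
         = (\<lambda>y. (case y of (k, m) \<Rightarrow> \<lambda>\<theta>. (\<Sum>i\<in>{- int k..int m}. f (piece (\<sigma> i) \<theta>)) + dist_of (p k) \<theta>) \<theta>)"
      proof
        fix y :: "nat \<times> nat"
        obtain k m where y: "y = (k, m)" by fastforce
        show "(case y of (k, m) \<Rightarrow> \<Sum>i\<in>{- int k..int m}. g i (F \<theta>)) + (\<Sum>\<beta>\<in>L. ?l \<beta> \<theta> * (\<Sum>i\<in>{0<..int (snd y)}. g i (w \<beta>)))
         = (case y of (k, m) \<Rightarrow> \<lambda>\<theta>. (\<Sum>i\<in>{- int k..int m}. f (piece (\<sigma> i) \<theta>)) + dist_of (p k) \<theta>) \<theta>"
          using eq[of k m] by (simp add: y g_def)
      qed
      ultimately show "((\<lambda>y. (case y of (k, m) \<Rightarrow> \<lambda>\<theta>. (\<Sum>i\<in>{- int k..int m}. f (piece (\<sigma> i) \<theta>)) + dist_of (p k) \<theta>) \<theta>) \<longlongrightarrow> U \<theta>) (sequentially \<times>\<^sub>F sequentially)"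
        by simp
    qed
  qed
qed

end

section \<open>Diagonal affine maps and the frame functions\<close>

lemma affine_diag:
  assumes "A = (\<chi> i l. if i = l then s i else 0)"
  shows "affine_map A b x $ i = s i * x $ i + b $ i"
  by (simp add: assms affine_map_def matrix_vector_mult_def if_distrib[of "\<lambda>z. z * _"] cong: if_cong)

lemma affine_diag_inverse:
  assumes A: "A = (\<chi> i l. if i = l then s i else 0)" and s: "\<And>i. 0 < s i"
  shows "affine_map A b (\<chi> i. (y $ i - b $ i) / s i) = y" "(\<chi> i. (affine_map A b x $ i - b $ i) / s i) = x"
  using s by (simp_all add: vec_eq_iff affine_diag[OF A] less_imp_neq[symmetric])

lemma inv_affine_diag:
  assumes A: "A = (\<chi> i l. if i = l then s i else 0)" and s: "\<And>i. 0 < s i"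
  shows "inv (affine_map A b) y = (\<chi> i. (y $ i - b $ i) / s i)"
  by (rule inv_f_eq[OF inj_on_inverseI[of _ "\<lambda>y. \<chi> i. (y $ i - b $ i) / s i"]]) (simp_all add: affine_diag_inverse[OF A s])

lemma affine_diag_image:
  assumes A: "A = (\<chi> i l. if i = l then s i else 0)" and s: "\<And>i. 0 < s i"
  shows "affine_map A b ` X = {y. (\<chi> i. (y $ i - b $ i) / s i) \<in> X}"
proof (intro set_eqI iffI)
  fix y assume "y \<in> affine_map A b ` X"
  then show "y \<in> {y. (\<chi> i. (y $ i - b $ i) / s i) \<in> X}" by (auto simp: affine_diag_inverse(2)[OF A s])
next
  fix y assume "y \<in> {y. (\<chi> i. (y $ i - b $ i) / s i) \<in> X}"
  then show "y \<in> affine_map A b ` X"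
    by (intro image_eqI[of y _ "\<chi> i. (y $ i - b $ i) / s i"]) (simp_all add: affine_diag_inverse(1)[OF A s])
qed

lemma affine_diag_open:
  fixes X :: "(real^'n::finite) set"
  assumes A: "A = (\<chi> i l. if i = l then s i else 0)" and s: "\<And>i. 0 < s i" and X: "open X"
  shows "open (affine_map A b ` X)"
proof -
  have "continuous_on UNIV (\<lambda>y::real^'n. \<chi> i. (y $ i - b $ i) / s i)"
    by (intro continuous_intros) (use s in \<open>auto simp: less_imp_neq[symmetric]\<close>)
  then have "open ((\<lambda>y. \<chi> i. (y $ i - b $ i) / s i) -` X)" by (intro open_vimage X)
  then show ?thesis unfolding affine_diag_image[OF A s] by (simp add: vimage_def)
qed

lemma abs_affine: "0 < s \<Longrightarrow> \<bar>y - (b + s * c)\<bar> = s * \<bar>(y - b) / s - (c::real)\<bar>"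
proof -
  assume s: "0 < s"
  then have "y - (b + s * c) = s * ((y - b) / s - c)" by (simp add: field_simps)
  then show ?thesis using s by (simp only: abs_mult abs_of_pos)
qed

lemma affine_diag_cube:
  assumes A: "A = (\<chi> i l. if i = l then s i else 0)" and s: "\<And>i. 0 < s i"
  shows "affine_map A b ` cube c a = {y. \<forall>i. \<bar>y $ i - (b $ i + s i * c $ i)\<bar> \<le> a * s i}"
proof -
  have "c $ i - a \<le> (y $ i - b $ i) / s i \<and> (y $ i - b $ i) / s i \<le> c $ i + a \<longleftrightarrow> \<bar>y $ i - (b $ i + s i * c $ i)\<bar> \<le> a * s i" for y i
    unfolding abs_affine[OF s[of i], of "y $ i" "b $ i" "c $ i"] mult.commute[of a] mult_le_cancel_left_pos[OF s[of i]] by (auto simp: abs_le_iff)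
  then show ?thesis
    unfolding affine_diag_image[OF A s] cube_def by (simp add: mem_box_cart)
qed

text \<open>An open subset of the closed cube lies in its interior; the resulting strict
  inequalities are what \<open>frame_expansion\<close> asks for.\<close>

lemma affine_diag_open_cube:
  assumes A: "A = (\<chi> i l. if i = l then s i else 0)" and s: "\<And>i. 0 < s i"
    and Q: "open Q" "Q \<subseteq> cube c a"
  shows "affine_map A b ` Q \<subseteq> {y. \<forall>i. \<bar>y $ i - (b $ i + s i * c $ i)\<bar> < a * s i}"
proof -
  have "Q \<subseteq> interior (cube c a)" using Q by (simp add: interior_maximal)
  then have "Q \<subseteq> {x. \<forall>i. c $ i - a < x $ i \<and> x $ i < c $ i + a}"
    unfolding cube_def interior_cbox by (auto simp: mem_box_cart)
  moreover have "c $ i - a < (y $ i - b $ i) / s i \<and> (y $ i - b $ i) / s i < c $ i + a \<longleftrightarrow> \<bar>y $ i - (b $ i + s i * c $ i)\<bar> < a * s i" for y i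
    unfolding abs_affine[OF s[of i], of "y $ i" "b $ i" "c $ i"] mult.commute[of a] mult_less_cancel_left_pos[OF s[of i]] by (auto simp: abs_less_iff)
  ultimately show ?thesis
    unfolding affine_diag_image[OF A s] by fastforce
qed

lemma det_diag:
  fixes s :: "'n::finite \<Rightarrow> real"
  shows "det (\<chi> i l. if i = l then s i else 0) = (\<Prod>i\<in>UNIV. s i)"
proof -
  have "det (\<chi> i l. if i = l then s i else 0) = (\<Prod>i\<in>UNIV. (\<chi> i l. if i = l then s i else 0) $ i $ i)"
    by (rule det_diagonal) simp
  then show ?thesis by simp
qed

text \<open>The cell volume of the sampling lattice in terms of the cube and the determinant; this
  is the origin of the power of 2 pi.\<close>

lemma prod_pi_div:
  fixes s :: "'n::finite \<Rightarrow> real" and a :: real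
  assumes "\<And>i. 0 < s i" "0 < a"
  shows "(\<Prod>i\<in>UNIV. pi / (a * s i)) = (2 * pi) ^ CARD('n) * inverse ((2 * a) ^ CARD('n)) * inverse (\<Prod>i\<in>UNIV. s i)"
proof -
  have "pi / (a * s i) = (2 * pi) * inverse (2 * a) * inverse (s i)" for i
    using assms(2) assms(1)[of i] by (simp add: field_simps)
  then show ?thesis
    by (simp only: prod.distrib prod_constant power_inverse power_mult_distrib prod_inversef[unfolded o_def])
qed

lemma cnj_FT: "cnj (FT s g x) = FT (- s) (\<lambda>\<xi>. cnj (g \<xi>)) x"
proof -
  have "cnj (LINT \<xi>|lborel. g \<xi> * cis (s * (\<xi> \<bullet> x))) = (LINT \<xi>|lborel. cnj (g \<xi> * cis (s * (\<xi> \<bullet> x))))"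
    by (rule Bochner_Integration.integral_cnj[symmetric])
  then show ?thesis by (simp add: FT_def cis_cnj)
qed

text \<open>The translation b enters the coefficient and the frame function through conjugate
  phases, which cancel. The two normalising constants multiply to the cell volume divided by the
  power of 2 pi, as the Fourier series requires.\<close>

theorem frame_sums:
  fixes \<phi> :: "real^'n::finite \<Rightarrow> real" and \<theta> :: "real^'n \<Rightarrow> complex"
  assumes f: "f \<in> dual V" and V: "sw_subspace V"
    and \<phi>: "(\<lambda>\<xi>. complex_of_real (\<phi> \<xi>)) \<in> schwartz"
    and \<phi>V: "\<And>\<kappa>. slow \<kappa> \<Longrightarrow> FT (-1) (\<lambda>\<xi>. complex_of_real (\<phi> \<xi>) * \<kappa> \<xi>) \<in> V"
    and A: "A = (\<chi> i l. if i = l then s i else 0)" and s: "\<And>i. 0 < s i" and a: "0 < a"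
    and Q: "open Q" "Q \<subseteq> cube c a" and supp: "fun_supp \<phi> \<subseteq> affine_map A b ` Q"
    and \<theta>: "\<theta> \<in> schwartz"
  shows "((\<lambda>n. frame_term f (frame_fun (cube c a) a A b \<phi> n) \<theta>) has_sum
    f (FT (-1) (\<lambda>\<xi>. complex_of_real (\<phi> \<xi>) * (complex_of_real (\<phi> \<xi>) * FT 1 \<theta> \<xi>)))) UNIV"
proof -
  let ?\<phi> = "\<lambda>\<xi>. complex_of_real (\<phi> \<xi>)" and ?C = "complex_of_real (FTc TYPE('n))"
  define v where "v = (\<lambda>n. vec_lambda (\<lambda>i. pi / (a * s i) * of_int (n $ i)) :: real^'n)"
  define c0 where "c0 = (2 * a) powr (- (real CARD('n) / 2)) * \<bar>det A\<bar> powr (- 1/2)"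
  have C0: "?C \<noteq> 0" using FTc_pos[where 'n = 'n] by simp
  have r: "0 < a * s i" for i using a s by simp
  have pos: "0 < (\<Prod>i\<in>UNIV. s i)" by (intro prod_pos) (use s in auto)
  have c0sq: "c0 * c0 = FTc TYPE('n) * FTc TYPE('n) * (\<Prod>i\<in>UNIV. pi / (a * s i))"
  proof -
    have 1: "(x powr (- (real CARD('n) / 2))) * (x powr (- (real CARD('n) / 2))) = inverse (x ^ CARD('n))" if "0 < x" for x :: real
      using that by (simp add: powr_add[symmetric] powr_minus powr_realpow inverse_mult_distrib[symmetric] del: inverse_mult_distrib)
    have 2: "(x powr (- 1/2)) * (x powr (- 1/2)) = inverse x" if "0 < x" for x :: real
      using that by (simp add: powr_add[symmetric] powr_minus inverse_mult_distrib[symmetric] del: inverse_mult_distrib)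
    have "c0 * c0 = inverse ((2 * a) ^ CARD('n)) * inverse (\<Prod>i\<in>UNIV. s i)"
      using 1[of "2 * a"] 2[of "\<Prod>i\<in>UNIV. s i"] a pos by (simp add: c0_def A det_diag mult_ac)
    moreover have "FTc TYPE('n) * FTc TYPE('n) = inverse ((2 * pi) ^ CARD('n))"
      unfolding FTc_def by (rule 1) simp
    moreover have "inverse ((2 * pi) ^ CARD('n)) * (2 * pi) ^ CARD('n) = 1" by (rule left_inverse) simp
    ultimately show ?thesis
      unfolding prod_pi_div[of s a, OF s a] by (simp only: mult.assoc[symmetric] mult_1_left)
  qed
  have \<phi>0: "\<phi> \<xi> = 0" if "\<xi> \<notin> affine_map A b ` Q" for \<xi>
    using that supp fun_supp_notin[of \<xi> \<phi>] by auto
  have suppc: "fun_supp ?\<phi> = fun_supp \<phi>" by (simp add: fun_supp_def)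
  have ph: "pi / a * (lattice_vec n \<bullet> inv (affine_map A b) \<xi>) = v n \<bullet> (\<xi> - b)" for n \<xi>
    by (simp add: inv_affine_diag[OF A s] inner_vec_def lattice_vec_def v_def sum_distrib_left mult_ac)
  \<comment> \<open>Where \<phi> does not vanish the indicator is 1, because Q lies in the cube;
    elsewhere both sides are 0.\<close>
  have fe: "?\<phi> \<xi> * frame_exp (cube c a) a A b n \<xi> = ?\<phi> \<xi> * (complex_of_real c0 * cis (v n \<bullet> (\<xi> - b)))" for n \<xi>
  proof (cases "\<xi> \<in> affine_map A b ` Q")
    case True
    then have "inv (affine_map A b) \<xi> \<in> cube c a"
      using Q(2) unfolding affine_diag_image[OF A s] inv_affine_diag[OF A s] by blast
    then show ?thesis unfolding frame_exp_def ph by (simp add: c0_def)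
  qed (simp add: \<phi>0)
  define \<eta> where "\<eta> = (\<lambda>n. frame_fun (cube c a) a A b \<phi> n)"
  have \<eta>: "\<eta> n = FT 1 (\<lambda>\<xi>. ?\<phi> \<xi> * (complex_of_real c0 * cis (v n \<bullet> (\<xi> - b))))" for n
    unfolding \<eta>_def frame_fun_def inv_fourier_FT fe ..
  \<comment> \<open>The pairing conjugates its second argument. As \<phi> and the constant are real,
    this only reverses the phases and the sign of the transform.\<close>
  have pw: "pairing f (\<eta> n) = complex_of_real c0 * cis (v n \<bullet> b) * f (FT (-1) (\<lambda>\<xi>. ?\<phi> \<xi> * cis (- v n \<bullet> \<xi>)))" for n
  proof -
    have "cnj (?\<phi> \<xi> * (complex_of_real c0 * cis (v n \<bullet> (\<xi> - b)))) = (complex_of_real c0 * cis (v n \<bullet> b)) * (?\<phi> \<xi> * cis (- v n \<bullet> \<xi>))" for \<xi>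
    proof -
      have "cnj (cis (v n \<bullet> (\<xi> - b))) = cis (v n \<bullet> b) * cis (- v n \<bullet> \<xi>)"
        by (simp add: cis_cnj cis_mult inner_diff_right)
      then show ?thesis by (simp add: mult_ac)
    qed
    then have "cnj (\<eta> n x) = (complex_of_real c0 * cis (v n \<bullet> b)) * FT (-1) (\<lambda>\<xi>. ?\<phi> \<xi> * cis (- v n \<bullet> \<xi>)) x" for x
      unfolding \<eta> cnj_FT by (simp only: FT_cmult)
    then show ?thesis
      unfolding pairing_def by (simp only: dualD(2)[OF f \<phi>V[OF slow_cis]])
  qed
  have \<psi>: "FT 1 \<theta> \<in> schwartz" by (rule schwartz_FT[OF _ \<theta>]) simp
  \<comment> \<open>Duality moves the transform from the frame function to \<theta>, which leaves a
    Fourier coefficient of \<phi> times \<open>FT 1 \<theta>\<close>.\<close>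
  have d\<eta>: "dist_of (\<eta> n) \<theta> = complex_of_real c0 * cis (- (v n \<bullet> b)) * (FT 1 (\<lambda>\<xi>. ?\<phi> \<xi> * FT 1 \<theta> \<xi>) (v n) / ?C)" for n
  proof -
    have e: "?\<phi> \<xi> * (complex_of_real c0 * cis (v n \<bullet> (\<xi> - b))) = (complex_of_real c0 * cis (- (v n \<bullet> b))) * (?\<phi> \<xi> * cis (v n \<bullet> \<xi>))" for \<xi>
    proof -
      have "cis (v n \<bullet> (\<xi> - b)) = cis (- (v n \<bullet> b)) * cis (v n \<bullet> \<xi>)"
        by (simp add: cis_mult inner_diff_right)
      then show ?thesis by (simp add: mult_ac)
    qed
    have "dist_of (\<eta> n) \<theta> = (LINT \<xi>|lborel. ((complex_of_real c0 * cis (- (v n \<bullet> b))) * (?\<phi> \<xi> * cis (v n \<bullet> \<xi>))) * FT 1 \<theta> \<xi>)"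
      unfolding dist_of_def \<eta> e
      by (rule FT_duality[OF schwartz_integrable[OF schwartz_cmult[OF schwartz_cis[OF \<phi>]]] schwartz_integrable[OF \<theta>]])
    also have "\<dots> = (complex_of_real c0 * cis (- (v n \<bullet> b))) * (LINT \<xi>|lborel. (?\<phi> \<xi> * FT 1 \<theta> \<xi>) * cis (1 * (\<xi> \<bullet> v n)))"
      by (simp add: inner_commute mult_ac flip: integral_mult_right_zero)
    also have "(LINT \<xi>|lborel. (?\<phi> \<xi> * FT 1 \<theta> \<xi>) * cis (1 * (\<xi> \<bullet> v n))) = FT 1 (\<lambda>\<xi>. ?\<phi> \<xi> * FT 1 \<theta> \<xi>) (v n) / ?C"
      unfolding FT_def[of 1 "\<lambda>\<xi>. ?\<phi> \<xi> * FT 1 \<theta> \<xi>"] FTc_def[of "TYPE('n)", symmetric] using C0 by simp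
    finally show ?thesis .
  qed
  have trm: "frame_term f (\<eta> n) \<theta> = complex_of_real (FTc TYPE('n) * (\<Prod>i\<in>UNIV. pi / (a * s i))) *
      FT 1 (\<lambda>\<xi>. ?\<phi> \<xi> * FT 1 \<theta> \<xi>) (v n) * f (FT (-1) (\<lambda>\<xi>. ?\<phi> \<xi> * cis (- v n \<bullet> \<xi>)))" for n
  proof -
    have cc: "cis (v n \<bullet> b) * cis (- (v n \<bullet> b)) = 1" by (simp add: cis_mult)
    have "frame_term f (\<eta> n) \<theta> = (cis (v n \<bullet> b) * cis (- (v n \<bullet> b))) * (complex_of_real (c0 * c0) / ?C) *
        FT 1 (\<lambda>\<xi>. ?\<phi> \<xi> * FT 1 \<theta> \<xi>) (v n) * f (FT (-1) (\<lambda>\<xi>. ?\<phi> \<xi> * cis (- v n \<bullet> \<xi>)))"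
      unfolding frame_term_def pw d\<eta> by (simp add: mult_ac)
    also have "complex_of_real (c0 * c0) / ?C = complex_of_real (FTc TYPE('n) * (\<Prod>i\<in>UNIV. pi / (a * s i)))"
      unfolding c0sq of_real_mult mult.assoc by (rule nonzero_mult_div_cancel_left[OF C0])
    finally show ?thesis unfolding cc by simp
  qed
  have "fun_supp ?\<phi> \<subseteq> {x. \<forall>i. \<bar>x $ i - (b $ i + s i * c $ i)\<bar> < a * s i}"
    unfolding suppc using supp affine_diag_open_cube[OF A s Q] by blast
  from frame_expansion[OF f V \<phi> \<phi>V r this \<psi>]
  show ?thesis unfolding \<eta>_def[symmetric] trm v_def .
qed

section \<open>Anisotropic balls around the origin\<close>

lemma norm_dil_mono:
  fixes \<zeta> :: "real^'n::finite"
  assumes \<alpha>: "\<And>i. 0 < \<alpha> $ i" and t: "0 < t" "t < u" and \<zeta>: "\<zeta> \<noteq> 0"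
  shows "norm (dil \<alpha> (1 / u) *v \<zeta>) < norm (dil \<alpha> (1 / t) *v \<zeta>)"
proof -
  have dil: "(dil \<alpha> x *v \<zeta>) $ i = x powr (\<alpha> $ i) * \<zeta> $ i" for x i
    by (simp add: dil_def matrix_vector_mult_def if_distrib[of "\<lambda>z. z * _"] cong: if_cong)
  have lt: "(1 / u) powr (\<alpha> $ i) < (1 / t) powr (\<alpha> $ i)" for i
    using t \<alpha> by (intro powr_less_mono2) (auto intro: frac_less2)
  obtain k where k: "\<zeta> $ k \<noteq> 0" using \<zeta> by (auto simp: vec_eq_iff)
  have le: "\<bar>(1 / u) powr (\<alpha> $ i) * \<zeta> $ i\<bar> \<le> \<bar>(1 / t) powr (\<alpha> $ i) * \<zeta> $ i\<bar>" for i
    using lt[of i] by (simp add: abs_mult mult_right_mono)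
  have "(\<Sum>i\<in>UNIV. ((1 / u) powr (\<alpha> $ i) * \<zeta> $ i)\<^sup>2) < (\<Sum>i\<in>UNIV. ((1 / t) powr (\<alpha> $ i) * \<zeta> $ i)\<^sup>2)"
  proof (rule sum_strict_mono_ex1)
    show "\<forall>i\<in>UNIV. ((1 / u) powr (\<alpha> $ i) * \<zeta> $ i)\<^sup>2 \<le> ((1 / t) powr (\<alpha> $ i) * \<zeta> $ i)\<^sup>2"
      using le by (auto simp: abs_le_square_iff[symmetric])
    have "\<bar>(1 / u) powr (\<alpha> $ k) * \<zeta> $ k\<bar> < \<bar>(1 / t) powr (\<alpha> $ k) * \<zeta> $ k\<bar>"
      using lt[of k] k by (simp add: abs_mult)
    then have "((1 / u) powr (\<alpha> $ k) * \<zeta> $ k)\<^sup>2 < ((1 / t) powr (\<alpha> $ k) * \<zeta> $ k)\<^sup>2"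
      by (simp only: not_le[symmetric] abs_le_square_iff not_False_eq_True)
    then show "\<exists>k\<in>UNIV. ((1 / u) powr (\<alpha> $ k) * \<zeta> $ k)\<^sup>2 < ((1 / t) powr (\<alpha> $ k) * \<zeta> $ k)\<^sup>2" by blast
  qed simp
  then show ?thesis
    unfolding norm_vec_def L2_set_def dil by simp
qed

text \<open>\<open>anorm\<close> is a definite description, so its t must be shown to exist and be
  unique. Uniqueness is strict monotonicity; existence is the intermediate value theorem on an
  interval ending at C.\<close>

lemma anorm_less:
  fixes \<zeta> :: "real^'n::finite"
  assumes \<alpha>: "\<And>i. 0 < \<alpha> $ i" and C: "0 < C" and less: "norm (dil \<alpha> (1 / C) *v \<zeta>) < 1"
  shows "anorm \<alpha> \<zeta> < C"
proof (cases "\<zeta> = 0")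
  case True
  then show ?thesis using C by (simp add: anorm_def)
next
  case False
  have dil: "(dil \<alpha> x *v \<zeta>) $ i = x powr (\<alpha> $ i) * \<zeta> $ i" for x i
    by (simp add: dil_def matrix_vector_mult_def if_distrib[of "\<lambda>z. z * _"] cong: if_cong)
  define g where "g = (\<lambda>t. norm (dil \<alpha> (1 / t) *v \<zeta>))"
  have mono: "g u < g t" if "0 < t" "t < u" for t u
    unfolding g_def by (rule norm_dil_mono[OF \<alpha> that False])
  obtain k where k: "\<zeta> $ k \<noteq> 0" using False by (auto simp: vec_eq_iff)
  \<comment> \<open>At this parameter one coordinate of the dilated vector already has modulus 1, so
    the norm is at least 1 at the left end of the interval.\<close>
  define t0 where "t0 = \<bar>\<zeta> $ k\<bar> powr (1 / \<alpha> $ k)"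
  have t0: "0 < t0" using k by (simp add: t0_def)
  have "t0 powr (\<alpha> $ k) = \<bar>\<zeta> $ k\<bar>"
    using \<alpha>[of k] by (simp add: t0_def powr_powr)
  then have "\<bar>(dil \<alpha> (1 / t0) *v \<zeta>) $ k\<bar> = 1"
    using k t0 by (simp add: dil abs_mult powr_divide)
  then have g0: "1 \<le> g t0" unfolding g_def using component_le_norm_cart[of "dil \<alpha> (1 / t0) *v \<zeta>" k] by simp
  have gC: "g C < 1" using less by (simp add: g_def)
  have t0C: "t0 < C"
  proof (rule ccontr)
    assume "\<not> t0 < C"
    then have "g t0 \<le> g C" using mono[OF C, of t0] by (cases "C = t0") auto
    then show False using g0 gC by simp
  qed
  have "continuous_on {t0..C} (\<lambda>t. \<chi> i. (1 / t) powr (\<alpha> $ i) * \<zeta> $ i)"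
    by (intro continuous_intros) (use t0 in auto)
  then have "continuous_on {t0..C} (\<lambda>t. norm (\<chi> i. (1 / t) powr (\<alpha> $ i) * \<zeta> $ i))"
    by (rule continuous_on_norm)
  moreover have "g = (\<lambda>t. norm (\<chi> i. (1 / t) powr (\<alpha> $ i) * \<zeta> $ i))"
  proof
    fix t
    have "dil \<alpha> (1 / t) *v \<zeta> = (\<chi> i. (1 / t) powr (\<alpha> $ i) * \<zeta> $ i)"
      unfolding vec_eq_iff dil vec_lambda_beta by blast
    then show "g t = norm (\<chi> i. (1 / t) powr (\<alpha> $ i) * \<zeta> $ i)" by (simp only: g_def)
  qed
  ultimately have "continuous_on {t0..C} g" by (simp only:)
  then obtain t where t: "t0 \<le> t" "t \<le> C" "g t = 1"
    using IVT2'[of g C 1 t0] g0 gC t0C by auto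
  have tpos: "0 < t" using t t0 by simp
  have "(THE t. 0 < t \<and> norm (dil \<alpha> (1 / t) *v \<zeta>) = 1) = t"
  proof (rule the_equality)
    show "0 < t \<and> norm (dil \<alpha> (1 / t) *v \<zeta>) = 1" using tpos t(3) by (simp add: g_def)
    fix u assume u: "0 < u \<and> norm (dil \<alpha> (1 / u) *v \<zeta>) = 1"
    then have "g u = 1" by (simp add: g_def)
    then show "u = t" using mono[of u t] mono[of t u] u tpos t(3) by (cases u t rule: linorder_cases) auto
  qed
  moreover have "t < C" using t gC by (cases "t = C") auto
  ultimately show ?thesis using False by (simp add: anorm_def)
qed

text \<open>Turns the separation of the sets with positive index from a quasi-ball at 0 into a
  Euclidean gap. The dilation is bounded as a linear map, so short vectors have small
  quasi-norm.\<close>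

lemma ball_subset_aball:
  fixes \<alpha> :: "real^'n::finite"
  assumes \<alpha>: "\<And>i. 0 < \<alpha> $ i" and C: "0 < C"
  obtains e where "0 < e" "ball 0 e \<subseteq> aball \<alpha> 0 C"
proof -
  have "bounded_linear ((*v) (dil \<alpha> (1 / C)))" by (rule matrix_vector_mul_bounded_linear)
  then obtain B where B: "0 < B" "\<And>x. norm (dil \<alpha> (1 / C) *v x) \<le> norm x * B"
    using bounded_linear.pos_bounded by blast
  show ?thesis
  proof (rule that[of "1 / B"])
    show "0 < 1 / B" using B by simp
    show "ball 0 (1 / B) \<subseteq> aball \<alpha> 0 C"
    proof
      fix x :: "real^'n" assume "x \<in> ball 0 (1 / B)"
      then have "norm (- x) * B < 1" using B(1) by (simp add: pos_less_divide_eq)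
      then have "norm (dil \<alpha> (1 / C) *v (- x)) < 1" using B(2)[of "- x"] by simp
      from anorm_less[OF \<alpha> C this] show "x \<in> aball \<alpha> 0 C" by (simp add: aball_def)
    qed
  qed
qed

lemma dual_subset: "u \<in> dual V \<Longrightarrow> W \<subseteq> V \<Longrightarrow> u \<in> dual W"
  unfolding dual_def by blast

text \<open>The cubes eventually contain every finite set of lattice points, so unconditional sums
  may be evaluated as limits of cubic partial sums.\<close>

lemma filterlim_lattice_cubes:
  "filterlim (\<lambda>N. {n::int^'n::finite. \<forall>l. \<bar>n $ l\<bar> \<le> int N}) (finite_subsets_at_top UNIV) sequentially"
  unfolding filterlim_finite_subsets_at_top
proof (intro allI impI)
  fix X :: "(int^'n) set" assume X: "finite X \<and> X \<subseteq> UNIV"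
  have fin: "finite {n::int^'n. \<forall>l. \<bar>n $ l\<bar> \<le> int N}" for N
  proof (rule finite_subset)
    show "finite (vec_lambda ` (UNIV \<rightarrow>\<^sub>E {- int N..int N}) :: (int^'n) set)"
      by (intro finite_imageI finite_PiE) auto
    show "{n::int^'n. \<forall>l. \<bar>n $ l\<bar> \<le> int N} \<subseteq> vec_lambda ` (UNIV \<rightarrow>\<^sub>E {- int N..int N})"
    proof
      fix n :: "int^'n" assume "n \<in> {n. \<forall>l. \<bar>n $ l\<bar> \<le> int N}"
      then have "($) n \<in> UNIV \<rightarrow>\<^sub>E {- int N..int N}" by (auto simp: abs_le_iff minus_le_iff)
      then show "n \<in> vec_lambda ` (UNIV \<rightarrow>\<^sub>E {- int N..int N})" by (rule image_eqI[rotated]) (simp add: vec_eq_iff)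
    qed
  qed
  define b where "b = (\<Sum>n\<in>X. \<Sum>l\<in>UNIV. \<bar>n $ l\<bar>)"
  have b: "\<bar>n $ l\<bar> \<le> b" if n: "n \<in> X" for n l
  proof -
    have "\<bar>n $ l\<bar> \<le> (\<Sum>l\<in>UNIV. \<bar>n $ l\<bar>)" by (rule member_le_sum) auto
    also have "\<dots> \<le> b" unfolding b_def using X n by (intro member_le_sum sum_nonneg) auto
    finally show ?thesis .
  qed
  show "\<forall>\<^sub>F N in sequentially. finite {n::int^'n. \<forall>l. \<bar>n $ l\<bar> \<le> int N} \<and> X \<subseteq> {n. \<forall>l. \<bar>n $ l\<bar> \<le> int N} \<and> {n::int^'n. \<forall>l. \<bar>n $ l\<bar> \<le> int N} \<subseteq> UNIV"
    using eventually_ge_at_top[of "nat b"]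
  proof eventually_elim
    case (elim N)
    then have "b \<le> int N" by simp
    then show ?case using b fin by (auto intro: order_trans)
  qed
qed

text \<open>The final claim is made for every extension f', since a class modulo polynomials has no
  distinguished representative. The constant in the sampling formula is the volume of a cell of the
  sample lattice, which fits the convolution \<open>dist_conv\<close> without a power of 2
  pi.\<close>

theorem proposition6p2:
  fixes \<alpha> :: "real^'n::finite"
    and \<kappa> :: real
    and \<rho> h1 h2 ht :: "real^'n \<Rightarrow> real"
    and R R1 R2 \<delta>0 \<delta>1 \<delta>2 \<delta>s \<delta> c0 c1 c2 c3 r C :: real
    and J :: "'j set"
    and \<xi>c b :: "'j \<Rightarrow> real^'n"
    and A :: "'j \<Rightarrow> real^'n^'n"
    and T :: "'j \<Rightarrow> real^'n \<Rightarrow> real^'n"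
    and P Q K :: "(real^'n) set"
    and c :: "real^'n"
    and a :: real
    and \<sigma> :: "int \<Rightarrow> 'j"
  assumes "anisotropy \<alpha>"
    and "\<kappa> \<ge> 1"
    and "\<And>\<xi> \<zeta>. anorm \<alpha> (\<xi> + \<zeta>) \<le> \<kappa> * (anorm \<alpha> \<xi> + anorm \<alpha> \<zeta>)"
    \<comment> \<open>the hybrid regulation function\<close>
    and "ramp \<alpha> \<rho>"
    and "moderate \<alpha> h1 R1 \<delta>1" and "moderate \<alpha> h2 R2 \<delta>2"
    and "hybrid_parts \<alpha> h1 h2 c0 c1 c2 c3 r"
    and "ht = hybrid \<rho> h1 h2"
    and "moderate \<alpha> ht R \<delta>0" and "0 < \<delta>" and "\<delta> < \<delta>0"
    \<comment> \<open>the structured admissible covering by anisotropic balls\<close>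
    and "\<And>j. j \<in> J \<Longrightarrow> \<xi>c j \<noteq> 0"
    and "\<And>j. j \<in> J \<Longrightarrow> A j = dil \<alpha> (\<delta> * ht (\<xi>c j))"
    and "structured_covering J A b P Q"
    and "\<And>j. T j = affine_map (A j) (b j)"
    and "\<And>j. j \<in> J \<Longrightarrow> T j ` Q = aball \<alpha> (\<xi>c j) (\<delta> * ht (\<xi>c j))"
    \<comment> \<open>the identification of J with the integers\<close>
    and "0 < \<delta>s" and "\<delta>s \<le> min \<delta>1 \<delta>2" and "\<delta>s * c1 < 1"
    and "0 < C" and "C < (2/3) / (\<kappa> * (1 + c1 * \<delta>s))"
    and "bij_betw \<sigma> UNIV J"
    and "\<And>i. i > 0 \<Longrightarrow> aball \<alpha> (\<xi>c (\<sigma> i)) (\<delta> * ht (\<xi>c (\<sigma> i))) \<inter> aball \<alpha> 0 C = {}"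
    and "\<And>i. i < 0 \<Longrightarrow> aball \<alpha> (\<xi>c (\<sigma> i)) (\<delta> * ht (\<xi>c (\<sigma> i))) \<inter> aball \<alpha> 0 C \<noteq> {}"
    \<comment> \<open>the cube\<close>
    and "a > 0" and "K = cube c a" and "Q \<subseteq> K"
  shows
    "(\<forall>g h j. g \<in> dual schwartz \<and> h \<in> schwartz \<and> j \<in> J \<and>
        dist_supp (dist_fourier g) \<subseteq> T j ` K \<and> fun_supp (fourier h) \<subseteq> T j ` K \<longrightarrow>
        (\<exists>G. smooth G \<and> given_by g G \<and>
           sums_in schwartz
             (\<lambda>n. dist_of (\<lambda>x.
                complex_of_real ((2 * pi) ^ CARD('n) * inverse ((2 * a) ^ CARD('n)) * inverse \<bar>det (A j)\<bar>) *
                G (- inv (T j) ((pi / a) *\<^sub>R lattice_vec n)) *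
                h (x + inv (T j) ((pi / a) *\<^sub>R lattice_vec n))))
             UNIV (dist_of (dist_conv g h))))
     \<and>
     (\<forall>\<phi> :: 'j \<Rightarrow> real^'n \<Rightarrow> real.
        (\<forall>j\<in>J. (\<lambda>\<xi>. complex_of_real (\<phi> j \<xi>)) \<in> schwartz \<and> fun_supp (\<phi> j) \<subseteq> T j ` Q) \<and>
        (\<forall>\<xi>. \<xi> \<noteq> 0 \<longrightarrow> ((\<lambda>j. (\<phi> j \<xi>)\<^sup>2) has_sum 1) J) \<and>
        uniformly_moderate_growth J \<phi> \<longrightarrow>
        (let \<eta> = (\<lambda>j n. frame_fun K a (A j) (b j) (\<phi> j) n) in
         \<forall>f \<in> dual schwartz0.
           (\<exists>F. (\<forall>j\<in>J. sums_in schwartz0 (\<lambda>n. frame_term f (\<eta> j n)) UNIV (F j)) \<and>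
                sums_in schwartz0 F J f) \<and>
           (\<exists>f'\<in>dual schwartz. \<forall>\<theta>\<in>schwartz0. f' \<theta> = f \<theta>) \<and>
           (\<forall>f'\<in>dual schwartz. (\<forall>\<theta>\<in>schwartz0. f' \<theta> = f \<theta>) \<longrightarrow>
             (\<exists>(p :: nat \<Rightarrow> real^'n \<Rightarrow> complex) (p' :: real^'n \<Rightarrow> complex)
               (S :: nat \<Rightarrow> nat \<Rightarrow> 'n functional) L.
               (\<forall>k. polynomial_function (p k)) \<and> polynomial_function p' \<and>
               (\<forall>k m. tends_in schwartz
                  (\<lambda>N \<theta>. \<Sum>i \<in> {- int k..int m}. \<Sum>n \<in> {n. \<forall>l. \<bar>n $ l\<bar> \<le> int N}.
                     frame_term f (\<eta> (\<sigma> i) n) \<theta>)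
                  (S k m) sequentially) \<and>
               tends_in schwartz (\<lambda>(k, m) \<theta>. S k m \<theta> + dist_of (p k) \<theta>) L
                 (sequentially \<times>\<^sub>F sequentially) \<and>
               (\<forall>\<theta>\<in>schwartz. f' \<theta> = L \<theta> + dist_of p' \<theta>)))))"
proof -
  note cov = \<open>structured_covering J A b P Q\<close> and T = \<open>\<And>j. T j = affine_map (A j) (b j)\<close>
  have \<alpha>: "0 < \<alpha> $ i" for i using \<open>anisotropy \<alpha>\<close> by (simp add: anisotropy_def)
  define t where "t = (\<lambda>j. \<delta> * ht (\<xi>c j))"
  \<comment> \<open>The diagonal entries of A_j; their positivity gives access to the diagonal
    lemmas.\<close>
  define s where "s = (\<lambda>j i. t j powr (\<alpha> $ i))"
  have tpos: "0 < t j" if "j \<in> J" for j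
    using \<open>moderate \<alpha> ht R \<delta>0\<close> \<open>0 < \<delta>\<close> assms(12)[OF that] by (simp add: t_def moderate_def)
  have s: "0 < s j i" if "j \<in> J" for j i using tpos[OF that] by (simp add: s_def)
  have A: "A j = (\<chi> i l. if i = l then s j i else 0)" if "j \<in> J" for j
    unfolding assms(13)[OF that] dil_def s_def t_def ..
  have oQ: "open Q" and adm: "admissible_covering J (\<lambda>j. T j ` Q)"
    using cov unfolding structured_covering_def T by blast+
  have K: "K = cube c a" and QK: "Q \<subseteq> cube c a" and a: "0 < a" using assms by auto
  show ?thesis
  proof (intro conjI allI impI)
    fix g :: "'n functional" and h :: "real^'n \<Rightarrow> complex" and j
    assume "g \<in> dual schwartz \<and> h \<in> schwartz \<and> j \<in> J \<and>
        dist_supp (dist_fourier g) \<subseteq> T j ` K \<and> fun_supp (fourier h) \<subseteq> T j ` K"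
    then have g: "g \<in> dual schwartz" and h: "h \<in> schwartz" and j: "j \<in> J"
      and sg: "dist_supp (dist_fourier g) \<subseteq> T j ` K" and sh: "fun_supp (fourier h) \<subseteq> T j ` K" by blast+
    note Aj = A[OF j] and sj = s[OF j]
    let ?p = "\<lambda>i. b j $ i + s j i * c $ i" and ?r = "\<lambda>i. a * s j i"
    have TK: "T j ` K = {x. \<forall>i. \<bar>x $ i - ?p i\<bar> \<le> ?r i}"
      unfolding T K by (rule affine_diag_cube[OF Aj sj])
    have r: "0 < ?r i" for i using a sj by simp
    obtain G where G: "slow G" "given_by g G" and
      sums: "\<And>t. sums_in schwartz (\<lambda>n. dist_of (\<lambda>x. complex_of_real (\<Prod>i\<in>UNIV. pi / ?r i) *
        G (t + vec_lambda (\<lambda>i. - (pi / ?r i) * of_int (n $ i))) *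
        h (x - (t + vec_lambda (\<lambda>i. - (pi / ?r i) * of_int (n $ i)))))) UNIV (dist_of (dist_conv g h))"
      using sampling[OF g h r sg[unfolded TK] sh[unfolded TK]] by blast
    \<comment> \<open>The offset \<open>b j $ i / s j i\<close> absorbs the translation part of T_j,
      so that the sample points become the required preimages.\<close>
    have y: "(\<chi> i. b j $ i / s j i) + vec_lambda (\<lambda>i. - (pi / ?r i) * of_int (n $ i)) = - inv (T j) ((pi / a) *\<^sub>R lattice_vec n)" for n :: "int^'n"
      unfolding T inv_affine_diag[OF Aj sj] by (simp add: vec_eq_iff lattice_vec_def diff_divide_distrib)
    have det: "\<bar>det (A j)\<bar> = (\<Prod>i\<in>UNIV. s j i)"
      unfolding Aj det_diag using sj by (simp add: prod_nonneg less_imp_le)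
    have "sums_in schwartz
             (\<lambda>n. dist_of (\<lambda>x.
                complex_of_real ((2 * pi) ^ CARD('n) * inverse ((2 * a) ^ CARD('n)) * inverse \<bar>det (A j)\<bar>) *
                G (- inv (T j) ((pi / a) *\<^sub>R lattice_vec n)) *
                h (x + inv (T j) ((pi / a) *\<^sub>R lattice_vec n))))
             UNIV (dist_of (dist_conv g h))"
      using sums[of "\<chi> i. b j $ i / s j i"] unfolding y prod_pi_div[of "s j" a, OF sj a] det diff_minus_eq_add .
    with slow_smooth[OF G(1)] G(2) show "\<exists>G. smooth G \<and> given_by g G \<and>
           sums_in schwartz
             (\<lambda>n. dist_of (\<lambda>x.
                complex_of_real ((2 * pi) ^ CARD('n) * inverse ((2 * a) ^ CARD('n)) * inverse \<bar>det (A j)\<bar>) *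
                G (- inv (T j) ((pi / a) *\<^sub>R lattice_vec n)) *
                h (x + inv (T j) ((pi / a) *\<^sub>R lattice_vec n))))
             UNIV (dist_of (dist_conv g h))" by blast
  next
    fix \<phi> :: "'j \<Rightarrow> real^'n \<Rightarrow> real"
    assume \<phi>: "(\<forall>j\<in>J. (\<lambda>\<xi>. complex_of_real (\<phi> j \<xi>)) \<in> schwartz \<and> fun_supp (\<phi> j) \<subseteq> T j ` Q) \<and>
        (\<forall>\<xi>. \<xi> \<noteq> 0 \<longrightarrow> ((\<lambda>j. (\<phi> j \<xi>)\<^sup>2) has_sum 1) J) \<and>
        uniformly_moderate_growth J \<phi>"
    interpret square_partition J "\<lambda>j. T j ` Q" \<phi>
    proof
      show "open (T j ` Q)" if "j \<in> J" for j
        unfolding T by (rule affine_diag_open[OF A[OF that] s[OF that] oQ])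
    qed (use \<phi> adm in auto)
    define \<eta> where "\<eta> = (\<lambda>j n. frame_fun K a (A j) (b j) (\<phi> j) n)"
    have expand: "((\<lambda>n. frame_term f (\<eta> j n) \<theta>) has_sum f (piece j \<theta>)) UNIV"
      if f: "f \<in> dual schwartz0" and j: "j \<in> J" and \<theta>: "\<theta> \<in> schwartz" for f j \<theta>
    proof -
      \<comment> \<open>Since phi_j vanishes near 0, its product with any multiplier has transform
        in \<open>schwartz0\<close>; only therefore may f be paired with the frame
        functions.\<close>
      obtain e where e: "0 < e" "\<And>\<xi>. norm \<xi> < e \<Longrightarrow> \<phi> j \<xi> = 0" by (rule phi_zero_near_0[OF j]) blast
      have \<phi>V: "FT (-1) (\<lambda>\<xi>. complex_of_real (\<phi> j \<xi>) * \<kappa> \<xi>) \<in> schwartz0" if "slow \<kappa>" for \<kappa>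
      proof (rule FT_in_schwartz0[OF _ e(1)])
        show "(\<lambda>\<xi>. complex_of_real (\<phi> j \<xi>) * \<kappa> \<xi>) \<in> schwartz"
          using schwartz_slow_mult[OF that sw[OF j]] by (simp add: mult.commute)
      qed (simp add: e(2))
      show ?thesis
        using frame_sums[OF f sw_subspace_schwartz0 sw[OF j] \<phi>V A[OF j] s[OF j] a oQ QK suppQ[OF j, unfolded T] \<theta>]
        unfolding \<eta>_def K piece_def sq_def mult.assoc .
    qed
    have "\<forall>f \<in> dual schwartz0.
           (\<exists>F. (\<forall>j\<in>J. sums_in schwartz0 (\<lambda>n. frame_term f (\<eta> j n)) UNIV (F j)) \<and>
                sums_in schwartz0 F J f) \<and>
           (\<exists>f'\<in>dual schwartz. \<forall>\<theta>\<in>schwartz0. f' \<theta> = f \<theta>) \<and>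
           (\<forall>f'\<in>dual schwartz. (\<forall>\<theta>\<in>schwartz0. f' \<theta> = f \<theta>) \<longrightarrow>
             (\<exists>(p :: nat \<Rightarrow> real^'n \<Rightarrow> complex) (p' :: real^'n \<Rightarrow> complex)
               (S :: nat \<Rightarrow> nat \<Rightarrow> 'n functional) L.
               (\<forall>k. polynomial_function (p k)) \<and> polynomial_function p' \<and>
               (\<forall>k m. tends_in schwartz
                  (\<lambda>N \<theta>. \<Sum>i \<in> {- int k..int m}. \<Sum>n \<in> {n. \<forall>l. \<bar>n $ l\<bar> \<le> int N}.
                     frame_term f (\<eta> (\<sigma> i) n) \<theta>)
                  (S k m) sequentially) \<and>
               tends_in schwartz (\<lambda>(k, m) \<theta>. S k m \<theta> + dist_of (p k) \<theta>) L
                 (sequentially \<times>\<^sub>F sequentially) \<and>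
               (\<forall>\<theta>\<in>schwartz. f' \<theta> = L \<theta> + dist_of p' \<theta>)))"
    proof (intro ballI conjI impI)
      fix f :: "'n functional" assume f: "f \<in> dual schwartz0"
      have d: "(\<lambda>\<theta>. f (piece j \<theta>)) \<in> dual schwartz" if "j \<in> J" for j
        by (rule dual_piece[OF f sw_subspace_schwartz0 order_refl that])
      have "sums_in schwartz0 (\<lambda>n. frame_term f (\<eta> j n)) UNIV (\<lambda>\<theta>. f (piece j \<theta>))" if j: "j \<in> J" for j
        unfolding sums_in_def using dual_subset[OF d[OF j] schwartz0_subset] expand[OF f j] schwartz0_schwartz by blast
      moreover have "sums_in schwartz0 (\<lambda>j \<theta>. f (piece j \<theta>)) J f"
      proof -
        obtain K where K: "\<And>\<theta>. \<theta> \<in> schwartz0 \<Longrightarrow> flat_at_0 K (FT 1 \<theta>) \<Longrightarrow> ((\<lambda>j. f (piece j \<theta>)) has_sum f \<theta>) J"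
          by (rule piece_sums[OF f sw_subspace_schwartz0 order_refl]) (rule that; assumption)
        show ?thesis unfolding sums_in_def using f K schwartz0_flat by blast
      qed
      ultimately show "\<exists>F. (\<forall>j\<in>J. sums_in schwartz0 (\<lambda>n. frame_term f (\<eta> j n)) UNIV (F j)) \<and> sums_in schwartz0 F J f"
        by (intro exI[of _ "\<lambda>j \<theta>. f (piece j \<theta>)"]) blast
      show "\<exists>f'\<in>dual schwartz. \<forall>\<theta>\<in>schwartz0. f' \<theta> = f \<theta>" by (rule extension[OF f])
      fix f' :: "'n functional" assume f': "f' \<in> dual schwartz" and eq: "\<forall>\<theta>\<in>schwartz0. f' \<theta> = f \<theta>"
      have \<sigma>J: "\<sigma> i \<in> J" for i using \<open>bij_betw \<sigma> UNIV J\<close> by (auto simp: bij_betw_def)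
      \<comment> \<open>Pieces lie in \<open>schwartz0\<close>, where all extensions coincide with
        f.\<close>
      have fp: "f' (piece (\<sigma> i) \<theta>) = f (piece (\<sigma> i) \<theta>)" if "\<theta> \<in> schwartz" for i \<theta>
        using eq piece_schwartz0[OF \<sigma>J that] by blast
      obtain e where e: "0 < e" "ball 0 e \<subseteq> aball \<alpha> 0 C"
        by (rule ball_subset_aball[of \<alpha> C, OF \<alpha> \<open>0 < C\<close>])
      \<comment> \<open>The sets with positive index miss the quasi-ball of radius C, hence a
        Euclidean ball around the origin.\<close>
      have away: "\<phi> (\<sigma> i) \<xi> = 0" if "0 < i" "norm \<xi> < e" for i \<xi>
      proof (rule phi_zero[OF \<sigma>J])
        have "\<xi> \<in> aball \<alpha> 0 C" using e(2) that(2) by auto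
        then show "\<xi> \<notin> T (\<sigma> i) ` Q"
          using assms(23)[OF that(1)] unfolding assms(16)[OF \<sigma>J] by blast
      qed
      obtain p p' L where p: "\<And>k::nat. polynomial_function (p k)" "polynomial_function p'"
        "tends_in schwartz (\<lambda>(k, m) \<theta>. (\<Sum>i\<in>{- int k..int m}. f' (piece (\<sigma> i) \<theta>)) + dist_of (p k) \<theta>) L (sequentially \<times>\<^sub>F sequentially)"
        "\<And>\<theta>. \<theta> \<in> schwartz \<Longrightarrow> f' \<theta> = L \<theta> + dist_of p' \<theta>"
        by (rule corrected_limit[OF f' \<open>bij_betw \<sigma> UNIV J\<close> e(1) away]) ((assumption | rule that)+)
      define S where "S = (\<lambda>k m \<theta>. \<Sum>i\<in>{- int k..int m}. f' (piece (\<sigma> i) \<theta>))"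
      have "tends_in schwartz
          (\<lambda>N \<theta>. \<Sum>i \<in> {- int k..int m}. \<Sum>n \<in> {n. \<forall>l. \<bar>n $ l\<bar> \<le> int N}. frame_term f (\<eta> (\<sigma> i) n) \<theta>)
          (S k m) sequentially" for k m :: nat
        unfolding tends_in_def
      proof (intro conjI ballI)
        show "S k m \<in> dual schwartz"
          unfolding S_def
          by (intro dual_functional_sum sw_subspace_schwartz dual_piece[OF f' sw_subspace_schwartz schwartz0_subset] \<sigma>J)
        fix \<theta> :: "real^'n \<Rightarrow> complex" assume \<theta>: "\<theta> \<in> schwartz"
        \<comment> \<open>The unconditional sum over n is read along growing cubes, one index j at a
          time; the outer sum is finite.\<close>
        have "(\<lambda>N. \<Sum>n \<in> {n. \<forall>l. \<bar>n $ l\<bar> \<le> int N}. frame_term f (\<eta> (\<sigma> i) n) \<theta>) \<longlonglongrightarrow> f' (piece (\<sigma> i) \<theta>)" for i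
          unfolding fp[OF \<theta>]
          by (rule filterlim_compose[OF expand[OF f \<sigma>J \<theta>, unfolded has_sum_def] filterlim_lattice_cubes])
        then show "(\<lambda>N. \<Sum>i \<in> {- int k..int m}. \<Sum>n \<in> {n. \<forall>l. \<bar>n $ l\<bar> \<le> int N}. frame_term f (\<eta> (\<sigma> i) n) \<theta>) \<longlonglongrightarrow> S k m \<theta>"
          unfolding S_def by (intro tendsto_sum)
      qed
      moreover have "tends_in schwartz (\<lambda>(k, m) \<theta>. S k m \<theta> + dist_of (p k) \<theta>) L (sequentially \<times>\<^sub>F sequentially)"
        using p(3) by (simp only: S_def)
      ultimately show "\<exists>(p :: nat \<Rightarrow> real^'n \<Rightarrow> complex) (p' :: real^'n \<Rightarrow> complex)
               (S :: nat \<Rightarrow> nat \<Rightarrow> 'n functional) L.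
               (\<forall>k. polynomial_function (p k)) \<and> polynomial_function p' \<and>
               (\<forall>k m. tends_in schwartz
                  (\<lambda>N \<theta>. \<Sum>i \<in> {- int k..int m}. \<Sum>n \<in> {n. \<forall>l. \<bar>n $ l\<bar> \<le> int N}.
                     frame_term f (\<eta> (\<sigma> i) n) \<theta>)
                  (S k m) sequentially) \<and>
               tends_in schwartz (\<lambda>(k, m) \<theta>. S k m \<theta> + dist_of (p k) \<theta>) L
                 (sequentially \<times>\<^sub>F sequentially) \<and>
               (\<forall>\<theta>\<in>schwartz. f' \<theta> = L \<theta> + dist_of p' \<theta>)"
        using p(1,2,4) by (intro exI[of _ p] exI[of _ p'] exI[of _ S] exI[of _ L]) blast
    qed
    then show "let \<eta> = (\<lambda>j n. frame_fun K a (A j) (b j) (\<phi> j) n) in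
         \<forall>f \<in> dual schwartz0.
           (\<exists>F. (\<forall>j\<in>J. sums_in schwartz0 (\<lambda>n. frame_term f (\<eta> j n)) UNIV (F j)) \<and>
                sums_in schwartz0 F J f) \<and>
           (\<exists>f'\<in>dual schwartz. \<forall>\<theta>\<in>schwartz0. f' \<theta> = f \<theta>) \<and>
           (\<forall>f'\<in>dual schwartz. (\<forall>\<theta>\<in>schwartz0. f' \<theta> = f \<theta>) \<longrightarrow>
             (\<exists>(p :: nat \<Rightarrow> real^'n \<Rightarrow> complex) (p' :: real^'n \<Rightarrow> complex)
               (S :: nat \<Rightarrow> nat \<Rightarrow> 'n functional) L.
               (\<forall>k. polynomial_function (p k)) \<and> polynomial_function p' \<and>
               (\<forall>k m. tends_in schwartz
                  (\<lambda>N \<theta>. \<Sum>i \<in> {- int k..int m}. \<Sum>n \<in> {n. \<forall>l. \<bar>n $ l\<bar> \<le> int N}.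
                     frame_term f (\<eta> (\<sigma> i) n) \<theta>)
                  (S k m) sequentially) \<and>
               tends_in schwartz (\<lambda>(k, m) \<theta>. S k m \<theta> + dist_of (p k) \<theta>) L
                 (sequentially \<times>\<^sub>F sequentially) \<and>
               (\<forall>\<theta>\<in>schwartz. f' \<theta> = L \<theta> + dist_of p' \<theta>)))"
      unfolding Let_def \<eta>_def .
  qed
qed

end
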